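(* A Reinhardt trajectory contains no singular arcs. That is, if $(g,z):[0,t_f]\to M$ is a Reinhardt trajectory and $\lambda$ is a Pontryagin extremal lifted trajectory of $(g,z)$, then there is no interval $[t_1,t_2]\subseteq[0,t_f]$ with $t_1<t_2$ on which $\lambda$ is a singular arc.
   Context: State equations. Let $e_j^*=(\cos(2\pi j/6),\sin(2\pi j/6))$, $J=\begin{pmatrix}0&-1\\1&0\end{pmatrix}$, $R=\exp(J\pi/3)$. $SL_2(\mathbb{R})$ acts on the upper half-plane $\mathfrak h=\{x+iy: y>0\}$ by linear fractional transformations $\rho.z$. For $z=x+iy\in\mathfrak h$ put $X=X(z)=\begin{pmatrix}x/y&-x^2/y-y\\1/y&-x/y\end{pmatrix}\in\mathfrak{sl}_2(\mathbb{R})$. The control set is $U=\{(u_0,u_1,u_2)\in\mathbb{R}^3:\sum u_i=1,\ u_i\ge0\}$. For $u\in U$ let $a=(u_1-u_2)/\sqrt3$, $b=u_0/3-2u_1/3-2u_2/3$, $c=u_0$, and $$f_1(x,y;u)=\frac{y(b+2ax-cx^2+cy^2)}{b+2ax-cx^2-cy^2},\qquad f_2(x,y;u)=\frac{2(a-cx)y^2}{b+2ax-cx^2-cy^2}.$$ Let $\mathfrak h^\star=\{x+iy\in\mathfrak h: |x|<1/\sqrt3,\ x^2+y^2>1/3\}$ and $M=SL_2(\mathbb{R})\times\mathfrak h$. A trajectory with measurable control $u:[0,t_f]\to U$ is an absolutely continuous $(g,z):[0,t_f]\to M$, $z=x+iy$, with $x'=f_1(x,y;u)$, $y'=f_2(x,y;u)$,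 $g'=gX(z)$ a.e. It is admissible if: $z$ has image in $\mathfrak h^\star$; $g(0)=I$, $g(t_f)=R$, $z(t_f)=R^{-1}.z(0)$; and $g$ is homotopic in $SL_2(\mathbb{R})$ (with fixed endpoints) to $t\mapsto\exp(J\pi t/(3t_f))$. For an admissible trajectory, $D(g,z)$ denotes the centrally symmetric convex disk in $\mathbb{R}^2$ bounded by the six arcs $t\mapsto g(t)e_j^*$, $t\in[0,t_f]$, $j=0,\dots,5$. Reinhardt problem. A disk is a compact convex subset of the plane with nonempty interior. A solution $D_{min}$ of the Reinhardt problem is a centrally symmetric disk for which the density of its densest lattice packing is the minimum, over all centrally symmetric disks, of the density of the densest lattice packing; it is normalized to be centered at the origin with the smallest-area centrally symmetric hexagon containing it having area $\sqrt{12}$. A Reinhardt trajectory is an admissible trajectory $(g,z)$ such that $D(g,z)=D_{min}$ is a (globally optimal) solution of the Reinhardt problem. Pontryagin extremals. Using left-invariant vector fields and the form $\langle A,B\rangle=\mathrm{trace}(AB)$, a point of $T^*M$ is written $\lambda=((g,\Lambda),(z,\nu))$ with $\Lambda\in\mathfrak{sl}_2(\mathbb{R})$, $\nu=(\nu_1,\nu_2)\in\mathbb{R}^2$. With $\lambda_{cost}\in\mathbb{R}$, the Hamiltonian is $H(\lambda;u)=\langle\Lambda,X\rangle-\tfrac32\lambda_{cost}\langle J,X\rangle+\nu_1f_1(x,y;u)+\nu_2f_2(x,y;u)$, and $H^+(\lambda)=\max_{u\in U}H(\lambda;u)$. A lifted trajectory of an admissible trajectory $(g,z)$ with control $u$ is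 a Lipschitz $\lambda:[0,t_f]\to T^*M$ over $(g,z)$ with, a.e., $\Lambda'=[\Lambda,X]$, $\nu_1'=-\partial H/\partial x$, $\nu_2'=-\partial H/\partial y$ (derivatives at fixed $\Lambda,\nu$ and at $u=u(t)$). It is a Pontryagin extremal if: (i) $H(\lambda(t);u(t))=H^+(\lambda(t))=0$ for a.e. $t$; (ii) $(\lambda_{cost},\Lambda(t),\nu(t))\ne0$ for every $t$; (iii) $\lambda_{cost}\le0$ is constant, normalized so that $\lambda_{cost}\in\{0,-1\}$; (iv) transversality: $\Lambda(t_f)=R^{-1}\Lambda(0)R$ and $F^t\nu(t_f)=\nu(0)$, where $F:T_{z(0)}\mathfrak h\to T_{z(t_f)}\mathfrak h$ is the differential of $z\mapsto R^{-1}.z$ at $z(0)$ and $F^t$ its transpose. Singular arcs. For $\lambda\in T^*M$ with $z\in\mathfrak h^\star$, let $U_\lambda=\{u\in U: H(\lambda;u)=H^+(\lambda)\}$, which is a face of $U$. A lifted trajectory $\lambda$ is a singular arc on $[t_1,t_2]$ if for all $t\in[t_1,t_2]$ the face $U_{\lambda(t)}$ has positive dimension. *)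

theory Defs
  imports "HOL-Analysis.Analysis"
begin

section \<open>Matrices and the upper half-plane\<close>

text \<open>The exponential has to be defined by its series, since the type \<open>real^2^2\<close> is not an
  instance of the class required by \<^const>\<open>exp\<close>.\<close>

definition mat_exp :: "real^'n^'n \<Rightarrow> real^'n^'n" where
  "mat_exp A = (\<Sum>n. inverse (fact n) *\<^sub>R (((**) A ^^ n) (mat 1)))"

definition J_mat :: "real^2^2" where
  "J_mat = vector [vector [0, -1], vector [1, 0]]"

definition R_mat :: "real^2^2" where
  "R_mat = mat_exp ((pi / 3) *\<^sub>R J_mat)"

definition SL2 :: "(real^2^2) set" where
  "SL2 = {A. det A = 1}"

definition e_star :: "nat \<Rightarrow> real^2" where
  "e_star j = vector [cos (2 * pi * real j / 6), sin (2 * pi * real j / 6)]"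

definition upper_half_plane :: "complex set" where
  "upper_half_plane = {z. Im z > 0}"

definition h_star :: "complex set" where
  "h_star = {z \<in> upper_half_plane. \<bar>Re z\<bar> < 1 / sqrt 3 \<and> (Re z)\<^sup>2 + (Im z)\<^sup>2 > 1 / 3}"

definition mobius :: "real^2^2 \<Rightarrow> complex \<Rightarrow> complex" where
  "mobius A z = (of_real (A$1$1) * z + of_real (A$1$2)) / (of_real (A$2$1) * z + of_real (A$2$2))"

definition X_mat :: "complex \<Rightarrow> real^2^2" where
  "X_mat z = (let x = Re z; y = Im z in
     vector [vector [x / y, - x\<^sup>2 / y - y], vector [1 / y, - x / y]])"

text \<open>The form \<open>\<langle>A, B\<rangle> = trace (A B)\<close> and the commutator.\<close>

definition trace_form :: "real^2^2 \<Rightarrow> real^2^2 \<Rightarrow> real" where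
  "trace_form A B = trace (A ** B)"

definition mat_bracket :: "real^2^2 \<Rightarrow> real^2^2 \<Rightarrow> real^2^2" where
  "mat_bracket A B = A ** B - B ** A"


section \<open>The control system\<close>

text \<open>The indices \<open>0, 1, 2\<close> are the three elements of the index type \<open>3\<close> (in which \<open>0 = 3\<close>).\<close>

definition control_set :: "(real^3) set" where
  "control_set = {u. (\<Sum>i\<in>UNIV. u $ i) = 1 \<and> (\<forall>i. 0 \<le> u $ i)}"

definition ctrl_a :: "real^3 \<Rightarrow> real" where
  "ctrl_a u = (u $ 1 - u $ 2) / sqrt 3"

definition ctrl_b :: "real^3 \<Rightarrow> real" where
  "ctrl_b u = u $ 0 / 3 - 2 * u $ 1 / 3 - 2 * u $ 2 / 3"

definition ctrl_c :: "real^3 \<Rightarrow> real" where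
  "ctrl_c u = u $ 0"

definition f1 :: "real \<Rightarrow> real \<Rightarrow> real^3 \<Rightarrow> real" where
  "f1 x y u = (let a = ctrl_a u; b = ctrl_b u; c = ctrl_c u in
     y * (b + 2 * a * x - c * x\<^sup>2 + c * y\<^sup>2) / (b + 2 * a * x - c * x\<^sup>2 - c * y\<^sup>2))"

definition f2 :: "real \<Rightarrow> real \<Rightarrow> real^3 \<Rightarrow> real" where
  "f2 x y u = (let a = ctrl_a u; b = ctrl_b u; c = ctrl_c u in
     2 * (a - c * x) * y\<^sup>2 / (b + 2 * a * x - c * x\<^sup>2 - c * y\<^sup>2))"

text \<open>Absolute continuity on \<open>[a, b]\<close>: a division is a finite family of non-overlapping nonempty
  compact intervals \<open>k = [Inf k, Sup k]\<close>.\<close>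

definition abs_continuous_on :: "real \<Rightarrow> real \<Rightarrow> (real \<Rightarrow> 'a::metric_space) \<Rightarrow> bool" where
  "abs_continuous_on a b f \<longleftrightarrow>
     (\<forall>\<epsilon>>0. \<exists>\<delta>>0. \<forall>d S. d division_of S \<and> S \<subseteq> {a..b} \<and> (\<Sum>k\<in>d. Sup k - Inf k) < \<delta>
        \<longrightarrow> (\<Sum>k\<in>d. dist (f (Inf k)) (f (Sup k))) < \<epsilon>)"

definition trajectory ::
    "real \<Rightarrow> (real \<Rightarrow> real^3) \<Rightarrow> (real \<Rightarrow> real^2^2) \<Rightarrow> (real \<Rightarrow> complex) \<Rightarrow> bool" where
  "trajectory tf u g z \<longleftrightarrow>
     0 < tf \<and>
     u \<in> borel_measurable (lebesgue_on {0..tf}) \<and> u ` {0..tf} \<subseteq> control_set \<and>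
     g ` {0..tf} \<subseteq> SL2 \<and> z ` {0..tf} \<subseteq> upper_half_plane \<and>
     abs_continuous_on 0 tf (\<lambda>t. (g t, z t)) \<and>
     (AE t in lebesgue_on {0..tf}.
        ((\<lambda>s. Re (z s)) has_real_derivative f1 (Re (z t)) (Im (z t)) (u t)) (at t within {0..tf}) \<and>
        ((\<lambda>s. Im (z s)) has_real_derivative f2 (Re (z t)) (Im (z t)) (u t)) (at t within {0..tf}) \<and>
        (g has_vector_derivative (g t ** X_mat (z t))) (at t within {0..tf}))"

text \<open>The library's path homotopies (relative to the endpoints) are between paths on the unit
  interval, so both curves are reparametrised by \<open>s \<mapsto> tf * s\<close>.\<close>

definition admissible_trajectory ::
    "real \<Rightarrow> (real \<Rightarrow> real^3) \<Rightarrow> (real \<Rightarrow> real^2^2) \<Rightarrow> (real \<Rightarrow> complex) \<Rightarrow> bool" where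
  "admissible_trajectory tf u g z \<longleftrightarrow>
     trajectory tf u g z \<and>
     z ` {0..tf} \<subseteq> h_star \<and>
     g 0 = mat 1 \<and> g tf = R_mat \<and>
     z tf = mobius (matrix_inv R_mat) (z 0) \<and>
     homotopic_paths SL2 (g \<circ> (\<lambda>s. tf * s))
       ((\<lambda>t. mat_exp ((pi * t / (3 * tf)) *\<^sub>R J_mat)) \<circ> (\<lambda>s. tf * s))"


section \<open>The Reinhardt problem\<close>

definition disk :: "(real^2) set \<Rightarrow> bool" where
  "disk D \<longleftrightarrow> compact D \<and> convex D \<and> interior D \<noteq> {}"

definition centrally_symmetric :: "(real^2) set \<Rightarrow> bool" where
  "centrally_symmetric D \<longleftrightarrow> (\<exists>c. (\<lambda>p. 2 *\<^sub>R c - p) ` D = D)"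

definition lattice_points :: "real^2 \<Rightarrow> real^2 \<Rightarrow> (real^2) set" where
  "lattice_points v w = {of_int m *\<^sub>R v + of_int n *\<^sub>R w | m n. True}"

definition lattice_packing :: "(real^2) set \<Rightarrow> real^2 \<Rightarrow> real^2 \<Rightarrow> bool" where
  "lattice_packing D v w \<longleftrightarrow>
     det (vector [v, w] :: real^2^2) \<noteq> 0 \<and>
     pairwise (\<lambda>p q. disjnt (interior ((+) p ` D)) (interior ((+) q ` D))) (lattice_points v w)"

definition packing_density :: "(real^2) set \<Rightarrow> real^2 \<Rightarrow> real^2 \<Rightarrow> real" where
  "packing_density D v w = measure lebesgue D / \<bar>det (vector [v, w] :: real^2^2)\<bar>"

text \<open>For a disk this supremum is finite and attained, so it is the density of a densest lattice
  packing.\<close>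

definition densest_lattice_density :: "(real^2) set \<Rightarrow> real" where
  "densest_lattice_density D =
     (SUP (v, w) \<in> {(v, w). lattice_packing D v w}. packing_density D v w)"

text \<open>Hexagons that degenerate to parallelograms are included; this makes the minimum of the area
  over the hexagons containing a given disk always attained, without changing the infimum.\<close>

definition cs_hexagon :: "(real^2) set \<Rightarrow> bool" where
  "cs_hexagon H \<longleftrightarrow>
     polytope H \<and> interior H \<noteq> {} \<and> centrally_symmetric H \<and> card {v. v extreme_point_of H} \<le> 6"

definition reinhardt_solution :: "(real^2) set \<Rightarrow> bool" where
  "reinhardt_solution D \<longleftrightarrow>
     disk D \<and> centrally_symmetric D \<and>
     (\<forall>D'. disk D' \<and> centrally_symmetric D' \<longrightarrow>
        densest_lattice_density D \<le> densest_lattice_density D') \<and>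
     uminus ` D = D \<and>
     (\<exists>H. cs_hexagon H \<and> D \<subseteq> H \<and> measure lebesgue H = sqrt 12 \<and>
        (\<forall>H'. cs_hexagon H' \<and> D \<subseteq> H' \<longrightarrow> sqrt 12 \<le> measure lebesgue H'))"

definition boundary_arcs :: "real \<Rightarrow> (real \<Rightarrow> real^2^2) \<Rightarrow> (real^2) set" where
  "boundary_arcs tf g = (\<Union>j\<in>{0..5}. (\<lambda>t. g t *v e_star j) ` {0..tf})"

text \<open>\<open>trajectory_disk tf g D\<close> says that \<open>D\<close> is the disk \<open>D(g, z)\<close>. It determines \<open>D\<close> uniquely,
  because a compact convex set is the convex hull of its frontier.\<close>

definition trajectory_disk :: "real \<Rightarrow> (real \<Rightarrow> real^2^2) \<Rightarrow> (real^2) set \<Rightarrow> bool" where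
  "trajectory_disk tf g D \<longleftrightarrow>
     disk D \<and> uminus ` D = D \<and> frontier D = boundary_arcs tf g"

definition reinhardt_trajectory ::
    "real \<Rightarrow> (real \<Rightarrow> real^3) \<Rightarrow> (real \<Rightarrow> real^2^2) \<Rightarrow> (real \<Rightarrow> complex) \<Rightarrow> bool" where
  "reinhardt_trajectory tf u g z \<longleftrightarrow>
     admissible_trajectory tf u g z \<and> (\<exists>D. trajectory_disk tf g D \<and> reinhardt_solution D)"


section \<open>Pontryagin extremals\<close>

text \<open>In the left-invariant trivialisation a point of \<open>T\<^sup>*M\<close> is \<open>((g, \<Lambda>), (z, \<nu>))\<close>. The Hamiltonian
  does not depend on \<open>g\<close>, and \<open>lc\<close> stands for \<open>\<lambda>_cost\<close>.\<close>

definition hamiltonian ::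
    "real \<Rightarrow> real^2^2 \<Rightarrow> complex \<Rightarrow> real^2 \<Rightarrow> real^3 \<Rightarrow> real" where
  "hamiltonian lc \<Lambda> z \<nu> u =
     trace_form \<Lambda> (X_mat z) - 3 / 2 * lc * trace_form J_mat (X_mat z)
     + \<nu> $ 1 * f1 (Re z) (Im z) u + \<nu> $ 2 * f2 (Re z) (Im z) u"

text \<open>For \<open>z\<close> in \<^const>\<open>h_star\<close> the denominator of \<^const>\<open>f1\<close> and \<^const>\<open>f2\<close> is negative on the
  compact control set, so the supremum is a maximum.\<close>

definition max_hamiltonian :: "real \<Rightarrow> real^2^2 \<Rightarrow> complex \<Rightarrow> real^2 \<Rightarrow> real" where
  "max_hamiltonian lc \<Lambda> z \<nu> = (SUP u\<in>control_set. hamiltonian lc \<Lambda> z \<nu> u)"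

definition lifted_trajectory ::
    "real \<Rightarrow> (real \<Rightarrow> real^3) \<Rightarrow> (real \<Rightarrow> real^2^2) \<Rightarrow> (real \<Rightarrow> complex)
     \<Rightarrow> real \<Rightarrow> (real \<Rightarrow> real^2^2) \<Rightarrow> (real \<Rightarrow> real^2) \<Rightarrow> bool" where
  "lifted_trajectory tf u g z lc \<Lambda> \<nu> \<longleftrightarrow>
     admissible_trajectory tf u g z \<and>
     (\<forall>t\<in>{0..tf}. trace (\<Lambda> t) = 0) \<and>
     (\<exists>C. C-lipschitz_on {0..tf} (\<lambda>t. ((g t, \<Lambda> t), (z t, \<nu> t)))) \<and>
     (AE t in lebesgue_on {0..tf}.
        (\<Lambda> has_vector_derivative mat_bracket (\<Lambda> t) (X_mat (z t))) (at t within {0..tf}) \<and>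
        ((\<lambda>s. \<nu> s $ 1) has_real_derivative
           - deriv (\<lambda>x. hamiltonian lc (\<Lambda> t) (Complex x (Im (z t))) (\<nu> t) (u t)) (Re (z t)))
          (at t within {0..tf}) \<and>
        ((\<lambda>s. \<nu> s $ 2) has_real_derivative
           - deriv (\<lambda>y. hamiltonian lc (\<Lambda> t) (Complex (Re (z t)) y) (\<nu> t) (u t)) (Im (z t)))
          (at t within {0..tf}))"

text \<open>The matrix, in the coordinates \<open>(x, y)\<close>, of the differential at \<open>z\<close> of a self-map of the
  half-plane.\<close>

definition half_plane_jacobian :: "(complex \<Rightarrow> complex) \<Rightarrow> complex \<Rightarrow> real^2^2" where
  "half_plane_jacobian f z =
     matrix (\<lambda>v :: real^2. let w = frechet_derivative f (at z) (Complex (v $ 1) (v $ 2))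
                           in vector [Re w, Im w] :: real^2)"

definition pontryagin_extremal ::
    "real \<Rightarrow> (real \<Rightarrow> real^3) \<Rightarrow> (real \<Rightarrow> real^2^2) \<Rightarrow> (real \<Rightarrow> complex)
     \<Rightarrow> real \<Rightarrow> (real \<Rightarrow> real^2^2) \<Rightarrow> (real \<Rightarrow> real^2) \<Rightarrow> bool" where
  "pontryagin_extremal tf u g z lc \<Lambda> \<nu> \<longleftrightarrow>
     lifted_trajectory tf u g z lc \<Lambda> \<nu> \<and>
     (AE t in lebesgue_on {0..tf}.
        hamiltonian lc (\<Lambda> t) (z t) (\<nu> t) (u t) = max_hamiltonian lc (\<Lambda> t) (z t) (\<nu> t) \<and>
        max_hamiltonian lc (\<Lambda> t) (z t) (\<nu> t) = 0) \<and>
     (\<forall>t\<in>{0..tf}. (lc, \<Lambda> t, \<nu> t) \<noteq> 0) \<and>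
     lc \<in> {0, -1} \<and>
     \<Lambda> tf = matrix_inv R_mat ** \<Lambda> 0 ** R_mat \<and>
     transpose (half_plane_jacobian (mobius (matrix_inv R_mat)) (z 0)) *v \<nu> tf = \<nu> 0"

definition maximizing_face ::
    "real \<Rightarrow> real^2^2 \<Rightarrow> complex \<Rightarrow> real^2 \<Rightarrow> (real^3) set" where
  "maximizing_face lc \<Lambda> z \<nu> =
     {u \<in> control_set. hamiltonian lc \<Lambda> z \<nu> u = max_hamiltonian lc \<Lambda> z \<nu>}"

definition singular_arc ::
    "real \<Rightarrow> real \<Rightarrow> real \<Rightarrow> (real \<Rightarrow> real^2^2) \<Rightarrow> (real \<Rightarrow> complex) \<Rightarrow> (real \<Rightarrow> real^2) \<Rightarrow> bool" where
  "singular_arc t1 t2 lc \<Lambda> z \<nu> \<longleftrightarrow>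
     (\<forall>t\<in>{t1..t2}. 0 < aff_dim (maximizing_face lc (\<Lambda> t) (z t) (\<nu> t)))"

end

theory Submission imports Defs begin

text \<open>A singular arc forces six circular arcs in the boundary of the disk, and a disk with such arcs
  can be deformed into one that packs less densely.

  Let \<open>Y = Z + \<langle>L, X\<rangle> X\<close> with \<open>L = \<Lambda> - \<mu> J\<close> and \<open>\<mu> = 3/2 * lc\<close>, where the traceless matrix \<open>Z\<close>
  represents the covector \<open>\<nu>\<close>. For a control with matrix \<open>P\<close> the Hamiltonian is \<open>\<langle>Y, P\<rangle> / \<langle>X,
  P\<rangle>\<close> with a negative denominator, so the maximum condition says that \<open>\<langle>Y, Q\<rangle> \<ge> 0\<close> at the three
  vertices \<open>Q\<close> of the control triangle, with equality somewhere; on a singular arc there is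
  equality at two vertices at least. If the inequality is strict at the third one, then the
  control runs along an edge. The equations then force \<open>\<mu> = 0\<close>, and they propagate this
  situation to one of the two ends of the trajectory (\<open>edge_forward\<close>, \<open>edge_backward\<close>). By
  transversality the data at the two ends differ by a rotation of order six, which permutes the
  edges, so the trajectory would have to run along two different edges at once (\<open>no_edge\<close>).
  Hence \<open>Y = 0\<close> on a singular arc (\<open>singular_Y_zero\<close>). By the differential equations then \<open>\<nu> =
  0\<close> and \<open>\<Lambda> = \<mu> J\<close>, and either all multipliers vanish, which is excluded, or \<open>X = J\<close>
  (\<open>Y_zero_circle\<close>). In the latter case \<open>g\<close> is a fixed matrix times a rotation, and in suitable
  linear coordinates of determinant \<open>1\<close> the boundary contains unit circular arcs around the six
  sixth roots of unity.

  Such arcs are not optimal. Replace the arc \<open>v * cis t\<close> around the root \<open>v\<close> by \<open>cis t * (\<rho> * v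
  + b * cis (- 3 * t) * cnj v)\<close>, where \<open>b\<close> is a small bump function of \<open>t\<close> and \<open>\<rho> = 1 + b^2 /
  2\<close>. At each time the six points are the image of the regular hexagon under a linear map of
  determinant \<open>\<rho>^2 - b^2 = 1 + b^4 / 4\<close>, so the inscribed hexagons do not become smaller,
  whereas the area swept by the six radii is proportional to \<open>1 - b^2 + b^4 / 4\<close> and does
  (\<open>deformed_area_less\<close>). Suppose that every boundary point \<open>p\<close> of a symmetric disk is a vertex
  of an inscribed hexagon with vertices \<open>p, q, q - p\<close> and their negatives, where the determinant
  of \<open>p, q\<close> is at least \<open>h\<close>. Then every packing lattice has determinant at least \<open>4 * h\<close>
  (\<open>packing_det_lower_bound\<close>), and a hexagon of this kind with vertices on the boundary and
  determinant \<open>h\<close> generates a packing with determinant \<open>4 * h\<close> (\<open>hexagon_lattice_packing\<close>). The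
  supposition holds with the same \<open>h\<close> for the original disk, where the bound is attained, and
  for the deformed one. So the density drops with the area, and the original disk is not a
  minimizer.\<close>

section \<open>Lipschitz functions and almost everywhere derivatives\<close>

text \<open>Cousin's lemma: the increments over the intervals of a fine tagged division whose tags lie in
  the null set add up to little, because a Lipschitz function is dominated there by the total
  length of those intervals.\<close>

lemma lipschitz_increment_le:
  fixes f :: "real \<Rightarrow> real"
  assumes ab: "a \<le> b" and lip: "L-lipschitz_on {a..b} f" and N: "negligible N"
    and der: "\<And>x. x \<in> {a..b} - N \<Longrightarrow> \<exists>d\<le>C. (f has_real_derivative d) (at x within {a..b})"
  shows "f b - f a \<le> C * (b - a)"
proof (rule field_le_epsilon)
  fix e0 :: real assume "0 < e0"
  define e where "e = e0 / (b - a + L + \<bar>C\<bar> + 1)"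
  have L: "0 \<le> L" using lip lipschitz_on_nonneg by blast
  have e: "0 < e" using \<open>0 < e0\<close> ab L unfolding e_def by (intro divide_pos_pos) auto
  have "(indicator N has_integral (0::real)) (cbox a b)"
    using N unfolding negligible_def by auto
  then obtain \<gamma>1 where g1: "gauge \<gamma>1" and
    g1': "\<And>p. p tagged_division_of (cbox a b) \<Longrightarrow> \<gamma>1 fine p \<Longrightarrow>
       norm ((\<Sum>(x,k)\<in>p. measure lborel k *\<^sub>R (indicator N x :: real)) - 0) < e"
    using has_integralD[OF _ e] by metis
  obtain D where D0: "\<forall>x\<in>{a..b} - N. D x \<le> C \<and> (f has_real_derivative D x) (at x within {a..b})"
    using bchoice[of "{a..b} - N" "\<lambda>x d. d \<le> C \<and> (f has_real_derivative d) (at x within {a..b})"] der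
    by blast
  then have D: "D x \<le> C" if "x \<in> {a..b} - N" for x using that by blast
  have "\<exists>d>0. x \<in> {a..b} - N \<longrightarrow> (\<forall>y\<in>{a..b}. dist y x < d \<longrightarrow>
      \<bar>f y - f x - D x * (y - x)\<bar> \<le> e * \<bar>y - x\<bar>)" for x
  proof (cases "x \<in> {a..b} - N")
    case True
    then have "(f has_derivative (*) (D x)) (at x within {a..b})"
      using D0 by (simp add: has_field_derivative_def)
    then have "\<forall>e>0. \<exists>d>0. \<forall>y\<in>{a..b}. norm (y - x) < d \<longrightarrow> norm (f y - f x - D x * (y - x)) \<le> e * norm (y - x)"
      unfolding has_derivative_within_alt by blast
    from this[rule_format, OF e] show ?thesis unfolding dist_norm real_norm_def by blast
  next
    case False
    then show ?thesis using zero_less_one by blast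
  qed
  then obtain d where d0: "\<forall>x. d x > 0 \<and> (x \<in> {a..b} - N \<longrightarrow> (\<forall>y\<in>{a..b}. dist y x < d x \<longrightarrow>
      \<bar>f y - f x - D x * (y - x)\<bar> \<le> e * \<bar>y - x\<bar>))"
    using choice[of "\<lambda>x d. d > 0 \<and> (x \<in> {a..b} - N \<longrightarrow> (\<forall>y\<in>{a..b}. dist y x < d \<longrightarrow>
      \<bar>f y - f x - D x * (y - x)\<bar> \<le> e * \<bar>y - x\<bar>))"] by blast
  then have dpos: "\<And>x. d x > 0" and
    d: "\<And>x y. x \<in> {a..b} - N \<Longrightarrow> y \<in> {a..b} \<Longrightarrow> dist y x < d x \<Longrightarrow>
      \<bar>f y - f x - D x * (y - x)\<bar> \<le> e * \<bar>y - x\<bar>"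
    by blast+
  have "gauge (\<lambda>x. \<gamma>1 x \<inter> ball x (d x))"
    using gauge_Int[OF g1 gauge_ball_dependent[of d]] dpos by simp
  then obtain p where p: "p tagged_division_of (cbox a b)" and
    fine: "(\<lambda>x. \<gamma>1 x \<inter> ball x (d x)) fine p"
    using fine_division_exists[of "\<lambda>x. \<gamma>1 x \<inter> ball x (d x)" a b] by metis
  have fine1: "\<gamma>1 fine p" and fine2: "(\<lambda>x. ball x (d x)) fine p"
    using fine by (auto simp: fine_def)
  have N1: "(\<Sum>(x,k)\<in>p. measure lborel k * indicator N x) < e"
    using g1'[OF p fine1] by auto
  have each: "f (Sup k) - f (Inf k) \<le> (C + e) * measure lborel k + (L + \<bar>C\<bar>) * (measure lborel k * indicator N x)"
    if xk: "(x,k) \<in> p" for x k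
  proof -
    obtain u v where k: "k = cbox u v" using p xk by (meson tagged_division_ofD(4))
    have xin: "x \<in> k" and sub: "k \<subseteq> cbox a b" using p xk by (auto dest: tagged_division_ofD)
    have uv: "u \<le> v" using xin k by auto
    have uvab: "u \<in> {a..b}" "v \<in> {a..b}" using sub k uv by auto
    have ks: "Sup k = v" "Inf k = u" "measure lborel k = v - u" using k uv by auto
    show ?thesis
    proof (cases "x \<in> N")
      case True
      have "f v - f u \<le> L * (v - u)"
        using lipschitz_onD[OF lip uvab(2) uvab(1)] uv by (auto simp: dist_real_def)
      also have "\<dots> \<le> (C + e) * (v - u) + (L + \<bar>C\<bar>) * (v - u)"
      proof -
        have "0 \<le> (C + \<bar>C\<bar> + e) * (v - u)" using uv e by (intro mult_nonneg_nonneg) auto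
        then show ?thesis by (simp add: algebra_simps)
      qed
      finally show ?thesis using True ks by simp
    next
      case False
      have xab: "x \<in> {a..b} - N" using xin sub False by auto
      have "cbox u v \<subseteq> ball x (d x)" using fine2 xk k by (auto simp: fine_def)
      then have "u \<in> ball x (d x)" "v \<in> ball x (d x)" using uv by auto
      then have du: "dist u x < d x" and dv: "dist v x < d x" by (auto simp: dist_commute)
      have xuv: "u \<le> x" "x \<le> v" using xin k by auto
      have "\<bar>f v - f x - D x * (v - x)\<bar> \<le> e * (v - x)"
        using d[OF xab uvab(2) dv] xuv by simp
      moreover have "\<bar>f u - f x - D x * (u - x)\<bar> \<le> e * (x - u)"
        using d[OF xab uvab(1) du] xuv by simp
      ultimately have "f v - f u \<le> D x * (v - u) + e * (v - u)" by (simp add: algebra_simps)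
      also have "\<dots> \<le> (C + e) * (v - u)"
        using mult_right_mono[OF D[OF xab], of "v - u"] uv by (simp add: algebra_simps)
      finally show ?thesis using False ks by simp
    qed
  qed
  have tel: "(\<Sum>(x,k)\<in>p. f (Sup k) - f (Inf k)) = f b - f a"
    using additive_tagged_division_1[OF ab, of p f] p by (simp add: split_def)
  have cont: "(\<Sum>(x,k)\<in>p. measure lborel k) = b - a"
    using additive_content_tagged_division[OF p] ab by (simp add: split_def)
  have "f b - f a \<le> (\<Sum>(x,k)\<in>p. (C + e) * measure lborel k + (L + \<bar>C\<bar>) * (measure lborel k * indicator N x))"
    unfolding tel[symmetric] by (rule sum_mono) (use each in auto)
  also have "\<dots> = (C + e) * (b - a) + (L + \<bar>C\<bar>) * (\<Sum>(x,k)\<in>p. measure lborel k * indicator N x)"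
    unfolding cont[symmetric] by (simp add: split_def sum.distrib sum_distrib_left)
  also have "\<dots> \<le> (C + e) * (b - a) + (L + \<bar>C\<bar>) * e"
    using N1 L by (intro add_left_mono mult_left_mono) auto
  also have "\<dots> \<le> C * (b - a) + e * (b - a + L + \<bar>C\<bar> + 1)" using e by (simp add: algebra_simps)
  also have "\<dots> = C * (b - a) + e0" unfolding e_def using ab L by (simp add: field_simps)
  finally show "f b - f a \<le> C * (b - a) + e0" .
qed

text \<open>The size of the Lipschitz constants never matters, only that sums, products and reciprocals of
  the coordinate functions of an extremal keep having one.\<close>

definition lip :: "real set \<Rightarrow> (real \<Rightarrow> real) \<Rightarrow> bool" where
  "lip S f \<longleftrightarrow> (\<exists>C. C-lipschitz_on S f)"

lemma lip_const [simp]: "lip S (\<lambda>t. c)"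
  unfolding lip_def using lipschitz_on_constant by blast

lemma lip_add: "lip S f \<Longrightarrow> lip S g \<Longrightarrow> lip S (\<lambda>t. f t + g t)"
  unfolding lip_def using lipschitz_on_add by blast

lemma lip_diff: "lip S f \<Longrightarrow> lip S g \<Longrightarrow> lip S (\<lambda>t. f t - g t)"
  unfolding lip_def using lipschitz_on_diff by blast

lemma lip_minus: "lip S f \<Longrightarrow> lip S (\<lambda>t. - f t)"
  unfolding lip_def using lipschitz_on_minus by blast

lemma lip_subset: "lip S f \<Longrightarrow> T \<subseteq> S \<Longrightarrow> lip T f"
  unfolding lip_def using lipschitz_on_subset by blast

lemma lip_continuous_on: "lip S f \<Longrightarrow> continuous_on S f"
  unfolding lip_def using lipschitz_on_continuous_on by blast

lemma lip_bounded:
  assumes "lip {a..b} f" obtains B where "B > 0" "\<And>t. t \<in> {a..b} \<Longrightarrow> \<bar>f t\<bar> \<le> B"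
proof -
  have "bounded (f ` {a..b})"
    using lip_continuous_on[OF assms] by (intro compact_imp_bounded compact_continuous_image) auto
  then show ?thesis using that by (auto simp: bounded_pos)
qed

lemma lip_mult:
  assumes "lip {a..b} f" "lip {a..b} g" shows "lip {a..b} (\<lambda>t. f t * g t)"
proof -
  obtain B1 B2 where B: "B1 > 0" "\<And>t. t \<in> {a..b} \<Longrightarrow> \<bar>f t\<bar> \<le> B1" "B2 > 0" "\<And>t. t \<in> {a..b} \<Longrightarrow> \<bar>g t\<bar> \<le> B2"
    using lip_bounded assms by metis
  obtain C1 C2 where C: "C1-lipschitz_on {a..b} f" "C2-lipschitz_on {a..b} g"
    using assms unfolding lip_def by auto
  have C0: "C1 \<ge> 0" "C2 \<ge> 0" using C lipschitz_on_nonneg by auto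
  have "(B1 * C2 + B2 * C1)-lipschitz_on {a..b} (\<lambda>t. f t * g t)"
  proof (rule lipschitz_onI)
    show "0 \<le> B1 * C2 + B2 * C1" using B C0 by auto
    fix x y assume xy: "x \<in> {a..b}" "y \<in> {a..b}"
    have 1: "\<bar>f x - f y\<bar> \<le> C1 * \<bar>x - y\<bar>" "\<bar>g x - g y\<bar> \<le> C2 * \<bar>x - y\<bar>"
      using lipschitz_onD[OF C(1) xy] lipschitz_onD[OF C(2) xy] by (auto simp: dist_real_def)
    have "f x * g x - f y * g y = f x * (g x - g y) + g y * (f x - f y)" by (simp add: algebra_simps)
    then have "\<bar>f x * g x - f y * g y\<bar> \<le> \<bar>f x\<bar> * \<bar>g x - g y\<bar> + \<bar>g y\<bar> * \<bar>f x - f y\<bar>"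
      by (metis abs_mult abs_triangle_ineq)
    also have "\<dots> \<le> B1 * (C2 * \<bar>x - y\<bar>) + B2 * (C1 * \<bar>x - y\<bar>)"
      using B xy 1 by (intro add_mono mult_mono) auto
    finally show "dist (f x * g x) (f y * g y) \<le> (B1 * C2 + B2 * C1) * dist x y"
      by (simp add: dist_real_def algebra_simps)
  qed
  then show ?thesis unfolding lip_def by blast
qed

lemma lip_inverse:
  assumes "lip {a..b} f" "\<And>t. t \<in> {a..b} \<Longrightarrow> f t > 0" shows "lip {a..b} (\<lambda>t. 1 / f t)"
proof (cases "a \<le> b")
  case True
  obtain m where m: "m \<in> {a..b}" "\<And>t. t \<in> {a..b} \<Longrightarrow> f m \<le> f t"
    using continuous_attains_inf[OF _ _ lip_continuous_on[OF assms(1)]] True by auto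
  have mp: "f m > 0" using assms m by auto
  obtain C where C: "C-lipschitz_on {a..b} f" using assms unfolding lip_def by auto
  have C0: "C \<ge> 0" using C lipschitz_on_nonneg by auto
  have "(C / (f m * f m))-lipschitz_on {a..b} (\<lambda>t. 1 / f t)"
  proof (rule lipschitz_onI)
    show "0 \<le> C / (f m * f m)" using C0 mp by auto
    fix x y assume xy: "x \<in> {a..b}" "y \<in> {a..b}"
    have 1: "\<bar>f y - f x\<bar> \<le> C * \<bar>x - y\<bar>"
      using lipschitz_onD[OF C xy] by (auto simp: dist_real_def)
    have p: "f x > 0" "f y > 0" using assms xy by auto
    have "1 / f x - 1 / f y = (f y - f x) / (f x * f y)" using p by (simp add: field_simps)
    then have "\<bar>1 / f x - 1 / f y\<bar> = \<bar>f y - f x\<bar> / (f x * f y)" using p by simp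
    also have "\<dots> \<le> (C * \<bar>x - y\<bar>) / (f m * f m)"
      using 1 p mp m xy C0 by (intro frac_le mult_mono) auto
    finally show "dist (1 / f x) (1 / f y) \<le> C / (f m * f m) * dist x y"
      by (simp add: dist_real_def)
  qed
  then show ?thesis unfolding lip_def by blast
qed (auto simp: lip_def intro!: exI[of _ 0])

lemma lip_increment_le:
  assumes "lip {a..b} f" "negligible N" "a \<le> s" "s \<le> t" "t \<le> b"
    and "\<And>x. x \<in> {s..t} - N \<Longrightarrow> \<exists>d\<le>C. (f has_real_derivative d) (at x within {a..b})"
  shows "f t - f s \<le> C * (t - s)"
proof -
  obtain L where "L-lipschitz_on {a..b} f" using assms unfolding lip_def by auto
  then have "L-lipschitz_on {s..t} f" using assms by (auto intro: lipschitz_on_subset)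
  moreover have "\<exists>d\<le>C. (f has_real_derivative d) (at x within {s..t})" if "x \<in> {s..t} - N" for x
    using assms(6)[OF that] assms by (meson atLeastatMost_subset_iff has_field_derivative_subset)
  ultimately show ?thesis using lipschitz_increment_le[of s t L f N C] assms by auto
qed

lemma lip_constant:
  assumes "lip {a..b} f" "negligible N" "a \<le> s" "s \<le> t" "t \<le> b"
    and der: "\<And>x. x \<in> {s..t} - N \<Longrightarrow> (f has_real_derivative 0) (at x within {a..b})"
  shows "f t = f s"
proof -
  have "f t - f s \<le> 0 * (t - s)"
    by (rule lip_increment_le[OF assms(1-5)]) (use der in blast)
  moreover have "- f t - - f s \<le> 0 * (t - s)"
  proof (rule lip_increment_le[OF lip_minus[OF assms(1)] assms(2-5)])
    fix x assume "x \<in> {s..t} - N"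
    from DERIV_minus[OF der[OF this]]
    show "\<exists>d\<le>0. ((\<lambda>t. - f t) has_real_derivative d) (at x within {a..b})" by auto
  qed
  ultimately show ?thesis by simp
qed

text \<open>Gronwall's argument on an interval so short that no iteration is needed: the maximum of \<open>\<bar>f\<bar>\<close>
  is at most \<open>K * (t - s) < 1\<close> times itself.\<close>

lemma lip_gronwall_step:
  assumes f: "lip {a..b} f" and N: "negligible N" and st: "a \<le> s" "s \<le> t" "t \<le> b"
    and K: "K \<ge> 0" and small: "K * (t - s) < 1"
    and der: "\<And>x. x \<in> {s..t} - N \<Longrightarrow> \<exists>d. \<bar>d\<bar> \<le> K * \<bar>f x\<bar> \<and> (f has_real_derivative d) (at x within {a..b})"
    and zero: "f s = 0 \<or> f t = 0" and x: "x \<in> {s..t}"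
  shows "f x = 0"
proof -
  have "continuous_on {s..t} (\<lambda>x. \<bar>f x\<bar>)"
    using lip_continuous_on[OF f] st by (intro continuous_intros) (auto intro: continuous_on_subset)
  then obtain m where m: "m \<in> {s..t}" "\<And>x. x \<in> {s..t} \<Longrightarrow> \<bar>f x\<bar> \<le> \<bar>f m\<bar>"
    using continuous_attains_sup[of "{s..t}" "\<lambda>x. \<bar>f x\<bar>"] st by auto
  have bd: "\<bar>f v - f u\<bar> \<le> K * \<bar>f m\<bar> * (v - u)" if "s \<le> u" "u \<le> v" "v \<le> t" for u v
  proof -
    have 1: "\<exists>d. \<bar>d\<bar> \<le> K * \<bar>f m\<bar> \<and> (f has_real_derivative d) (at x within {a..b})" if "x \<in> {u..v} - N" for x
    proof -
      have "x \<in> {s..t} - N" using that \<open>s \<le> u\<close> \<open>v \<le> t\<close> by auto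
      from der[OF this] m(2)[of x] show ?thesis
        using K \<open>x \<in> {s..t} - N\<close> by (metis Diff_iff mult_left_mono order_trans)
    qed
    have "f v - f u \<le> K * \<bar>f m\<bar> * (v - u)"
    proof (rule lip_increment_le[OF f N])
      fix x assume "x \<in> {u..v} - N"
      from 1[OF this] show "\<exists>d\<le>K * \<bar>f m\<bar>. (f has_real_derivative d) (at x within {a..b})"
        using abs_le_D1 by blast
    qed (use that st in auto)
    moreover have "- f v - - f u \<le> K * \<bar>f m\<bar> * (v - u)"
    proof (rule lip_increment_le[OF lip_minus[OF f] N])
      fix x assume "x \<in> {u..v} - N"
      from 1[OF this] obtain d where "\<bar>d\<bar> \<le> K * \<bar>f m\<bar>" "(f has_real_derivative d) (at x within {a..b})" by auto
      then show "\<exists>d\<le>K * \<bar>f m\<bar>. ((\<lambda>t. - f t) has_real_derivative d) (at x within {a..b})"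
        by (intro exI[of _ "-d"] conjI DERIV_minus) auto
    qed (use that st in auto)
    ultimately show ?thesis by auto
  qed
  have "\<bar>f m\<bar> \<le> K * \<bar>f m\<bar> * (t - s)"
  proof (cases "f s = 0")
    case True
    have "\<bar>f m\<bar> \<le> K * \<bar>f m\<bar> * (m - s)" using bd[of s m] m(1) True by auto
    also have "\<dots> \<le> K * \<bar>f m\<bar> * (t - s)" using m(1) K by (intro mult_left_mono) auto
    finally show ?thesis .
  next
    case False
    then have "f t = 0" using zero by auto
    then have "\<bar>f m\<bar> \<le> K * \<bar>f m\<bar> * (t - m)" using bd[of m t] m(1) by auto
    also have "\<dots> \<le> K * \<bar>f m\<bar> * (t - s)" using m(1) K by (intro mult_left_mono) auto
    finally show ?thesis .
  qed
  then have "\<bar>f m\<bar> * (1 - K * (t - s)) \<le> 0" by (simp add: algebra_simps)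
  then have "f m = 0" using small by (auto simp: mult_le_0_iff)
  then show ?thesis using m(2)[OF x] by simp
qed

text \<open>The derivatives in a trajectory exist at almost every time; negligible sets are the form in
  which the exceptional times enter the increment estimates above.\<close>

lemma AE_lebesgue_on_exceptional_set:
  assumes "AE t in lebesgue_on {a..b::real}. Q t"
  shows "\<exists>N. negligible N \<and> (\<forall>t\<in>{a..b} - N. Q t)"
proof -
  have ae: "AE t in lebesgue. t \<in> {a..b} \<longrightarrow> Q t"
    using assms by (subst (asm) AE_restrict_space_iff) auto
  obtain N where N: "N \<in> null_sets lebesgue" "{t \<in> space lebesgue. \<not> (t \<in> {a..b} \<longrightarrow> Q t)} \<subseteq> N"
    using ae unfolding eventually_ae_filter by blast
  have "negligible N" using N(1) by (simp add: negligible_iff_null_sets)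
  moreover have "Q t" if "t \<in> {a..b} - N" for t
  proof (rule ccontr)
    assume "\<not> Q t"
    then have "t \<in> {t \<in> space lebesgue. \<not> (t \<in> {a..b} \<longrightarrow> Q t)}" using that by simp
    then show False using N(2) that by blast
  qed
  ultimately show ?thesis by blast
qed

lemma negligible_interval_witness:
  assumes "negligible N" "a < (b::real)" obtains t where "t \<in> {a<..<b}" "t \<notin> N"
proof -
  have "{a<..<b} \<noteq> {}" using assms(2) by simp
  then have "\<not> negligible {a<..<b}" using open_not_negligible open_greaterThanLessThan by blast
  then have "\<not> {a<..<b} \<subseteq> N" using negligible_subset assms(1) by blast
  then show ?thesis using that by blast
qed

lemma nonneg_off_negligible:
  fixes f :: "real \<Rightarrow> real"
  assumes c: "continuous_on {a..b} f" and N: "negligible N" and ab: "a < b"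
    and nn: "\<And>t. t \<in> {a..b} - N \<Longrightarrow> 0 \<le> f t" and t: "t \<in> {a..b}"
  shows "0 \<le> f t"
proof (rule ccontr)
  assume neg: "\<not> 0 \<le> f t"
  then have "0 < - f t" by simp
  with c t obtain d where d: "d > 0" "\<And>s. s \<in> {a..b} \<Longrightarrow> dist s t < d \<Longrightarrow> dist (f s) (f t) < - f t"
    unfolding continuous_on_iff by blast
  have "max a (t - d) < min b (t + d)" using ab t d(1) by auto
  from negligible_interval_witness[OF N this] obtain s
    where s: "s \<in> {max a (t - d)<..<min b (t + d)}" "s \<notin> N" .
  then have sab: "s \<in> {a..b}" and "dist s t < d" by (auto simp: dist_real_def)
  from d(2)[OF this] have "f s < 0" by (simp add: dist_real_def)
  then show False using nn[of s] s(2) sab by simp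
qed

lemma zero_off_negligible:
  fixes f :: "real \<Rightarrow> real"
  assumes c: "continuous_on {a..b} f" and N: "negligible N" and ab: "a < b"
    and z: "\<And>t. t \<in> {a..b} - N \<Longrightarrow> f t = 0" and t: "t \<in> {a..b}"
  shows "f t = 0"
proof -
  have "0 \<le> f t" by (rule nonneg_off_negligible[OF c N ab _ t]) (simp add: z)
  moreover have "0 \<le> - f t"
    by (rule nonneg_off_negligible[OF continuous_on_minus[OF c] N ab _ t]) (simp add: z)
  ultimately show ?thesis by simp
qed

section \<open>The extremal equations in matrix form\<close>

lemma entry_has_derivative:
  fixes F :: "real \<Rightarrow> real^2^2"
  assumes "(F has_vector_derivative D) (at t within S)"
  shows "((\<lambda>t. F t $ i $ j) has_real_derivative D $ i $ j) (at t within S)"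
proof -
  have bl: "bounded_linear (\<lambda>A :: real^2^2. A $ i $ j)"
    by (rule bounded_linear_compose[OF bounded_linear_vec_nth bounded_linear_vec_nth])
  from bounded_linear.has_vector_derivative[OF bl assms] show ?thesis
    by (simp add: has_real_derivative_iff_has_vector_derivative)
qed

lemma trace_form_entries:
  "trace_form A B = A$1$1 * B$1$1 + A$1$2 * B$2$1 + A$2$1 * B$1$2 + A$2$2 * B$2$2"
  by (simp add: trace_form_def trace_def matrix_matrix_mult_def sum_2)

lemma mat_bracket_entries:
  assumes "A$2$2 = - A$1$1" "B$2$2 = - B$1$1"
  shows "mat_bracket A B $1$1 = A$1$2 * B$2$1 - B$1$2 * A$2$1"
    "mat_bracket A B $1$2 = 2 * (A$1$1 * B$1$2 - A$1$2 * B$1$1)"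
    "mat_bracket A B $2$1 = 2 * (A$2$1 * B$1$1 - A$1$1 * B$2$1)"
    "mat_bracket A B $2$2 = - (A$1$2 * B$2$1 - B$1$2 * A$2$1)"
  using assms by (simp_all add: mat_bracket_def matrix_matrix_mult_def sum_2 algebra_simps)

text \<open>Conjugation by the rotation by \<open>pi / 3\<close> is the symmetry of the problem. It has order three,
  because the cube of the rotation is \<open>- 1\<close>, and it permutes the three vertices of the control
  triangle cyclically.\<close>

definition rot60 :: "real^2^2" where
  "rot60 = vector [vector [1/2, - sqrt 3 / 2], vector [sqrt 3 / 2, 1/2]]"

definition mconj :: "real^2^2 \<Rightarrow> real^2^2" where
  "mconj A = rot60 ** A ** transpose rot60"

lemma rot60_orth: "transpose rot60 ** rot60 = mat 1" "rot60 ** transpose rot60 = mat 1"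
  by (simp_all add: vec_eq_iff forall_2 rot60_def matrix_matrix_mult_def sum_2 transpose_def mat_def algebra_simps)

lemma mconj_mult: "mconj (A ** B) = mconj A ** mconj B"
  unfolding mconj_def by (metis matrix_mul_assoc matrix_mul_rid rot60_orth(1))

lemma mconj_linear:
  "mconj (A + B) = mconj A + mconj B" "mconj (A - B) = mconj A - mconj B" "mconj (r *\<^sub>R A) = r *\<^sub>R mconj A"
  unfolding mconj_def
  by (simp_all add: vec_eq_iff forall_2 matrix_matrix_mult_def sum_2 algebra_simps)

lemma mconj_bracket: "mconj (mat_bracket A B) = mat_bracket (mconj A) (mconj B)"
  by (simp add: mat_bracket_def mconj_linear mconj_mult)

lemma mconj_entries:
  assumes "A$2$2 = - A$1$1"
  shows "mconj A $1$1 = - A$1$1 / 2 - sqrt 3 / 4 * (A$1$2 + A$2$1)"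
    "mconj A $1$2 = sqrt 3 / 2 * A$1$1 + A$1$2 / 4 - 3/4 * A$2$1"
    "mconj A $2$1 = sqrt 3 / 2 * A$1$1 - 3/4 * A$1$2 + A$2$1 / 4"
    "mconj A $2$2 = - mconj A $1$1"
  using assms unfolding mconj_def rot60_def
  by (simp_all add: matrix_matrix_mult_def sum_2 transpose_def field_simps)

lemma trace_form_mconj: "trace_form (mconj A) (mconj B) = trace_form A B"
proof -
  have "trace (rot60 ** (A ** B) ** transpose rot60) = trace (transpose rot60 ** (rot60 ** (A ** B)))"
    by (rule trace_mul_sym)
  also have "\<dots> = trace (A ** B)" by (simp add: matrix_mul_assoc rot60_orth)
  finally have "trace (mconj (A ** B)) = trace (A ** B)" by (simp only: mconj_def)
  then show ?thesis unfolding trace_form_def mconj_mult .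
qed

lemma trace_form_linear:
  "trace_form (A + B) C = trace_form A C + trace_form B C"
  "trace_form (A - B) C = trace_form A C - trace_form B C"
  "trace_form (r *\<^sub>R A) C = r * trace_form A C"
  "trace_form C (A + B) = trace_form C A + trace_form C B"
  "trace_form C (r *\<^sub>R A) = r * trace_form C A"
  by (simp_all add: trace_form_entries algebra_simps)

lemma J_mat_entries: "J_mat$1$1 = 0" "J_mat$1$2 = -1" "J_mat$2$1 = 1" "J_mat$2$2 = 0"
  by (simp_all add: J_mat_def)

lemma mconj_J: "mconj J_mat = J_mat"
  by (simp add: vec_eq_iff forall_2 mconj_entries J_mat_entries)

definition vert0 :: "real^2^2" where "vert0 = vector [vector [0, 1/3], vector [1, 0]]"
definition vert1 :: "real^2^2" where "vert1 = vector [vector [1 / sqrt 3, -2/3], vector [0, - 1 / sqrt 3]]"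
definition vert2 :: "real^2^2" where "vert2 = vector [vector [- 1 / sqrt 3, -2/3], vector [0, 1 / sqrt 3]]"

lemma vert_entries:
  "vert0$1$1 = 0" "vert0$1$2 = 1/3" "vert0$2$1 = 1" "vert0$2$2 = 0"
  "vert1$1$1 = 1 / sqrt 3" "vert1$1$2 = -2/3" "vert1$2$1 = 0" "vert1$2$2 = - 1 / sqrt 3"
  "vert2$1$1 = - 1 / sqrt 3" "vert2$1$2 = -2/3" "vert2$2$1 = 0" "vert2$2$2 = 1 / sqrt 3"
  by (simp_all add: vert0_def vert1_def vert2_def)

lemma vert_distinct: "vert0 \<noteq> vert1" "vert0 \<noteq> vert2" "vert1 \<noteq> vert2"
proof -
  have "vert0$2$1 \<noteq> vert1$2$1" "vert0$2$1 \<noteq> vert2$2$1" "vert1$1$1 \<noteq> vert2$1$1" by (simp_all add: vert_entries)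
  then show "vert0 \<noteq> vert1" "vert0 \<noteq> vert2" "vert1 \<noteq> vert2" by metis+
qed

lemma mconj_vert: "mconj vert0 = vert2" "mconj vert2 = vert1" "mconj vert1 = vert0"
  by (simp_all add: vec_eq_iff forall_2 mconj_entries vert_entries field_simps)

definition verts :: "(real^2^2) set" where "verts = {vert0, vert1, vert2}"

lemma mconj_verts: "mconj ` verts = verts"
  unfolding verts_def using mconj_vert by auto

text \<open>The vertices are the matrices of the extreme controls, so these combinations are the matrices
  of all controls.\<close>

definition wcomb :: "real \<Rightarrow> real \<Rightarrow> real \<Rightarrow> real^2^2" where
  "wcomb a b c = a *\<^sub>R vert0 + b *\<^sub>R vert1 + c *\<^sub>R vert2"

lemma mconj_wcomb: "mconj (wcomb a b c) = wcomb c a b \<or> mconj (wcomb a b c) = wcomb b c a"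
  unfolding wcomb_def mconj_linear mconj_vert by (simp add: algebra_simps)

lemma wcomb_entries:
  "wcomb a b c $1$1 = (b - c) / sqrt 3" "wcomb a b c $1$2 = a / 3 - 2/3 * b - 2/3 * c"
  "wcomb a b c $2$1 = a" "wcomb a b c $2$2 = - wcomb a b c $1$1"
  by (simp_all add: wcomb_def vert_entries field_simps)

definition simplex_mats :: "(real^2^2) set" where
  "simplex_mats = {wcomb a b c | a b c. 0 \<le> a \<and> 0 \<le> b \<and> 0 \<le> c \<and> a + b + c = 1}"

lemma simplex_mats_mconj: "P \<in> simplex_mats \<Longrightarrow> mconj P \<in> simplex_mats"
  unfolding simplex_mats_def using mconj_wcomb by (smt (verit, best) mem_Collect_eq)

lemma simplex_neg:
  assumes neg: "\<And>Q. Q \<in> verts \<Longrightarrow> trace_form A Q < 0" and P: "P' \<in> simplex_mats"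
  shows "trace_form A P' < 0"
proof -
  obtain a b c where p: "P' = wcomb a b c" "0 \<le> a" "0 \<le> b" "0 \<le> c" "a + b + c = 1" using P unfolding simplex_mats_def by blast
  have v: "trace_form A vert0 < 0" "trace_form A vert1 < 0" "trace_form A vert2 < 0"
    using neg by (auto simp: verts_def)
  have e: "trace_form A P' = a * trace_form A vert0 + b * trace_form A vert1 + c * trace_form A vert2"
    unfolding p(1) wcomb_def trace_form_linear by simp
  have n: "a * trace_form A vert0 \<le> 0" "b * trace_form A vert1 \<le> 0" "c * trace_form A vert2 \<le> 0"
    using p v by (auto intro: mult_nonneg_nonpos)
  consider "a > 0" | "b > 0" | "c > 0" using p by linarith
  then show ?thesis
  proof cases
    case 1 then show ?thesis using e n mult_pos_neg[OF 1 v(1)] by linarith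
  next
    case 2 then show ?thesis using e n mult_pos_neg[OF 2 v(2)] by linarith
  next
    case 3 then show ?thesis using e n mult_pos_neg[OF 3 v(3)] by linarith
  qed
qed

text \<open>An extremal, written with matrices only: \<open>X\<close> stands for \<open>z\<close>, the moment map \<open>Z\<close> for the
  covector \<open>\<nu>\<close>, \<open>P\<close> for the control, and \<open>\<mu>\<close> for \<open>3/2\<close> times the multiplier of the cost. The
  point of this form is that it is visibly invariant under \<open>mconj\<close>, so that the three edges of
  the control triangle need not be treated separately; \<open>periodic\<close> is the transversality
  condition.\<close>

locale extremal_system =
  fixes T \<mu> :: real and \<Lambda> X Z P :: "real \<Rightarrow> real^2^2"
  assumes T_pos: "0 < T"
    and lip_\<Lambda>: "\<And>i j. lip {0..T} (\<lambda>t. \<Lambda> t $ i $ j)"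
    and lip_X: "\<And>i j. lip {0..T} (\<lambda>t. X t $ i $ j)"
    and lip_Z: "\<And>i j. lip {0..T} (\<lambda>t. Z t $ i $ j)"
    and traceless: "\<And>t. t \<in> {0..T} \<Longrightarrow> \<Lambda> t $ 2 $ 2 = - \<Lambda> t $ 1 $ 1"
      "\<And>t. t \<in> {0..T} \<Longrightarrow> X t $ 2 $ 2 = - X t $ 1 $ 1"
      "\<And>t. t \<in> {0..T} \<Longrightarrow> Z t $ 2 $ 2 = - Z t $ 1 $ 1"
    and X_pos: "\<And>t. t \<in> {0..T} \<Longrightarrow> 0 < X t $ 2 $ 1 - X t $ 1 $ 2"
    and X_det: "\<And>t. t \<in> {0..T} \<Longrightarrow> det (X t) = 1"
    and ZX: "\<And>t. t \<in> {0..T} \<Longrightarrow> trace_form (Z t) (X t) = 0"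
    and neg: "\<And>t Q. t \<in> {0..T} \<Longrightarrow> Q \<in> verts \<Longrightarrow> trace_form (X t) Q < 0"
    and nonneg: "\<And>t Q. t \<in> {0..T} \<Longrightarrow> Q \<in> verts \<Longrightarrow>
      0 \<le> trace_form (Z t + trace_form (\<Lambda> t - \<mu> *\<^sub>R J_mat) (X t) *\<^sub>R X t) Q"
    and ode: "\<exists>N. negligible N \<and> (\<forall>t\<in>{0..T} - N.
       P t \<in> simplex_mats \<and>
       trace_form (Z t + trace_form (\<Lambda> t - \<mu> *\<^sub>R J_mat) (X t) *\<^sub>R X t) (P t) = 0 \<and>
       (X has_vector_derivative (1 / trace_form (X t) (P t)) *\<^sub>R mat_bracket (P t) (X t)) (at t within {0..T}) \<and>
       (\<Lambda> has_vector_derivative mat_bracket (\<Lambda> t) (X t)) (at t within {0..T}) \<and>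
       (Z has_vector_derivative mat_bracket (\<Lambda> t - \<mu> *\<^sub>R J_mat) (X t) + (1 / trace_form (X t) (P t)) *\<^sub>R
          mat_bracket (P t) (Z t + trace_form (\<Lambda> t - \<mu> *\<^sub>R J_mat) (X t) *\<^sub>R X t)) (at t within {0..T}))"
    and periodic: "mconj (X T) = X 0" "mconj (\<Lambda> T) = \<Lambda> 0" "mconj (Z T) = Z 0"

lemma lip_mconj_entry:
  assumes "\<And>i j. lip {0..T} (\<lambda>t. F t $ i $ j)"
  shows "lip {0..T} (\<lambda>t. mconj (F t) $ i $ j)"
proof -
  have "mconj (F t) $ i $ j = (rot60$i$1 * F t$1$1 + rot60$i$2 * F t$2$1) * rot60$j$1
      + (rot60$i$1 * F t$1$2 + rot60$i$2 * F t$2$2) * rot60$j$2" for t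
    by (simp add: mconj_def matrix_matrix_mult_def sum_2 transpose_def)
  then show ?thesis by (simp only:) (intro lip_add lip_mult lip_const assms)
qed

lemma has_vector_derivative_mconj:
  assumes "(F has_vector_derivative D) (at t within S)"
  shows "((\<lambda>t. mconj (F t)) has_vector_derivative mconj D) (at t within S)"
proof -
  have "linear mconj" by (rule linearI) (simp_all add: mconj_linear)
  then have "bounded_linear mconj" by (simp add: linear_conv_bounded_linear)
  from bounded_linear.has_vector_derivative[OF this assms] show ?thesis .
qed

lemma extremal_system_mconj:
  assumes "extremal_system T \<mu> \<Lambda> X Z P"
  shows "extremal_system T \<mu> (\<lambda>t. mconj (\<Lambda> t)) (\<lambda>t. mconj (X t)) (\<lambda>t. mconj (Z t)) (\<lambda>t. mconj (P t))"
proof -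
  interpret extremal_system T \<mu> \<Lambda> X Z P by fact
  have L: "mconj (\<Lambda> t) - \<mu> *\<^sub>R J_mat = mconj (\<Lambda> t - \<mu> *\<^sub>R J_mat)" for t
    by (simp add: mconj_linear mconj_J)
  have Y: "mconj (Z t) + trace_form (mconj (\<Lambda> t) - \<mu> *\<^sub>R J_mat) (mconj (X t)) *\<^sub>R mconj (X t)
    = mconj (Z t + trace_form (\<Lambda> t - \<mu> *\<^sub>R J_mat) (X t) *\<^sub>R X t)" for t
    unfolding L trace_form_mconj by (simp add: mconj_linear)
  have Q: "\<exists>Q'\<in>verts. Q = mconj Q'" if "Q \<in> verts" for Q using that mconj_verts by blast
  show ?thesis
  proof
    fix t assume t: "t \<in> {0..T}"
    show "mconj (\<Lambda> t) $ 2 $ 2 = - mconj (\<Lambda> t) $ 1 $ 1" "mconj (X t) $ 2 $ 2 = - mconj (X t) $ 1 $ 1"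
      "mconj (Z t) $ 2 $ 2 = - mconj (Z t) $ 1 $ 1"
      using traceless t by (auto intro: mconj_entries(4))
    show "0 < mconj (X t) $ 2 $ 1 - mconj (X t) $ 1 $ 2"
      using X_pos[OF t] traceless(2)[OF t] by (simp add: mconj_entries)
    show "det (mconj (X t)) = 1"
    proof -
      have "det rot60 * det (transpose rot60) = 1" using rot60_orth(2) by (metis det_I det_mul)
      then show ?thesis using X_det[OF t] unfolding mconj_def det_mul by simp
    qed
    show "trace_form (mconj (Z t)) (mconj (X t)) = 0" using ZX[OF t] by (simp add: trace_form_mconj)
    fix Q assume "Q \<in> verts"
    then obtain Q' where Q': "Q' \<in> verts" "Q = mconj Q'" using Q by blast
    show "trace_form (mconj (X t)) Q < 0" using neg[OF t Q'(1)] by (simp add: Q' trace_form_mconj)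
    show "0 \<le> trace_form (mconj (Z t) + trace_form (mconj (\<Lambda> t) - \<mu> *\<^sub>R J_mat) (mconj (X t)) *\<^sub>R mconj (X t)) Q"
      unfolding Y Q'(2) trace_form_mconj using nonneg[OF t Q'(1)] .
  next
    obtain N where N: "negligible N" and o: "\<And>t. t \<in> {0..T} - N \<Longrightarrow>
       P t \<in> simplex_mats \<and>
       trace_form (Z t + trace_form (\<Lambda> t - \<mu> *\<^sub>R J_mat) (X t) *\<^sub>R X t) (P t) = 0 \<and>
       (X has_vector_derivative (1 / trace_form (X t) (P t)) *\<^sub>R mat_bracket (P t) (X t)) (at t within {0..T}) \<and>
       (\<Lambda> has_vector_derivative mat_bracket (\<Lambda> t) (X t)) (at t within {0..T}) \<and>
       (Z has_vector_derivative mat_bracket (\<Lambda> t - \<mu> *\<^sub>R J_mat) (X t) + (1 / trace_form (X t) (P t)) *\<^sub>R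
          mat_bracket (P t) (Z t + trace_form (\<Lambda> t - \<mu> *\<^sub>R J_mat) (X t) *\<^sub>R X t)) (at t within {0..T})"
      using ode by blast
    show "\<exists>N. negligible N \<and> (\<forall>t\<in>{0..T} - N.
       mconj (P t) \<in> simplex_mats \<and>
       trace_form (mconj (Z t) + trace_form (mconj (\<Lambda> t) - \<mu> *\<^sub>R J_mat) (mconj (X t)) *\<^sub>R mconj (X t)) (mconj (P t)) = 0 \<and>
       ((\<lambda>t. mconj (X t)) has_vector_derivative (1 / trace_form (mconj (X t)) (mconj (P t))) *\<^sub>R mat_bracket (mconj (P t)) (mconj (X t))) (at t within {0..T}) \<and>
       ((\<lambda>t. mconj (\<Lambda> t)) has_vector_derivative mat_bracket (mconj (\<Lambda> t)) (mconj (X t))) (at t within {0..T}) \<and>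
       ((\<lambda>t. mconj (Z t)) has_vector_derivative mat_bracket (mconj (\<Lambda> t) - \<mu> *\<^sub>R J_mat) (mconj (X t)) + (1 / trace_form (mconj (X t)) (mconj (P t))) *\<^sub>R
          mat_bracket (mconj (P t)) (mconj (Z t) + trace_form (mconj (\<Lambda> t) - \<mu> *\<^sub>R J_mat) (mconj (X t)) *\<^sub>R mconj (X t))) (at t within {0..T}))"
    proof (intro exI[of _ N] conjI N ballI)
      fix t assume "t \<in> {0..T} - N"
      note o' = o[OF this]
      show "mconj (P t) \<in> simplex_mats" using o' simplex_mats_mconj by blast
      show "trace_form (mconj (Z t) + trace_form (mconj (\<Lambda> t) - \<mu> *\<^sub>R J_mat) (mconj (X t)) *\<^sub>R mconj (X t)) (mconj (P t)) = 0"
        unfolding Y trace_form_mconj using o' by blast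
      show "((\<lambda>t. mconj (X t)) has_vector_derivative (1 / trace_form (mconj (X t)) (mconj (P t))) *\<^sub>R mat_bracket (mconj (P t)) (mconj (X t))) (at t within {0..T})"
        unfolding trace_form_mconj mconj_bracket[symmetric] mconj_linear(3)[symmetric]
        by (rule has_vector_derivative_mconj) (use o' in blast)
      show "((\<lambda>t. mconj (\<Lambda> t)) has_vector_derivative mat_bracket (mconj (\<Lambda> t)) (mconj (X t))) (at t within {0..T})"
        unfolding mconj_bracket[symmetric]
        by (rule has_vector_derivative_mconj) (use o' in blast)
      show "((\<lambda>t. mconj (Z t)) has_vector_derivative mat_bracket (mconj (\<Lambda> t) - \<mu> *\<^sub>R J_mat) (mconj (X t)) + (1 / trace_form (mconj (X t)) (mconj (P t))) *\<^sub>R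
          mat_bracket (mconj (P t)) (mconj (Z t) + trace_form (mconj (\<Lambda> t) - \<mu> *\<^sub>R J_mat) (mconj (X t)) *\<^sub>R mconj (X t))) (at t within {0..T})"
        unfolding Y L trace_form_mconj mconj_bracket[symmetric] mconj_linear(3)[symmetric] mconj_linear(1)[symmetric]
        by (rule has_vector_derivative_mconj) (use o' in blast)
    qed
  qed (simp_all only: T_pos periodic lip_mconj_entry[OF lip_\<Lambda>] lip_mconj_entry[OF lip_X] lip_mconj_entry[OF lip_Z])
qed

section \<open>No extremal runs along an edge of the control triangle\<close>

lemma derivative_zero_on:
  fixes f :: "real \<Rightarrow> real"
  assumes d: "(f has_real_derivative d) (at t within {0..T})"
    and z: "\<And>s. s \<in> {a<..<b} \<Longrightarrow> f s = c" and t: "t \<in> {a<..<b}" and sub: "{a<..<b} \<subseteq> {0..T}"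
  shows "d = 0"
proof -
  have "(f has_real_derivative d) (at t within {a<..<b})"
    using d sub has_field_derivative_subset by blast
  then have "(f has_real_derivative d) (at t)"
    unfolding at_within_open[OF t open_greaterThanLessThan] .
  moreover have "(f has_real_derivative 0) (at t)"
    by (rule has_field_derivative_transform_within_open[OF DERIV_const open_greaterThanLessThan t z[symmetric]])
  ultimately show ?thesis by (rule DERIV_unique)
qed

text \<open>Continuous induction: consider the supremum of the initial segments on which \<open>Q\<close> holds.\<close>

lemma real_interval_induct:
  fixes a b :: real
  assumes "a \<le> b" "Q a"
    and step: "\<And>s. a \<le> s \<Longrightarrow> s < b \<Longrightarrow> Q s \<Longrightarrow> \<exists>\<delta>>0. \<forall>t. s \<le> t \<and> t < s + \<delta> \<and> t \<le> b \<longrightarrow> Q t"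
    and limit: "\<And>s. a < s \<Longrightarrow> s \<le> b \<Longrightarrow> (\<And>t. a \<le> t \<Longrightarrow> t < s \<Longrightarrow> Q t) \<Longrightarrow> Q s"
    and t: "a \<le> t" "t \<le> b"
  shows "Q t"
proof -
  define A where "A = {s. a \<le> s \<and> s \<le> b \<and> (\<forall>r. a \<le> r \<and> r \<le> s \<longrightarrow> Q r)}"
  have aA: "a \<in> A" unfolding A_def using assms(1,2) by auto
  have bd: "bdd_above A" unfolding A_def by (auto intro: bdd_aboveI[of _ b])
  define s where "s = Sup A"
  have as: "a \<le> s" unfolding s_def by (rule cSup_upper[OF aA bd])
  have sb: "s \<le> b" unfolding s_def using aA by (intro cSup_least) (auto simp: A_def)
  have below: "Q r" if r: "a \<le> r" "r < s" for r
  proof -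
    have "\<exists>x\<in>A. r < x" using r(2) less_cSup_iff[OF _ bd] aA unfolding s_def by blast
    then obtain x where "x \<in> A" "r < x" by blast
    then show ?thesis using r(1) unfolding A_def by simp
  qed
  have Qs: "Q s"
  proof (cases "a = s")
    case False
    then have "a < s" using as by simp
    from limit[OF this sb below] show ?thesis .
  qed (use assms(2) in simp)
  have "s = b"
  proof (rule ccontr)
    assume "s \<noteq> b"
    then have "s < b" using sb by simp
    then obtain \<delta> where d: "\<delta> > 0" "\<And>t. s \<le> t \<Longrightarrow> t < s + \<delta> \<Longrightarrow> t \<le> b \<Longrightarrow> Q t"
      using step[OF as \<open>s < b\<close> Qs] by blast
    define x where "x = min b (s + \<delta> / 2)"
    have x: "s < x" "x \<le> b" "x < s + \<delta>" using \<open>s < b\<close> d(1) by (auto simp: x_def min_def)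
    have "x \<in> A" unfolding A_def
    proof (intro CollectI conjI allI impI)
      fix r assume r: "a \<le> r \<and> r \<le> x"
      show "Q r"
      proof (cases "r < s")
        case True
        then show ?thesis using below r by simp
      next
        case False
        then show ?thesis using d(2)[of r] r x by simp
      qed
    qed (use x as in auto)
    then have "x \<le> s" unfolding s_def by (rule cSup_upper[OF _ bd])
    then show False using x by simp
  qed
  then show ?thesis using below[OF t(1)] Qs t(2) by (cases "t = b") simp_all
qed

context extremal_system
begin

text \<open>For a control with matrix \<open>P\<close> the Hamiltonian is \<open>\<langle>Y, P\<rangle> / \<langle>X, P\<rangle>\<close>. The numbers \<open>x\<close> and \<open>y\<close>
  are the coordinates of the point of the half-plane behind \<open>X\<close>, and \<open>l1, l2, l3\<close> are the
  entries of \<open>L\<close>. The functions \<open>\<kappa>\<close> and \<open>\<Psi>\<close> arise by differentiating \<open>l3\<close> along the edge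
  opposite to vertex \<open>0\<close>: for \<open>\<mu> = 0\<close> one has \<open>l3' = 2 \<kappa> / y\<close>, \<open>\<kappa>' = - \<Psi> / y\<close> and \<open>\<Psi>' = 0\<close>
  there.\<close>

definition L :: "real \<Rightarrow> real^2^2" where "L t = \<Lambda> t - \<mu> *\<^sub>R J_mat"
definition Y :: "real \<Rightarrow> real^2^2" where "Y t = Z t + trace_form (L t) (X t) *\<^sub>R X t"

definition y :: "real \<Rightarrow> real" where "y t = 1 / X t $2$1"
definition x :: "real \<Rightarrow> real" where "x t = X t $1$1 * y t"
definition l1 :: "real \<Rightarrow> real" where "l1 t = \<Lambda> t $1$1"
definition l2 :: "real \<Rightarrow> real" where "l2 t = \<Lambda> t $1$2 + \<mu>"
definition l3 :: "real \<Rightarrow> real" where "l3 t = \<Lambda> t $2$1 - \<mu>"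
definition \<kappa> :: "real \<Rightarrow> real" where "\<kappa> t = l3 t * x t - l1 t"
definition \<Psi> :: "real \<Rightarrow> real" where "\<Psi> t = 2 * l1 t * x t + l2 t - l3 t * (x t)\<^sup>2"

lemma X21_pos: assumes t: "t \<in> {0..T}" shows "0 < X t $2$1"
proof (rule ccontr)
  assume n: "\<not> 0 < X t $2$1"
  have d: "- (X t $1$1)\<^sup>2 - X t $1$2 * X t $2$1 = 1"
    using X_det[OF t] traceless(2)[OF t] by (simp add: det_2 power2_eq_square)
  have "X t $1$2 < 0" using X_pos[OF t] n by linarith
  then have "0 \<le> X t $1$2 * X t $2$1" using n by (simp add: mult_nonpos_nonpos)
  then show False using d zero_le_power2[of "X t $1$1"] by linarith
qed

lemma y_pos: "t \<in> {0..T} \<Longrightarrow> 0 < y t" using X21_pos by (simp add: y_def)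

lemma X_entries:
  assumes t: "t \<in> {0..T}"
  shows "X t $1$1 = x t / y t" "X t $2$1 = 1 / y t" "X t $1$2 = - ((x t)\<^sup>2 + (y t)\<^sup>2) / y t" "X t $2$2 = - (x t / y t)"
proof -
  note p = X21_pos[OF t]
  show e: "X t $1$1 = x t / y t" "X t $2$1 = 1 / y t" using p by (simp_all add: x_def y_def)
  show "X t $2$2 = - (x t / y t)" using traceless(2)[OF t] e by simp
  have d: "- (X t $1$1)\<^sup>2 - X t $1$2 * X t $2$1 = 1"
    using X_det[OF t] traceless(2)[OF t] by (simp add: det_2 power2_eq_square)
  then have "X t $1$2 * (1 / y t) = - (1 + (x t / y t)\<^sup>2)" unfolding e by simp
  then have "X t $1$2 = - (1 + (x t / y t)\<^sup>2) * y t" using y_pos[OF t] by (simp add: divide_eq_eq)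
  also have "\<dots> = - ((x t)\<^sup>2 + (y t)\<^sup>2) / y t"
    using y_pos[OF t] by (simp add: field_simps power2_eq_square)
  finally show "X t $1$2 = - ((x t)\<^sup>2 + (y t)\<^sup>2) / y t" .
qed

lemma L_entries: "L t $1$1 = l1 t" "L t $1$2 = l2 t" "L t $2$1 = l3 t" "t \<in> {0..T} \<Longrightarrow> L t $2$2 = - l1 t"
  using traceless(1)[of t] by (simp_all add: L_def l1_def l2_def l3_def J_mat_entries)

lemma L_bracket:
  assumes t: "t \<in> {0..T}"
  shows "mat_bracket (L t) (X t) $1$1 = (l2 t + l3 t * ((x t)\<^sup>2 + (y t)\<^sup>2)) / y t"
    "mat_bracket (L t) (X t) $2$1 = 2 * (l3 t * x t - l1 t) / y t"
proof -
  have b: "L t $2$2 = - L t $1$1" "X t $2$2 = - X t $1$1"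
    using L_entries(1) L_entries(4)[OF t] traceless(2)[OF t] by simp_all
  show "mat_bracket (L t) (X t) $1$1 = (l2 t + l3 t * ((x t)\<^sup>2 + (y t)\<^sup>2)) / y t"
    unfolding mat_bracket_entries(1)[OF b] L_entries(1-3) X_entries[OF t]
    using y_pos[OF t] by (simp add: field_simps)
  show "mat_bracket (L t) (X t) $2$1 = 2 * (l3 t * x t - l1 t) / y t"
    unfolding mat_bracket_entries(3)[OF b] L_entries(1-3) X_entries[OF t]
    using y_pos[OF t] by (simp add: field_simps)
qed

lemma LX: assumes t: "t \<in> {0..T}" shows "trace_form (L t) (X t) = \<Psi> t / y t - l3 t * y t"
  unfolding trace_form_entries L_entries(1-3) L_entries(4)[OF t] X_entries[OF t] \<Psi>_def
  using y_pos[OF t] by (simp add: field_simps power2_eq_square)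

lemma Y_traceless: "t \<in> {0..T} \<Longrightarrow> Y t $2$2 = - Y t $1$1"
  using traceless(2,3) by (simp add: Y_def)

lemma YX: assumes t: "t \<in> {0..T}" shows "trace_form (Y t) (X t) = - 2 * trace_form (L t) (X t)"
proof -
  have "trace_form (X t) (X t) = -2"
    using X_det[OF t] traceless(2)[OF t] by (simp add: trace_form_entries det_2 power2_eq_square)
  then show ?thesis unfolding Y_def trace_form_linear ZX[OF t] by simp
qed

lemma Y_nonneg: "t \<in> {0..T} \<Longrightarrow> Q \<in> verts \<Longrightarrow> 0 \<le> trace_form (Y t) Q"
  using nonneg by (simp add: Y_def L_def)

lemma lips: "lip {0..T} y" "lip {0..T} x" "lip {0..T} l1" "lip {0..T} l2" "lip {0..T} l3"
  "lip {0..T} \<kappa>" "lip {0..T} \<Psi>" "lip {0..T} (\<lambda>t. Y t $i$j)"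
proof -
  show y: "lip {0..T} y" unfolding y_def[abs_def] by (rule lip_inverse[OF lip_X X21_pos])
  show x: "lip {0..T} x" unfolding x_def[abs_def] by (intro lip_mult lip_X y)
  show l: "lip {0..T} l1" "lip {0..T} l2" "lip {0..T} l3"
    unfolding l1_def[abs_def] l2_def[abs_def] l3_def[abs_def] by (intro lip_add lip_diff lip_\<Lambda> lip_const)+
  show "lip {0..T} \<kappa>" unfolding \<kappa>_def[abs_def] by (intro lip_diff lip_mult l x)
  show "lip {0..T} \<Psi>" unfolding \<Psi>_def[abs_def] power2_eq_square
    by (intro lip_add lip_diff lip_mult lip_const l x)
  show "lip {0..T} (\<lambda>t. Y t $i$j)"
    unfolding Y_def[abs_def] L_def trace_form_entries
    by (simp, intro lip_add lip_diff lip_mult lip_const lip_X lip_Z lip_\<Lambda>)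
qed

lemma good_times:
  obtains N where "negligible N"
    and "\<And>t. t \<in> {0..T} - N \<Longrightarrow> P t \<in> simplex_mats"
    and "\<And>t. t \<in> {0..T} - N \<Longrightarrow> trace_form (Y t) (P t) = 0"
    and "\<And>t i j. t \<in> {0..T} - N \<Longrightarrow> ((\<lambda>t. X t $i$j) has_real_derivative (1 / trace_form (X t) (P t)) * mat_bracket (P t) (X t) $i$j) (at t within {0..T})"
    and "\<And>t i j. t \<in> {0..T} - N \<Longrightarrow> ((\<lambda>t. \<Lambda> t $i$j) has_real_derivative mat_bracket (\<Lambda> t) (X t) $i$j) (at t within {0..T})"
    and "\<And>t i j. t \<in> {0..T} - N \<Longrightarrow> ((\<lambda>t. Z t $i$j) has_real_derivative mat_bracket (L t) (X t) $i$j + (1 / trace_form (X t) (P t)) * mat_bracket (P t) (Y t) $i$j) (at t within {0..T})"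
proof -
  obtain N where N: "negligible N" and o: "\<And>t. t \<in> {0..T} - N \<Longrightarrow>
       P t \<in> simplex_mats \<and> trace_form (Y t) (P t) = 0 \<and>
       (X has_vector_derivative (1 / trace_form (X t) (P t)) *\<^sub>R mat_bracket (P t) (X t)) (at t within {0..T}) \<and>
       (\<Lambda> has_vector_derivative mat_bracket (\<Lambda> t) (X t)) (at t within {0..T}) \<and>
       (Z has_vector_derivative mat_bracket (L t) (X t) + (1 / trace_form (X t) (P t)) *\<^sub>R
          mat_bracket (P t) (Y t)) (at t within {0..T})"
    using ode unfolding Y_def L_def by blast
  show ?thesis
  proof (rule that[OF N])
    fix t i j assume t: "t \<in> {0..T} - N"
    note o = o[OF t]
    show "P t \<in> simplex_mats" "trace_form (Y t) (P t) = 0" using o by blast+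
    show "((\<lambda>t. X t $i$j) has_real_derivative (1 / trace_form (X t) (P t)) * mat_bracket (P t) (X t) $i$j) (at t within {0..T})"
      using entry_has_derivative[of X _ t "{0..T}" i j] o by fastforce
    show "((\<lambda>t. \<Lambda> t $i$j) has_real_derivative mat_bracket (\<Lambda> t) (X t) $i$j) (at t within {0..T})"
      using entry_has_derivative[of \<Lambda> _ t "{0..T}" i j] o by blast
    show "((\<lambda>t. Z t $i$j) has_real_derivative mat_bracket (L t) (X t) $i$j + (1 / trace_form (X t) (P t)) * mat_bracket (P t) (Y t) $i$j) (at t within {0..T})"
      using entry_has_derivative[of Z _ t "{0..T}" i j] o by fastforce
  qed
qed

lemma XP_neg: "t \<in> {0..T} \<Longrightarrow> P' \<in> simplex_mats \<Longrightarrow> trace_form (X t) P' < 0"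
  by (rule simplex_neg[OF neg])

text \<open>A control at which the Hamiltonian vanishes puts weight only on vertices at which \<open>Y\<close>
  vanishes, so a control that avoids vertex \<open>0\<close> lies on the opposite edge. There \<open>X\<close> moves along
  a horocycle, with \<open>x' = y\<close>.\<close>

lemma control_on_edge:
  assumes t: "t \<in> {0..T}" and P: "P' \<in> simplex_mats" "trace_form (Y t) P' = 0" "0 < trace_form (Y t) vert0"
  shows "P'$2$1 = 0" "P'$2$2 = - P'$1$1" "\<bar>P'$1$1\<bar> \<le> 1"
proof -
  obtain a b c where p: "P' = wcomb a b c" "0 \<le> a" "0 \<le> b" "0 \<le> c" "a + b + c = 1" using P(1) unfolding simplex_mats_def by blast
  have "trace_form (Y t) P' = a * trace_form (Y t) vert0 + b * trace_form (Y t) vert1 + c * trace_form (Y t) vert2"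
    unfolding p(1) wcomb_def trace_form_linear by simp
  moreover have "0 \<le> b * trace_form (Y t) vert1" "0 \<le> c * trace_form (Y t) vert2" "0 \<le> a * trace_form (Y t) vert0"
    using p Y_nonneg[OF t] by (auto simp: verts_def)
  ultimately have "a * trace_form (Y t) vert0 = 0" using P(2) by linarith
  then have a: "a = 0" using P(3) by simp
  then show "P'$2$1 = 0" unfolding p(1) by (simp add: wcomb_entries)
  show "P'$2$2 = - P'$1$1" unfolding p(1) by (simp add: wcomb_entries)
  have "\<bar>b - c\<bar> \<le> 1" using p a by auto
  also have "1 \<le> sqrt (3::real)" by simp
  finally show "\<bar>P'$1$1\<bar> \<le> 1" unfolding p(1) wcomb_entries(1) by (simp add: abs_divide divide_le_eq)
qed

lemma Y_vert:
  assumes t: "t \<in> {0..T}"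
  shows "trace_form (Y t) vert0 = Y t $1$2 + Y t $2$1 / 3"
    "trace_form (Y t) vert1 = 2 * Y t $1$1 / sqrt 3 - 2/3 * Y t $2$1"
    "trace_form (Y t) vert2 = - 2 * Y t $1$1 / sqrt 3 - 2/3 * Y t $2$1"
  using Y_traceless[OF t] by (simp_all add: trace_form_entries vert_entries)

lemma x_derivative:
  assumes t: "t \<in> {0..T}" and P: "P'$2$1 = 0" "P'$2$2 = - P'$1$1" "trace_form (X t) P' \<noteq> 0"
    and d: "\<And>i j. ((\<lambda>t. X t $i$j) has_real_derivative (1 / trace_form (X t) P') * mat_bracket P' (X t) $i$j) (at t within {0..T})"
  shows "(x has_real_derivative y t) (at t within {0..T})"
proof -
  define s where "s = 1 / trace_form (X t) P'"
  note p = X21_pos[OF t]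
  have sp: "s * (2 * P'$1$1 * X t $1$1 + P'$1$2 * X t $2$1) = 1"
  proof -
    have "trace_form (X t) P' = 2 * P'$1$1 * X t $1$1 + P'$1$2 * X t $2$1"
      using P(1,2) traceless(2)[OF t] by (simp add: trace_form_entries)
    then show ?thesis using P(3) unfolding s_def by simp
  qed
  note b = mat_bracket_entries[OF P(2) traceless(2)[OF t]]
  have d11: "((\<lambda>t. X t $1$1) has_real_derivative s * (P'$1$2 * X t $2$1)) (at t within {0..T})"
    using d[of 1 1] unfolding b s_def P(1) by (simp add: mult.assoc)
  have d21: "((\<lambda>t. X t $2$1) has_real_derivative s * (- 2 * P'$1$1 * X t $2$1)) (at t within {0..T})"
    using d[of 2 1] unfolding b s_def P(1) by (simp add: mult.assoc)
  have "((\<lambda>t. X t $1$1 / X t $2$1) has_real_derivative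
     (s * (P'$1$2 * X t $2$1) * X t $2$1 - X t $1$1 * (s * (- 2 * P'$1$1 * X t $2$1))) / (X t $2$1 * X t $2$1)) (at t within {0..T})"
    by (rule DERIV_divide[OF d11 d21]) (use p in simp)
  moreover have "(s * (P'$1$2 * X t $2$1) * X t $2$1 - X t $1$1 * (s * (- 2 * P'$1$1 * X t $2$1))) / (X t $2$1 * X t $2$1)
     = s * (2 * P'$1$1 * X t $1$1 + P'$1$2 * X t $2$1) / X t $2$1"
    using p by (simp add: field_simps)
  ultimately show ?thesis unfolding sp by (simp add: x_def[abs_def] y_def)
qed

lemma \<Lambda>_derivatives:
  assumes t: "t \<in> {0..T}"
    and d: "\<And>i j. ((\<lambda>t. \<Lambda> t $i$j) has_real_derivative mat_bracket (\<Lambda> t) (X t) $i$j) (at t within {0..T})"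
  shows "(l1 has_real_derivative ((l2 t - \<mu>) + (l3 t + \<mu>) * ((x t)\<^sup>2 + (y t)\<^sup>2)) / y t) (at t within {0..T})"
    "(l2 has_real_derivative - 2 * (l1 t * ((x t)\<^sup>2 + (y t)\<^sup>2) + (l2 t - \<mu>) * x t) / y t) (at t within {0..T})"
    "(l3 has_real_derivative 2 * ((l3 t + \<mu>) * x t - l1 t) / y t) (at t within {0..T})"
proof -
  note b = mat_bracket_entries[OF traceless(1)[OF t] traceless(2)[OF t]]
  have e: "\<Lambda> t $1$1 = l1 t" "\<Lambda> t $1$2 = l2 t - \<mu>" "\<Lambda> t $2$1 = l3 t + \<mu>" by (simp_all add: l1_def l2_def l3_def)
  note yp = y_pos[OF t]
  have "mat_bracket (\<Lambda> t) (X t) $1$1 = ((l2 t - \<mu>) + (l3 t + \<mu>) * ((x t)\<^sup>2 + (y t)\<^sup>2)) / y t"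
    unfolding b e X_entries[OF t] using yp by (simp add: field_simps)
  then show "(l1 has_real_derivative ((l2 t - \<mu>) + (l3 t + \<mu>) * ((x t)\<^sup>2 + (y t)\<^sup>2)) / y t) (at t within {0..T})"
    using d[of 1 1] unfolding l1_def[abs_def] by simp
  have "mat_bracket (\<Lambda> t) (X t) $1$2 = - 2 * (l1 t * ((x t)\<^sup>2 + (y t)\<^sup>2) + (l2 t - \<mu>) * x t) / y t"
    unfolding b e X_entries[OF t] using yp by (simp add: field_simps)
  then show "(l2 has_real_derivative - 2 * (l1 t * ((x t)\<^sup>2 + (y t)\<^sup>2) + (l2 t - \<mu>) * x t) / y t) (at t within {0..T})"
    using DERIV_add[OF d[of 1 2] DERIV_const] unfolding l2_def[abs_def] by simp
  have "mat_bracket (\<Lambda> t) (X t) $2$1 = 2 * ((l3 t + \<mu>) * x t - l1 t) / y t"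
    unfolding b e X_entries[OF t] using yp by (simp add: field_simps)
  then show "(l3 has_real_derivative 2 * ((l3 t + \<mu>) * x t - l1 t) / y t) (at t within {0..T})"
    using DERIV_diff[OF d[of 2 1] DERIV_const] unfolding l3_def[abs_def] by simp
qed

lemma derived_derivatives:
  assumes \<mu>: "\<mu> = 0" and t: "t \<in> {0..T}"
    and dx: "(x has_real_derivative y t) (at t within {0..T})"
    and d: "\<And>i j. ((\<lambda>t. \<Lambda> t $i$j) has_real_derivative mat_bracket (\<Lambda> t) (X t) $i$j) (at t within {0..T})"
  shows "(\<Psi> has_real_derivative 0) (at t within {0..T})"
    "(\<kappa> has_real_derivative - \<Psi> t / y t) (at t within {0..T})"
    "(l3 has_real_derivative 2 * \<kappa> t / y t) (at t within {0..T})"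
proof -
  have m: "l3 t + \<mu> = l3 t" "l2 t - \<mu> = l2 t" using \<mu> by linarith+
  note D = \<Lambda>_derivatives[OF t d, unfolded m]
  note yp = y_pos[OF t]
  show "(l3 has_real_derivative 2 * \<kappa> t / y t) (at t within {0..T})" using D(3) by (simp add: \<kappa>_def)
  have "(\<kappa> has_real_derivative ((2 * (l3 t * x t - l1 t) / y t) * x t + y t * l3 t - (l2 t + l3 t * ((x t)\<^sup>2 + (y t)\<^sup>2)) / y t)) (at t within {0..T})"
    unfolding \<kappa>_def[abs_def] by (intro DERIV_diff DERIV_mult D dx)
  moreover have "(2 * (l3 t * x t - l1 t) / y t) * x t + y t * l3 t - (l2 t + l3 t * ((x t)\<^sup>2 + (y t)\<^sup>2)) / y t = - \<Psi> t / y t"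
    unfolding \<Psi>_def using yp by (simp add: field_simps power2_eq_square)
  ultimately show "(\<kappa> has_real_derivative - \<Psi> t / y t) (at t within {0..T})" by simp
  have e: "\<Psi> = (\<lambda>t. 2 * (l1 t * x t) + l2 t - l3 t * (x t * x t))" by (simp add: \<Psi>_def fun_eq_iff power2_eq_square mult.assoc)
  have "(\<Psi> has_real_derivative (2 * (((l2 t + l3 t * ((x t)\<^sup>2 + (y t)\<^sup>2)) / y t) * x t + y t * l1 t)
     + (- 2 * (l1 t * ((x t)\<^sup>2 + (y t)\<^sup>2) + l2 t * x t) / y t)
     - ((2 * (l3 t * x t - l1 t) / y t) * (x t * x t) + (y t * x t + y t * x t) * l3 t))) (at t within {0..T})"
    unfolding e by (intro DERIV_diff DERIV_add DERIV_cmult DERIV_mult D dx)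
  moreover have "2 * (((l2 t + l3 t * ((x t)\<^sup>2 + (y t)\<^sup>2)) / y t) * x t + y t * l1 t)
     + (- 2 * (l1 t * ((x t)\<^sup>2 + (y t)\<^sup>2) + l2 t * x t) / y t)
     - ((2 * (l3 t * x t - l1 t) / y t) * (x t * x t) + (y t * x t + y t * x t) * l3 t) = 0"
    using yp by (simp add: field_simps power2_eq_square)
  ultimately show "(\<Psi> has_real_derivative 0) (at t within {0..T})" by simp
qed

text \<open>The first three conditions say that of the three vertices only vertex \<open>0\<close> has \<open>\<langle>Y, Q\<rangle> > 0\<close>.
  The condition \<open>\<Psi> t = 0\<close> follows from them on intervals; it is included so that the property
  can be propagated from a single time.\<close>

definition edge :: "real \<Rightarrow> bool" where
  "edge t \<longleftrightarrow> Y t $1$1 = 0 \<and> Y t $2$1 = 0 \<and> 0 < Y t $1$2 \<and> \<Psi> t = 0"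

lemma Y12_eq:
  assumes t: "t \<in> {0..T}" and "Y t $1$1 = 0" "Y t $2$1 = 0" "\<Psi> t = 0"
  shows "Y t $1$2 = 2 * l3 t * (y t)\<^sup>2"
proof -
  have "trace_form (Y t) (X t) = Y t $1$2 / y t"
    unfolding trace_form_entries Y_traceless[OF t] assms X_entries[OF t] by simp
  moreover have "trace_form (Y t) (X t) = 2 * l3 t * y t"
    unfolding YX[OF t] LX[OF t] assms by simp
  ultimately have "Y t $1$2 / y t = 2 * l3 t * y t" by simp
  then show ?thesis using y_pos[OF t] by (simp add: field_simps power2_eq_square)
qed

text \<open>On an interval along an edge the two vanishing entries of \<open>Y\<close> can be differentiated. This
  gives \<open>\<Psi> = 0\<close> and then \<open>Z\<^sub>2\<^sub>1 = l3\<close>. The derivatives of these two functions differ by a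
  multiple of \<open>\<mu> x\<close>, so \<open>\<mu> \<noteq> 0\<close> would imply \<open>x = 0\<close>, against \<open>x' = y > 0\<close>.\<close>

lemma edge_interval:
  assumes ab: "a < b" and sub: "{a<..<b} \<subseteq> {0..T}"
    and Y1: "\<And>t. t \<in> {a<..<b} \<Longrightarrow> trace_form (Y t) vert1 = 0"
    and Y2: "\<And>t. t \<in> {a<..<b} \<Longrightarrow> trace_form (Y t) vert2 = 0"
    and Y0: "\<And>t. t \<in> {a<..<b} \<Longrightarrow> 0 < trace_form (Y t) vert0"
  shows "\<mu> = 0" "\<exists>t\<in>{a<..<b}. edge t"
proof -
  have Yz: "Y t $1$1 = 0" "Y t $2$1 = 0" "0 < Y t $1$2" if t: "t \<in> {a<..<b}" for t
  proof -
    have t0: "t \<in> {0..T}" using t sub by auto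
    have e: "2 * Y t $1$1 / sqrt 3 - 2/3 * Y t $2$1 = 0" "- 2 * Y t $1$1 / sqrt 3 - 2/3 * Y t $2$1 = 0"
      using Y1[OF t] Y2[OF t] unfolding Y_vert[OF t0] by auto
    then show 21: "Y t $2$1 = 0" by linarith
    then show "Y t $1$1 = 0" using e by simp
    show "0 < Y t $1$2" using Y0[OF t] 21 unfolding Y_vert[OF t0] by simp
  qed
  obtain N where N: "negligible N"
    and gP: "\<And>t. t \<in> {0..T} - N \<Longrightarrow> P t \<in> simplex_mats"
    and gY: "\<And>t. t \<in> {0..T} - N \<Longrightarrow> trace_form (Y t) (P t) = 0"
    and gX: "\<And>t i j. t \<in> {0..T} - N \<Longrightarrow> ((\<lambda>t. X t $i$j) has_real_derivative (1 / trace_form (X t) (P t)) * mat_bracket (P t) (X t) $i$j) (at t within {0..T})"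
    and g\<Lambda>: "\<And>t i j. t \<in> {0..T} - N \<Longrightarrow> ((\<lambda>t. \<Lambda> t $i$j) has_real_derivative mat_bracket (\<Lambda> t) (X t) $i$j) (at t within {0..T})"
    and gZ: "\<And>t i j. t \<in> {0..T} - N \<Longrightarrow> ((\<lambda>t. Z t $i$j) has_real_derivative mat_bracket (L t) (X t) $i$j + (1 / trace_form (X t) (P t)) * mat_bracket (P t) (Y t) $i$j) (at t within {0..T})"
    using good_times by blast
  have good: "\<Psi> t = 0 \<and> (x has_real_derivative y t) (at t within {0..T})
     \<and> ((\<lambda>t. Z t $2$1) has_real_derivative 2 * (l3 t * x t - l1 t) / y t) (at t within {0..T})"
    if t: "t \<in> {a<..<b} - N" for t
  proof -
    have t0: "t \<in> {0..T} - N" "t \<in> {0..T}" "t \<in> {a<..<b}" using t sub by auto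
    note ed = control_on_edge[OF t0(2) gP[OF t0(1)] gY[OF t0(1)] Y0[OF t0(3)]]
    have ne: "trace_form (X t) (P t) \<noteq> 0" using XP_neg[OF t0(2) gP[OF t0(1)]] by simp
    have dx: "(x has_real_derivative y t) (at t within {0..T})"
      by (rule x_derivative[OF t0(2) ed(1,2) ne gX[OF t0(1)]])
    note yp = y_pos[OF t0(2)]
    have bPY: "mat_bracket (P t) (Y t) $1$1 = 0" "mat_bracket (P t) (Y t) $2$1 = 0"
      using mat_bracket_entries(1,3)[OF ed(2) Y_traceless[OF t0(2)]] Yz[OF t0(3)] ed(1) by simp_all
    have z11: "((\<lambda>t. Z t $1$1) has_real_derivative (l2 t + l3 t * ((x t)\<^sup>2 + (y t)\<^sup>2)) / y t) (at t within {0..T})"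
      using gZ[OF t0(1), of 1 1] unfolding bPY L_bracket[OF t0(2)] by simp
    have z21: "((\<lambda>t. Z t $2$1) has_real_derivative 2 * (l3 t * x t - l1 t) / y t) (at t within {0..T})"
      using gZ[OF t0(1), of 2 1] unfolding bPY L_bracket[OF t0(2)] by simp
    have "((\<lambda>t. Z t $1$1 - x t * Z t $2$1) has_real_derivative
       (l2 t + l3 t * ((x t)\<^sup>2 + (y t)\<^sup>2)) / y t - (y t * Z t $2$1 + 2 * (l3 t * x t - l1 t) / y t * x t)) (at t within {0..T})"
      by (intro DERIV_diff DERIV_mult z11 z21 dx)
    moreover have "Z s $1$1 - x s * Z s $2$1 = 0" if s: "s \<in> {a<..<b}" for s
    proof -
      have s0: "s \<in> {0..T}" using s sub by auto
      have "Z s $1$1 = - trace_form (L s) (X s) * (x s / y s)" "Z s $2$1 = - trace_form (L s) (X s) * (1 / y s)"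
        using Yz(1,2)[OF s] unfolding Y_def X_entries(1,2)[OF s0, symmetric] by simp_all
      then show ?thesis by simp
    qed
    ultimately have "(l2 t + l3 t * ((x t)\<^sup>2 + (y t)\<^sup>2)) / y t - (y t * Z t $2$1 + 2 * (l3 t * x t - l1 t) / y t * x t) = 0"
      by (rule derivative_zero_on[OF _ _ t0(3) sub])
    moreover have "Z t $2$1 = - (\<Psi> t / y t - l3 t * y t) * (1 / y t)"
      using Yz(2)[OF t0(3)] unfolding Y_def LX[OF t0(2), symmetric] X_entries(2)[OF t0(2), symmetric] by simp
    ultimately have "(l2 t + l3 t * ((x t)\<^sup>2 + (y t)\<^sup>2)) / y t + (\<Psi> t / y t - l3 t * y t) - 2 * (l3 t * x t - l1 t) / y t * x t = 0"
      using yp by simp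
    moreover have "(l2 t + l3 t * ((x t)\<^sup>2 + (y t)\<^sup>2)) / y t + (\<Psi> t / y t - l3 t * y t) - 2 * (l3 t * x t - l1 t) / y t * x t = 2 * \<Psi> t / y t"
      unfolding \<Psi>_def using yp by (simp add: field_simps power2_eq_square)
    ultimately have "2 * \<Psi> t / y t = 0" by (simp only:)
    then have "\<Psi> t = 0" using yp by simp
    then show ?thesis using dx z21 by blast
  qed
  have \<Psi>z: "\<Psi> t = 0" if t: "t \<in> {a<..<b}" for t
  proof (rule zero_off_negligible[of "(a+t)/2" "(t+b)/2" \<Psi> N])
    show "continuous_on {(a+t)/2..(t+b)/2} \<Psi>"
      using lip_continuous_on[OF lips(7)] sub t by (elim continuous_on_subset) (auto simp: subset_iff)
    show "\<Psi> s = 0" if "s \<in> {(a+t)/2..(t+b)/2} - N" for s using good[of s] that t by auto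
  qed (use N t in auto)
  have Zl: "Z t $2$1 - l3 t = 0" if t: "t \<in> {a<..<b}" for t
  proof -
    have t0: "t \<in> {0..T}" using t sub by auto
    have "Z t $2$1 = - (\<Psi> t / y t - l3 t * y t) * (1 / y t)"
      using Yz(2)[OF t] unfolding Y_def LX[OF t0, symmetric] X_entries(2)[OF t0, symmetric] by simp
    then show ?thesis using \<Psi>z[OF t] y_pos[OF t0] by simp
  qed
  show "\<mu> = 0"
  proof (rule ccontr)
    assume "\<mu> \<noteq> 0"
    have xz: "x t = 0" if t: "t \<in> {a<..<b} - N" for t
    proof -
      have t0: "t \<in> {0..T} - N" "t \<in> {0..T}" "t \<in> {a<..<b}" using t sub by auto
      have "((\<lambda>t. Z t $2$1 - l3 t) has_real_derivative 2 * (l3 t * x t - l1 t) / y t - 2 * ((l3 t + \<mu>) * x t - l1 t) / y t) (at t within {0..T})"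
        using good[OF t] \<Lambda>_derivatives(3)[OF t0(2) g\<Lambda>[OF t0(1)]] by (intro DERIV_diff) auto
      from derivative_zero_on[OF this Zl t0(3) sub]
      have "\<mu> * x t = 0" using y_pos[OF t0(2)] by (simp add: field_simps)
      then show ?thesis using \<open>\<mu> \<noteq> 0\<close> by simp
    qed
    have x0: "x t = 0" if t: "t \<in> {a<..<b}" for t
    proof (rule zero_off_negligible[of "(a+t)/2" "(t+b)/2" x N])
      show "continuous_on {(a+t)/2..(t+b)/2} x"
        using lip_continuous_on[OF lips(2)] sub t by (elim continuous_on_subset) (auto simp: subset_iff)
      show "x s = 0" if "s \<in> {(a+t)/2..(t+b)/2} - N" for s using xz[of s] that t by auto
    qed (use N t in auto)
    obtain t where t: "t \<in> {a<..<b}" "t \<notin> N" using negligible_interval_witness[OF N ab] .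
    have "(x has_real_derivative y t) (at t within {0..T})" using good[of t] t by blast
    from derivative_zero_on[where f = x, OF this x0 t(1) sub] have "y t = 0" .
    then show False using y_pos[of t] t sub by auto
  qed
  have "(a + b) / 2 \<in> {a<..<b}" using ab by auto
  then show "\<exists>t\<in>{a<..<b}. edge t" using Yz \<Psi>z unfolding edge_def by blast
qed

lemma vert0_continuous: "continuous_on {0..T} (\<lambda>t. trace_form (Y t) vert0)"
  unfolding trace_form_entries vert_entries
  by (intro lip_continuous_on lip_add lip_mult lip_const lips(8))

lemma speed_bound: obtains B where "B > 0" "\<And>t P'. t \<in> {0..T} \<Longrightarrow> P' \<in> simplex_mats \<Longrightarrow> \<bar>1 / trace_form (X t) P'\<bar> \<le> B"
proof -
  have lv: "lip {0..T} (\<lambda>t. 1 / - trace_form (X t) Q)" if "Q \<in> verts" for Q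
  proof (rule lip_inverse)
    show "lip {0..T} (\<lambda>t. - trace_form (X t) Q)"
      unfolding trace_form_entries by (intro lip_minus lip_add lip_mult lip_X lip_const)
    show "0 < - trace_form (X t) Q" if "t \<in> {0..T}" for t using neg[OF that \<open>Q \<in> verts\<close>] by simp
  qed
  obtain B0 where B0: "B0 > 0" "\<And>t. t \<in> {0..T} \<Longrightarrow> \<bar>1 / - trace_form (X t) vert0\<bar> \<le> B0"
    using lip_bounded[OF lv[of vert0]] by (auto simp: verts_def)
  obtain B1 where B1: "B1 > 0" "\<And>t. t \<in> {0..T} \<Longrightarrow> \<bar>1 / - trace_form (X t) vert1\<bar> \<le> B1"
    using lip_bounded[OF lv[of vert1]] by (auto simp: verts_def)
  obtain B2 where B2: "B2 > 0" "\<And>t. t \<in> {0..T} \<Longrightarrow> \<bar>1 / - trace_form (X t) vert2\<bar> \<le> B2"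
    using lip_bounded[OF lv[of vert2]] by (auto simp: verts_def)
  define B where "B = B0 + B1 + B2"
  have Bp: "B > 0" using B0 B1 B2 by (simp add: B_def)
  have "\<bar>1 / trace_form (X t) P'\<bar> \<le> B" if t: "t \<in> {0..T}" and P: "P' \<in> simplex_mats" for t P'
  proof -
    obtain a b c where p: "P' = wcomb a b c" "0 \<le> a" "0 \<le> b" "0 \<le> c" "a + b + c = 1" using P unfolding simplex_mats_def by blast
    have inv: "1 / B \<le> - trace_form (X t) Q" if "Q \<in> verts" for Q
    proof -
      have n: "trace_form (X t) Q < 0" using neg[OF t that] .
      have "1 / - trace_form (X t) Q \<le> B"
      proof -
        have "1 / - trace_form (X t) vert0 \<le> B" using B0(2)[OF t] B1(1) B2(1) unfolding B_def by linarith
        moreover have "1 / - trace_form (X t) vert1 \<le> B" using B1(2)[OF t] B0(1) B2(1) unfolding B_def by linarith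
        moreover have "1 / - trace_form (X t) vert2 \<le> B" using B2(2)[OF t] B0(1) B1(1) unfolding B_def by linarith
        ultimately show ?thesis using that by (auto simp: verts_def)
      qed
      then show ?thesis using n Bp by (simp add: field_simps)
    qed
    have "- trace_form (X t) P' = a * - trace_form (X t) vert0 + b * - trace_form (X t) vert1 + c * - trace_form (X t) vert2"
      unfolding p(1) wcomb_def trace_form_linear by simp
    also have "\<dots> \<ge> a * (1/B) + b * (1/B) + c * (1/B)"
      using p inv by (intro add_mono mult_left_mono) (auto simp: verts_def)
    also have "a * (1/B) + b * (1/B) + c * (1/B) = 1 / B" using p(5) by (simp add: add_divide_distrib[symmetric])
    finally have "1 / B \<le> - trace_form (X t) P'" by simp
    then have "1 / (- trace_form (X t) P') \<le> B" "trace_form (X t) P' < 0" using Bp XP_neg[OF t P]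
      by (auto simp: field_simps)
    then show ?thesis by (simp add: abs_if)
  qed
  then show ?thesis using that Bp by blast
qed

text \<open>The edge equations are preserved in both directions of time while \<open>\<langle>Y, vert0\<rangle>\<close> is positive,
  which it is near \<open>s\<close> by continuity: \<open>\<Psi>\<close> and \<open>\<kappa>\<close> are constant, the lower left entry of \<open>Y\<close>
  satisfies a homogeneous linear equation, and the conditions \<open>\<langle>Y, Q\<rangle> \<ge> 0\<close> at the other two
  vertices bound the diagonal entry by it.\<close>

lemma edge_local:
  assumes \<mu>: "\<mu> = 0" and s: "s \<in> {0..T}" and e: "edge s"
  shows "\<exists>\<delta>>0. \<forall>t. t \<in> {0..T} \<longrightarrow> \<bar>t - s\<bar> < \<delta> \<longrightarrow> edge t \<and> \<kappa> t = \<kappa> s \<and>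
    (s \<le> t \<longrightarrow> 0 \<le> \<kappa> s \<longrightarrow> l3 s \<le> l3 t) \<and> (t \<le> s \<longrightarrow> \<kappa> s \<le> 0 \<longrightarrow> l3 s \<le> l3 t)"
proof -
  obtain B where B: "B > 0" "\<And>t P'. t \<in> {0..T} \<Longrightarrow> P' \<in> simplex_mats \<Longrightarrow> \<bar>1 / trace_form (X t) P'\<bar> \<le> B"
    using speed_bound by blast
  have "0 < trace_form (Y s) vert0" using e Y_vert(1)[OF s] unfolding edge_def by simp
  then obtain d0 where d0: "d0 > 0" "\<And>t. t \<in> {0..T} \<Longrightarrow> dist t s < d0 \<Longrightarrow>
      dist (trace_form (Y t) vert0) (trace_form (Y s) vert0) < trace_form (Y s) vert0"
    using vert0_continuous s unfolding continuous_on_iff by blast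
  have Ypos: "0 < trace_form (Y t) vert0" if "t \<in> {0..T}" "\<bar>t - s\<bar> < d0" for t
    using d0(2)[of t] that by (auto simp: dist_real_def)
  define \<delta> where "\<delta> = min d0 (1 / (4 * B))"
  have \<delta>: "\<delta> > 0" "\<delta> \<le> d0" "2 * B * \<delta> < 1" using d0 B by (auto simp: \<delta>_def field_simps min_def)
  obtain N where N: "negligible N"
    and gP: "\<And>t. t \<in> {0..T} - N \<Longrightarrow> P t \<in> simplex_mats"
    and gY: "\<And>t. t \<in> {0..T} - N \<Longrightarrow> trace_form (Y t) (P t) = 0"
    and gX: "\<And>t i j. t \<in> {0..T} - N \<Longrightarrow> ((\<lambda>t. X t $i$j) has_real_derivative (1 / trace_form (X t) (P t)) * mat_bracket (P t) (X t) $i$j) (at t within {0..T})"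
    and g\<Lambda>: "\<And>t i j. t \<in> {0..T} - N \<Longrightarrow> ((\<lambda>t. \<Lambda> t $i$j) has_real_derivative mat_bracket (\<Lambda> t) (X t) $i$j) (at t within {0..T})"
    and gZ: "\<And>t i j. t \<in> {0..T} - N \<Longrightarrow> ((\<lambda>t. Z t $i$j) has_real_derivative mat_bracket (L t) (X t) $i$j + (1 / trace_form (X t) (P t)) * mat_bracket (P t) (Y t) $i$j) (at t within {0..T})"
    using good_times by blast
  have good: "(\<Psi> has_real_derivative 0) (at t within {0..T})"
      "(\<kappa> has_real_derivative - \<Psi> t / y t) (at t within {0..T})"
      "(l3 has_real_derivative 2 * \<kappa> t / y t) (at t within {0..T})"
      "\<exists>\<alpha>. \<bar>\<alpha>\<bar> \<le> B \<and> ((\<lambda>t. Z t $2$1) has_real_derivative 2 * (l3 t * x t - l1 t) / y t - 2 * \<alpha> * Y t $2$1) (at t within {0..T})"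
    if t: "t \<in> {0..T} - N" "\<bar>t - s\<bar> < \<delta>" for t
  proof -
    have t0: "t \<in> {0..T}" using t by auto
    have Y0: "0 < trace_form (Y t) vert0" using Ypos[OF t0] t \<delta> by auto
    note ed = control_on_edge[OF t0 gP[OF t(1)] gY[OF t(1)] Y0]
    have ne: "trace_form (X t) (P t) \<noteq> 0" using XP_neg[OF t0 gP[OF t(1)]] by simp
    have dx: "(x has_real_derivative y t) (at t within {0..T})"
      by (rule x_derivative[OF t0 ed(1,2) ne gX[OF t(1)]])
    show "(\<Psi> has_real_derivative 0) (at t within {0..T})"
      "(\<kappa> has_real_derivative - \<Psi> t / y t) (at t within {0..T})"
      "(l3 has_real_derivative 2 * \<kappa> t / y t) (at t within {0..T})"
      by (rule derived_derivatives[OF \<mu> t0 dx g\<Lambda>[OF t(1)]])+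
    define \<alpha> where "\<alpha> = (1 / trace_form (X t) (P t)) * P t $1$1"
    have "\<bar>\<alpha>\<bar> \<le> B * 1" unfolding \<alpha>_def abs_mult
      using B(2)[OF t0 gP[OF t(1)]] ed(3) B(1) by (intro mult_mono) auto
    moreover
    have pY: "(1 / trace_form (X t) (P t)) * mat_bracket (P t) (Y t) $2$1 = - 2 * \<alpha> * Y t $2$1"
      using mat_bracket_entries(3)[OF ed(2) Y_traceless[OF t0]] ed(1) by (simp add: \<alpha>_def)
    have "((\<lambda>t. Z t $2$1) has_real_derivative 2 * (l3 t * x t - l1 t) / y t - 2 * \<alpha> * Y t $2$1) (at t within {0..T})"
      using gZ[OF t(1), of 2 1] unfolding pY L_bracket[OF t0] by simp
    ultimately show "\<exists>\<alpha>. \<bar>\<alpha>\<bar> \<le> B \<and> ((\<lambda>t. Z t $2$1) has_real_derivative 2 * (l3 t * x t - l1 t) / y t - 2 * \<alpha> * Y t $2$1) (at t within {0..T})"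
      by auto
  qed
  have const: "f t = f s" if f: "lip {0..T} f" and z: "\<And>r. r \<in> {0..T} - N \<Longrightarrow> \<bar>r - s\<bar> < \<delta> \<Longrightarrow> (f has_real_derivative 0) (at r within {0..T})"
    and t: "t \<in> {0..T}" "\<bar>t - s\<bar> < \<delta>" for f t
  proof (cases "s \<le> t")
    case True
    show ?thesis by (rule lip_constant[OF f N _ True]) (use s t True in \<open>auto intro!: z\<close>)
  next
    case False
    have "f s = f t" by (rule lip_constant[OF f N _ _ _]) (use s t False in \<open>auto intro!: z\<close>)
    then show ?thesis by simp
  qed
  have \<Psi>z: "\<Psi> t = 0" if t: "t \<in> {0..T}" "\<bar>t - s\<bar> < \<delta>" for t
    using const[OF lips(7) good(1) t] e unfolding edge_def by simp
  have \<kappa>c: "\<kappa> t = \<kappa> s" if t: "t \<in> {0..T}" "\<bar>t - s\<bar> < \<delta>" for t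
    by (rule const[OF lips(6) _ t]) (use good(2) \<Psi>z in fastforce)
  have Yl: "Y t $2$1 = Z t $2$1 - l3 t" if t: "t \<in> {0..T}" "\<bar>t - s\<bar> < \<delta>" for t
    unfolding Y_def using LX[OF t(1)] X_entries(2)[OF t(1)] \<Psi>z[OF t] y_pos[OF t(1)] by simp
  define f where "f t = Z t $2$1 - l3 t" for t
  have f0: "f s = 0" using Yl[OF s] e \<delta> unfolding edge_def f_def by simp
  have fl: "lip {0..T} f" unfolding f_def[abs_def] by (intro lip_diff lip_Z lips)
  have fz: "f t = 0" if t: "t \<in> {0..T}" "\<bar>t - s\<bar> < \<delta>" for t
  proof -
    have df: "\<exists>d. \<bar>d\<bar> \<le> (2 * B) * \<bar>f r\<bar> \<and> (f has_real_derivative d) (at r within {0..T})"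
      if r: "r \<in> {0..T} - N" "\<bar>r - s\<bar> < \<delta>" for r
    proof -
      obtain \<alpha> where a: "\<bar>\<alpha>\<bar> \<le> B" "((\<lambda>t. Z t $2$1) has_real_derivative 2 * (l3 r * x r - l1 r) / y r - 2 * \<alpha> * Y r $2$1) (at r within {0..T})"
        using good(4)[OF r] by blast
      have "(f has_real_derivative (2 * (l3 r * x r - l1 r) / y r - 2 * \<alpha> * Y r $2$1) - 2 * \<kappa> r / y r) (at r within {0..T})"
        unfolding f_def[abs_def] by (intro DERIV_diff a good(3)[OF r])
      moreover have "(2 * (l3 r * x r - l1 r) / y r - 2 * \<alpha> * Y r $2$1) - 2 * \<kappa> r / y r = - 2 * \<alpha> * f r"
        using Yl[of r] r by (simp add: \<kappa>_def f_def)
      moreover have "\<bar>- 2 * \<alpha> * f r\<bar> \<le> (2 * B) * \<bar>f r\<bar>"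
        unfolding abs_mult using a(1) by (intro mult_right_mono) auto
      ultimately show ?thesis by metis
    qed
    have small: "2 * B * \<bar>t - s\<bar> < 1"
    proof -
      have "2 * B * \<bar>t - s\<bar> \<le> 2 * B * \<delta>" using t B by (intro mult_left_mono) auto
      then show ?thesis using \<delta> by linarith
    qed
    show ?thesis
    proof (cases "s \<le> t")
      case True
      show ?thesis
        by (rule lip_gronwall_step[OF fl N, of s t "2 * B"]) (use s t True B small f0 df in auto)
    next
      case False
      show ?thesis
        by (rule lip_gronwall_step[OF fl N, of t s "2 * B"]) (use s t False B small f0 df in auto)
    qed
  qed
  have et: "edge t" if t: "t \<in> {0..T}" "\<bar>t - s\<bar> < \<delta>" for t
  proof -
    have 21: "Y t $2$1 = 0" using Yl[OF t] fz[OF t] by (simp add: f_def)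
    have "0 \<le> trace_form (Y t) vert1" "0 \<le> trace_form (Y t) vert2"
      using Y_nonneg[OF t(1)] by (auto simp: verts_def)
    then have "0 \<le> Y t $1$1 / sqrt 3" "Y t $1$1 / sqrt 3 \<le> 0" unfolding Y_vert[OF t(1)] 21 by auto
    then have 11: "Y t $1$1 = 0" by (simp add: field_simps)
    have "0 < trace_form (Y t) vert0" using Ypos[OF t(1)] t \<delta> by auto
    then have "0 < Y t $1$2" unfolding Y_vert[OF t(1)] 21 by simp
    then show ?thesis using 11 21 \<Psi>z[OF t] unfolding edge_def by simp
  qed
  show ?thesis
  proof (intro exI[of _ \<delta>] conjI \<delta>(1) allI impI)
    fix t assume t: "t \<in> {0..T}" "\<bar>t - s\<bar> < \<delta>"
    show "edge t" "\<kappa> t = \<kappa> s" using et[OF t] \<kappa>c[OF t] by simp_all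
    show "l3 s \<le> l3 t" if "s \<le> t" "0 \<le> \<kappa> s"
    proof -
      have "- l3 t - - l3 s \<le> 0 * (t - s)"
      proof (rule lip_increment_le[OF lip_minus[OF lips(5)] N])
        fix r assume r: "r \<in> {s..t} - N"
        then have r0: "r \<in> {0..T} - N" "\<bar>r - s\<bar> < \<delta>" using s t by auto
        have "- (2 * \<kappa> r / y r) \<le> 0" using \<kappa>c[of r] r0 that(2) y_pos[of r] by simp
        then show "\<exists>d\<le>0. ((\<lambda>t. - l3 t) has_real_derivative d) (at r within {0..T})"
          using DERIV_minus[OF good(3)[OF r0]] by blast
      qed (use s t that in auto)
      then show ?thesis by simp
    qed
    show "l3 s \<le> l3 t" if "t \<le> s" "\<kappa> s \<le> 0"
    proof -
      have "l3 s - l3 t \<le> 0 * (s - t)"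
      proof (rule lip_increment_le[OF lips(5) N])
        fix r assume r: "r \<in> {t..s} - N"
        then have r0: "r \<in> {0..T} - N" "\<bar>r - s\<bar> < \<delta>" using s t by auto
        have "2 * \<kappa> r / y r \<le> 0" using \<kappa>c[of r] r0 that(2) y_pos[of r] by (simp add: divide_nonpos_pos)
        then show "\<exists>d\<le>0. (l3 has_real_derivative d) (at r within {0..T})"
          using good(3)[OF r0] by blast
      qed (use s t that in auto)
      then show ?thesis by simp
    qed
  qed
qed

lemma edge_l3_pos: assumes t: "t \<in> {0..T}" "edge t" shows "0 < l3 t"
proof -
  have "0 < 2 * l3 t * (y t)\<^sup>2" using Y12_eq[OF t(1)] t(2) unfolding edge_def by metis
  then show ?thesis using y_pos[OF t(1)] by (simp add: zero_less_mult_iff)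
qed

text \<open>Only the strict inequality \<open>0 < Y\<^sub>1\<^sub>2 = 2 l3 y\<^sup>2\<close> could get lost in a limit. It survives where
  \<open>l3\<close> does not decrease, and the sign of the constant \<open>\<kappa>\<close> tells in which direction of time that
  is the case.\<close>

lemma edge_closed:
  assumes s: "s \<in> {0..T}" "s0 \<in> {0..T}" and e0: "edge s0"
    and lim: "s islimpt A" "A \<subseteq> {0..T}" and A: "\<And>t. t \<in> A \<Longrightarrow> edge t \<and> \<kappa> t = \<kappa> s0 \<and> l3 s0 \<le> l3 t"
  shows "edge s \<and> \<kappa> s = \<kappa> s0 \<and> l3 s0 \<le> l3 s"
proof -
  have F: "at s within A \<noteq> bot" using lim(1) by (simp add: trivial_limit_within)
  have tl: "(f \<longlongrightarrow> f s) (at s within A)" if "lip {0..T} f" for f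
    using lip_continuous_on[OF that] s(1) lim(2) unfolding continuous_on by (meson tendsto_within_subset)
  have ev: "\<forall>\<^sub>F t in at s within A. t \<in> A" by (auto simp: eventually_at_filter)
  have lim0: "f s = c" if "lip {0..T} f" "\<And>t. t \<in> A \<Longrightarrow> f t = c" for f c
  proof (rule tendsto_unique[OF F tl[OF that(1)]])
    show "(f \<longlongrightarrow> c) (at s within A)" by (rule tendsto_eventually[OF eventually_mono[OF ev]]) (rule that(2))
  qed
  have 1: "Y s $1$1 = 0" by (rule lim0[OF lips(8)]) (use A in \<open>auto simp: edge_def\<close>)
  have 2: "Y s $2$1 = 0" by (rule lim0[OF lips(8)]) (use A in \<open>auto simp: edge_def\<close>)
  have 3: "\<Psi> s = 0" by (rule lim0[OF lips(7)]) (use A in \<open>auto simp: edge_def\<close>)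
  have 4: "\<kappa> s = \<kappa> s0" by (rule lim0[OF lips(6)]) (use A in auto)
  have 5: "l3 s0 \<le> l3 s"
    by (rule tendsto_lowerbound[OF tl[OF lips(5)] _ F]) (rule eventually_mono[OF ev], use A in blast)
  have "0 < l3 s" using 5 edge_l3_pos[OF s(2) e0] by linarith
  then have "0 < Y s $1$2" unfolding Y12_eq[OF s(1) 1 2 3] using y_pos[OF s(1)] by simp
  then show ?thesis using 1 2 3 4 5 unfolding edge_def by simp
qed

lemma edge_forward:
  assumes \<mu>: "\<mu> = 0" and s0: "s0 \<in> {0..T}" "edge s0" "0 \<le> \<kappa> s0" and t: "s0 \<le> t" "t \<le> T"
  shows "edge t \<and> \<kappa> t = \<kappa> s0"
proof -
  have "edge t \<and> \<kappa> t = \<kappa> s0 \<and> l3 s0 \<le> l3 t"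
  proof (rule real_interval_induct[of s0 T "\<lambda>t. edge t \<and> \<kappa> t = \<kappa> s0 \<and> l3 s0 \<le> l3 t"])
    fix s assume s: "s0 \<le> s" "s < T" "edge s \<and> \<kappa> s = \<kappa> s0 \<and> l3 s0 \<le> l3 s"
    then have sT: "s \<in> {0..T}" using s0 by auto
    from edge_local[OF \<mu> sT] s(3) obtain \<delta> where d: "\<delta> > 0"
      "\<forall>t. t \<in> {0..T} \<longrightarrow> \<bar>t - s\<bar> < \<delta> \<longrightarrow> edge t \<and> \<kappa> t = \<kappa> s \<and>
        (s \<le> t \<longrightarrow> 0 \<le> \<kappa> s \<longrightarrow> l3 s \<le> l3 t) \<and> (t \<le> s \<longrightarrow> \<kappa> s \<le> 0 \<longrightarrow> l3 s \<le> l3 t)"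
      by blast
    have "edge t \<and> \<kappa> t = \<kappa> s0 \<and> l3 s0 \<le> l3 t" if "s \<le> t" "t < s + \<delta>" "t \<le> T" for t
    proof -
      have "t \<in> {0..T}" "\<bar>t - s\<bar> < \<delta>" using that sT by auto
      from d(2)[rule_format, OF this] show ?thesis using that s(3) s0(3) by auto
    qed
    then show "\<exists>\<delta>>0. \<forall>t. s \<le> t \<and> t < s + \<delta> \<and> t \<le> T \<longrightarrow> edge t \<and> \<kappa> t = \<kappa> s0 \<and> l3 s0 \<le> l3 t"
      using d(1) by blast
  next
    fix s assume s: "s0 < s" "s \<le> T" and b: "\<And>t. s0 \<le> t \<Longrightarrow> t < s \<Longrightarrow> edge t \<and> \<kappa> t = \<kappa> s0 \<and> l3 s0 \<le> l3 t"
    show "edge s \<and> \<kappa> s = \<kappa> s0 \<and> l3 s0 \<le> l3 s"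
    proof (rule edge_closed[OF _ s0(1,2) islimpt_greaterThanLessThan2[OF s(1)]])
      show "s \<in> {0..T}" "{s0<..<s} \<subseteq> {0..T}" using s s0(1) by auto
      show "edge t \<and> \<kappa> t = \<kappa> s0 \<and> l3 s0 \<le> l3 t" if "t \<in> {s0<..<s}" for t using b[of t] that by simp
    qed
  qed (use s0 t in auto)
  then show ?thesis by simp
qed

lemma edge_backward:
  assumes \<mu>: "\<mu> = 0" and s0: "s0 \<in> {0..T}" "edge s0" "\<kappa> s0 \<le> 0" and t: "0 \<le> t" "t \<le> s0"
  shows "edge t \<and> \<kappa> t = \<kappa> s0"
proof -
  have "edge (- (- t)) \<and> \<kappa> (- (- t)) = \<kappa> s0 \<and> l3 s0 \<le> l3 (- (- t))"
  proof (rule real_interval_induct[of "- s0" 0 "\<lambda>t. edge (- t) \<and> \<kappa> (- t) = \<kappa> s0 \<and> l3 s0 \<le> l3 (- t)"])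
    fix s assume s: "- s0 \<le> s" "s < 0" "edge (- s) \<and> \<kappa> (- s) = \<kappa> s0 \<and> l3 s0 \<le> l3 (- s)"
    then have sT: "- s \<in> {0..T}" using s0 by auto
    from edge_local[OF \<mu> sT] s(3) obtain \<delta> where d: "\<delta> > 0"
      "\<forall>t. t \<in> {0..T} \<longrightarrow> \<bar>t - - s\<bar> < \<delta> \<longrightarrow> edge t \<and> \<kappa> t = \<kappa> (- s) \<and>
        (- s \<le> t \<longrightarrow> 0 \<le> \<kappa> (- s) \<longrightarrow> l3 (- s) \<le> l3 t) \<and> (t \<le> - s \<longrightarrow> \<kappa> (- s) \<le> 0 \<longrightarrow> l3 (- s) \<le> l3 t)"
      by blast
    have "edge (- t) \<and> \<kappa> (- t) = \<kappa> s0 \<and> l3 s0 \<le> l3 (- t)" if "s \<le> t" "t < s + \<delta>" "t \<le> 0" for t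
    proof -
      have "- t \<in> {0..T}" "\<bar>- t - - s\<bar> < \<delta>" using that sT by auto
      from d(2)[rule_format, OF this] show ?thesis using that s(3) s0(3) by auto
    qed
    then show "\<exists>\<delta>>0. \<forall>t. s \<le> t \<and> t < s + \<delta> \<and> t \<le> 0 \<longrightarrow> edge (- t) \<and> \<kappa> (- t) = \<kappa> s0 \<and> l3 s0 \<le> l3 (- t)"
      using d(1) by blast
  next
    fix s assume s: "- s0 < s" "s \<le> 0" and b: "\<And>t. - s0 \<le> t \<Longrightarrow> t < s \<Longrightarrow> edge (- t) \<and> \<kappa> (- t) = \<kappa> s0 \<and> l3 s0 \<le> l3 (- t)"
    have b': "edge r \<and> \<kappa> r = \<kappa> s0 \<and> l3 s0 \<le> l3 r" if "r \<in> {- s<..<s0}" for r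
      using b[of "- r"] that by auto
    show "edge (- s) \<and> \<kappa> (- s) = \<kappa> s0 \<and> l3 s0 \<le> l3 (- s)"
    proof (rule edge_closed[OF _ s0(1,2) islimpt_greaterThanLessThan1])
      show "- s \<in> {0..T}" "{- s<..<s0} \<subseteq> {0..T}" "- s < s0" using s s0(1) by auto
    qed (rule b')
  qed (use s0 t in auto)
  then show ?thesis by simp
qed

end

lemma mconj3:
  assumes "A$2$2 = - A$1$1" shows "mconj (mconj (mconj A)) = A"
proof -
  note e = mconj_entries[OF assms]
  note e2 = mconj_entries[OF e(4)]
  note e3 = mconj_entries[OF e2(4)]
  have r3: "sqrt 3 * (sqrt 3 * z) = 3 * z" for z :: real
    by (simp add: mult.assoc[symmetric])
  have "mconj (mconj (mconj A)) $1$1 = A$1$1"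
    unfolding e3(1) e2(1-3) e(1-3) by (simp add: field_simps r3)
  moreover have "mconj (mconj (mconj A)) $1$2 = A$1$2"
    unfolding e3(2) e2(1-3) e(1-3) by (simp add: field_simps r3)
  moreover have "mconj (mconj (mconj A)) $2$1 = A$2$1"
    unfolding e3(3) e2(1-3) e(1-3) by (simp add: field_simps r3)
  ultimately show ?thesis using e3(4) assms by (simp add: vec_eq_iff forall_2)
qed

lemma Y_mconj:
  assumes "extremal_system T \<mu> \<Lambda> X Z P"
  shows "extremal_system.Y \<mu> (\<lambda>t. mconj (\<Lambda> t)) (\<lambda>t. mconj (X t)) (\<lambda>t. mconj (Z t)) t
    = mconj (extremal_system.Y \<mu> \<Lambda> X Z t)"
proof -
  interpret C: extremal_system T \<mu> "\<lambda>t. mconj (\<Lambda> t)" "\<lambda>t. mconj (X t)" "\<lambda>t. mconj (Z t)" "\<lambda>t. mconj (P t)"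
    by (rule extremal_system_mconj[OF assms])
  interpret extremal_system T \<mu> \<Lambda> X Z P by fact
  have "C.L t = mconj (L t)" by (simp add: C.L_def L_def mconj_linear mconj_J)
  then show ?thesis unfolding C.Y_def Y_def by (simp add: trace_form_mconj mconj_linear)
qed

text \<open>The edge equations reach \<open>T\<close> if \<open>\<kappa> \<ge> 0\<close> and reach \<open>0\<close> if \<open>\<kappa> \<le> 0\<close>. By periodicity a conjugate
  of the system then satisfies the same equations, with the same \<open>\<kappa>\<close>, at the opposite end, and
  so along the whole interval back to the end at which one started. There two different vertices
  would each be the only one with \<open>\<langle>Y, Q\<rangle> > 0\<close>.\<close>

lemma (in extremal_system) no_edge0:
  assumes "a < b" "{a<..<b} \<subseteq> {0..T}"
    and "\<And>t. t \<in> {a<..<b} \<Longrightarrow> trace_form (Y t) vert1 = 0"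
    and "\<And>t. t \<in> {a<..<b} \<Longrightarrow> trace_form (Y t) vert2 = 0"
    and "\<And>t. t \<in> {a<..<b} \<Longrightarrow> 0 < trace_form (Y t) vert0"
  shows False
proof -
  have sys: "extremal_system T \<mu> \<Lambda> X Z P" by (rule extremal_system_axioms)
  note sys1 = extremal_system_mconj[OF sys]
  note sys2 = extremal_system_mconj[OF sys1]
  interpret C: extremal_system T \<mu> "\<lambda>t. mconj (\<Lambda> t)" "\<lambda>t. mconj (X t)" "\<lambda>t. mconj (Z t)" "\<lambda>t. mconj (P t)"
    by (rule sys1)
  interpret C2: extremal_system T \<mu> "\<lambda>t. mconj (mconj (\<Lambda> t))" "\<lambda>t. mconj (mconj (X t))" "\<lambda>t. mconj (mconj (Z t))" "\<lambda>t. mconj (mconj (P t))"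
    by (rule sys2)
  have \<mu>: "\<mu> = 0" by (rule edge_interval(1)[OF assms])
  obtain s where s: "s \<in> {a<..<b}" "edge s" using edge_interval(2)[OF assms] by blast
  have s0: "s \<in> {0..T}" using s(1) assms(2) by auto
  have ends: "0 \<in> {0..T}" "T \<in> {0..T}" using T_pos by auto
  show False
  proof (cases "0 \<le> \<kappa> s")
    case True
    have eT: "edge T" "\<kappa> T = \<kappa> s" using edge_forward[OF \<mu> s0 s(2) True, of T] s0 by auto
    have same: "mconj (mconj (\<Lambda> 0)) = \<Lambda> T" "mconj (mconj (X 0)) = X T" "mconj (mconj (Z 0)) = Z T"
      unfolding periodic[symmetric] using traceless[OF ends(2)] by (simp_all add: mconj3)
    have "C2.\<kappa> 0 = \<kappa> T" "C2.edge 0 = edge T"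
      unfolding C2.\<kappa>_def \<kappa>_def C2.edge_def edge_def C2.\<Psi>_def \<Psi>_def C2.Y_def Y_def C2.L_def L_def
        C2.l1_def l1_def C2.l2_def l2_def C2.l3_def l3_def C2.x_def x_def C2.y_def y_def same by simp_all
    then have "C2.edge T" using C2.edge_forward[OF \<mu> ends(1), of T] eT True T_pos by auto
    then have "0 < trace_form (C2.Y T) vert0" using C2.Y_vert(1)[OF ends(2)] unfolding C2.edge_def by simp
    moreover have "trace_form (C2.Y T) vert0 = trace_form (Y T) vert2"
      unfolding Y_mconj[OF sys1] Y_mconj[OF sys] mconj_vert(3)[symmetric] mconj_vert(2)[symmetric] trace_form_mconj ..
    moreover have "trace_form (Y T) vert2 = 0" using eT(1) Y_vert(3)[OF ends(2)] unfolding edge_def by simp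
    ultimately show False by simp
  next
    case False
    then have neg: "\<kappa> s \<le> 0" by simp
    have e0: "edge 0" "\<kappa> 0 = \<kappa> s" using edge_backward[OF \<mu> s0 s(2) neg, of 0] s0 by auto
    have "C.\<kappa> T = \<kappa> 0" "C.edge T = edge 0"
      unfolding C.\<kappa>_def \<kappa>_def C.edge_def edge_def C.\<Psi>_def \<Psi>_def C.Y_def Y_def C.L_def L_def
        C.l1_def l1_def C.l2_def l2_def C.l3_def l3_def C.x_def x_def C.y_def y_def periodic by simp_all
    then have "C.edge 0" using C.edge_backward[OF \<mu> ends(2), of 0] e0 neg T_pos by auto
    then have "0 < trace_form (C.Y 0) vert0" using C.Y_vert(1)[OF ends(1)] unfolding C.edge_def by simp
    moreover have "trace_form (C.Y 0) vert0 = trace_form (Y 0) vert1"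
      unfolding Y_mconj[OF sys] mconj_vert(3)[symmetric] trace_form_mconj ..
    moreover have "trace_form (Y 0) vert1 = 0" using e0(1) Y_vert(2)[OF ends(1)] unfolding edge_def by simp
    ultimately show False by simp
  qed
qed

context extremal_system
begin

text \<open>The symmetry moves every vertex to vertex \<open>0\<close>.\<close>

lemma no_edge:
  assumes ab: "a < b" "{a<..<b} \<subseteq> {0..T}" and Q: "Q \<in> verts"
    and pos: "\<And>t. t \<in> {a<..<b} \<Longrightarrow> 0 < trace_form (Y t) Q"
    and zero: "\<And>t Q'. t \<in> {a<..<b} \<Longrightarrow> Q' \<in> verts \<Longrightarrow> Q' \<noteq> Q \<Longrightarrow> trace_form (Y t) Q' = 0"
  shows False
proof -
  have sys: "extremal_system T \<mu> \<Lambda> X Z P" by (rule extremal_system_axioms)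
  note sys1 = extremal_system_mconj[OF sys]
  note sys2 = extremal_system_mconj[OF sys1]
  note d = vert_distinct
  have v: "vert0 \<in> verts" "vert1 \<in> verts" "vert2 \<in> verts" by (auto simp: verts_def)
  consider "Q = vert0" | "Q = vert1" | "Q = vert2" using Q by (auto simp: verts_def)
  then show False
  proof cases
    case 1
    show ?thesis
      by (rule no_edge0[OF ab]) (use 1 pos zero v d in auto)
  next
    case 2
    have e: "trace_form (extremal_system.Y \<mu> (\<lambda>t. mconj (\<Lambda> t)) (\<lambda>t. mconj (X t)) (\<lambda>t. mconj (Z t)) t) (mconj V) = trace_form (Y t) V" for t V
      unfolding Y_mconj[OF sys] trace_form_mconj ..
    show ?thesis
      by (rule extremal_system.no_edge0[OF sys1 ab])
        (use 2 pos zero v d e[of _ vert1] e[of _ vert0] e[of _ vert2] in \<open>auto simp: mconj_vert\<close>)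
  next
    case 3
    have e: "trace_form (extremal_system.Y \<mu> (\<lambda>t. mconj (mconj (\<Lambda> t))) (\<lambda>t. mconj (mconj (X t))) (\<lambda>t. mconj (mconj (Z t))) t) (mconj (mconj V)) = trace_form (Y t) V" for t V
      unfolding Y_mconj[OF sys1] Y_mconj[OF sys] trace_form_mconj ..
    show ?thesis
      by (rule extremal_system.no_edge0[OF sys2 ab])
        (use 3 pos zero v d e[of _ vert1] e[of _ vert0] e[of _ vert2] in \<open>auto simp: mconj_vert\<close>)
  qed
qed

section \<open>A singular arc is a circular arc\<close>

lemma Y_zero_if_vertices_zero:
  assumes t: "t \<in> {0..T}" and z: "\<And>Q. Q \<in> verts \<Longrightarrow> trace_form (Y t) Q = 0" shows "Y t = 0"
proof -
  have e: "Y t $1$2 + Y t $2$1 / 3 = 0" "2 * Y t $1$1 / sqrt 3 - 2/3 * Y t $2$1 = 0" "- 2 * Y t $1$1 / sqrt 3 - 2/3 * Y t $2$1 = 0"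
    using z unfolding Y_vert[OF t, symmetric] by (auto simp: verts_def)
  then have 21: "Y t $2$1 = 0" by linarith
  then have "Y t $1$1 = 0" "Y t $1$2 = 0" using e by simp_all
  then show ?thesis using 21 Y_traceless[OF t] by (simp add: vec_eq_iff forall_2)
qed

text \<open>If \<open>Y t \<noteq> 0\<close>, then \<open>\<langle>Y, Q\<rangle>\<close> is positive at one vertex \<open>Q\<close>, near \<open>t\<close> by continuity. So the two
  vertices at which it vanishes are the other two, and the system runs along an edge.\<close>

lemma singular_Y_zero:
  assumes ab: "{a<..<b} \<subseteq> {0..T}"
    and sing: "\<And>t. t \<in> {a<..<b} \<Longrightarrow> \<exists>Q\<in>verts. \<exists>Q'\<in>verts. Q \<noteq> Q' \<and> trace_form (Y t) Q = 0 \<and> trace_form (Y t) Q' = 0"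
    and t: "t \<in> {a<..<b}"
  shows "Y t = 0"
proof (rule ccontr)
  assume "Y t \<noteq> 0"
  have t0: "t \<in> {0..T}" using t ab by auto
  obtain Q where Q: "Q \<in> verts" "trace_form (Y t) Q \<noteq> 0" using Y_zero_if_vertices_zero[OF t0] \<open>Y t \<noteq> 0\<close> by blast
  then have pos: "0 < trace_form (Y t) Q" using Y_nonneg[OF t0 Q(1)] by simp
  have "continuous_on {0..T} (\<lambda>t. trace_form (Y t) Q)"
    unfolding trace_form_entries by (intro lip_continuous_on lip_add lip_mult lip_const lips(8))
  then obtain d where d: "d > 0" "\<And>s. s \<in> {0..T} \<Longrightarrow> dist s t < d \<Longrightarrow> dist (trace_form (Y s) Q) (trace_form (Y t) Q) < trace_form (Y t) Q"
    using t0 pos unfolding continuous_on_iff by blast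
  define a' where "a' = max a (t - d)" define b' where "b' = min b (t + d)"
  have ab': "a' < b'" "{a'<..<b'} \<subseteq> {0..T}" using t d(1) ab by (auto simp: a'_def b'_def)
  have p: "0 < trace_form (Y s) Q" if "s \<in> {a'<..<b'}" for s
  proof -
    have "s \<in> {0..T}" "dist s t < d" using that ab' by (auto simp: a'_def b'_def dist_real_def)
    from d(2)[OF this] show ?thesis by (simp add: dist_real_def abs_if split: if_splits)
  qed
  show False
  proof (rule no_edge[OF ab' Q(1) p])
    fix s Q' assume s: "s \<in> {a'<..<b'}" and Q': "Q' \<in> verts" "Q' \<noteq> Q"
    have "s \<in> {a<..<b}" using s by (auto simp: a'_def b'_def)
    from sing[OF this] obtain Q1 Q2 where Q12: "Q1 \<in> verts" "Q2 \<in> verts" "Q1 \<noteq> Q2"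
      "trace_form (Y s) Q1 = 0" "trace_form (Y s) Q2 = 0" by blast
    have "Q1 \<noteq> Q" "Q2 \<noteq> Q" using Q12 p[OF s] by auto
    then have "Q' = Q1 \<or> Q' = Q2" using Q12(1-3) Q' Q(1) unfolding verts_def by auto
    then show "trace_form (Y s) Q' = 0" using Q12 by auto
  qed
qed

text \<open>If \<open>Y = 0\<close>, then \<open>\<langle>L, X\<rangle> = 0\<close> and \<open>Z = 0\<close>, because \<open>Z\<close> and \<open>X\<close> are orthogonal. The equation
  for \<open>Z\<close> becomes \<open>[L, X] = 0\<close>, so \<open>L\<close> is a multiple of \<open>X\<close> orthogonal to \<open>X\<close>, and hence \<open>L =
  0\<close>. Then \<open>\<Lambda> = \<mu> J\<close> is constant, and the equation for \<open>\<Lambda>\<close> becomes \<open>\<mu> [J, X] = 0\<close>. The only \<open>X\<close>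
  that commutes with \<open>J\<close> is \<open>J\<close>.\<close>

lemma Y_zero_circle:
  assumes ab: "a < b" "{a<..<b} \<subseteq> {0..T}" and Y0: "\<And>t. t \<in> {a<..<b} \<Longrightarrow> Y t = 0"
  shows "\<mu> = 0 \<Longrightarrow> \<exists>t\<in>{a<..<b}. \<Lambda> t = 0 \<and> Z t = 0"
    and "\<mu> \<noteq> 0 \<Longrightarrow> t \<in> {a<..<b} \<Longrightarrow> X t $1$1 = 0 \<and> X t $2$1 = 1"
proof -
  have k0: "trace_form (L t) (X t) = 0" "Z t = 0" if t: "t \<in> {a<..<b}" for t
  proof -
    have t0: "t \<in> {0..T}" using t ab by auto
    show "trace_form (L t) (X t) = 0" using YX[OF t0] Y0[OF t] by (simp add: trace_form_entries)
    then show "Z t = 0" using Y0[OF t] by (simp add: Y_def)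
  qed
  obtain N where N: "negligible N"
    and "\<And>t. t \<in> {0..T} - N \<Longrightarrow> P t \<in> simplex_mats"
    and "\<And>t. t \<in> {0..T} - N \<Longrightarrow> trace_form (Y t) (P t) = 0"
    and "\<And>t i j. t \<in> {0..T} - N \<Longrightarrow> ((\<lambda>t. X t $i$j) has_real_derivative (1 / trace_form (X t) (P t)) * mat_bracket (P t) (X t) $i$j) (at t within {0..T})"
    and g\<Lambda>: "\<And>t i j. t \<in> {0..T} - N \<Longrightarrow> ((\<lambda>t. \<Lambda> t $i$j) has_real_derivative mat_bracket (\<Lambda> t) (X t) $i$j) (at t within {0..T})"
    and gZ: "\<And>t i j. t \<in> {0..T} - N \<Longrightarrow> ((\<lambda>t. Z t $i$j) has_real_derivative mat_bracket (L t) (X t) $i$j + (1 / trace_form (X t) (P t)) * mat_bracket (P t) (Y t) $i$j) (at t within {0..T})"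
    using good_times by blast
  have Lz: "l1 t = 0 \<and> l2 t = 0 \<and> l3 t = 0" if t: "t \<in> {a<..<b} - N" for t
  proof -
    have t0: "t \<in> {0..T} - N" "t \<in> {0..T}" "t \<in> {a<..<b}" using t ab by auto
    note yp = y_pos[OF t0(2)]
    have z: "mat_bracket (L t) (X t) $i$j = 0" for i j
    proof -
      have "mat_bracket (L t) (X t) $i$j + (1 / trace_form (X t) (P t)) * mat_bracket (P t) (Y t) $i$j = 0"
        by (rule derivative_zero_on[where f = "\<lambda>t. Z t $i$j" and c = 0, OF gZ[OF t0(1)] _ t0(3) ab(2)]) (simp add: k0)
      then show ?thesis using Y0[OF t0(3)] by (simp add: mat_bracket_def)
    qed
    have 1: "l2 t + l3 t * ((x t)\<^sup>2 + (y t)\<^sup>2) = 0" using z[of 1 1] yp unfolding L_bracket[OF t0(2)] by simp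
    have 2: "l3 t * x t - l1 t = 0" using z[of 2 1] yp unfolding L_bracket[OF t0(2)] by simp
    have "\<Psi> t / y t - l3 t * y t = 0" using k0(1)[OF t0(3)] unfolding LX[OF t0(2)] .
    then have "\<Psi> t = l3 t * (y t)\<^sup>2" using yp by (simp add: field_simps power2_eq_square)
    then have "2 * l1 t * x t + l2 t - l3 t * (x t)\<^sup>2 = l3 t * (y t)\<^sup>2" unfolding \<Psi>_def .
    moreover have "l1 t = l3 t * x t" "l2 t = - (l3 t * ((x t)\<^sup>2 + (y t)\<^sup>2))" using 1 2 by simp_all
    ultimately have "l3 t * (y t)\<^sup>2 = 0" by (simp add: algebra_simps power2_eq_square)
    then have "l3 t = 0" using yp by simp
    then show ?thesis using 1 2 by simp
  qed
  have all0: "f t = c" if f: "lip {0..T} f" and z: "\<And>t. t \<in> {a<..<b} - N \<Longrightarrow> f t = c" and t: "t \<in> {a<..<b}" for f c t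
  proof -
    have "f t - c = 0"
    proof (rule zero_off_negligible[of "(a+t)/2" "(t+b)/2" "\<lambda>t. f t - c" N])
      have "{(a+t)/2..(t+b)/2} \<subseteq> {a<..<b}" using t by auto
      then show "continuous_on {(a+t)/2..(t+b)/2} (\<lambda>t. f t - c)"
        using ab(2) by (intro continuous_on_subset[OF lip_continuous_on[OF lip_diff[OF f lip_const]]]) blast
      show "f s - c = 0" if "s \<in> {(a+t)/2..(t+b)/2} - N" for s using z[of s] that t by auto
    qed (use N t in auto)
    then show ?thesis by simp
  qed
  have L0: "l1 t = 0" "l2 t = 0" "l3 t = 0" if t: "t \<in> {a<..<b}" for t
    using all0[OF lips(3) _ t, of 0] all0[OF lips(4) _ t, of 0] all0[OF lips(5) _ t, of 0] Lz by blast+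
  show "\<exists>t\<in>{a<..<b}. \<Lambda> t = 0 \<and> Z t = 0" if \<mu>: "\<mu> = 0"
  proof (intro bexI[of _ "(a+b)/2"] conjI)
    show m: "(a+b)/2 \<in> {a<..<b}" using ab by auto
    then have "(a+b)/2 \<in> {0..T}" using ab by blast
    have e: "\<Lambda> ((a+b)/2) $1$1 = 0" "\<Lambda> ((a+b)/2) $1$2 = 0" "\<Lambda> ((a+b)/2) $2$1 = 0"
      using L0[OF m] \<mu> unfolding l1_def l2_def l3_def by linarith+
    have "\<Lambda> ((a+b)/2) $2$2 = 0" using traceless(1)[OF \<open>(a+b)/2 \<in> {0..T}\<close>] e(1) by simp
    then show "\<Lambda> ((a+b)/2) = 0" using e by (simp add: vec_eq_iff forall_2)
    show "Z ((a+b)/2) = 0" by (rule k0(2)[OF m])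
  qed
  show "X t $1$1 = 0 \<and> X t $2$1 = 1" if \<mu>: "\<mu> \<noteq> 0" and t: "t \<in> {a<..<b}"
  proof -
    have g: "X t $1$1 = 0 \<and> X t $2$1 = 1" if t: "t \<in> {a<..<b} - N" for t
    proof -
      have t0: "t \<in> {0..T} - N" "t \<in> {0..T}" "t \<in> {a<..<b}" using t ab by auto
      note yp = y_pos[OF t0(2)]
      have "((l2 t - \<mu>) + (l3 t + \<mu>) * ((x t)\<^sup>2 + (y t)\<^sup>2)) / y t = 0"
        by (rule derivative_zero_on[where f = l1 and c = 0, OF \<Lambda>_derivatives(1)[OF t0(2) g\<Lambda>[OF t0(1)]] L0(1) t0(3) ab(2)])
      then have 1: "\<mu> * ((x t)\<^sup>2 + (y t)\<^sup>2 - 1) = 0" using yp L0[OF t0(3)] by (simp add: algebra_simps)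
      have "2 * ((l3 t + \<mu>) * x t - l1 t) / y t = 0"
        by (rule derivative_zero_on[where f = l3 and c = 0, OF \<Lambda>_derivatives(3)[OF t0(2) g\<Lambda>[OF t0(1)]] L0(3) t0(3) ab(2)])
      then have 2: "\<mu> * x t = 0" using yp L0[OF t0(3)] by simp
      have "x t = 0" "(y t)\<^sup>2 = 1" using 1 2 \<mu> by simp_all
      then have "y t = 1" using yp by (simp add: power2_eq_1_iff)
      then show ?thesis using \<open>x t = 0\<close> X_entries(1,2)[OF t0(2)] by simp
    qed
    show ?thesis using all0[OF lip_X[of 1 1] _ t, of 0] all0[OF lip_X[of 2 1] _ t, of 1] g by blast
  qed
qed

end

section \<open>From the Hamiltonian equations to the matrix form\<close>

lemma matrix_has_vector_derivative:
  fixes F :: "real \<Rightarrow> real^2^2"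
  assumes "\<And>i j. ((\<lambda>t. F t $ i $ j) has_real_derivative D $ i $ j) (at t within S)"
  shows "(F has_vector_derivative D) (at t within S)"
proof -
  define M :: "2 \<Rightarrow> 2 \<Rightarrow> real^2^2" where "M i j = axis i (axis j 1)" for i j
  have dec: "A = A$1$1 *\<^sub>R M 1 1 + A$1$2 *\<^sub>R M 1 2 + A$2$1 *\<^sub>R M 2 1 + A$2$2 *\<^sub>R M 2 2" for A
    by (simp add: vec_eq_iff forall_2 M_def axis_def)
  have one: "((\<lambda>t. F t $ i $ j *\<^sub>R M i j) has_vector_derivative D $ i $ j *\<^sub>R M i j) (at t within S)" for i j
    using bounded_linear.has_vector_derivative[OF bounded_linear_scaleR_left, OF assms[of i j, unfolded has_real_derivative_iff_has_vector_derivative]] .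
  have "((\<lambda>t. F t $1$1 *\<^sub>R M 1 1 + F t $1$2 *\<^sub>R M 1 2 + F t $2$1 *\<^sub>R M 2 1 + F t $2$2 *\<^sub>R M 2 2)
     has_vector_derivative (D $1$1 *\<^sub>R M 1 1 + D $1$2 *\<^sub>R M 1 2 + D $2$1 *\<^sub>R M 2 1 + D $2$2 *\<^sub>R M 2 2)) (at t within S)"
    by (intro has_vector_derivative_add one)
  then show ?thesis unfolding dec[symmetric] .
qed

text \<open>A traceless matrix with entries \<open>a, b, c, -a\<close> acts on the half-plane by the vector field \<open>b +
  2aw - cw\<^sup>2\<close>. The right-hand side \<open>(f1, f2)\<close> is that of the control matrix \<open>Pm u\<close> divided by
  \<open>\<langle>X, Pm u\<rangle>\<close>, and \<open>Zm n w\<close> is the moment map: \<open>\<langle>Zm n w, A\<rangle>\<close> is the value of the covector \<open>n\<close> on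
  the vector field of \<open>A\<close> at \<open>w\<close>.\<close>

definition Pm :: "real^3 \<Rightarrow> real^2^2" where
  "Pm u = vector [vector [ctrl_a u, ctrl_b u], vector [ctrl_c u, - ctrl_a u]]"

definition Zm :: "real^2 \<Rightarrow> complex \<Rightarrow> real^2^2" where
  "Zm n w = vector [vector [n$1 * Re w + n$2 * Im w, - (n$1 * ((Re w)\<^sup>2 - (Im w)\<^sup>2) + 2 * n$2 * Re w * Im w)],
     vector [n$1, - (n$1 * Re w + n$2 * Im w)]]"

definition Ym :: "real \<Rightarrow> real^2^2 \<Rightarrow> complex \<Rightarrow> real^2 \<Rightarrow> real^2^2" where
  "Ym lc M w n = Zm n w + trace_form (M - (3/2 * lc) *\<^sub>R J_mat) (X_mat w) *\<^sub>R X_mat w"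

lemma Pm_entries: "Pm u$1$1 = ctrl_a u" "Pm u$1$2 = ctrl_b u" "Pm u$2$1 = ctrl_c u" "Pm u$2$2 = - ctrl_a u"
  by (simp_all add: Pm_def)

lemma X_mat_entries: "X_mat w$1$1 = Re w / Im w" "X_mat w$1$2 = - (Re w)\<^sup>2 / Im w - Im w"
  "X_mat w$2$1 = 1 / Im w" "X_mat w$2$2 = - (Re w / Im w)"
  by (simp_all add: X_mat_def Let_def)

lemma Zm_entries: "Zm n w$1$1 = n$1 * Re w + n$2 * Im w"
  "Zm n w$1$2 = - (n$1 * ((Re w)\<^sup>2 - (Im w)\<^sup>2) + 2 * n$2 * Re w * Im w)"
  "Zm n w$2$1 = n$1" "Zm n w$2$2 = - (n$1 * Re w + n$2 * Im w)"
  by (simp_all add: Zm_def)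

definition den :: "real \<Rightarrow> real \<Rightarrow> real^3 \<Rightarrow> real" where
  "den x y u = ctrl_b u + 2 * ctrl_a u * x - ctrl_c u * x\<^sup>2 - ctrl_c u * y\<^sup>2"

lemma trace_form_X_Pm: "Im w \<noteq> 0 \<Longrightarrow> trace_form (X_mat w) (Pm u) = den (Re w) (Im w) u / Im w"
  by (simp add: trace_form_entries X_mat_entries Pm_entries den_def field_simps power2_eq_square)

lemma trace_form_Z_Pm: "trace_form (Zm n w) (Pm u) =
   n$1 * (ctrl_b u + 2 * ctrl_a u * Re w - ctrl_c u * (Re w)\<^sup>2 + ctrl_c u * (Im w)\<^sup>2) + n$2 * (2 * (ctrl_a u - ctrl_c u * Re w) * Im w)"
  by (simp add: trace_form_entries Zm_entries Pm_entries algebra_simps power2_eq_square)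

lemma hamiltonian_Ym:
  assumes w: "Im w \<noteq> 0" and d: "den (Re w) (Im w) u \<noteq> 0"
  shows "hamiltonian lc M w n u = trace_form (Ym lc M w n) (Pm u) / trace_form (X_mat w) (Pm u)"
proof -
  have f: "f1 (Re w) (Im w) u = Im w * (ctrl_b u + 2 * ctrl_a u * Re w - ctrl_c u * (Re w)\<^sup>2 + ctrl_c u * (Im w)\<^sup>2) / den (Re w) (Im w) u"
    "f2 (Re w) (Im w) u = 2 * (ctrl_a u - ctrl_c u * Re w) * (Im w)\<^sup>2 / den (Re w) (Im w) u"
    by (simp_all add: f1_def f2_def Let_def den_def)
  have h: "hamiltonian lc M w n u = trace_form (M - (3/2 * lc) *\<^sub>R J_mat) (X_mat w)
     + trace_form (Zm n w) (Pm u) * Im w / den (Re w) (Im w) u"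
    unfolding hamiltonian_def trace_form_linear trace_form_Z_Pm f
    by (simp add: power2_eq_square add_divide_distrib[symmetric] algebra_simps)
  have "trace_form (X_mat w) (Pm u) \<noteq> 0" unfolding trace_form_X_Pm[OF w] using w d by simp
  then show ?thesis unfolding h Ym_def trace_form_linear(1,3) add_divide_distrib
    using trace_form_X_Pm[OF w, of u] w d by simp
qed

lemma sum_UNIV_3: "(\<Sum>i\<in>UNIV. u $ i) = u$0 + u$1 + u$2" for u :: "real^3"
proof -
  have "(3::3) = 0" by simp
  then have "u$3 = u$0" by (rule arg_cong)
  then show ?thesis unfolding sum_3 by (simp only: add.commute add.left_commute)
qed

lemma Pm_wcomb:
  assumes "u \<in> control_set" shows "Pm u = wcomb (u$0) (u$1) (u$2)"
proof -
  have "u$0 + u$1 + u$2 = 1" using assms unfolding control_set_def sum_UNIV_3 by simp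
  then show ?thesis
    by (simp add: vec_eq_iff forall_2 wcomb_entries Pm_entries ctrl_a_def ctrl_b_def ctrl_c_def)
qed

lemma Pm_simplex: assumes "u \<in> control_set" shows "Pm u \<in> simplex_mats"
proof -
  have "u$0 + u$1 + u$2 = 1" "0 \<le> u$0" "0 \<le> u$1" "0 \<le> u$2"
    using assms unfolding control_set_def sum_UNIV_3 by simp_all
  then show ?thesis unfolding simplex_mats_def Pm_wcomb[OF assms] by blast
qed

lemma Pm_vertices:
  shows "axis 0 1 \<in> control_set" "axis 1 1 \<in> control_set" "axis 2 1 \<in> control_set"
    "Pm (axis 0 1) = vert0" "Pm (axis 1 1) = vert1" "Pm (axis 2 1) = vert2"
proof -
  have ne: "(0::3) \<noteq> 1" "(0::3) \<noteq> 2" "(1::3) \<noteq> 2" "(1::3) \<noteq> 0" "(2::3) \<noteq> 0" "(2::3) \<noteq> 1" by simp_all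
  show "axis 0 1 \<in> control_set" "axis 1 1 \<in> control_set" "axis 2 1 \<in> control_set"
    unfolding control_set_def sum_UNIV_3 using ne by (auto simp: axis_def)
  then show "Pm (axis 0 1) = vert0" "Pm (axis 1 1) = vert1" "Pm (axis 2 1) = vert2"
    using ne by (simp_all add: Pm_wcomb wcomb_def axis_def)
qed

text \<open>The three inequalities at the vertices are exactly the ones that define the region \<open>h_star\<close>.\<close>

lemma h_star_neg:
  assumes w: "w \<in> h_star" and Q: "Q \<in> verts" shows "trace_form (X_mat w) Q < 0"
proof -
  have y: "Im w > 0" and x: "\<bar>Re w\<bar> < 1 / sqrt 3" and r: "(Re w)\<^sup>2 + (Im w)\<^sup>2 > 1/3"
    using w by (auto simp: h_star_def upper_half_plane_def)
  have s: "\<bar>Re w\<bar> * sqrt 3 < 1" using x by (simp add: field_simps)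
  have "\<bar>Re w * sqrt 3\<bar> < 1" using s by (simp add: abs_mult)
  then have "Re w * sqrt 3 < 1" "- Re w * sqrt 3 < 1" by linarith+
  moreover have "v / sqrt 3 = v * sqrt 3 / 3" for v :: real by (simp add: field_simps)
  ultimately have "Re w / sqrt 3 < 1/3" "- Re w / sqrt 3 < 1/3" by simp_all
  have c: "ctrl_a (axis 0 1) = 0" "ctrl_b (axis 0 1) = 1/3" "ctrl_c (axis 0 1) = 1"
      "ctrl_a (axis 1 1) = 1 / sqrt 3" "ctrl_b (axis 1 1) = -2/3" "ctrl_c (axis 1 1) = 0"
      "ctrl_a (axis 2 1) = - 1 / sqrt 3" "ctrl_b (axis 2 1) = -2/3" "ctrl_c (axis 2 1) = 0"
    unfolding Pm_entries[symmetric] Pm_vertices vert_entries by (rule refl)+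
  from \<open>Re w / sqrt 3 < 1/3\<close> \<open>- Re w / sqrt 3 < 1/3\<close>
  have "den (Re w) (Im w) (axis 0 1) < 0" "den (Re w) (Im w) (axis 1 1) < 0" "den (Re w) (Im w) (axis 2 1) < 0"
  proof -
    assume k: "Re w / sqrt 3 < 1/3" "- Re w / sqrt 3 < 1/3"
    have m: "2 * (1 / sqrt 3) * Re w = 2 * (Re w / sqrt 3)" "2 * (- 1 / sqrt 3) * Re w = 2 * (- Re w / sqrt 3)" by simp_all
    show "den (Re w) (Im w) (axis 0 1) < 0" "den (Re w) (Im w) (axis 1 1) < 0" "den (Re w) (Im w) (axis 2 1) < 0"
      unfolding den_def c m using k r by linarith+
  qed
  then have "trace_form (X_mat w) (Pm (axis i 1)) < 0" if "i \<in> {0,1,2}" for i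
    using that y trace_form_X_Pm[of w] by (auto simp: divide_neg_pos)
  from this[of 0] this[of 1] this[of 2] show ?thesis using Q unfolding verts_def Pm_vertices by auto
qed

lemma den_neg:
  assumes "w \<in> h_star" "u \<in> control_set" shows "den (Re w) (Im w) u < 0"
proof -
  have y: "Im w > 0" using assms(1) by (auto simp: h_star_def upper_half_plane_def)
  have "den (Re w) (Im w) u / Im w < 0"
    using simplex_neg[OF h_star_neg[OF assms(1)] Pm_simplex[OF assms(2)]] trace_form_X_Pm[of w u] y by simp
  then show ?thesis using y by (simp add: divide_less_0_iff)
qed

lemma hamiltonian_ratio:
  assumes "w \<in> h_star" "u \<in> control_set"
  shows "hamiltonian lc M w n u = trace_form (Ym lc M w n) (Pm u) / trace_form (X_mat w) (Pm u)"
    "trace_form (X_mat w) (Pm u) < 0"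
  using hamiltonian_Ym[of w u] den_neg[OF assms] assms(1) simplex_neg[OF h_star_neg[OF assms(1)] Pm_simplex[OF assms(2)]]
  by (auto simp: h_star_def upper_half_plane_def)

lemma hamiltonian_bdd:
  assumes w: "w \<in> h_star" shows "bdd_above (hamiltonian lc M w n ` control_set)"
proof -
  define m where "m = Min {- trace_form (X_mat w) vert0, - trace_form (X_mat w) vert1, - trace_form (X_mat w) vert2}"
  have m: "0 < m" "m \<le> - trace_form (X_mat w) vert0" "m \<le> - trace_form (X_mat w) vert1" "m \<le> - trace_form (X_mat w) vert2"
    using h_star_neg[OF w] by (auto simp: m_def verts_def)
  define K where "K = \<bar>trace_form (Ym lc M w n) vert0\<bar> + \<bar>trace_form (Ym lc M w n) vert1\<bar> + \<bar>trace_form (Ym lc M w n) vert2\<bar>"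
  have "hamiltonian lc M w n u \<le> K / m" if u: "u \<in> control_set" for u
  proof -
    have p: "u$0 + u$1 + u$2 = 1" "0 \<le> u$0" "0 \<le> u$1" "0 \<le> u$2"
      using u unfolding control_set_def sum_UNIV_3 by simp_all
    have le1: "u$0 \<le> 1" "u$1 \<le> 1" "u$2 \<le> 1" using p by linarith+
    have e: "trace_form A (Pm u) = u$0 * trace_form A vert0 + u$1 * trace_form A vert1 + u$2 * trace_form A vert2" for A
      unfolding Pm_wcomb[OF u] wcomb_def trace_form_linear by simp
    have "m = u$0 * m + u$1 * m + u$2 * m" using p(1) by (simp add: distrib_right[symmetric])
    also have "\<dots> \<le> u$0 * - trace_form (X_mat w) vert0 + u$1 * - trace_form (X_mat w) vert1 + u$2 * - trace_form (X_mat w) vert2"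
      using p m by (intro add_mono mult_left_mono) auto
    finally have mX: "m \<le> - trace_form (X_mat w) (Pm u)" unfolding e by simp
    have c: "\<bar>v * r\<bar> \<le> \<bar>r\<bar>" if "0 \<le> v" "v \<le> 1" for v r :: real
      using mult_right_mono[OF that(2), of "\<bar>r\<bar>"] that by (simp add: abs_mult)
    have Y: "\<bar>trace_form (Ym lc M w n) (Pm u)\<bar> \<le> K"
      unfolding e K_def using c[OF p(2) le1(1), of "trace_form (Ym lc M w n) vert0"]
        c[OF p(3) le1(2), of "trace_form (Ym lc M w n) vert1"] c[OF p(4) le1(3), of "trace_form (Ym lc M w n) vert2"] by linarith
    have "hamiltonian lc M w n u \<le> \<bar>hamiltonian lc M w n u\<bar>" by simp
    also have "\<dots> = \<bar>trace_form (Ym lc M w n) (Pm u)\<bar> / - trace_form (X_mat w) (Pm u)"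
      unfolding hamiltonian_ratio(1)[OF w u] abs_divide using hamiltonian_ratio(2)[OF w u] by simp
    also have "\<dots> \<le> K / m" using Y mX m(1) by (intro frac_le) auto
    finally show ?thesis .
  qed
  then show ?thesis by (auto intro!: bdd_aboveI)
qed

text \<open>The Hamiltonian is a quotient of two functions that are affine on the control triangle, with
  negative denominator, so its sign is decided by the numerator at the vertices.\<close>

lemma max_hamiltonian_zero:
  assumes w: "w \<in> h_star" and nn: "\<And>Q. Q \<in> verts \<Longrightarrow> 0 \<le> trace_form (Ym lc M w n) Q"
    and z: "\<exists>Q\<in>verts. trace_form (Ym lc M w n) Q = 0"
  shows "max_hamiltonian lc M w n = 0"
proof -
  have le: "hamiltonian lc M w n u \<le> 0" if u: "u \<in> control_set" for u
  proof -
    have p: "0 \<le> u$0" "0 \<le> u$1" "0 \<le> u$2" using u unfolding control_set_def by simp_all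
    have "trace_form (Ym lc M w n) (Pm u) = u$0 * trace_form (Ym lc M w n) vert0 + u$1 * trace_form (Ym lc M w n) vert1 + u$2 * trace_form (Ym lc M w n) vert2"
      unfolding Pm_wcomb[OF u] wcomb_def trace_form_linear by simp
    also have "\<dots> \<ge> 0" using p nn by (auto simp: verts_def)
    finally show ?thesis unfolding hamiltonian_ratio(1)[OF w u] using hamiltonian_ratio(2)[OF w u] by (simp add: divide_nonneg_neg)
  qed
  obtain u where u: "u \<in> control_set" "trace_form (Ym lc M w n) (Pm u) = 0"
    using z Pm_vertices unfolding verts_def by (metis insertE singletonD)
  have "hamiltonian lc M w n u = 0" unfolding hamiltonian_ratio(1)[OF w u(1)] u(2) by simp
  then have "0 \<le> max_hamiltonian lc M w n"
    unfolding max_hamiltonian_def by (metis cSUP_upper[OF u(1) hamiltonian_bdd[OF w]])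
  moreover have "max_hamiltonian lc M w n \<le> 0"
    unfolding max_hamiltonian_def using u(1) le by (intro cSUP_least) auto
  ultimately show ?thesis by simp
qed

lemma maximal_zero_vertices:
  assumes w: "w \<in> h_star" and u: "u \<in> control_set"
    and h: "hamiltonian lc M w n u = max_hamiltonian lc M w n" "max_hamiltonian lc M w n = 0"
  shows "trace_form (Ym lc M w n) (Pm u) = 0"
    "Q \<in> verts \<Longrightarrow> 0 \<le> trace_form (Ym lc M w n) Q"
proof -
  show "trace_form (Ym lc M w n) (Pm u) = 0"
    using h hamiltonian_ratio(1)[OF w u, of lc M n] hamiltonian_ratio(2)[OF w u] by (auto simp: divide_eq_0_iff)
  have le: "0 \<le> trace_form (Ym lc M w n) (Pm v)" if v: "v \<in> control_set" for v
  proof -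
    have "hamiltonian lc M w n v \<le> 0"
      using cSUP_upper[OF v hamiltonian_bdd[OF w], of lc M n] h(2) unfolding max_hamiltonian_def by simp
    then show ?thesis using hamiltonian_ratio(1)[OF w v, of lc M n] hamiltonian_ratio(2)[OF w v]
      by (simp add: divide_le_0_iff)
  qed
  show "0 \<le> trace_form (Ym lc M w n) Q" if "Q \<in> verts"
    using that le Pm_vertices unfolding verts_def by (metis insertE singletonD)
qed

lemma product_zero_vertices:
  assumes nn: "\<And>Q. Q \<in> verts \<Longrightarrow> 0 \<le> trace_form A Q" and u: "u \<in> control_set" and z: "trace_form A (Pm u) = 0"
  shows "u$0 * trace_form A vert0 = 0" "u$1 * trace_form A vert1 = 0" "u$2 * trace_form A vert2 = 0"
proof -
  have p: "0 \<le> u$0" "0 \<le> u$1" "0 \<le> u$2" using u unfolding control_set_def by simp_all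
  have "u$0 * trace_form A vert0 + u$1 * trace_form A vert1 + u$2 * trace_form A vert2 = 0"
    using z unfolding Pm_wcomb[OF u] wcomb_def trace_form_linear by simp
  moreover have "0 \<le> u$0 * trace_form A vert0" "0 \<le> u$1 * trace_form A vert1" "0 \<le> u$2 * trace_form A vert2"
    using p nn by (auto simp: verts_def)
  ultimately show "u$0 * trace_form A vert0 = 0" "u$1 * trace_form A vert1 = 0" "u$2 * trace_form A vert2 = 0"
    by linarith+
qed

text \<open>A control in the face has weight only at vertices at which the numerator vanishes. If there
  were only one such vertex, then the face would be a single point.\<close>

lemma face_two_vertices:
  assumes w: "w \<in> h_star" and nn: "\<And>Q. Q \<in> verts \<Longrightarrow> 0 \<le> trace_form (Ym lc M w n) Q"
    and z: "\<exists>Q\<in>verts. trace_form (Ym lc M w n) Q = 0"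
    and d: "0 < aff_dim (maximizing_face lc M w n)"
  shows "\<exists>Q\<in>verts. \<exists>Q'\<in>verts. Q \<noteq> Q' \<and> trace_form (Ym lc M w n) Q = 0 \<and> trace_form (Ym lc M w n) Q' = 0"
proof -
  let ?A = "Ym lc M w n"
  have m0: "max_hamiltonian lc M w n = 0" by (rule max_hamiltonian_zero[OF w nn z])
  have "\<not> (\<exists>v. maximizing_face lc M w n \<subseteq> {v})"
  proof
    assume "\<exists>v. maximizing_face lc M w n \<subseteq> {v}"
    then obtain v where "maximizing_face lc M w n \<subseteq> {v}" by blast
    from aff_dim_subset[OF this] show False using d by simp
  qed
  then obtain u v where uv: "u \<in> maximizing_face lc M w n" "v \<in> maximizing_face lc M w n" "u \<noteq> v"
    by (metis insertCI subsetI singletonI)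
  have cs: "u \<in> control_set" "v \<in> control_set" and h: "hamiltonian lc M w n u = max_hamiltonian lc M w n"
    "hamiltonian lc M w n v = max_hamiltonian lc M w n" using uv by (auto simp: maximizing_face_def)
  note zu = product_zero_vertices[OF nn cs(1) maximal_zero_vertices(1)[OF w cs(1) h(1) m0]]
  note zv = product_zero_vertices[OF nn cs(2) maximal_zero_vertices(1)[OF w cs(2) h(2) m0]]
  have su: "u$0 + u$1 + u$2 = 1" "v$0 + v$1 + v$2 = 1" using cs unfolding control_set_def sum_UNIV_3 by simp_all
  have ext: "u = v" if "u$0 = v$0" "u$1 = v$1" "u$2 = v$2"
  proof -
    have "(3::3) = 0" by simp
    then have "u$3 = u$0" "v$3 = v$0" by (rule arg_cong)+
    then show ?thesis using that by (simp add: vec_eq_iff forall_3)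
  qed
  note ne = vert_distinct
  have key: "(trace_form ?A vert0 = 0 \<and> trace_form ?A vert1 = 0) \<or> (trace_form ?A vert0 = 0 \<and> trace_form ?A vert2 = 0)
    \<or> (trace_form ?A vert1 = 0 \<and> trace_form ?A vert2 = 0)"
  proof (rule ccontr)
    assume c: "\<not> ?thesis"
    consider "trace_form ?A vert0 \<noteq> 0" "trace_form ?A vert1 \<noteq> 0" | "trace_form ?A vert0 \<noteq> 0" "trace_form ?A vert2 \<noteq> 0"
      | "trace_form ?A vert1 \<noteq> 0" "trace_form ?A vert2 \<noteq> 0" using c by blast
    then have "u$0 = v$0 \<and> u$1 = v$1 \<and> u$2 = v$2"
      by cases (use zu zv su in auto)
    then show False using ext uv(3) by blast
  qed
  then show ?thesis using ne unfolding verts_def by blast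
qed

lemma hamiltonian_entries:
  assumes "M$2$2 = - M$1$1"
  shows "hamiltonian lc M (Complex x y) n u =
    (2 * M$1$1 * x + (M$1$2 + 3/2 * lc)) * (1/y) - (M$2$1 - 3/2 * lc) * (x * x * (1/y) + y)
    + n$1 * f1 x y u + n$2 * f2 x y u"
proof -
  define r where "r = 1 / y"
  define m where "m = 3/2 * lc"
  have X: "X_mat (Complex x y)$1$1 = x * r" "X_mat (Complex x y)$1$2 = - (x * x * r) - y"
    "X_mat (Complex x y)$2$1 = r" "X_mat (Complex x y)$2$2 = - (x * r)"
    by (simp_all add: X_mat_entries r_def power2_eq_square)
  have "trace_form M (X_mat (Complex x y)) - m * trace_form J_mat (X_mat (Complex x y))
    = (2 * M$1$1 * x + (M$1$2 + m)) * r - (M$2$1 - m) * (x * x * r + y)"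
    unfolding trace_form_entries X J_mat_entries assms by (simp add: algebra_simps)
  then show ?thesis unfolding hamiltonian_def m_def r_def by simp
qed

lemma f1_deriv:
  assumes "den x y u \<noteq> 0"
  shows "((\<lambda>x. f1 x y u) has_real_derivative
      (y * (2 * ctrl_a u - 2 * ctrl_c u * x)) / den x y u
      - (y * (ctrl_b u + 2 * ctrl_a u * x - ctrl_c u * x\<^sup>2 + ctrl_c u * y\<^sup>2)) * (2 * ctrl_a u - 2 * ctrl_c u * x) / (den x y u * den x y u)) (at x)"
    "((\<lambda>y. f1 x y u) has_real_derivative
      (ctrl_b u + 2 * ctrl_a u * x - ctrl_c u * x\<^sup>2 + 3 * ctrl_c u * y\<^sup>2) / den x y u
      + (y * (ctrl_b u + 2 * ctrl_a u * x - ctrl_c u * x\<^sup>2 + ctrl_c u * y\<^sup>2)) * (2 * ctrl_c u * y) / (den x y u * den x y u)) (at y)"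
    "((\<lambda>x. f2 x y u) has_real_derivative
      (- 2 * ctrl_c u * y\<^sup>2) / den x y u
      - (2 * (ctrl_a u - ctrl_c u * x) * y\<^sup>2) * (2 * ctrl_a u - 2 * ctrl_c u * x) / (den x y u * den x y u)) (at x)"
    "((\<lambda>y. f2 x y u) has_real_derivative
      (4 * (ctrl_a u - ctrl_c u * x) * y) / den x y u
      + (2 * (ctrl_a u - ctrl_c u * x) * y\<^sup>2) * (2 * ctrl_c u * y) / (den x y u * den x y u)) (at y)"
proof -
  have dx: "((\<lambda>x. den x y u) has_real_derivative 2 * ctrl_a u - 2 * ctrl_c u * x) (at x)"
    unfolding den_def by (auto intro!: derivative_eq_intros)
  have dy: "((\<lambda>y. den x y u) has_real_derivative - (2 * ctrl_c u * y)) (at y)"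
    unfolding den_def by (auto intro!: derivative_eq_intros)
  have q: "(f' * d - f * d') / (d * d) = f' / d - f * d' / (d * d)" if "d \<noteq> 0" for f' d f d' :: real
    using that by (simp add: field_simps)
  have q2: "(f' * d - f * - d') / (d * d) = f' / d + f * d' / (d * d)" if "d \<noteq> 0" for f' d f d' :: real
    using that by (simp add: field_simps)
  have e1: "(\<lambda>x. f1 x y u) = (\<lambda>x. y * (ctrl_b u + 2 * ctrl_a u * x - ctrl_c u * x\<^sup>2 + ctrl_c u * y\<^sup>2) / den x y u)"
    by (simp add: f1_def Let_def den_def)
  have e1': "(\<lambda>y. f1 x y u) = (\<lambda>y. y * (ctrl_b u + 2 * ctrl_a u * x - ctrl_c u * x\<^sup>2 + ctrl_c u * y\<^sup>2) / den x y u)"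
    by (simp add: f1_def Let_def den_def)
  have e2: "(\<lambda>x. f2 x y u) = (\<lambda>x. 2 * (ctrl_a u - ctrl_c u * x) * y\<^sup>2 / den x y u)"
    by (simp add: f2_def Let_def den_def)
  have e2': "(\<lambda>y. f2 x y u) = (\<lambda>y. 2 * (ctrl_a u - ctrl_c u * x) * y\<^sup>2 / den x y u)"
    by (simp add: f2_def Let_def den_def)
  have n1: "((\<lambda>x. y * (ctrl_b u + 2 * ctrl_a u * x - ctrl_c u * x\<^sup>2 + ctrl_c u * y\<^sup>2)) has_real_derivative y * (2 * ctrl_a u - 2 * ctrl_c u * x)) (at x)"
    by (auto intro!: derivative_eq_intros)
  have n1': "((\<lambda>y. y * (ctrl_b u + 2 * ctrl_a u * x - ctrl_c u * x\<^sup>2 + ctrl_c u * y\<^sup>2)) has_real_derivative (ctrl_b u + 2 * ctrl_a u * x - ctrl_c u * x\<^sup>2 + 3 * ctrl_c u * y\<^sup>2)) (at y)"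
    by (auto intro!: derivative_eq_intros simp: algebra_simps power2_eq_square)
  have n2: "((\<lambda>x. 2 * (ctrl_a u - ctrl_c u * x) * y\<^sup>2) has_real_derivative - 2 * ctrl_c u * y\<^sup>2) (at x)"
    by (auto intro!: derivative_eq_intros)
  have n2': "((\<lambda>y. 2 * (ctrl_a u - ctrl_c u * x) * y\<^sup>2) has_real_derivative 4 * (ctrl_a u - ctrl_c u * x) * y) (at y)"
    by (auto intro!: derivative_eq_intros)
  show "((\<lambda>x. f1 x y u) has_real_derivative
      (y * (2 * ctrl_a u - 2 * ctrl_c u * x)) / den x y u
      - (y * (ctrl_b u + 2 * ctrl_a u * x - ctrl_c u * x\<^sup>2 + ctrl_c u * y\<^sup>2)) * (2 * ctrl_a u - 2 * ctrl_c u * x) / (den x y u * den x y u)) (at x)"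
    unfolding e1 by (rule DERIV_cong[OF DERIV_divide[OF n1 dx assms] q[OF assms]])
  show "((\<lambda>y. f1 x y u) has_real_derivative
      (ctrl_b u + 2 * ctrl_a u * x - ctrl_c u * x\<^sup>2 + 3 * ctrl_c u * y\<^sup>2) / den x y u
      + (y * (ctrl_b u + 2 * ctrl_a u * x - ctrl_c u * x\<^sup>2 + ctrl_c u * y\<^sup>2)) * (2 * ctrl_c u * y) / (den x y u * den x y u)) (at y)"
    unfolding e1' by (rule DERIV_cong[OF DERIV_divide[OF n1' dy assms] q2[OF assms]])
  show "((\<lambda>x. f2 x y u) has_real_derivative
      (- 2 * ctrl_c u * y\<^sup>2) / den x y u
      - (2 * (ctrl_a u - ctrl_c u * x) * y\<^sup>2) * (2 * ctrl_a u - 2 * ctrl_c u * x) / (den x y u * den x y u)) (at x)"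
    unfolding e2 by (rule DERIV_cong[OF DERIV_divide[OF n2 dx assms] q[OF assms]])
  show "((\<lambda>y. f2 x y u) has_real_derivative
      (4 * (ctrl_a u - ctrl_c u * x) * y) / den x y u
      + (2 * (ctrl_a u - ctrl_c u * x) * y\<^sup>2) * (2 * ctrl_c u * y) / (den x y u * den x y u)) (at y)"
    unfolding e2' by (rule DERIV_cong[OF DERIV_divide[OF n2' dy assms] q2[OF assms]])
qed

text \<open>Written with \<open>q = 1 / den\<close> and \<open>r = 1 / y\<close> the derivatives are polynomials, so that the
  identities that follow can be checked modulo \<open>r y = 1\<close> and \<open>q den = 1\<close>.\<close>

lemma hamiltonian_derivs:
  assumes M: "M$2$2 = - M$1$1" and y: "y \<noteq> 0" and d: "den x y u \<noteq> 0"
    and q: "q = 1 / den x y u" and r: "r = 1 / y"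
  shows "deriv (\<lambda>x. hamiltonian lc M (Complex x y) n u) x =
      2 * M$1$1 * r - 2 * (M$2$1 - 3/2 * lc) * x * r
      + n$1 * (y * (2 * ctrl_a u - 2 * ctrl_c u * x) * q - y * (ctrl_b u + 2 * ctrl_a u * x - ctrl_c u * x\<^sup>2 + ctrl_c u * y\<^sup>2) * (2 * ctrl_a u - 2 * ctrl_c u * x) * q * q)
      + n$2 * (- 2 * ctrl_c u * y\<^sup>2 * q - 2 * (ctrl_a u - ctrl_c u * x) * y\<^sup>2 * (2 * ctrl_a u - 2 * ctrl_c u * x) * q * q)"
    "deriv (\<lambda>y. hamiltonian lc M (Complex x y) n u) y =
      - (2 * M$1$1 * x + (M$1$2 + 3/2 * lc)) * r * r + (M$2$1 - 3/2 * lc) * (x * x * r * r - 1)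
      + n$1 * ((ctrl_b u + 2 * ctrl_a u * x - ctrl_c u * x\<^sup>2 + 3 * ctrl_c u * y\<^sup>2) * q + y * (ctrl_b u + 2 * ctrl_a u * x - ctrl_c u * x\<^sup>2 + ctrl_c u * y\<^sup>2) * (2 * ctrl_c u * y) * q * q)
      + n$2 * (4 * (ctrl_a u - ctrl_c u * x) * y * q + 2 * (ctrl_a u - ctrl_c u * x) * y\<^sup>2 * (2 * ctrl_c u * y) * q * q)"
proof -
  have dq: "a / den x y u = a * q" "a / (den x y u * den x y u) = a * q * q" for a
    by (simp_all add: q)
  note F = f1_deriv[OF d, unfolded dq]
  have "((\<lambda>x. (2 * M$1$1 * x + (M$1$2 + 3/2 * lc)) * r' - (M$2$1 - 3/2 * lc) * (x * x * r' + y)) has_real_derivative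
     2 * M$1$1 * r' - 2 * (M$2$1 - 3/2 * lc) * x * r') (at x)" for r'
    by (auto intro!: derivative_eq_intros simp: algebra_simps)
  from this[of "1/y"] have "((\<lambda>x. (2 * M$1$1 * x + (M$1$2 + 3/2 * lc)) * (1/y) - (M$2$1 - 3/2 * lc) * (x * x * (1/y) + y)) has_real_derivative
     2 * M$1$1 * r - 2 * (M$2$1 - 3/2 * lc) * x * r) (at x)"
    unfolding r .
  from DERIV_add[OF DERIV_add[OF this DERIV_cmult[OF F(1), of "n$1"]] DERIV_cmult[OF F(3), of "n$2"]]
  show "deriv (\<lambda>x. hamiltonian lc M (Complex x y) n u) x =
      2 * M$1$1 * r - 2 * (M$2$1 - 3/2 * lc) * x * r
      + n$1 * (y * (2 * ctrl_a u - 2 * ctrl_c u * x) * q - y * (ctrl_b u + 2 * ctrl_a u * x - ctrl_c u * x\<^sup>2 + ctrl_c u * y\<^sup>2) * (2 * ctrl_a u - 2 * ctrl_c u * x) * q * q)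
      + n$2 * (- 2 * ctrl_c u * y\<^sup>2 * q - 2 * (ctrl_a u - ctrl_c u * x) * y\<^sup>2 * (2 * ctrl_a u - 2 * ctrl_c u * x) * q * q)"
    unfolding hamiltonian_entries[OF M] by (rule DERIV_imp_deriv)
  have "((\<lambda>y. 1 / y) has_real_derivative - (r * r)) (at y)"
    using y unfolding r by (auto intro!: derivative_eq_intros simp: power2_eq_square)
  then have "((\<lambda>y. (2 * M$1$1 * x + (M$1$2 + 3/2 * lc)) * (1/y) - (M$2$1 - 3/2 * lc) * (x * x * (1/y) + y)) has_real_derivative
     (2 * M$1$1 * x + (M$1$2 + 3/2 * lc)) * - (r * r) - (M$2$1 - 3/2 * lc) * (x * x * - (r * r) + 1)) (at y)"
    by (intro DERIV_diff DERIV_cmult DERIV_add DERIV_ident)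
  moreover have "(2 * M$1$1 * x + (M$1$2 + 3/2 * lc)) * - (r * r) - (M$2$1 - 3/2 * lc) * (x * x * - (r * r) + 1)
    = - (2 * M$1$1 * x + (M$1$2 + 3/2 * lc)) * r * r + (M$2$1 - 3/2 * lc) * (x * x * r * r - 1)"
  proof -
    have "A * - (r * r) - C * (x * x * - (r * r) + 1) = - A * r * r + C * (x * x * r * r - 1)" for A C
      by (simp add: algebra_simps)
    then show ?thesis .
  qed
  ultimately have "((\<lambda>y. (2 * M$1$1 * x + (M$1$2 + 3/2 * lc)) * (1/y) - (M$2$1 - 3/2 * lc) * (x * x * (1/y) + y)) has_real_derivative
     - (2 * M$1$1 * x + (M$1$2 + 3/2 * lc)) * r * r + (M$2$1 - 3/2 * lc) * (x * x * r * r - 1)) (at y)" by (simp only:)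
  from DERIV_add[OF DERIV_add[OF this DERIV_cmult[OF F(2), of "n$1"]] DERIV_cmult[OF F(4), of "n$2"]]
  show "deriv (\<lambda>y. hamiltonian lc M (Complex x y) n u) y =
      - (2 * M$1$1 * x + (M$1$2 + 3/2 * lc)) * r * r + (M$2$1 - 3/2 * lc) * (x * x * r * r - 1)
      + n$1 * ((ctrl_b u + 2 * ctrl_a u * x - ctrl_c u * x\<^sup>2 + 3 * ctrl_c u * y\<^sup>2) * q + y * (ctrl_b u + 2 * ctrl_a u * x - ctrl_c u * x\<^sup>2 + ctrl_c u * y\<^sup>2) * (2 * ctrl_c u * y) * q * q)
      + n$2 * (4 * (ctrl_a u - ctrl_c u * x) * y * q + 2 * (ctrl_a u - ctrl_c u * x) * y\<^sup>2 * (2 * ctrl_c u * y) * q * q)"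
    unfolding hamiltonian_entries[OF M] by (rule DERIV_imp_deriv)
qed

text \<open>The map \<open>X_mat\<close> is equivariant, so the vector field of a matrix on the half-plane becomes its
  bracket with \<open>X\<close>.\<close>

lemma X_mat_ode:
  assumes y: "Im (w t) > 0" and d: "den (Re (w t)) (Im (w t)) u \<noteq> 0"
    and dx: "((\<lambda>s. Re (w s)) has_real_derivative f1 (Re (w t)) (Im (w t)) u) (at t within S)"
    and dy: "((\<lambda>s. Im (w s)) has_real_derivative f2 (Re (w t)) (Im (w t)) u) (at t within S)"
  shows "((\<lambda>s. X_mat (w s)) has_vector_derivative
     (1 / trace_form (X_mat (w t)) (Pm u)) *\<^sub>R mat_bracket (Pm u) (X_mat (w t))) (at t within S)"
proof (rule matrix_has_vector_derivative)
  fix i j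
  define x where "x = Re (w t)" define y where "y = Im (w t)"
  define a where "a = ctrl_a u" define b where "b = ctrl_b u" define c where "c = ctrl_c u"
  define q where "q = 1 / den x y u" define r where "r = 1 / y"
  have yp: "y \<noteq> 0" using assms(1) by (simp add: y_def)
  have r1: "r * y = 1" using yp by (simp add: r_def)
  have q1: "q * (b + 2 * a * x - c * x\<^sup>2 - c * y\<^sup>2) = 1"
    using d unfolding q_def x_def y_def a_def b_def c_def by (simp add: den_def)
  define X' where "X' = y * (b + 2 * a * x - c * x\<^sup>2 + c * y\<^sup>2) * q"
  define Y' where "Y' = 2 * (a - c * x) * y\<^sup>2 * q"
  have X: "((\<lambda>s. Re (w s)) has_real_derivative X') (at t within S)"
    using dx by (simp add: X'_def f1_def Let_def q_def den_def a_def b_def c_def x_def y_def)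
  have Y: "((\<lambda>s. Im (w s)) has_real_derivative Y') (at t within S)"
    using dy by (simp add: Y'_def f2_def Let_def q_def den_def a_def b_def c_def x_def y_def)
  have ne: "Im (w t) \<noteq> 0" using yp by (simp add: y_def)
  have R: "((\<lambda>s. 1 / Im (w s)) has_real_derivative - Y' * r * r) (at t within S)"
    using DERIV_divide[OF DERIV_const[of 1] Y ne] by (simp add: r_def y_def)
  have s: "1 / trace_form (X_mat (w t)) (Pm u) = y * q"
    unfolding trace_form_X_Pm[OF ne] q_def x_def y_def by simp
  have tl: "Pm u$2$2 = - Pm u$1$1" "X_mat (w t)$2$2 = - X_mat (w t)$1$1" by (simp_all add: Pm_entries X_mat_entries)
  have XE: "X_mat (w t)$1$1 = x * r" "X_mat (w t)$1$2 = - (x * x * r) - y" "X_mat (w t)$2$1 = r"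
    by (simp_all add: X_mat_entries x_def y_def r_def power2_eq_square)
  note B = mat_bracket_entries[OF tl, unfolded Pm_entries XE, folded a_def b_def c_def]
  have 11: "((\<lambda>s. X_mat (w s)$1$1) has_real_derivative (X' * r + - Y' * r * r * x)) (at t within S)"
    using DERIV_mult[OF X R] unfolding X_mat_entries by (simp add: r_def y_def x_def)
  have 21: "((\<lambda>s. X_mat (w s)$2$1) has_real_derivative (- Y' * r * r)) (at t within S)"
    using R unfolding X_mat_entries .
  have "((\<lambda>s. - (Re (w s) * Re (w s) * (1 / Im (w s))) - Im (w s)) has_real_derivative
     (- ((X' * x + X' * x) * r + - Y' * r * r * (x * x)) - Y')) (at t within S)"
    using DERIV_diff[OF DERIV_minus[OF DERIV_mult[OF DERIV_mult[OF X X] R]] Y] by (simp add: r_def y_def x_def)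
  then have 12: "((\<lambda>s. X_mat (w s)$1$2) has_real_derivative (- ((X' * x + X' * x) * r + - Y' * r * r * (x * x)) - Y')) (at t within S)"
    unfolding X_mat_entries by (simp add: power2_eq_square)
  have 22: "((\<lambda>s. X_mat (w s)$2$2) has_real_derivative - (X' * r + - Y' * r * r * x)) (at t within S)"
    using DERIV_minus[OF 11] unfolding X_mat_entries .
  have E11: "X' * r + - Y' * r * r * x = y * q * (b * r - (- (x * x * r) - y) * c)"
    unfolding X'_def Y'_def using r1 by algebra
  have E21: "- Y' * r * r = y * q * (2 * (c * (x * r) - a * r))"
    unfolding Y'_def using r1 by algebra
  have E12: "- ((X' * x + X' * x) * r + - Y' * r * r * (x * x)) - Y' = y * q * (2 * (a * (- (x * x * r) - y) - b * (x * r)))"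
    unfolding X'_def Y'_def using r1 by algebra
  have "\<forall>i j. ((\<lambda>s. X_mat (w s) $ i $ j) has_real_derivative ((1 / trace_form (X_mat (w t)) (Pm u)) *\<^sub>R mat_bracket (Pm u) (X_mat (w t))) $ i $ j) (at t within S)"
    unfolding forall_2 s vector_scaleR_component real_scaleR_def B
    using 11[unfolded E11] 12[unfolded E12] 21[unfolded E21] 22[unfolded E11]
    by (simp only: mult_minus_right simp_thms)
  then show "((\<lambda>s. X_mat (w s) $ i $ j) has_real_derivative ((1 / trace_form (X_mat (w t)) (Pm u)) *\<^sub>R mat_bracket (Pm u) (X_mat (w t))) $ i $ j) (at t within S)"
    by blast
qed

text \<open>Along the flow of a fixed matrix the moment map evolves by the bracket. Here the flow is
  rescaled by the function \<open>1 / \<langle>X, P\<rangle>\<close> of \<open>z\<close> and the Hamiltonian has the further term \<open>\<langle>L,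
  X\<rangle>\<close>; the corrections combine to brackets with \<open>Y\<close> and with \<open>L\<close> because \<open>\<langle>Y, P\<rangle> = 0\<close>, that is,
  because the Hamiltonian vanishes.\<close>

lemma Zm_ode:
  assumes M: "M$2$2 = - M$1$1" and y: "Im (w t) > 0" and d: "den (Re (w t)) (Im (w t)) u \<noteq> 0"
    and Y0: "trace_form (Ym lc M (w t) (n t)) (Pm u) = 0"
    and dx: "((\<lambda>s. Re (w s)) has_real_derivative f1 (Re (w t)) (Im (w t)) u) (at t within S)"
    and dy: "((\<lambda>s. Im (w s)) has_real_derivative f2 (Re (w t)) (Im (w t)) u) (at t within S)"
    and dn1: "((\<lambda>s. n s $ 1) has_real_derivative - deriv (\<lambda>x. hamiltonian lc M (Complex x (Im (w t))) (n t) u) (Re (w t))) (at t within S)"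
    and dn2: "((\<lambda>s. n s $ 2) has_real_derivative - deriv (\<lambda>y. hamiltonian lc M (Complex (Re (w t)) y) (n t) u) (Im (w t))) (at t within S)"
  shows "((\<lambda>s. Zm (n s) (w s)) has_vector_derivative
     mat_bracket (M - (3/2 * lc) *\<^sub>R J_mat) (X_mat (w t)) + (1 / trace_form (X_mat (w t)) (Pm u)) *\<^sub>R mat_bracket (Pm u) (Ym lc M (w t) (n t))) (at t within S)"
proof (rule matrix_has_vector_derivative)
  fix i j
  define x where "x = Re (w t)" define y where "y = Im (w t)"
  define a where "a = ctrl_a u" define b where "b = ctrl_b u" define c where "c = ctrl_c u"
  define n1 where "n1 = n t$1" define n2 where "n2 = n t$2"
  define l1 where "l1 = M$1$1" define l2 where "l2 = M$1$2 + 3/2 * lc" define l3 where "l3 = M$2$1 - 3/2 * lc"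
  define q where "q = 1 / den x y u" define r where "r = 1 / y"
  have yp: "y \<noteq> 0" using assms(2) by (simp add: y_def)
  have r1: "r * y = 1" using yp by (simp add: r_def)
  have q1: "q * (b + 2 * a * x - c * x\<^sup>2 - c * y\<^sup>2) = 1"
    using d unfolding q_def x_def y_def a_def b_def c_def by (simp add: den_def)
  define X' where "X' = y * (b + 2 * a * x - c * x\<^sup>2 + c * y\<^sup>2) * q"
  define Y' where "Y' = 2 * (a - c * x) * y\<^sup>2 * q"
  have X: "((\<lambda>s. Re (w s)) has_real_derivative X') (at t within S)"
    using dx by (simp add: X'_def f1_def Let_def q_def den_def a_def b_def c_def x_def y_def)
  have Y: "((\<lambda>s. Im (w s)) has_real_derivative Y') (at t within S)"
    using dy by (simp add: Y'_def f2_def Let_def q_def den_def a_def b_def c_def x_def y_def)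
  have ne: "Im (w t) \<noteq> 0" using yp by (simp add: y_def)
  have dne: "den x y u \<noteq> 0" using d by (simp add: x_def y_def)
  define N1 where "N1 = - (2 * l1 * r - 2 * l3 * x * r
      + n1 * (y * (2 * a - 2 * c * x) * q - y * (b + 2 * a * x - c * x\<^sup>2 + c * y\<^sup>2) * (2 * a - 2 * c * x) * q * q)
      + n2 * (- 2 * c * y\<^sup>2 * q - 2 * (a - c * x) * y\<^sup>2 * (2 * a - 2 * c * x) * q * q))"
  define N2 where "N2 = - (- (2 * l1 * x + l2) * r * r + l3 * (x * x * r * r - 1)
      + n1 * ((b + 2 * a * x - c * x\<^sup>2 + 3 * c * y\<^sup>2) * q + y * (b + 2 * a * x - c * x\<^sup>2 + c * y\<^sup>2) * (2 * c * y) * q * q)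
      + n2 * (4 * (a - c * x) * y * q + 2 * (a - c * x) * y\<^sup>2 * (2 * c * y) * q * q))"
  have D1: "((\<lambda>s. n s $ 1) has_real_derivative N1) (at t within S)"
    using dn1 unfolding hamiltonian_derivs(1)[OF M yp dne q_def r_def, folded x_def y_def] x_def[symmetric] y_def[symmetric]
    by (simp only: hamiltonian_derivs(1)[OF M yp dne q_def r_def] N1_def n1_def n2_def l1_def l2_def l3_def a_def b_def c_def)
  have D2: "((\<lambda>s. n s $ 2) has_real_derivative N2) (at t within S)"
    using dn2 unfolding x_def[symmetric] y_def[symmetric]
    by (simp only: hamiltonian_derivs(2)[OF M yp dne q_def r_def] N2_def n1_def n2_def l1_def l2_def l3_def a_def b_def c_def)
  have s: "1 / trace_form (X_mat (w t)) (Pm u) = y * q"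
    unfolding trace_form_X_Pm[OF ne] q_def x_def y_def by simp
  define k where "k = trace_form (M - (3/2 * lc) *\<^sub>R J_mat) (X_mat (w t))"
  have XE: "X_mat (w t)$1$1 = x * r" "X_mat (w t)$1$2 = - (x * x * r) - y" "X_mat (w t)$2$1 = r" "X_mat (w t)$2$2 = - (x * r)"
    by (simp_all add: X_mat_entries x_def y_def r_def power2_eq_square)
  have kv: "k = - (y * q * (n1 * (b + 2 * a * x - c * x\<^sup>2 + c * y\<^sup>2) + n2 * (2 * (a - c * x) * y)))"
  proof -
    have "(n1 * (b + 2 * a * x - c * x\<^sup>2 + c * y\<^sup>2) + n2 * (2 * (a - c * x) * y)) + k * (den x y u / y) = 0"
      using Y0 unfolding Ym_def trace_form_linear(1,3) trace_form_Z_Pm trace_form_X_Pm[OF ne]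
      by (simp add: k_def n1_def n2_def a_def b_def c_def x_def y_def)
    moreover have "den x y u / y * (y * q) = 1" using dne yp by (simp add: q_def)
    moreover have "k' = - (m * N)" if "N + k' * e = 0" "e * m = 1" for N k' e m :: real
      using that by algebra
    ultimately show ?thesis by blast
  qed
  have Lm: "(M - (3/2 * lc) *\<^sub>R J_mat)$1$1 = l1" "(M - (3/2 * lc) *\<^sub>R J_mat)$1$2 = l2" "(M - (3/2 * lc) *\<^sub>R J_mat)$2$1 = l3"
     "(M - (3/2 * lc) *\<^sub>R J_mat)$2$2 = - l1"
    using M by (simp_all add: J_mat_entries l1_def l2_def l3_def)
  have Ye: "Ym lc M (w t) (n t)$1$1 = (n1 * x + n2 * y) + k * (x * r)"
    "Ym lc M (w t) (n t)$1$2 = - (n1 * (x\<^sup>2 - y\<^sup>2) + 2 * n2 * x * y) + k * (- (x * x * r) - y)"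
    "Ym lc M (w t) (n t)$2$1 = n1 + k * r" "Ym lc M (w t) (n t)$2$2 = - ((n1 * x + n2 * y) + k * (x * r))"
    unfolding Ym_def k_def[symmetric] by (simp_all add: Zm_entries XE n1_def n2_def x_def y_def)
  have tl: "(M - (3/2 * lc) *\<^sub>R J_mat)$2$2 = - (M - (3/2 * lc) *\<^sub>R J_mat)$1$1" "X_mat (w t)$2$2 = - X_mat (w t)$1$1"
    "Pm u$2$2 = - Pm u$1$1" "Ym lc M (w t) (n t)$2$2 = - Ym lc M (w t) (n t)$1$1"
    unfolding Lm Ye by (simp_all add: Pm_entries X_mat_entries)
  note BL = mat_bracket_entries[OF tl(1,2), unfolded Lm XE]
  note BP = mat_bracket_entries[OF tl(3,4), unfolded Ye Pm_entries a_def[symmetric] b_def[symmetric] c_def[symmetric]]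
  have 11: "((\<lambda>s. Zm (n s) (w s)$1$1) has_real_derivative (N1 * x + X' * n1) + (N2 * y + Y' * n2)) (at t within S)"
    using DERIV_add[OF DERIV_mult[OF D1 X] DERIV_mult[OF D2 Y]] unfolding Zm_entries by (simp add: x_def y_def n1_def n2_def)
  have 21: "((\<lambda>s. Zm (n s) (w s)$2$1) has_real_derivative N1) (at t within S)"
    using D1 unfolding Zm_entries .
  have "((\<lambda>s. - (n s$1 * (Re (w s) * Re (w s) - Im (w s) * Im (w s)) + 2 * (n s$2 * (Re (w s) * Im (w s))))) has_real_derivative
     - ((N1 * (x * x - y * y) + ((X' * x + X' * x) - (Y' * y + Y' * y)) * n1) + 2 * (N2 * (x * y) + (X' * y + Y' * x) * n2))) (at t within S)"
    using DERIV_minus[OF DERIV_add[OF DERIV_mult[OF D1 DERIV_diff[OF DERIV_mult[OF X X] DERIV_mult[OF Y Y]]]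
        DERIV_cmult[OF DERIV_mult[OF D2 DERIV_mult[OF X Y]], of 2]]]
    by (simp add: x_def y_def n1_def n2_def)
  then have 12: "((\<lambda>s. Zm (n s) (w s)$1$2) has_real_derivative
     - ((N1 * (x * x - y * y) + ((X' * x + X' * x) - (Y' * y + Y' * y)) * n1) + 2 * (N2 * (x * y) + (X' * y + Y' * x) * n2))) (at t within S)"
    unfolding Zm_entries by (simp add: power2_eq_square mult.assoc)
  have 22: "((\<lambda>s. Zm (n s) (w s)$2$2) has_real_derivative - ((N1 * x + X' * n1) + (N2 * y + Y' * n2))) (at t within S)"
    using DERIV_minus[OF 11] unfolding Zm_entries .
  have E21: "N1 = 2 * (l3 * (x * r) - l1 * r) + y * q * (2 * (c * ((n1 * x + n2 * y) + k * (x * r)) - a * (n1 + k * r)))"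
    unfolding N1_def kv using r1 q1 by algebra
  have E11: "(N1 * x + X' * n1) + (N2 * y + Y' * n2) =
     (l2 * r - (- (x * x * r) - y) * l3) + y * q * (b * (n1 + k * r) - (- (n1 * (x\<^sup>2 - y\<^sup>2) + 2 * n2 * x * y) + k * (- (x * x * r) - y)) * c)"
    unfolding N1_def N2_def X'_def Y'_def kv using r1 q1 by algebra
  have E12: "- ((N1 * (x * x - y * y) + ((X' * x + X' * x) - (Y' * y + Y' * y)) * n1) + 2 * (N2 * (x * y) + (X' * y + Y' * x) * n2)) =
     2 * (l1 * (- (x * x * r) - y) - l2 * (x * r)) + y * q * (2 * (a * (- (n1 * (x\<^sup>2 - y\<^sup>2) + 2 * n2 * x * y) + k * (- (x * x * r) - y)) - b * ((n1 * x + n2 * y) + k * (x * r))))"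
    unfolding N1_def N2_def X'_def Y'_def kv using r1 q1 by algebra
  have "\<forall>i j. ((\<lambda>s. Zm (n s) (w s) $ i $ j) has_real_derivative
      (mat_bracket (M - (3/2 * lc) *\<^sub>R J_mat) (X_mat (w t)) + (1 / trace_form (X_mat (w t)) (Pm u)) *\<^sub>R mat_bracket (Pm u) (Ym lc M (w t) (n t))) $ i $ j) (at t within S)"
    unfolding forall_2 s vector_add_component vector_scaleR_component real_scaleR_def BL BP
    using 11[unfolded E11] 12[unfolded E12] 21[unfolded E21] 22[unfolded E11]
    by (simp only: mult_minus_right minus_add_distrib simp_thms)
  then show "((\<lambda>s. Zm (n s) (w s) $ i $ j) has_real_derivative
      (mat_bracket (M - (3/2 * lc) *\<^sub>R J_mat) (X_mat (w t)) + (1 / trace_form (X_mat (w t)) (Pm u)) *\<^sub>R mat_bracket (Pm u) (Ym lc M (w t) (n t))) $ i $ j) (at t within S)"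
    by blast
qed

section \<open>Rotations, transversality, and the circular arcs\<close>

text \<open>Complex multiplication as a matrix. Since this is a continuous ring homomorphism, it turns
  \<open>mat_exp\<close> into the complex exponential.\<close>

definition rotm :: "complex \<Rightarrow> real^2^2" where
  "rotm w = vector [vector [Re w, - Im w], vector [Im w, Re w]]"

lemma rotm_entries: "rotm w$1$1 = Re w" "rotm w$1$2 = - Im w" "rotm w$2$1 = Im w" "rotm w$2$2 = Re w"
  by (simp_all add: rotm_def)

lemma rotm_mult: "rotm (v * w) = rotm v ** rotm w"
  by (simp add: vec_eq_iff forall_2 rotm_entries matrix_matrix_mult_def sum_2)

lemma rotm_one: "rotm 1 = mat 1"
  by (simp add: vec_eq_iff forall_2 rotm_entries mat_def)

lemma linear_rotm: "linear rotm"
  by (rule linearI) (simp_all add: vec_eq_iff forall_2 rotm_entries)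

lemma mat_exp_rotm: "mat_exp (rotm w) = rotm (exp w)"
proof -
  have p: "((**) (rotm w) ^^ n) (mat 1) = rotm (w ^ n)" for n
    by (induction n) (simp_all add: rotm_one rotm_mult)
  have "bounded_linear rotm" using linear_rotm by (simp add: linear_conv_bounded_linear)
  from bounded_linear.sums[OF this exp_converges[of w]]
  have "(\<lambda>n. inverse (fact n) *\<^sub>R rotm (w ^ n)) sums rotm (exp w)"
    by (simp add: linear_scale[OF linear_rotm])
  then show ?thesis unfolding mat_exp_def p by (rule sums_unique[symmetric])
qed

lemma R_mat_rotm: "R_mat = rotm (cis (pi / 3))"
proof -
  have "(pi / 3) *\<^sub>R J_mat = rotm (\<i> * of_real (pi / 3))"
    by (simp add: vec_eq_iff forall_2 rotm_entries J_mat_entries)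
  then show ?thesis unfolding R_mat_def by (simp add: mat_exp_rotm cis_conv_exp)
qed

lemma R_mat_rot60: "R_mat = rot60"
  unfolding R_mat_rotm by (simp add: vec_eq_iff forall_2 rotm_entries rot60_def cos_60 sin_60)

lemma matrix_inv_R: "matrix_inv R_mat = transpose rot60"
proof -
  have "rot60 ** matrix_inv rot60 = mat 1 \<and> matrix_inv rot60 ** rot60 = mat 1"
    unfolding matrix_inv_def by (rule someI[of _ "transpose rot60"]) (simp add: rot60_orth)
  then have "matrix_inv rot60 = matrix_inv rot60 ** (rot60 ** transpose rot60)" "matrix_inv rot60 ** rot60 = mat 1"
    by (simp_all add: rot60_orth)
  then show ?thesis unfolding R_mat_rot60 by (simp add: matrix_mul_assoc)
qed

lemma mconj_cancel: "mconj (transpose rot60 ** A ** rot60) = A"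
proof -
  have "mconj (transpose rot60 ** A ** rot60) = (rot60 ** transpose rot60) ** A ** (rot60 ** transpose rot60)"
    unfolding mconj_def by (simp only: matrix_mul_assoc)
  then show ?thesis by (simp add: rot60_orth)
qed

text \<open>The action on the half-plane corresponds to conjugation of \<open>X\<close>, and the dual action on
  covectors to conjugation of the moment map \<open>Z\<close>.\<close>

definition zR :: "complex \<Rightarrow> complex" where
  "zR w = (of_real (1/2) * w + of_real (sqrt 3 / 2)) / (of_real (- sqrt 3 / 2) * w + of_real (1/2))"

lemma mobius_R: "mobius (matrix_inv R_mat) w = zR w"
  unfolding matrix_inv_R mobius_def zR_def by (simp add: rot60_def transpose_def)

lemma zR_denominator: "Im w > 0 \<Longrightarrow> of_real (- sqrt 3 / 2) * w + of_real (1/2) \<noteq> 0"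
  by (auto simp: complex_eq_iff)

lemma X_mat_periodic:
  assumes w: "Im w > 0" and w': "Im (zR w) > 0"
  shows "mconj (X_mat (zR w)) = X_mat w"
proof -
  define x where "x = Re w" define y where "y = Im w"
  define D where "D = (1/2 - sqrt 3 / 2 * x)\<^sup>2 + (sqrt 3 / 2 * y)\<^sup>2"
  have yp: "y > 0" using w by (simp add: y_def)
  have r3: "sqrt 3 * sqrt 3 = (3::real)" by simp
  have r3': "sqrt 3 * (sqrt 3 * a) = 3 * a" for a :: real by (simp add: mult.assoc[symmetric])
  have Dp: "D > 0" unfolding D_def using yp by (intro add_nonneg_pos) auto
  have den: "of_real (- sqrt 3 / 2) * w + of_real (1/2) = Complex (1/2 - sqrt 3 / 2 * x) (- sqrt 3 / 2 * y)"
    by (simp add: complex_eq_iff x_def y_def)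
  have num: "of_real (1/2) * w + of_real (sqrt 3 / 2) = Complex (x / 2 + sqrt 3 / 2) (y / 2)"
    by (simp add: complex_eq_iff x_def y_def)
  have Im: "Im (zR w) = y / D"
  proof -
    have "Im (zR w) = ((y / 2) * (1/2 - sqrt 3 / 2 * x) - (x / 2 + sqrt 3 / 2) * (- sqrt 3 / 2 * y)) / D"
      unfolding zR_def den num D_def by (simp add: Im_divide power2_eq_square)
    also have "(y / 2) * (1/2 - sqrt 3 / 2 * x) - (x / 2 + sqrt 3 / 2) * (- sqrt 3 / 2 * y) = y"
      by (simp add: field_simps r3')
    finally show ?thesis .
  qed
  have Re: "Re (zR w) = ((x / 2 + sqrt 3 / 2) * (1/2 - sqrt 3 / 2 * x) - (y / 2) * (sqrt 3 / 2 * y)) / D"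
    unfolding zR_def den num D_def by (simp add: Re_divide power2_eq_square)
  have X11: "X_mat (zR w)$1$1 = ((x / 2 + sqrt 3 / 2) * (1/2 - sqrt 3 / 2 * x) - (y / 2) * (sqrt 3 / 2 * y)) / y"
    unfolding X_mat_entries Im Re using Dp yp by simp
  have X21: "X_mat (zR w)$2$1 = D / y" unfolding X_mat_entries Im using Dp yp by simp
  have X12: "X_mat (zR w)$1$2 = - ((x / 2 + sqrt 3 / 2)\<^sup>2 + (y / 2)\<^sup>2) / y"
  proof -
    have n: "(Re (zR w))\<^sup>2 + (Im (zR w))\<^sup>2 = ((x / 2 + sqrt 3 / 2)\<^sup>2 + (y / 2)\<^sup>2) / D"
    proof -
      have "(cmod (zR w))\<^sup>2 = (cmod (Complex (x / 2 + sqrt 3 / 2) (y / 2)))\<^sup>2 / (cmod (Complex (1/2 - sqrt 3 / 2 * x) (- sqrt 3 / 2 * y)))\<^sup>2"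
        unfolding zR_def den num by (simp add: norm_divide power_divide)
      then show ?thesis unfolding cmod_power2 D_def by simp
    qed
    have "X_mat (zR w)$1$2 = - ((Re (zR w))\<^sup>2 + (Im (zR w))\<^sup>2) / Im (zR w)"
      unfolding X_mat_entries using w' by (simp add: field_simps power2_eq_square)
    then show ?thesis unfolding n unfolding Im using Dp yp by simp
  qed
  define r where "r = 1 / y"
  have rr: "a / y = a * r" for a by (simp add: r_def)
  have ry: "r * y = 1" using yp by (simp add: r_def)
  have tl: "X_mat (zR w)$2$2 = - X_mat (zR w)$1$1" by (simp add: X_mat_entries)
  note E = mconj_entries[OF tl, unfolded X11 X12 X21 D_def rr]
  have "y * y * r = y" using ry by (simp add: algebra_simps)
  then have T: "X_mat w$1$1 = x * r" "X_mat w$1$2 = - (x * x + y * y) * r" "X_mat w$2$1 = r"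
    by (simp_all add: X_mat_entries x_def[symmetric] y_def[symmetric] rr power2_eq_square algebra_simps)
  have 1: "mconj (X_mat (zR w))$1$1 = X_mat w$1$1" unfolding E T by (simp add: field_simps power2_eq_square r3')
  have 2: "mconj (X_mat (zR w))$1$2 = X_mat w$1$2" unfolding E T by (simp add: field_simps power2_eq_square r3')
  have 3: "mconj (X_mat (zR w))$2$1 = X_mat w$2$1" unfolding E T by (simp add: field_simps power2_eq_square r3')
  have 4: "mconj (X_mat (zR w))$2$2 = X_mat w$2$2"
    using mconj_entries(4)[OF tl] 1 by (simp add: X_mat_entries)
  show ?thesis using 1 2 3 4 by (simp add: vec_eq_iff forall_2)
qed

lemma Zm_complex:
  "Zm n w $1$1 = Re (Complex (n$1) (- (n$2)) * w)" "Zm n w $1$2 = - Re (Complex (n$1) (- (n$2)) * w\<^sup>2)"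
  "Zm n w $2$1 = Re (Complex (n$1) (- (n$2)))"
  by (simp_all add: Zm_entries power2_eq_square algebra_simps)

text \<open>The Moebius transformation \<open>zR\<close> has the complex derivative \<open>1 / dn\<^sup>2\<close> with \<open>dn\<close> its
  denominator, because the matrix has determinant \<open>1\<close>. So with covectors as complex numbers, \<open>N'
  = N dn\<^sup>2\<close>, and the entries of the moment map are the real parts of \<open>N\<close> times the quadratic
  polynomials \<open>dn\<^sup>2\<close>, \<open>dn nm\<close> and \<open>nm\<^sup>2\<close> in \<open>w\<close>, on which conjugation acts linearly.\<close>

lemma Zm_periodic:
  assumes w: "Im w > 0"
    and t: "transpose (half_plane_jacobian (mobius (matrix_inv R_mat)) w) *v n' = n"
  shows "mconj (Zm n' (zR w)) = Zm n w"
proof -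
  define dn where "dn = of_real (- sqrt 3 / 2) * w + of_real (1/2)"
  define nm where "nm = of_real (1/2) * w + of_real (sqrt 3 / 2)"
  have dn0: "dn \<noteq> 0" unfolding dn_def by (rule zR_denominator[OF w])
  define d where "d = 1 / dn\<^sup>2"
  have r3: "sqrt 3 * sqrt 3 = (3::real)" by simp
  have r3': "sqrt 3 * (sqrt 3 * a) = 3 * a" for a :: real by (simp add: mult.assoc[symmetric])
  have "(zR has_field_derivative ((of_real (1/2) * dn - nm * of_real (- sqrt 3 / 2)) / (dn * dn))) (at w)"
    unfolding zR_def[abs_def] dn_def nm_def
    by (rule DERIV_divide) (use dn0 in \<open>auto intro!: derivative_eq_intros simp: dn_def\<close>)
  moreover have "of_real (1/2) * dn - nm * of_real (- sqrt 3 / 2) = 1"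
    unfolding dn_def nm_def using r3 by (simp add: complex_eq_iff algebra_simps)
  ultimately have "(zR has_field_derivative d) (at w)" by (simp add: d_def power2_eq_square)
  then have D: "(zR has_derivative (*) d) (at w)" by (simp add: has_field_derivative_def)
  have mz: "mobius (matrix_inv R_mat) = zR" by (rule ext) (rule mobius_R)
  have fd: "frechet_derivative zR (at w) = (*) d" using frechet_derivative_at[OF D] by simp
  have J: "half_plane_jacobian zR w = vector [vector [Re d, - Im d], vector [Im d, Re d]]"
    unfolding half_plane_jacobian_def fd Let_def
    by (simp add: vec_eq_iff forall_2 matrix_def axis_def)
  have n: "n$1 = Re d * n'$1 + Im d * n'$2" "n$2 = - Im d * n'$1 + Re d * n'$2"
    unfolding t[symmetric] mz J by (simp_all add: matrix_vector_mult_def transpose_def sum_2)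
  define N where "N = Complex (n$1) (- (n$2))"
  define N' where "N' = Complex (n'$1) (- (n'$2))"
  have "N = N' * d" unfolding N_def N'_def by (simp add: complex_eq_iff n algebra_simps)
  then have N': "N' = N * dn\<^sup>2" unfolding d_def using dn0 by simp
  have z: "zR w * dn = nm" unfolding zR_def dn_def[symmetric] nm_def[symmetric] using dn0 by simp
  have a: "N' * zR w = N * (dn * nm)" unfolding N' z[symmetric] by (simp add: power2_eq_square)
  have b: "N' * (zR w)\<^sup>2 = N * nm\<^sup>2" unfolding N' z[symmetric] by (simp add: power2_eq_square)
  have Z: "Zm n' (zR w)$1$1 = Re (N * (dn * nm))" "Zm n' (zR w)$1$2 = - Re (N * nm\<^sup>2)" "Zm n' (zR w)$2$1 = Re (N * dn\<^sup>2)"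
    unfolding Zm_complex N'_def[symmetric] a b by (simp_all add: N')
  define A where "A = Re N" define B where "B = Re (N * w)" define C where "C = Re (N * w\<^sup>2)"
  have e1: "dn * nm = of_real (- sqrt 3 / 4) * w\<^sup>2 + of_real (- 1/2) * w + of_real (sqrt 3 / 4)"
    unfolding dn_def nm_def using r3 by (simp add: complex_eq_iff power2_eq_square algebra_simps)
  have e2: "nm\<^sup>2 = of_real (1/4) * w\<^sup>2 + of_real (sqrt 3 / 2) * w + of_real (3/4)"
    unfolding nm_def using r3 by (simp add: complex_eq_iff power2_eq_square algebra_simps)
  have e3: "dn\<^sup>2 = of_real (3/4) * w\<^sup>2 + of_real (- sqrt 3 / 2) * w + of_real (1/4)"
    unfolding dn_def using r3 by (simp add: complex_eq_iff power2_eq_square algebra_simps)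
  have lin: "Re (N * (of_real p * w\<^sup>2 + of_real q * w + of_real s)) = p * C + q * B + s * A" for p q s
    unfolding A_def B_def C_def by (simp add: algebra_simps)
  have Z': "Zm n' (zR w)$1$1 = - sqrt 3 / 4 * C + (- 1/2) * B + sqrt 3 / 4 * A"
    "Zm n' (zR w)$1$2 = - (1/4 * C + sqrt 3 / 2 * B + 3/4 * A)"
    "Zm n' (zR w)$2$1 = 3/4 * C + (- sqrt 3 / 2) * B + 1/4 * A"
    unfolding Z e1 e2 e3 lin by (rule refl)+
  have T: "Zm n w$1$1 = B" "Zm n w$1$2 = - C" "Zm n w$2$1 = A"
    unfolding Zm_complex N_def[symmetric] A_def B_def C_def by (rule refl)+
  have tl: "Zm n' (zR w)$2$2 = - Zm n' (zR w)$1$1" by (simp add: Zm_entries)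
  note E = mconj_entries[OF tl, unfolded Z']
  have 1: "mconj (Zm n' (zR w))$1$1 = Zm n w$1$1" unfolding E T by (simp add: field_simps r3')
  have 2: "mconj (Zm n' (zR w))$1$2 = Zm n w$1$2" unfolding E T by (simp add: field_simps r3')
  have 3: "mconj (Zm n' (zR w))$2$1 = Zm n w$2$1" unfolding E T by (simp add: field_simps r3')
  have 4: "mconj (Zm n' (zR w))$2$2 = Zm n w$2$2"
    using mconj_entries(4)[OF tl] 1 by (simp add: Zm_entries)
  show ?thesis using 1 2 3 4 by (simp add: vec_eq_iff forall_2)
qed

lemma lip_of_lipschitz:
  assumes "C-lipschitz_on S F" and "\<And>a b. a \<in> S \<Longrightarrow> b \<in> S \<Longrightarrow> \<bar>h a - h b\<bar> \<le> dist (F a) (F b)"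
  shows "lip S h"
  unfolding lip_def
proof (intro exI lipschitz_onI)
  show "0 \<le> C" using assms(1) lipschitz_on_nonneg by blast
  show "dist (h a) (h b) \<le> C * dist a b" if "a \<in> S" "b \<in> S" for a b
    using assms(2)[OF that] lipschitz_onD[OF assms(1) that] by (simp add: dist_real_def)
qed

text \<open>The maximum condition holds at almost every time. Its consequences for the values of \<open>Y\<close> at
  the vertices are closed conditions, so by continuity they hold at all times. The existence of
  a vertex at which \<open>Y\<close> vanishes is made closed by taking the product over the three vertices.\<close>

lemma extremal_system_of_pontryagin:
  assumes "pontryagin_extremal T u g z lc \<Lambda> \<nu>"
  shows "extremal_system T (3/2 * lc) \<Lambda> (\<lambda>t. X_mat (z t)) (\<lambda>t. Zm (\<nu> t) (z t)) (\<lambda>t. Pm (u t))"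
    and "t \<in> {0..T} \<Longrightarrow> \<exists>Q\<in>verts. trace_form (Ym lc (\<Lambda> t) (z t) (\<nu> t)) Q = 0"
    and "t \<in> {0..T} \<Longrightarrow> Q \<in> verts \<Longrightarrow> 0 \<le> trace_form (Ym lc (\<Lambda> t) (z t) (\<nu> t)) Q"
    and "lip {0..T} (\<lambda>t. g t $ i $ j)"
proof -
  have lt: "lifted_trajectory T u g z lc \<Lambda> \<nu>" using assms by (simp add: pontryagin_extremal_def)
  have adm: "admissible_trajectory T u g z" using lt by (simp add: lifted_trajectory_def)
  have tr: "trajectory T u g z" using adm by (simp add: admissible_trajectory_def)
  have T: "0 < T" using tr by (simp add: trajectory_def)
  have hs: "z t \<in> h_star" if "t \<in> {0..T}" for t using adm that by (auto simp: admissible_trajectory_def)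
  have Imz: "Im (z t) > 0" if "t \<in> {0..T}" for t using hs[OF that] by (simp add: h_star_def upper_half_plane_def)
  have uc: "u t \<in> control_set" if "t \<in> {0..T}" for t using tr that by (auto simp: trajectory_def)
  have tl\<Lambda>: "\<Lambda> t$2$2 = - \<Lambda> t$1$1" if "t \<in> {0..T}" for t
    using lt that by (auto simp: lifted_trajectory_def trace_def sum_2 add_eq_0_iff)
  obtain C where C: "C-lipschitz_on {0..T} (\<lambda>t. ((g t, \<Lambda> t), (z t, \<nu> t)))"
    using lt by (auto simp: lifted_trajectory_def)
  let ?F = "\<lambda>t. ((g t, \<Lambda> t), (z t, \<nu> t))"
  have d: "dist (g a) (g b) \<le> dist (?F a) (?F b)" "dist (\<Lambda> a) (\<Lambda> b) \<le> dist (?F a) (?F b)"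
    "dist (z a) (z b) \<le> dist (?F a) (?F b)" "dist (\<nu> a) (\<nu> b) \<le> dist (?F a) (?F b)" for a b
    using dist_fst_le[of "?F a" "?F b"] dist_snd_le[of "?F a" "?F b"]
      dist_fst_le[of "(g a, \<Lambda> a)" "(g b, \<Lambda> b)"] dist_snd_le[of "(g a, \<Lambda> a)" "(g b, \<Lambda> b)"]
      dist_fst_le[of "(z a, \<nu> a)" "(z b, \<nu> b)"] dist_snd_le[of "(z a, \<nu> a)" "(z b, \<nu> b)"] by auto
  have ent: "\<bar>A $ i $ j - B $ i $ j\<bar> \<le> dist A B" for A B :: "real^2^2" and i j
    using dist_vec_nth_le[of "A $ i" j "B $ i"] dist_vec_nth_le[of A i B] by (simp add: dist_real_def)
  have lg: "lip {0..T} (\<lambda>t. g t $ i $ j)" for i j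
    by (rule lip_of_lipschitz[OF C]) (rule order_trans[OF ent d(1)])
  then show "lip {0..T} (\<lambda>t. g t $ i $ j)" .
  have l\<Lambda>: "lip {0..T} (\<lambda>t. \<Lambda> t $ i $ j)" for i j
    by (rule lip_of_lipschitz[OF C]) (rule order_trans[OF ent d(2)])
  have lRe: "lip {0..T} (\<lambda>t. Re (z t))"
    by (rule lip_of_lipschitz[OF C], rule order_trans[OF _ d(3)])
       (metis abs_Re_le_cmod dist_norm minus_complex.sel(1))
  have lIm: "lip {0..T} (\<lambda>t. Im (z t))"
    by (rule lip_of_lipschitz[OF C], rule order_trans[OF _ d(3)])
       (metis abs_Im_le_cmod dist_norm minus_complex.sel(2))
  have l\<nu>: "lip {0..T} (\<lambda>t. \<nu> t $ i)" for i
    by (rule lip_of_lipschitz[OF C], rule order_trans[OF _ d(4)])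
       (metis dist_real_def dist_vec_nth_le)
  have lI: "lip {0..T} (\<lambda>t. 1 / Im (z t))" by (rule lip_inverse[OF lIm Imz])
  have lX: "lip {0..T} (\<lambda>t. X_mat (z t) $ i $ j)" for i j
  proof -
    have e: "X_mat w$1$1 = Re w * (1 / Im w)" "X_mat w$1$2 = - (Re w * Re w * (1 / Im w)) - Im w"
      "X_mat w$2$1 = 1 / Im w" "X_mat w$2$2 = - (Re w * (1 / Im w))" for w
      by (simp_all add: X_mat_entries power2_eq_square)
    have "\<forall>i j. lip {0..T} (\<lambda>t. X_mat (z t) $ i $ j)"
      unfolding forall_2 e by (intro conjI lip_diff lip_minus lip_mult lI lRe lIm)
    then show ?thesis by blast
  qed
  have lZ: "lip {0..T} (\<lambda>t. Zm (\<nu> t) (z t) $ i $ j)" for i j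
  proof -
    have "\<forall>i j. lip {0..T} (\<lambda>t. Zm (\<nu> t) (z t) $ i $ j)"
      unfolding forall_2 Zm_entries power2_eq_square
      by (intro conjI lip_add lip_diff lip_minus lip_mult lip_const l\<nu> lRe lIm)
    then show ?thesis by blast
  qed
  have cY: "continuous_on {0..T} (\<lambda>t. trace_form (Ym lc (\<Lambda> t) (z t) (\<nu> t)) Q)" for Q
    unfolding Ym_def trace_form_entries vector_add_component vector_scaleR_component vector_minus_component real_scaleR_def
    by (intro lip_continuous_on lip_add lip_diff lip_mult lip_const lX lZ l\<Lambda>)
  have ae1: "AE t in lebesgue_on {0..T}.
      ((\<lambda>s. Re (z s)) has_real_derivative f1 (Re (z t)) (Im (z t)) (u t)) (at t within {0..T}) \<and>
      ((\<lambda>s. Im (z s)) has_real_derivative f2 (Re (z t)) (Im (z t)) (u t)) (at t within {0..T}) \<and>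
      (g has_vector_derivative (g t ** X_mat (z t))) (at t within {0..T})"
    using tr unfolding trajectory_def by blast
  obtain N1 where N1: "negligible N1" and o1: "\<And>t. t \<in> {0..T} - N1 \<Longrightarrow>
      ((\<lambda>s. Re (z s)) has_real_derivative f1 (Re (z t)) (Im (z t)) (u t)) (at t within {0..T}) \<and>
      ((\<lambda>s. Im (z s)) has_real_derivative f2 (Re (z t)) (Im (z t)) (u t)) (at t within {0..T}) \<and>
      (g has_vector_derivative (g t ** X_mat (z t))) (at t within {0..T})"
    using AE_lebesgue_on_exceptional_set[OF ae1] by blast
  have ae2: "AE t in lebesgue_on {0..T}.
      (\<Lambda> has_vector_derivative mat_bracket (\<Lambda> t) (X_mat (z t))) (at t within {0..T}) \<and>
      ((\<lambda>s. \<nu> s $ 1) has_real_derivative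
           - deriv (\<lambda>x. hamiltonian lc (\<Lambda> t) (Complex x (Im (z t))) (\<nu> t) (u t)) (Re (z t))) (at t within {0..T}) \<and>
      ((\<lambda>s. \<nu> s $ 2) has_real_derivative
           - deriv (\<lambda>y. hamiltonian lc (\<Lambda> t) (Complex (Re (z t)) y) (\<nu> t) (u t)) (Im (z t))) (at t within {0..T})"
    using lt unfolding lifted_trajectory_def by blast
  obtain N2 where N2: "negligible N2" and o2: "\<And>t. t \<in> {0..T} - N2 \<Longrightarrow>
      (\<Lambda> has_vector_derivative mat_bracket (\<Lambda> t) (X_mat (z t))) (at t within {0..T}) \<and>
      ((\<lambda>s. \<nu> s $ 1) has_real_derivative
           - deriv (\<lambda>x. hamiltonian lc (\<Lambda> t) (Complex x (Im (z t))) (\<nu> t) (u t)) (Re (z t))) (at t within {0..T}) \<and>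
      ((\<lambda>s. \<nu> s $ 2) has_real_derivative
           - deriv (\<lambda>y. hamiltonian lc (\<Lambda> t) (Complex (Re (z t)) y) (\<nu> t) (u t)) (Im (z t))) (at t within {0..T})"
    using AE_lebesgue_on_exceptional_set[OF ae2] by blast
  have ae3: "AE t in lebesgue_on {0..T}.
      hamiltonian lc (\<Lambda> t) (z t) (\<nu> t) (u t) = max_hamiltonian lc (\<Lambda> t) (z t) (\<nu> t) \<and>
      max_hamiltonian lc (\<Lambda> t) (z t) (\<nu> t) = 0"
    using assms unfolding pontryagin_extremal_def by blast
  obtain N3 where N3: "negligible N3" and o3: "\<And>t. t \<in> {0..T} - N3 \<Longrightarrow>
      hamiltonian lc (\<Lambda> t) (z t) (\<nu> t) (u t) = max_hamiltonian lc (\<Lambda> t) (z t) (\<nu> t) \<and>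
      max_hamiltonian lc (\<Lambda> t) (z t) (\<nu> t) = 0"
    using AE_lebesgue_on_exceptional_set[OF ae3] by blast
  define N where "N = N1 \<union> N2 \<union> N3"
  have N: "negligible N" unfolding N_def using N1 N2 N3 by (intro negligible_Un)
  have YP: "trace_form (Ym lc (\<Lambda> t) (z t) (\<nu> t)) (Pm (u t)) = 0" if t: "t \<in> {0..T} - N3" for t
  proof -
    have t0: "t \<in> {0..T}" using t by simp
    show ?thesis using maximal_zero_vertices(1)[OF hs[OF t0] uc[OF t0]] o3[OF t] by blast
  qed
  have Ynn: "0 \<le> trace_form (Ym lc (\<Lambda> t) (z t) (\<nu> t)) Q" if t: "t \<in> {0..T}" and Q: "Q \<in> verts" for t Q
  proof (rule nonneg_off_negligible[OF cY N3 T _ t])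
    fix s assume s: "s \<in> {0..T} - N3"
    then have s0: "s \<in> {0..T}" by simp
    show "0 \<le> trace_form (Ym lc (\<Lambda> s) (z s) (\<nu> s)) Q"
      using maximal_zero_vertices(2)[OF hs[OF s0] uc[OF s0] _ _ Q] o3[OF s] by blast
  qed
  then show "t \<in> {0..T} \<Longrightarrow> Q \<in> verts \<Longrightarrow> 0 \<le> trace_form (Ym lc (\<Lambda> t) (z t) (\<nu> t)) Q" .
  have prod0: "trace_form (Ym lc (\<Lambda> t) (z t) (\<nu> t)) vert0 * trace_form (Ym lc (\<Lambda> t) (z t) (\<nu> t)) vert1 * trace_form (Ym lc (\<Lambda> t) (z t) (\<nu> t)) vert2 = 0"
    if t: "t \<in> {0..T}" for t
  proof (rule zero_off_negligible[OF _ N3 T _ t])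
    show "continuous_on {0..T} (\<lambda>t. trace_form (Ym lc (\<Lambda> t) (z t) (\<nu> t)) vert0 * trace_form (Ym lc (\<Lambda> t) (z t) (\<nu> t)) vert1 * trace_form (Ym lc (\<Lambda> t) (z t) (\<nu> t)) vert2)"
      by (intro continuous_on_mult cY)
    fix s assume s: "s \<in> {0..T} - N3"
    then have s0: "s \<in> {0..T}" by simp
    note p = product_zero_vertices[OF Ynn[OF s0] uc[OF s0] YP[OF s]]
    have "u s$0 + u s$1 + u s$2 = 1" using uc[OF s0] unfolding control_set_def sum_UNIV_3 by simp
    then have "u s$0 \<noteq> 0 \<or> u s$1 \<noteq> 0 \<or> u s$2 \<noteq> 0" by auto
    then show "trace_form (Ym lc (\<Lambda> s) (z s) (\<nu> s)) vert0 * trace_form (Ym lc (\<Lambda> s) (z s) (\<nu> s)) vert1 * trace_form (Ym lc (\<Lambda> s) (z s) (\<nu> s)) vert2 = 0"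
      using p by auto
  qed
  then show "t \<in> {0..T} \<Longrightarrow> \<exists>Q\<in>verts. trace_form (Ym lc (\<Lambda> t) (z t) (\<nu> t)) Q = 0"
    by (auto simp: verts_def)
  have zT: "z T = zR (z 0)" using adm by (simp add: admissible_trajectory_def mobius_R)
  have ends: "0 \<in> {0..T}" "T \<in> {0..T}" using T by auto
  show "extremal_system T (3/2 * lc) \<Lambda> (\<lambda>t. X_mat (z t)) (\<lambda>t. Zm (\<nu> t) (z t)) (\<lambda>t. Pm (u t))"
  proof
    show "0 < T" by (rule T)
    show "lip {0..T} (\<lambda>t. \<Lambda> t $ i $ j)" "lip {0..T} (\<lambda>t. X_mat (z t) $ i $ j)" "lip {0..T} (\<lambda>t. Zm (\<nu> t) (z t) $ i $ j)" for i j
      by (rule l\<Lambda> lX lZ)+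
    show "\<exists>N. negligible N \<and> (\<forall>t\<in>{0..T} - N.
       Pm (u t) \<in> simplex_mats \<and>
       trace_form (Zm (\<nu> t) (z t) + trace_form (\<Lambda> t - (3/2 * lc) *\<^sub>R J_mat) (X_mat (z t)) *\<^sub>R X_mat (z t)) (Pm (u t)) = 0 \<and>
       ((\<lambda>t. X_mat (z t)) has_vector_derivative (1 / trace_form (X_mat (z t)) (Pm (u t))) *\<^sub>R mat_bracket (Pm (u t)) (X_mat (z t))) (at t within {0..T}) \<and>
       (\<Lambda> has_vector_derivative mat_bracket (\<Lambda> t) (X_mat (z t))) (at t within {0..T}) \<and>
       ((\<lambda>t. Zm (\<nu> t) (z t)) has_vector_derivative mat_bracket (\<Lambda> t - (3/2 * lc) *\<^sub>R J_mat) (X_mat (z t)) + (1 / trace_form (X_mat (z t)) (Pm (u t))) *\<^sub>R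
          mat_bracket (Pm (u t)) (Zm (\<nu> t) (z t) + trace_form (\<Lambda> t - (3/2 * lc) *\<^sub>R J_mat) (X_mat (z t)) *\<^sub>R X_mat (z t))) (at t within {0..T}))"
    proof (intro exI[of _ N] conjI N ballI)
      fix t assume t: "t \<in> {0..T} - N"
      then have t0: "t \<in> {0..T}" and t1: "t \<in> {0..T} - N1" and t2: "t \<in> {0..T} - N2" and t3: "t \<in> {0..T} - N3"
        by (auto simp: N_def)
      have dn: "den (Re (z t)) (Im (z t)) (u t) \<noteq> 0" using den_neg[OF hs[OF t0] uc[OF t0]] by simp
      show "Pm (u t) \<in> simplex_mats" by (rule Pm_simplex[OF uc[OF t0]])
      show "trace_form (Zm (\<nu> t) (z t) + trace_form (\<Lambda> t - (3/2 * lc) *\<^sub>R J_mat) (X_mat (z t)) *\<^sub>R X_mat (z t)) (Pm (u t)) = 0"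
        using YP[OF t3] unfolding Ym_def .
      show "((\<lambda>t. X_mat (z t)) has_vector_derivative (1 / trace_form (X_mat (z t)) (Pm (u t))) *\<^sub>R mat_bracket (Pm (u t)) (X_mat (z t))) (at t within {0..T})"
        by (rule X_mat_ode[where w = z and t = t, OF Imz[OF t0] dn]) (use o1[OF t1] in blast)+
      show "(\<Lambda> has_vector_derivative mat_bracket (\<Lambda> t) (X_mat (z t))) (at t within {0..T})"
        using o2[OF t2] by blast
      show "((\<lambda>t. Zm (\<nu> t) (z t)) has_vector_derivative mat_bracket (\<Lambda> t - (3/2 * lc) *\<^sub>R J_mat) (X_mat (z t)) + (1 / trace_form (X_mat (z t)) (Pm (u t))) *\<^sub>R
          mat_bracket (Pm (u t)) (Zm (\<nu> t) (z t) + trace_form (\<Lambda> t - (3/2 * lc) *\<^sub>R J_mat) (X_mat (z t)) *\<^sub>R X_mat (z t))) (at t within {0..T})"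
        unfolding Ym_def[symmetric]
        by (rule Zm_ode[where w = z and t = t and n = \<nu>, OF tl\<Lambda>[OF t0] Imz[OF t0] dn YP[OF t3]]) (use o1[OF t1] o2[OF t2] in blast)+
    qed
    show "mconj (X_mat (z T)) = X_mat (z 0)"
      unfolding zT by (rule X_mat_periodic[OF Imz[OF ends(1)]]) (use Imz[OF ends(2)] zT in simp)
    show "mconj (\<Lambda> T) = \<Lambda> 0"
    proof -
      have "\<Lambda> T = transpose rot60 ** \<Lambda> 0 ** rot60"
        using assms unfolding pontryagin_extremal_def R_mat_rot60 matrix_inv_R[unfolded R_mat_rot60] by blast
      then show ?thesis by (simp only: mconj_cancel)
    qed
    show "mconj (Zm (\<nu> T) (z T)) = Zm (\<nu> 0) (z 0)"
      unfolding zT by (rule Zm_periodic[OF Imz[OF ends(1)]]) (use assms in \<open>simp add: pontryagin_extremal_def\<close>)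
    fix t assume t: "t \<in> {0..T}"
    show "\<Lambda> t $ 2 $ 2 = - \<Lambda> t $ 1 $ 1" by (rule tl\<Lambda>[OF t])
    show "X_mat (z t) $ 2 $ 2 = - X_mat (z t) $ 1 $ 1" "Zm (\<nu> t) (z t) $ 2 $ 2 = - Zm (\<nu> t) (z t) $ 1 $ 1"
      by (simp_all add: X_mat_entries Zm_entries)
    note yp = Imz[OF t]
    show "0 < X_mat (z t) $ 2 $ 1 - X_mat (z t) $ 1 $ 2"
    proof -
      have "0 \<le> (Re (z t))\<^sup>2 / Im (z t)" "0 < 1 / Im (z t)" using yp by simp_all
      then show ?thesis unfolding X_mat_entries minus_divide_left[symmetric] using yp by linarith
    qed
    show "det (X_mat (z t)) = 1"
      unfolding det_2 X_mat_entries using yp by (simp add: field_simps power2_eq_square)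
    show "trace_form (Zm (\<nu> t) (z t)) (X_mat (z t)) = 0"
      unfolding trace_form_entries Zm_entries X_mat_entries using yp by (simp add: field_simps power2_eq_square)
    fix Q assume Q: "Q \<in> verts"
    show "trace_form (X_mat (z t)) Q < 0" by (rule h_star_neg[OF hs[OF t] Q])
    show "0 \<le> trace_form (Zm (\<nu> t) (z t) + trace_form (\<Lambda> t - (3/2 * lc) *\<^sub>R J_mat) (X_mat (z t)) *\<^sub>R X_mat (z t)) Q"
      using Ynn[OF t Q] unfolding Ym_def .
  qed
qed

section \<open>Lattice packings and inscribed hexagons\<close>

definition cross2 :: "real^2 \<Rightarrow> real^2 \<Rightarrow> real" where
  "cross2 v w = v$1 * w$2 - v$2 * w$1"

lemma det_vector_cross2: "det (vector [v, w] :: real^2^2) = cross2 v w"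
  by (simp add: det_2 cross2_def)

lemma cross2_bilinear:
  "cross2 (a + b) c = cross2 a c + cross2 b c" "cross2 c (a + b) = cross2 c a + cross2 c b"
  "cross2 (r *\<^sub>R a) c = r * cross2 a c" "cross2 a (r *\<^sub>R c) = r * cross2 a c"
  "cross2 (a - b) c = cross2 a c - cross2 b c" "cross2 c (a - b) = cross2 c a - cross2 c b"
  "cross2 (- a) c = - cross2 a c" "cross2 a (- c) = - cross2 a c"
  "cross2 a a = 0" "cross2 0 a = 0" "cross2 a 0 = 0"
  by (simp_all add: cross2_def algebra_simps)

lemma cross2_combination:
  "cross2 (a *\<^sub>R v + b *\<^sub>R w) (c *\<^sub>R v + d *\<^sub>R w) = (a * d - b * c) * cross2 v w"
  by (simp add: cross2_def algebra_simps)

lemma cross2_decomp: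
  assumes "cross2 p q \<noteq> 0"
  shows "y = (cross2 y q / cross2 p q) *\<^sub>R p + (cross2 p y / cross2 p q) *\<^sub>R q"
proof -
  have "cross2 p q *\<^sub>R y = cross2 y q *\<^sub>R p + cross2 p y *\<^sub>R q"
    by (simp add: vec_eq_iff forall_2 cross2_def algebra_simps)
  then have "(1 / cross2 p q) *\<^sub>R (cross2 p q *\<^sub>R y) = (1 / cross2 p q) *\<^sub>R (cross2 y q *\<^sub>R p + cross2 p y *\<^sub>R q)"
    by simp
  then show ?thesis using assms by (simp add: scaleR_add_right)
qed

lemma interior_combination:
  fixes K :: "'a::euclidean_space set"
  assumes "convex K" "c \<in> interior K" "x \<in> K" "0 < a" "0 \<le> b" "a + b = (1::real)"
  shows "a *\<^sub>R c + b *\<^sub>R x \<in> interior K"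
proof -
  have "x - a *\<^sub>R (x - c) \<in> interior K"
    using mem_interior_convex_shrink[OF assms(1-3), of a] assms by auto
  moreover have "x - a *\<^sub>R (x - c) = a *\<^sub>R c + b *\<^sub>R x"
    using assms(6) by (simp add: algebra_simps flip: scaleR_add_left)
  ultimately show ?thesis by simp
qed

lemma scale_in_convex:
  assumes "convex K" "0 \<in> K" "x \<in> K" "0 \<le> r" "r \<le> (1::real)" shows "r *\<^sub>R x \<in> K"
  using convexD_alt[OF assms(1,2,3,4,5)] by simp

lemma interior_combination_le:
  fixes K :: "'a::euclidean_space set"
  assumes "convex K" "0 \<in> interior K" "c \<in> interior K" "x \<in> K" "0 < a" "0 \<le> b" "a + b \<le> (1::real)"
  shows "a *\<^sub>R c + b *\<^sub>R x \<in> interior K"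
proof (cases "a = 1")
  case True then show ?thesis using assms by auto
next
  case False
  then have a: "a < 1" using assms by auto
  have "(b / (1 - a)) *\<^sub>R x \<in> K"
    using assms a interior_subset by (intro scale_in_convex) (auto simp: field_simps)
  from interior_combination[OF assms(1,3) this, of a "1 - a"] show ?thesis using a assms by auto
qed

lemma interior_combination_zero:
  fixes K :: "'a::euclidean_space set"
  assumes "convex K" "0 \<in> interior K" "x \<in> K" "y \<in> K" "0 \<le> a" "0 \<le> b" "a + b < (1::real)"
  shows "a *\<^sub>R x + b *\<^sub>R y \<in> interior K"
proof (cases "a + b = 0")
  case True then show ?thesis using assms by (simp add: add_nonneg_eq_0_iff)
next
  case False
  then have ab: "a + b > 0" using assms by auto
  have "(a/(a+b)) *\<^sub>R x + (b/(a+b)) *\<^sub>R y \<in> K"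
    using assms ab by (intro convexD) (auto simp: add_divide_distrib[symmetric])
  from interior_combination[OF assms(1,2) this, of "1-(a+b)" "a+b"] show ?thesis
    using assms ab by (simp add: scaleR_add_right)
qed

lemma symmetric_interior:
  fixes K :: "'a::euclidean_space set"
  assumes "uminus ` K = K" "x \<in> interior K" shows "- x \<in> interior K"
  using interior_negations[of K] assms by (metis image_eqI)

lemma zero_in_interior:
  fixes K :: "'a::euclidean_space set"
  assumes "convex K" "uminus ` K = K" "interior K \<noteq> {}" shows "0 \<in> interior K"
proof -
  obtain x where x: "x \<in> interior K" using assms by auto
  then have "-x \<in> K" using symmetric_interior[OF assms(2)] interior_subset by blast
  from interior_combination[OF assms(1) x this, of "1/2" "1/2"] show ?thesis by simp
qed

text \<open>If a lattice point other than the six vertices were in the interior, then it would pull a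
  vertex of the hexagon into the interior; the six sextants are images of one another under the
  step \<open>(p, q) \<mapsto> (q, q - p)\<close>.\<close>

lemma sextant_not_interior:
  fixes p q :: "real^2"
  assumes K: "convex K" "uminus ` K = K" "0 \<in> interior K"
    and "q - p \<in> K" "p \<notin> interior K" and m: "1 \<le> m" "0 \<le> (n::int)"
  shows "of_int m *\<^sub>R p + of_int n *\<^sub>R q \<notin> interior K"
proof
  let ?c = "of_int m *\<^sub>R p + of_int n *\<^sub>R q"
  assume c: "?c \<in> interior K"
  have mn: "real_of_int (m + n) > 0" using m by auto
  have "p - q \<in> K" using assms(2,4) by (metis image_eqI minus_diff_eq)
  have "(1 / of_int (m+n)) *\<^sub>R ?c + (of_int n / of_int (m+n)) *\<^sub>R (p - q) \<in> interior K"
  proof (rule interior_combination_le[OF K(1,3) c \<open>p - q \<in> K\<close>])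
    show "0 < 1 / real_of_int (m + n)" "0 \<le> real_of_int n / real_of_int (m + n)" using mn m by simp_all
    have "1 + real_of_int n \<le> real_of_int (m + n)" using m by simp
    then show "1 / real_of_int (m + n) + real_of_int n / real_of_int (m + n) \<le> 1"
      using mn by (metis add_divide_distrib divide_le_eq_1_pos)
  qed
  moreover have "?c + of_int n *\<^sub>R (p - q) = of_int (m+n) *\<^sub>R p" by (simp add: algebra_simps)
  then have "(1 / of_int (m+n)) *\<^sub>R ?c + (of_int n / of_int (m+n)) *\<^sub>R (p - q) = (1 / of_int (m+n)) *\<^sub>R of_int (m+n) *\<^sub>R p"
    by (metis scaleR_add_right scaleR_scaleR times_divide_eq_left mult_1)
  then have "(1 / of_int (m+n)) *\<^sub>R ?c + (of_int n / of_int (m+n)) *\<^sub>R (p - q) = p" using mn by simp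
  ultimately show False using assms by simp
qed

lemma hexagon_no_interior_lattice_point:
  fixes p q :: "real^2"
  assumes K: "convex K" "uminus ` K = K" "0 \<in> interior K"
    and in_K: "p \<in> K" "q \<in> K" "q - p \<in> K"
    and fr: "p \<notin> interior K" "q \<notin> interior K" "q - p \<notin> interior K"
    and mn: "(m, n) \<noteq> (0, 0 :: int)"
  shows "of_int m *\<^sub>R p + of_int n *\<^sub>R q \<notin> interior K"
proof -
  have neg: "x \<in> K \<Longrightarrow> -x \<in> K" for x using K(2) by (metis image_eqI)
  have pos: "of_int m *\<^sub>R p + of_int n *\<^sub>R q \<notin> interior K"
    if "n > 0 \<or> (n = 0 \<and> m > 0)" for m n :: int
  proof -
    have "(m \<ge> 1 \<and> n \<ge> 0) \<or> (m \<le> 0 \<and> m + n \<ge> 1) \<or> (m + n \<le> 0 \<and> n \<ge> 1)" using that by presburger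
    then consider "m \<ge> 1" "n \<ge> 0" | "m \<le> 0" "m + n \<ge> 1" | "m + n \<le> 0" "n \<ge> 1" by blast
    then show ?thesis
    proof cases
      case 1 then show ?thesis using sextant_not_interior[OF K in_K(3) fr(1)] by auto
    next
      case 2
      have "of_int (m+n) *\<^sub>R q + of_int (-m) *\<^sub>R (q - p) \<notin> interior K"
        by (rule sextant_not_interior[OF K]) (use neg[OF in_K(1)] fr 2 in auto)
      then show ?thesis by (simp add: algebra_simps)
    next
      case 3
      have "of_int n *\<^sub>R (q - p) + of_int (-(m+n)) *\<^sub>R (- p) \<notin> interior K"
        by (rule sextant_not_interior[OF K]) (use neg[OF in_K(2)] fr 3 in auto)
      then show ?thesis by (simp add: algebra_simps)
    qed
  qed
  show ?thesis
  proof (cases "n > 0 \<or> (n = 0 \<and> m > 0)")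
    case True then show ?thesis by (rule pos)
  next
    case False
    then have "(-n) > 0 \<or> (-n = 0 \<and> -m > 0)" using mn by auto
    from pos[OF this] have "- (of_int m *\<^sub>R p + of_int n *\<^sub>R q) \<notin> interior K" by (simp add: algebra_simps)
    then show ?thesis using symmetric_interior[OF K(2)] by blast
  qed
qed

text \<open>If two translates overlap, then by symmetry half the difference of the two lattice points lies
  in the interior of \<open>K\<close>; but that is a nonzero integral combination of \<open>p\<close> and \<open>q\<close>.\<close>

lemma hexagon_lattice_packing:
  fixes p q :: "real^2"
  assumes K: "convex K" "uminus ` K = K" "0 \<in> interior K"
    and in_K: "p \<in> K" "q \<in> K" "q - p \<in> K"
    and fr: "p \<notin> interior K" "q \<notin> interior K" "q - p \<notin> interior K"
    and pq: "cross2 p q \<noteq> 0"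
  shows "lattice_packing K (2 *\<^sub>R p) (2 *\<^sub>R q)"
  unfolding lattice_packing_def
proof
  show "det (vector [2 *\<^sub>R p, 2 *\<^sub>R q] :: real^2^2) \<noteq> 0"
    using pq by (simp add: det_vector_cross2 cross2_bilinear del: vector_def)
  show "pairwise (\<lambda>p q. disjnt (interior ((+) p ` K)) (interior ((+) q ` K))) (lattice_points (2 *\<^sub>R p) (2 *\<^sub>R q))"
  proof (rule pairwiseI)
    fix a b assume a: "a \<in> lattice_points (2 *\<^sub>R p) (2 *\<^sub>R q)" and b: "b \<in> lattice_points (2 *\<^sub>R p) (2 *\<^sub>R q)" and "a \<noteq> b"
    obtain m n where a: "a = of_int m *\<^sub>R 2 *\<^sub>R p + of_int n *\<^sub>R 2 *\<^sub>R q" using a unfolding lattice_points_def by auto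
    obtain m' n' where b: "b = of_int m' *\<^sub>R 2 *\<^sub>R p + of_int n' *\<^sub>R 2 *\<^sub>R q" using b unfolding lattice_points_def by auto
    have "(m - m', n - n') \<noteq> (0,0)" using \<open>a \<noteq> b\<close> a b by auto
    from hexagon_no_interior_lattice_point[OF K in_K fr this]
    have ni: "(1/2) *\<^sub>R (a - b) \<notin> interior K" by (simp add: a b algebra_simps)
    show "disjnt (interior ((+) a ` K)) (interior ((+) b ` K))"
      unfolding disjnt_iff
    proof (intro allI notI)
      fix x assume "x \<in> interior ((+) a ` K) \<and> x \<in> interior ((+) b ` K)"
      then have "x \<in> (+) a ` interior K" "x \<in> (+) b ` interior K"
        unfolding interior_translation by auto
      then have "x - a \<in> interior K" "x - b \<in> interior K"
        by (metis add_diff_cancel_left' imageE)+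
      then have "-(x - a) \<in> interior K" "x - b \<in> K"
        using symmetric_interior[OF K(2)] interior_subset by blast+
      from interior_combination[OF K(1) this, of "1/2" "1/2"]
      have "(1/2) *\<^sub>R (a - b) \<in> interior K" by (simp add: algebra_simps)
      then show False using ni by simp
    qed
  qed
qed

lemma packing_half_not_interior:
  fixes K :: "(real^2) set"
  assumes K: "uminus ` K = K"
    and pk: "lattice_packing K v w" and mn: "(m, n) \<noteq> (0, 0 :: int)"
  shows "(1/2) *\<^sub>R (of_int m *\<^sub>R v + of_int n *\<^sub>R w) \<notin> interior K"
proof
  let ?c = "of_int m *\<^sub>R v + of_int n *\<^sub>R w"
  assume h: "(1/2) *\<^sub>R ?c \<in> interior K"
  have vw: "cross2 v w \<noteq> 0" using pk unfolding lattice_packing_def det_vector_cross2 by auto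
  have "cross2 v ?c = of_int n * cross2 v w" "cross2 ?c w = of_int m * cross2 v w"
    by (simp_all add: cross2_bilinear)
  then have c0: "?c \<noteq> 0" using vw mn by (metis cross2_bilinear(10,11) mult_eq_0_iff of_int_eq_0_iff)
  have "?c \<in> lattice_points v w" unfolding lattice_points_def by auto
  moreover have "0 \<in> lattice_points v w" unfolding lattice_points_def by (auto intro!: exI[of _ 0])
  ultimately have "disjnt (interior ((+) ?c ` K)) (interior ((+) 0 ` K))"
    using pk c0 unfolding lattice_packing_def pairwise_def by blast
  moreover have "(1/2) *\<^sub>R ?c \<in> interior ((+) 0 ` K)" using h by simp
  moreover have "(1/2) *\<^sub>R ?c \<in> interior ((+) ?c ` K)"
  proof -
    have "- ((1/2) *\<^sub>R ?c) \<in> interior K" using symmetric_interior[OF K h] .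
    moreover have "?c + - ((1/2) *\<^sub>R ?c) = (1/2) *\<^sub>R ?c" by (simp add: vec_eq_iff field_simps)
    ultimately show ?thesis unfolding interior_translation by (metis image_eqI)
  qed
  ultimately show False unfolding disjnt_iff by blast
qed

lemma ray_factor_ge_one:
  fixes K :: "'a::euclidean_space set"
  assumes "convex K" "0 \<in> interior K" "x \<in> K" "r *\<^sub>R x \<notin> interior K" "0 \<le> r" shows "1 \<le> r"
proof (rule ccontr)
  assume "\<not> 1 \<le> r"
  then show False using interior_combination_zero[OF assms(1,2,3,3), of r 0] assms by auto
qed

lemma frontier_ray_unique:
  fixes K :: "'a::euclidean_space set"
  assumes K: "convex K" "0 \<in> interior K" "compact K" and x: "x \<in> frontier K" "r *\<^sub>R x \<in> frontier K" and r: "0 < r"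
  shows "r = 1"
proof -
  have sub: "frontier K \<subseteq> K" using K(3) frontier_subset_compact by blast
  have "1 \<le> r" using ray_factor_ge_one[OF K(1,2), of x r] x sub r by (auto simp: frontier_def)
  moreover have "1 \<le> 1 / r"
    using ray_factor_ge_one[OF K(1,2), of "r *\<^sub>R x" "1/r"] x sub r by (auto simp: frontier_def)
  ultimately show ?thesis using r by (simp add: field_simps)
qed

text \<open>The open trapezoid over the diameter from \<open>-p\<close> to \<open>p\<close> with upper side from \<open>q - p\<close> to \<open>q\<close> has
  at every height less than that of \<open>q\<close> a chord longer than \<open>p\<close>.\<close>

lemma trapezoid_row_meets_interior:
  fixes p q y :: "real^2"
  assumes K: "convex K" "uminus ` K = K" "0 \<in> interior K"
    and in_K: "p \<in> K" "q \<in> K" "q - p \<in> K"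
    and y: "0 < cross2 p y" "cross2 p y < cross2 p q"
  shows "\<exists>k::int. y + of_int k *\<^sub>R p \<in> interior K"
proof -
  have neg: "x \<in> K \<Longrightarrow> -x \<in> K" for x using K(2) by (metis image_eqI)
  define s where "s = cross2 p y / cross2 p q"
  define a0 where "a0 = cross2 y q / cross2 p q"
  have s: "0 < s" "s < 1" using y by (auto simp: s_def)
  have ydec: "y = a0 *\<^sub>R p + s *\<^sub>R q" unfolding s_def a0_def using cross2_decomp[of p q y] y by auto
  define k where "k = \<lceil>- s - a0\<rceil>"
  define a where "a = a0 + of_int k"
  have a: "- s \<le> a" "a < 1 - s" unfolding a_def k_def by linarith+
  have yk: "y + of_int k *\<^sub>R p = a *\<^sub>R p + s *\<^sub>R q" unfolding ydec a_def by (simp add: algebra_simps)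
  have "a *\<^sub>R p + s *\<^sub>R q \<in> interior K"
  proof (cases "a \<ge> 0")
    case True then show ?thesis using interior_combination_zero[OF K(1,3) in_K(1,2), of a s] a s by auto
  next
    case False
    have "(s + a) *\<^sub>R q + (- a) *\<^sub>R (q - p) \<in> interior K"
      using interior_combination_zero[OF K(1,3) in_K(2,3), of "s + a" "- a"] a s False by auto
    then show ?thesis by (simp add: algebra_simps)
  qed
  then show ?thesis unfolding yk[symmetric] by blast
qed

lemma lattice_finite_bounded:
  fixes v w :: "real^2"
  assumes "bounded B" "cross2 v w \<noteq> 0"
  shows "finite {(m::int, n::int). of_int m *\<^sub>R v + of_int n *\<^sub>R w \<in> B}"
proof -
  obtain b where b: "\<And>x. x \<in> B \<Longrightarrow> norm x \<le> b" using assms(1) unfolding bounded_iff by blast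
  have cb: "\<bar>cross2 x y\<bar> \<le> 2 * norm x * norm y" for x y :: "real^2"
  proof -
    have "\<bar>cross2 x y\<bar> \<le> \<bar>x$1\<bar> * \<bar>y$2\<bar> + \<bar>x$2\<bar> * \<bar>y$1\<bar>"
      unfolding cross2_def by (metis abs_mult abs_triangle_ineq4)
    also have "\<dots> \<le> norm x * norm y + norm x * norm y"
      by (intro add_mono mult_mono component_le_norm_cart) auto
    finally show ?thesis by simp
  qed
  define M where "M = \<lceil>2 * b * norm w / \<bar>cross2 v w\<bar> + 2 * norm v * b / \<bar>cross2 v w\<bar>\<rceil>"
  have "{(m::int, n::int). of_int m *\<^sub>R v + of_int n *\<^sub>R w \<in> B} \<subseteq> {-M..M} \<times> {-M..M}"
  proof clarify
    fix m n :: int assume "of_int m *\<^sub>R v + of_int n *\<^sub>R w \<in> B" (is "?c \<in> B")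
    then have nb: "norm ?c \<le> b" using b by auto
    have b0: "0 \<le> b" using nb norm_ge_zero order_trans by blast
    have "\<bar>of_int n * cross2 v w\<bar> \<le> 2 * norm v * b"
      using cb[of v ?c] nb mult_left_mono[OF nb, of "2 * norm v"] by (simp add: cross2_bilinear)
    moreover have "\<bar>of_int m * cross2 v w\<bar> \<le> 2 * b * norm w"
      using cb[of ?c w] nb mult_right_mono[OF nb, of "norm w"] by (simp add: cross2_bilinear)
    ultimately have "\<bar>of_int n\<bar> \<le> 2 * norm v * b / \<bar>cross2 v w\<bar>" "\<bar>of_int m\<bar> \<le> 2 * b * norm w / \<bar>cross2 v w\<bar>"
      using assms(2) by (simp_all add: field_simps abs_mult)
    moreover have "0 \<le> 2 * norm v * b / \<bar>cross2 v w\<bar>" "0 \<le> 2 * b * norm w / \<bar>cross2 v w\<bar>" using b0 by auto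
    ultimately have "\<bar>real_of_int n\<bar> \<le> of_int M" "\<bar>real_of_int m\<bar> \<le> of_int M" unfolding M_def by linarith+
    then show "m \<in> {-M..M} \<and> n \<in> {-M..M}" by auto
  qed
  then show ?thesis using finite_subset by blast
qed

text \<open>Scale the lattice by the largest factor \<open>d\<close> for which a nonzero lattice point \<open>p\<close> lies on the
  boundary; no lattice point but \<open>0\<close> is then in the interior, and \<open>d \<le> 1/2\<close> because the original
  lattice packs. The point \<open>p\<close> is primitive, and by the trapezoid argument the next row of the
  scaled lattice parallel to \<open>p\<close> cannot be lower than \<open>q\<close>. So the scaled lattice has determinant
  at least \<open>h\<close>, and the original one at least \<open>4h\<close>.\<close>

lemma packing_det_lower_bound:
  fixes K :: "(real^2) set"
  assumes K: "convex K" "uminus ` K = K" "0 \<in> interior K" "compact K"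
    and hex: "\<And>p. p \<in> frontier K \<Longrightarrow> \<exists>q. q \<in> K \<and> q - p \<in> K \<and> h \<le> cross2 p q"
    and pk: "lattice_packing K v w"
  shows "4 * h \<le> \<bar>det (vector [v, w] :: real^2^2)\<bar>"
proof -
  define c where "c = (\<lambda>(m,n). of_int m *\<^sub>R v + of_int n *\<^sub>R w :: real^2)"
  have vw: "cross2 v w \<noteq> 0" using pk unfolding lattice_packing_def det_vector_cross2 by auto
  have "cross2 v (c (m,n)) = of_int n * cross2 v w" "cross2 (c (m,n)) w = of_int m * cross2 v w" for m n
    by (simp_all add: cross2_bilinear c_def)
  note cc = this
  have c0: "c x \<noteq> 0" if "x \<noteq> (0,0)" for x
  proof
    assume z: "c x = 0"
    obtain m n where mn: "x = (m, n)" by (cases x)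
    have "of_int n * cross2 v w = 0" "of_int m * cross2 v w = 0"
      using cc[where m = m and n = n] z unfolding mn by (simp_all add: cross2_bilinear)
    then show False using vw that mn by simp
  qed
  have bK: "bounded K" using K(4) compact_imp_bounded by blast
  have "\<exists>d>0. x \<noteq> (0,0) \<longrightarrow> d *\<^sub>R c x \<in> frontier K" for x
  proof (cases "x = (0,0)")
    case True
    then show ?thesis using zero_less_one by blast
  next
    case False
    obtain d where "0 < d" "0 + d *\<^sub>R c x \<in> frontier K"
      using ray_to_frontier[OF bK K(3) c0[OF False]] by blast
    then show ?thesis by (intro exI[of _ d]) simp
  qed
  then obtain d where "\<forall>x. d x > 0 \<and> (x \<noteq> (0,0) \<longrightarrow> d x *\<^sub>R c x \<in> frontier K)"
    using choice[of "\<lambda>x d. d > 0 \<and> (x \<noteq> (0,0) \<longrightarrow> d *\<^sub>R c x \<in> frontier K)"] by blast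
  then have dpos: "\<And>x. d x > 0" and dfr: "\<And>x. x \<noteq> (0,0) \<Longrightarrow> d x *\<^sub>R c x \<in> frontier K"
    by blast+
  (* Candidates for the largest factor; they are finitely many, since K is bounded. *)
  define S where "S = {x. x \<noteq> (0,0) \<and> d x \<ge> d (1,0)}"
  have "S \<subseteq> {(m, n). of_int m *\<^sub>R v + of_int n *\<^sub>R w \<in> (\<lambda>y. (1 / d (1,0)) *\<^sub>R y) ` K}"
  proof
    fix x assume x: "x \<in> S"
    have "d x *\<^sub>R c x \<in> K" using dfr[of x] x K(4) frontier_subset_compact unfolding S_def by blast
    moreover have "0 \<le> d (1,0) / d x" "d (1,0) / d x \<le> 1"
      using x dpos[of x] dpos[of "(1,0)"] unfolding S_def by auto
    ultimately have "(d (1,0) / d x) *\<^sub>R d x *\<^sub>R c x \<in> K"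
      by (rule scale_in_convex[OF K(1) subsetD[OF interior_subset K(3)]])
    then have "d (1,0) *\<^sub>R c x \<in> K" using dpos[of x] by simp
    then have "(1 / d (1,0)) *\<^sub>R d (1,0) *\<^sub>R c x \<in> (\<lambda>y. (1 / d (1,0)) *\<^sub>R y) ` K" by blast
    then have "c x \<in> (\<lambda>y. (1 / d (1,0)) *\<^sub>R y) ` K" using dpos[of "(1,0)"] by simp
    then show "x \<in> {(m, n). of_int m *\<^sub>R v + of_int n *\<^sub>R w \<in> (\<lambda>y. (1 / d (1,0)) *\<^sub>R y) ` K}"
      by (auto simp: c_def split: prod.splits)
  qed
  moreover have "bounded ((\<lambda>y. (1 / d (1,0)) *\<^sub>R y) ` K)" using bK bounded_scaling by blast
  ultimately have "finite S" using lattice_finite_bounded[OF _ vw] finite_subset by blast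
  moreover have "(1,0) \<in> S" unfolding S_def by auto
  ultimately have "finite (d ` S)" "d ` S \<noteq> {}" by auto
  then have "Max (d ` S) \<in> d ` S" by (rule Max_in)
  then obtain x where x: "x \<in> S" "d x = Max (d ` S)" by auto
  have xmax: "d y \<le> d x" if "y \<in> S" for y
    unfolding x(2) using that \<open>finite (d ` S)\<close> by simp
  have x0: "x \<noteq> (0,0)" using x(1) unfolding S_def by simp
  have dmax: "d y \<le> d x" if "y \<noteq> (0,0)" for y
  proof (cases "y \<in> S")
    case False
    then have "d y < d (1,0)" using that unfolding S_def by auto
    also have "\<dots> \<le> d x" by (rule xmax[OF \<open>(1,0) \<in> S\<close>])
    finally show ?thesis by simp
  qed (rule xmax)
  define p where "p = d x *\<^sub>R c x"
  have pf: "p \<in> frontier K" unfolding p_def by (rule dfr[OF x0])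
  have pK: "p \<in> K" using pf K(4) frontier_subset_compact by blast
  have noint: "d x *\<^sub>R c y \<notin> interior K" if "y \<noteq> (0,0)" for y
  proof
    assume i: "d x *\<^sub>R c y \<in> interior K"
    have "(d y / d x) *\<^sub>R d x *\<^sub>R c y + 0 *\<^sub>R (d x *\<^sub>R c y) \<in> interior K"
      using dpos[of y] dpos[of x] dmax[OF that] interior_subset i
      by (intro interior_combination_le K) auto
    then have "d y *\<^sub>R c y \<in> interior K" using dpos[of x] by simp
    then show False using dfr[OF that] by (auto simp: frontier_def)
  qed
  have dhalf: "d x \<le> 1/2"
  proof -
    obtain m n where mn: "x = (m,n)" by (cases x)
    have "(1/2) *\<^sub>R c x \<notin> interior K"
      using packing_half_not_interior[OF K(2) pk, of m n] x0 unfolding mn c_def by auto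
    then have "((1/2) / d x) *\<^sub>R p \<notin> interior K" using dpos[of x] by (simp add: p_def)
    from ray_factor_ge_one[OF K(1,3) pK this] show ?thesis using dpos[of x] by (auto simp: field_simps)
  qed
  obtain q where q: "q \<in> K" "q - p \<in> K" "h \<le> cross2 p q" using hex[OF pf] by auto
  obtain m n where mn: "x = (m,n)" by (cases x)
  have g: "gcd m n = 1"
  proof (rule ccontr)
    assume "gcd m n \<noteq> 1"
    moreover have "gcd m n \<noteq> 0" using x0 mn by auto
    ultimately have g2: "gcd m n \<ge> 2" using gcd_ge_0_int[of m n] by linarith
    obtain m' n' where m': "m = gcd m n * m'" and n': "n = gcd m n * n'" by (meson dvdE gcd_dvd1 gcd_dvd2)
    have "(m',n') \<noteq> (0,0)" using x0 mn m' n' by auto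
    from noint[OF this] have "d x *\<^sub>R c (m',n') \<notin> interior K" .
    moreover have "p = of_int (gcd m n) *\<^sub>R d x *\<^sub>R c (m',n')"
    proof -
      have "c x = of_int (gcd m n) *\<^sub>R c (m',n')"
        using m' n' unfolding mn c_def by (simp add: scaleR_add_right) (metis of_int_mult)
      then show ?thesis by (simp add: p_def)
    qed
    then have "d x *\<^sub>R c (m',n') = (1 / of_int (gcd m n)) *\<^sub>R p"
      using \<open>gcd m n \<noteq> 0\<close> by simp
    ultimately have "(1 / of_int (gcd m n)) *\<^sub>R p \<notin> interior K" by simp
    moreover have "0 \<le> 1 / real_of_int (gcd m n)" by (intro divide_nonneg_nonneg) simp_all
    ultimately have le: "1 \<le> 1 / real_of_int (gcd m n)"
      by (rule ray_factor_ge_one[OF K(1,3) pK])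
    define G where "G = real_of_int (gcd m n)"
    have "1 < G" unfolding G_def using g2 by linarith
    moreover have "1 \<le> 1 / G" using le unfolding G_def .
    ultimately show False by simp
  qed
  (* Complete p to a basis, oriented such that the cross product is positive. *)
  obtain i j where ij: "i * m + j * n = 1" using bezout_int[of m n] g by metis
  define D where "D = cross2 v w"
  define y0 where "y0 = (if D > 0 then (-j, i) else (j, -i))"
  define y where "y = d x *\<^sub>R c y0"
  have "real_of_int i * of_int m + of_int j * of_int n = 1" using ij by (metis of_int_1 of_int_add of_int_mult)
  then have "cross2 (c x) (c (-j,i)) = D"
    unfolding mn c_def D_def prod.case cross2_combination by (simp add: mult.commute)
  moreover have "c (j,-i) = - c (-j,i)" by (simp add: c_def)
  ultimately have "cross2 (c x) (c y0) = \<bar>D\<bar>" unfolding y0_def by (auto simp: cross2_bilinear)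
  then have py: "cross2 p y = (d x)\<^sup>2 * \<bar>D\<bar>" unfolding p_def y_def by (simp add: cross2_bilinear power2_eq_square)
  have "h \<le> cross2 p y"
  proof (rule ccontr)
    assume "\<not> h \<le> cross2 p y"
    then have "cross2 p y < cross2 p q" using q by auto
    moreover have "0 < cross2 p y" unfolding py using dpos[of x] vw by (simp add: D_def)
    ultimately obtain k :: int where k: "y + of_int k *\<^sub>R p \<in> interior K"
      using trapezoid_row_meets_interior[OF K(1-3) pK q(1,2)] by blast
    define y1 where "y1 = (fst y0 + k * m, snd y0 + k * n)"
    have yk: "y + of_int k *\<^sub>R p = d x *\<^sub>R c y1"
      unfolding y_def p_def y1_def mn c_def by (simp add: split_def algebra_simps)
    have "y1 \<noteq> (0,0)"
    proof
      assume "y1 = (0,0)"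
      then have "c y1 = 0" by (simp add: c_def)
      then have "y = - (of_int k *\<^sub>R p)" using yk by (simp add: add_eq_0_iff2)
      then have "cross2 p y = 0" by (simp add: cross2_bilinear)
      then show False using \<open>0 < cross2 p y\<close> by simp
    qed
    then show False using noint[of y1] k yk by simp
  qed
  also have "(d x)\<^sup>2 * \<bar>D\<bar> \<le> (1/2)\<^sup>2 * \<bar>D\<bar>" using dhalf dpos[of x] by (intro mult_right_mono power_mono) auto
  then have "cross2 p y \<le> \<bar>D\<bar> / 4" unfolding py by (simp add: power2_eq_square)
  finally show ?thesis by (simp add: det_vector_cross2 D_def)
qed

section \<open>A deformation of six circular arcs\<close>

text \<open>The form \<open>cross2\<close> on the complex plane, where rotations are multiplications.\<close>

definition cr :: "complex \<Rightarrow> complex \<Rightarrow> real" where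
  "cr x y = Re x * Im y - Im x * Re y"

lemma cr_alt: "cr x y = Im (cnj x * y)"
  by (simp add: cr_def)

lemma cr_bilinear:
  "cr (a + b) c = cr a c + cr b c" "cr c (a + b) = cr c a + cr c b"
  "cr (r *\<^sub>R a) c = r * cr a c" "cr a (r *\<^sub>R c) = r * cr a c"
  "cr (a - b) c = cr a c - cr b c" "cr c (a - b) = cr c a - cr c b"
  "cr a a = 0"
  by (simp_all add: cr_def algebra_simps)

lemma cr_commute: "cr a b = - cr b a"
  by (simp add: cr_def)

text \<open>The determinant of such a map is \<open>1\<close>.\<close>

lemma area_preserving_bij:
  fixes T :: "complex \<Rightarrow> real^2"
  assumes T: "linear T" and crT: "\<And>x y. cross2 (T x) (T y) = cr x y"
  shows "bij T"
proof (rule bijI)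
  show "inj T"
  proof (rule injI)
    fix x y assume "T x = T y"
    then have "T (x - y) = 0" using linear_diff[OF T] by simp
    then have "cr (x - y) 1 = 0" "cr (x - y) \<i> = 0" by (simp_all add: cross2_def flip: crT)
    then show "x = y" by (simp add: cr_def complex_eq_iff)
  qed
  show "surj T"
  proof (rule surjI)
    fix y
    have "cross2 (T 1) (T \<i>) = 1" by (simp add: crT cr_def)
    then have "y = cross2 y (T \<i>) *\<^sub>R T 1 + cross2 (T 1) y *\<^sub>R T \<i>"
      using cross2_decomp[of "T 1" "T \<i>" y] by simp
    then show "T (cross2 y (T \<i>) *\<^sub>R 1 + cross2 (T 1) y *\<^sub>R \<i>) = y"
      by (simp add: linear_add[OF T] linear_scale[OF T])
  qed
qed

text \<open>The inner product in the orthonormal basis \<open>b\<close>, \<open>\<i> b\<close>.\<close>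

lemma inner_rotate:
  fixes n x b :: complex
  assumes "norm b = 1" shows "n \<bullet> x = (n \<bullet> b) * (x \<bullet> b) + cr b n * cr b x"
proof -
  have 1: "(Re b)\<^sup>2 + (Im b)\<^sup>2 = 1" using assms by (simp add: cmod_def)
  have "(n \<bullet> b) * (x \<bullet> b) + cr b n * cr b x = ((Re b)\<^sup>2 + (Im b)\<^sup>2) * (n \<bullet> x)"
    unfolding cr_def inner_complex_def power2_eq_square by algebra
  then show ?thesis using 1 by simp
qed

text \<open>Points within \<open>1/8\<close> of the same unit vector point in about the same direction; all points and
  normals on one deformed arc are of this kind.\<close>

lemma inner_near_unit:
  fixes v :: complex
  assumes v: "norm v = 1" and p: "norm (p - v) \<le> 1/8" and q: "norm (q - v) \<le> 1/8"
  shows "1/2 < p \<bullet> q"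
proof -
  have "p \<bullet> q = v \<bullet> v + (p - v) \<bullet> v + (q - v) \<bullet> v + (p - v) \<bullet> (q - v)"
    by (simp add: inner_diff_left inner_diff_right inner_commute)
  moreover have "v \<bullet> v = 1" using v by (simp add: dot_square_norm)
  moreover have "\<bar>(p - v) \<bullet> v\<bar> \<le> 1/8" "\<bar>(q - v) \<bullet> v\<bar> \<le> 1/8"
    using Cauchy_Schwarz_ineq2[of "p - v" v] Cauchy_Schwarz_ineq2[of "q - v" v] p q v by auto
  moreover have "\<bar>(p - v) \<bullet> (q - v)\<bar> \<le> 1/8 * (1/8)"
    by (rule order_trans[OF Cauchy_Schwarz_ineq2]) (use p q in \<open>intro mult_mono\<close>, auto)
  ultimately show ?thesis by linarith
qed

lemma parallel_to_unit:
  assumes "cr u y = 0" "norm u = 1" shows "y = (y \<bullet> u) *\<^sub>R u"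
proof -
  have 1: "(Re u)\<^sup>2 + (Im u)\<^sup>2 = 1" using assms(2) by (metis cmod_power2 one_power2)
  have 2: "Re u * Im y = Im u * Re y" using assms(1) by (simp add: cr_def)
  have "Re y * ((Re u)\<^sup>2 + (Im u)\<^sup>2) = (Re y * Re u + Im y * Im u) * Re u"
    "Im y * ((Re u)\<^sup>2 + (Im u)\<^sup>2) = (Re y * Re u + Im y * Im u) * Im u"
    using 2 by algebra+
  then show ?thesis unfolding 1 complex_eq_iff inner_complex_def by simp
qed

text \<open>A primitive sixth root of unity. Because of \<open>hexroot * hexroot = hexroot - 1\<close>, three
  consecutive vertices of a regular hexagon have the form \<open>p, q, q - p\<close>.\<close>

definition hexroot :: complex where
  "hexroot = Complex (1/2) (sqrt 3 / 2)"

definition hexroots :: "complex set" where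
  "hexroots = {1, hexroot, hexroot - 1, - 1, - hexroot, 1 - hexroot}"

lemma hexroot_simps:
  "Re hexroot = 1/2" "Im hexroot = sqrt 3 / 2"
  by (simp_all add: hexroot_def)

lemma hexroot_sq: "hexroot * hexroot = hexroot - 1"
  by (simp add: complex_eq_iff hexroot_simps)

lemma hexroots_mult: "v \<in> hexroots \<Longrightarrow> v * hexroot \<in> hexroots"
proof -
  assume "v \<in> hexroots"
  moreover have "(hexroot - 1) * hexroot = - 1" "(1 - hexroot) * hexroot = 1"
    using hexroot_sq by (auto simp: algebra_simps)
  ultimately show ?thesis unfolding hexroots_def using hexroot_sq by auto
qed

lemma hexroots_uminus: "v \<in> hexroots \<Longrightarrow> - v \<in> hexroots"
  unfolding hexroots_def by auto

lemma finite_hexroots: "finite hexroots"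
  unfolding hexroots_def by auto

lemma hexroots_norm: "v \<in> hexroots \<Longrightarrow> norm v = 1"
proof -
  have "\<forall>v\<in>hexroots. norm v = 1"
    unfolding hexroots_def by (simp add: cmod_def hexroot_simps power2_eq_square algebra_simps)
  then show "v \<in> hexroots \<Longrightarrow> norm v = 1" by blast
qed

lemma hexroots_inner:
  assumes "v \<in> hexroots" "w \<in> hexroots" "v \<noteq> w" shows "v \<bullet> w \<le> 1/2"
proof -
  have "\<forall>v\<in>hexroots. \<forall>w\<in>hexroots. v \<noteq> w \<longrightarrow> v \<bullet> w \<le> 1/2"
    unfolding hexroots_def by (simp add: inner_complex_def hexroot_simps algebra_simps)
  then show ?thesis using assms by blast
qed

lemma hexroots_dist:
  assumes "v \<in> hexroots" "w \<in> hexroots" "v \<noteq> w" shows "1 \<le> norm (v - w)"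
proof -
  have "(norm (v - w))\<^sup>2 = (norm v)\<^sup>2 + (norm w)\<^sup>2 - 2 * (v \<bullet> w)"
    by (simp add: power2_norm_eq_inner inner_diff inner_commute algebra_simps)
  also have "\<dots> \<ge> 1"
    using hexroots_norm[OF assms(1)] hexroots_norm[OF assms(2)] hexroots_inner[OF assms] by simp
  finally show ?thesis by (metis abs_le_square_iff abs_norm_cancel abs_one one_power2)
qed

lemma sum_hexroots:
  fixes F :: "complex \<Rightarrow> 'a::comm_monoid_add"
  shows "sum F hexroots = F 1 + F hexroot + F (hexroot - 1) + F (- 1) + F (- hexroot) + F (1 - hexroot)"
proof -
  have "distinct [1, hexroot, hexroot - 1, - 1, - hexroot, 1 - hexroot]"
    by (auto simp: complex_eq_iff hexroot_simps)
  moreover have "hexroots = set [1, hexroot, hexroot - 1, - 1, - hexroot, 1 - hexroot]"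
    by (simp add: hexroots_def)
  ultimately have "sum F hexroots = sum_list (map F [1, hexroot, hexroot - 1, - 1, - hexroot, 1 - hexroot])"
    by (metis sum.distinct_set_conv_list)
  then show ?thesis by (simp add: add.assoc)
qed

lemma norm_cis_diff: "norm (cis s - cis t) \<le> \<bar>s - t\<bar>"
proof -
  have "cis s - cis t = cis t * (cis (s - t) - 1)" by (simp add: algebra_simps cis_mult)
  then have "norm (cis s - cis t) = norm (cis (s - t) - 1)" by (simp add: norm_mult)
  also have "\<dots> \<le> \<bar>s - t\<bar>"
  proof -
    define d where "d = s - t"
    have "(norm (cis d - 1))\<^sup>2 = 2 - 2 * cos d"
      unfolding cmod_power2 using sin_cos_squared_add3[of d] by (simp add: power2_eq_square algebra_simps)
    also have "\<dots> = (2 * sin (d/2))\<^sup>2"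
      using cos_double_sin[of "d/2"] by (simp add: power2_eq_square algebra_simps)
    also have "\<dots> \<le> d\<^sup>2"
    proof -
      have "\<bar>2 * sin (d/2)\<bar> \<le> \<bar>d\<bar>" using abs_sin_x_le_abs_x[of "d/2"] by simp
      then show ?thesis using abs_le_square_iff by blast
    qed
    finally show ?thesis unfolding d_def by (metis abs_le_square_iff abs_norm_cancel)
  qed
  finally show ?thesis .
qed

subsection \<open>The deformed curves\<close>

text \<open>The new arc is \<open>new_arc v t = cis t * (rho t *\<^sub>R v + beta t * cnj v)\<close>. The factor \<open>phi\<close>
  vanishes together with its derivative at \<open>\<plusminus>\<sigma>\<close>, so the new arc joins the circle there with the
  same tangent, and \<open>eps\<close> is small enough for it to remain convex. The bound \<open>1/16\<close> on \<open>\<sigma>\<close> keeps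
  all points and normals of an arc close to \<open>v\<close>. The phase \<open>cis (- 3 * t)\<close> is what lowers the
  area: with \<open>cis (- k * t)\<close> the area swept by the six arcs changes in second order by \<open>2 - k\<close>
  times the square of \<open>eps * phi t\<close>. The radius \<open>rho\<close> compensates in second order the effect of
  \<open>beta\<close> on the inscribed hexagons.\<close>

locale bump =
  fixes \<sigma> :: real
  assumes s_pos: "0 < \<sigma>" and s_small: "\<sigma> \<le> 1/16"
begin

definition phi :: "real \<Rightarrow> real" where "phi t = (\<sigma>\<^sup>2 - t\<^sup>2)\<^sup>2"
definition phi1 :: "real \<Rightarrow> real" where "phi1 t = - 4 * t * (\<sigma>\<^sup>2 - t\<^sup>2)"
definition phi2 :: "real \<Rightarrow> real" where "phi2 t = 12 * t\<^sup>2 - 4 * \<sigma>\<^sup>2"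

definition eps :: real where "eps = 1/200"

definition rho :: "real \<Rightarrow> real" where "rho t = 1 + (eps * phi t)\<^sup>2 / 2"
definition beta :: "real \<Rightarrow> complex" where "beta t = (eps * phi t) *\<^sub>R cis (- 3 * t)"

definition new_arc :: "complex \<Rightarrow> real \<Rightarrow> complex" where
  "new_arc v t = cis t * (rho t *\<^sub>R v + beta t * cnj v)"

text \<open>Position and velocity of the new arc in the frame that rotates with the old one: \<open>new_arc v t
  = v * cis t * mm v t\<close>, and its derivative is \<open>new_arc' v t = \<i> * v * cis t * qq v t\<close>. For the
  circle both factors are \<open>1\<close>.\<close>

definition mm :: "complex \<Rightarrow> real \<Rightarrow> complex" where
  "mm v t = of_real (rho t) + beta t * (cnj v)\<^sup>2"
definition mm1 :: "complex \<Rightarrow> real \<Rightarrow> complex" where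
  "mm1 v t = of_real (eps\<^sup>2 * phi t * phi1 t) + of_real eps * (of_real (phi1 t) - 3 * \<i> * of_real (phi t)) * cis (- 3 * t) * (cnj v)\<^sup>2"
definition mm2 :: "complex \<Rightarrow> real \<Rightarrow> complex" where
  "mm2 v t = of_real (eps\<^sup>2 * ((phi1 t)\<^sup>2 + phi t * phi2 t)) + of_real eps * (of_real (phi2 t) - 6 * \<i> * of_real (phi1 t) - 9 * of_real (phi t)) * cis (- 3 * t) * (cnj v)\<^sup>2"

definition qq :: "complex \<Rightarrow> real \<Rightarrow> complex" where
  "qq v t = mm v t - \<i> * mm1 v t"

definition new_arc' :: "complex \<Rightarrow> real \<Rightarrow> complex" where
  "new_arc' v t = \<i> * v * cis t * qq v t"

lemma new_arc_mm: "norm v = 1 \<Longrightarrow> new_arc v t = v * cis t * mm v t"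
proof -
  assume "norm v = 1"
  then have "v * cnj v = 1" by (simp add: complex_norm_square[symmetric])
  then show ?thesis unfolding new_arc_def mm_def by (simp add: algebra_simps power2_eq_square scaleR_conv_of_real)
qed

lemma deriv_cis3: "((\<lambda>t. cis (- 3 * t)) has_vector_derivative (- 3 * \<i> * cis (- 3 * t))) (at t within S)"
proof -
  have "((\<lambda>t. exp (of_real t * (- 3 * \<i>))) has_vector_derivative (exp (of_real t * (- 3 * \<i>)) * (- 3 * \<i>))) (at t within S)"
    using exp_scaleR_has_vector_derivative_right[of "- 3 * \<i>" t S]
    by (simp add: scaleR_conv_of_real)
  moreover have "exp (of_real t * (- 3 * \<i>)) = cis (- 3 * t)" for t
    by (simp add: cis_conv_exp algebra_simps)
  ultimately show ?thesis by (simp add: mult.commute)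
qed

lemma deriv_cis: "(cis has_vector_derivative (\<i> * cis t)) (at t within S)"
proof -
  have "((\<lambda>t. exp (of_real t * \<i>)) has_vector_derivative (exp (of_real t * \<i>) * \<i>)) (at t within S)"
    using exp_scaleR_has_vector_derivative_right[of "\<i>" t S]
    by (simp add: scaleR_conv_of_real)
  moreover have "exp (of_real t * \<i>) = cis t" for t
    by (simp add: cis_conv_exp algebra_simps)
  ultimately show ?thesis by (simp add: mult.commute)
qed

lemma deriv_phi: "(phi has_vector_derivative phi1 t) (at t within S)"
  unfolding phi_def phi1_def has_real_derivative_iff_has_vector_derivative[symmetric]
  by (auto intro!: derivative_eq_intros simp: power2_eq_square algebra_simps)

lemma deriv_phi1: "(phi1 has_vector_derivative phi2 t) (at t within S)"
  unfolding phi1_def phi2_def has_real_derivative_iff_has_vector_derivative[symmetric]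
  by (auto intro!: derivative_eq_intros simp: power2_eq_square algebra_simps)

lemma mm_alt: "mm v = (\<lambda>t. of_real (1 + (eps * phi t)\<^sup>2 / 2) + of_real (eps * phi t) * cis (- 3 * t) * (cnj v)\<^sup>2)"
  by (simp add: mm_def rho_def beta_def scaleR_conv_of_real fun_eq_iff)

lemma deriv_mm: "(mm v has_vector_derivative mm1 v t) (at t within S)"
proof -
  have "((\<lambda>t. 1 + (eps * phi t)\<^sup>2 / 2) has_real_derivative eps\<^sup>2 * phi t * phi1 t) (at t within S)"
    using deriv_phi[of t S] unfolding has_real_derivative_iff_has_vector_derivative[symmetric]
    by (auto intro!: derivative_eq_intros simp: power2_eq_square algebra_simps)
  then have 1: "((\<lambda>t. complex_of_real (1 + (eps * phi t)\<^sup>2 / 2)) has_vector_derivative of_real (eps\<^sup>2 * phi t * phi1 t)) (at t within S)"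
    by (intro has_vector_derivative_of_real) 
  have 2: "((\<lambda>t. complex_of_real (phi t)) has_vector_derivative of_real (phi1 t)) (at t within S)"
    using deriv_phi[of t S] by (intro has_vector_derivative_of_real) (simp add: has_real_derivative_iff_has_vector_derivative)
  have 3: "((\<lambda>t. complex_of_real (phi t) * cis (- 3 * t)) has_vector_derivative
       (of_real (phi t) * (- 3 * \<i> * cis (- 3 * t)) + of_real (phi1 t) * cis (- 3 * t))) (at t within S)"
    by (rule has_vector_derivative_mult[OF 2 deriv_cis3])
  have 4: "((\<lambda>t. (of_real eps * (cnj v)\<^sup>2) * (complex_of_real (phi t) * cis (- 3 * t))) has_vector_derivative
       (of_real eps * (cnj v)\<^sup>2) * (of_real (phi t) * (- 3 * \<i> * cis (- 3 * t)) + of_real (phi1 t) * cis (- 3 * t))) (at t within S)"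
    by (rule has_vector_derivative_mult_right[OF 3])
  show ?thesis
    using has_vector_derivative_add[OF 1 4]
    by (simp add: mm_alt mm1_def algebra_simps)
qed

lemma deriv_mm1: "(mm1 v has_vector_derivative mm2 v t) (at t within S)"
proof -
  have "((\<lambda>t. eps\<^sup>2 * phi t * phi1 t) has_real_derivative (eps\<^sup>2 * ((phi1 t)\<^sup>2 + phi t * phi2 t))) (at t within S)"
    using deriv_phi[of t S] deriv_phi1[of t S] unfolding has_real_derivative_iff_has_vector_derivative[symmetric]
    by (auto intro!: derivative_eq_intros simp: power2_eq_square algebra_simps)
  then have 1: "((\<lambda>t. complex_of_real (eps\<^sup>2 * phi t * phi1 t)) has_vector_derivative of_real (eps\<^sup>2 * ((phi1 t)\<^sup>2 + phi t * phi2 t))) (at t within S)"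
    by (intro has_vector_derivative_of_real)
  have 2: "((\<lambda>t. complex_of_real (phi t)) has_vector_derivative of_real (phi1 t)) (at t within S)"
    using deriv_phi[of t S] by (intro has_vector_derivative_of_real) (simp add: has_real_derivative_iff_has_vector_derivative)
  have 5: "((\<lambda>t. complex_of_real (phi1 t)) has_vector_derivative of_real (phi2 t)) (at t within S)"
    using deriv_phi1[of t S] by (intro has_vector_derivative_of_real) (simp add: has_real_derivative_iff_has_vector_derivative)
  have 6: "((\<lambda>t. complex_of_real (phi1 t) - 3 * \<i> * of_real (phi t)) has_vector_derivative (of_real (phi2 t) - 3 * \<i> * of_real (phi1 t))) (at t within S)"
    by (rule has_vector_derivative_diff[OF 5 has_vector_derivative_mult_right[OF 2]])
  note 3 = has_vector_derivative_mult[OF 6 deriv_cis3]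
  note 4 = has_vector_derivative_mult_right[OF 3, of "of_real eps * (cnj v)\<^sup>2"]
  show ?thesis
    using has_vector_derivative_add[OF 1 4]
    by (simp add: mm1_def[abs_def] mm2_def algebra_simps)
qed

lemma deriv_qq: "(qq v has_vector_derivative (mm1 v t - \<i> * mm2 v t)) (at t within S)"
  unfolding qq_def[abs_def]
  by (rule has_vector_derivative_diff[OF deriv_mm has_vector_derivative_mult_right[OF deriv_mm1]])

lemma deriv_new_arc:
  assumes "norm v = 1" shows "(new_arc v has_vector_derivative new_arc' v t) (at t within S)"
proof -
  have "((\<lambda>t. v * (cis t * mm v t)) has_vector_derivative v * (cis t * mm1 v t + (\<i> * cis t) * mm v t)) (at t within S)"
    by (rule has_vector_derivative_mult_right[OF has_vector_derivative_mult[OF deriv_cis deriv_mm]])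
  moreover have "v * (cis t * mm1 v t + (\<i> * cis t) * mm v t) = new_arc' v t"
    unfolding new_arc'_def qq_def by (simp add: algebra_simps)
  moreover have "new_arc v = (\<lambda>t. v * (cis t * mm v t))" using new_arc_mm[OF assms] by (auto simp: mult.assoc)
  ultimately show ?thesis by simp
qed

lemma phi_bounds:
  assumes "\<bar>t\<bar> \<le> \<sigma>" shows "\<bar>phi t\<bar> \<le> 1" "\<bar>phi1 t\<bar> \<le> 1" "\<bar>phi2 t\<bar> \<le> 1"
proof -
  have t2: "t\<^sup>2 \<le> \<sigma>\<^sup>2" using assms s_pos by (metis abs_le_square_iff abs_of_pos)
  have "\<sigma>\<^sup>2 \<le> (1/16)\<^sup>2" using s_small s_pos by (intro power_mono) auto
  then have s2: "\<sigma>\<^sup>2 \<le> 1/256" by (simp add: power2_eq_square)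
  have t0: "0 \<le> t\<^sup>2" by simp
  have d: "0 \<le> \<sigma>\<^sup>2 - t\<^sup>2" "\<sigma>\<^sup>2 - t\<^sup>2 \<le> 1/16" using t2 s2 t0 by linarith+
  show "\<bar>phi t\<bar> \<le> 1" unfolding phi_def using d by (simp add: power_le_one)
  have "\<bar>t\<bar> * (\<sigma>\<^sup>2 - t\<^sup>2) \<le> 1 * (1/16)" using assms s_small d by (intro mult_mono) auto
  then show "\<bar>phi1 t\<bar> \<le> 1" unfolding phi1_def using d by (simp add: abs_mult)
  show "\<bar>phi2 t\<bar> \<le> 1" unfolding phi2_def using t2 s2 t0 by linarith
qed

lemma mm_bounds:
  assumes t: "\<bar>t\<bar> \<le> \<sigma>" and v: "norm v = 1"
  shows "norm (mm v t - 1) \<le> 1/50" "norm (mm1 v t) \<le> 1/40" "norm (mm2 v t) \<le> 1/10"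
proof -
  note b = phi_bounds[OF t]
  define w where "w = cis (- 3 * t) * (cnj v)\<^sup>2"
  have c: "norm w = 1" unfolding w_def using v by (simp add: norm_mult norm_power)
  have e2: "\<bar>eps\<^sup>2 * r\<bar> \<le> 1/20000" if "\<bar>r\<bar> \<le> 2" for r
    using that by (simp add: eps_def abs_mult power2_eq_square)
  have ps: "\<bar>phi t * phi1 t\<bar> \<le> 1" "\<bar>(phi t)\<^sup>2\<bar> \<le> 1" "\<bar>(phi1 t)\<^sup>2\<bar> \<le> 1" "\<bar>phi t * phi2 t\<bar> \<le> 1"
  proof -
    have m: "\<bar>x * y\<bar> \<le> 1" if "\<bar>x\<bar> \<le> 1" "\<bar>y\<bar> \<le> 1" for x y :: real
      unfolding abs_mult by (rule mult_le_one) (use that in auto)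
    show "\<bar>phi t * phi1 t\<bar> \<le> 1" "\<bar>(phi t)\<^sup>2\<bar> \<le> 1" "\<bar>(phi1 t)\<^sup>2\<bar> \<le> 1" "\<bar>phi t * phi2 t\<bar> \<le> 1"
      unfolding power2_eq_square by (intro m b)+
  qed
  have "mm v t - 1 = of_real (eps\<^sup>2 * ((phi t)\<^sup>2 / 2)) + of_real (eps * phi t) * w"
    by (simp add: mm_alt power_mult_distrib w_def)
  also have "norm \<dots> \<le> \<bar>eps\<^sup>2 * ((phi t)\<^sup>2 / 2)\<bar> + \<bar>eps * phi t\<bar>"
    by (rule order_trans[OF norm_triangle_ineq]) (simp only: norm_mult norm_of_real c mult_1_right)
  also have "\<dots> \<le> 1/20000 + 1/200"
    using b e2[of "(phi t)\<^sup>2 / 2"] ps by (intro add_mono) (auto simp: eps_def abs_mult)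
  finally show "norm (mm v t - 1) \<le> 1/50" by simp
  have "mm1 v t = of_real (eps\<^sup>2 * (phi t * phi1 t)) + of_real eps * (of_real (phi1 t) - 3 * \<i> * of_real (phi t)) * w"
    by (simp add: mm1_def mult.assoc w_def)
  also have "norm \<dots> \<le> \<bar>eps\<^sup>2 * (phi t * phi1 t)\<bar> + \<bar>eps\<bar> * norm (of_real (phi1 t) - 3 * \<i> * of_real (phi t))"
    by (rule order_trans[OF norm_triangle_ineq]) (simp only: norm_mult norm_of_real c mult_1_right)
  also have "\<dots> \<le> 1/20000 + 1/200 * (1 + 3)"
  proof (intro add_mono mult_mono)
    show "norm (of_real (phi1 t) - 3 * \<i> * of_real (phi t)) \<le> 1 + 3"
      by (rule order_trans[OF norm_triangle_ineq4]) (use b in \<open>auto simp: norm_mult\<close>)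
  qed (use e2[of "phi t * phi1 t"] ps in \<open>auto simp: eps_def\<close>)
  finally show "norm (mm1 v t) \<le> 1/40" by simp
  have "mm2 v t = of_real (eps\<^sup>2 * ((phi1 t)\<^sup>2 + phi t * phi2 t)) + of_real eps * (of_real (phi2 t) - 6 * \<i> * of_real (phi1 t) - 9 * of_real (phi t)) * w"
    by (simp add: mm2_def mult.assoc w_def)
  also have "norm \<dots> \<le> \<bar>eps\<^sup>2 * ((phi1 t)\<^sup>2 + phi t * phi2 t)\<bar> + \<bar>eps\<bar> * norm (of_real (phi2 t) - 6 * \<i> * of_real (phi1 t) - 9 * of_real (phi t))"
    by (rule order_trans[OF norm_triangle_ineq]) (simp only: norm_mult norm_of_real c mult_1_right)
  also have "\<dots> \<le> 1/20000 + 1/200 * (1 + 6 + 9)"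
  proof (intro add_mono mult_mono)
    have "norm (of_real (phi2 t) - 6 * \<i> * of_real (phi1 t) - 9 * complex_of_real (phi t)) \<le>
        norm (of_real (phi2 t) - 6 * \<i> * of_real (phi1 t)) + norm (9 * complex_of_real (phi t))"
      by (rule norm_triangle_ineq4)
    also have "\<dots> \<le> norm (complex_of_real (phi2 t)) + norm (6 * \<i> * of_real (phi1 t)) + norm (9 * complex_of_real (phi t))"
      by (intro add_right_mono norm_triangle_ineq4)
    also have "\<dots> \<le> 1 + 6 + 9" using b by (auto simp: norm_mult)
    finally show "norm (of_real (phi2 t) - 6 * \<i> * of_real (phi1 t) - 9 * complex_of_real (phi t)) \<le> 1 + 6 + 9" .
    show "\<bar>eps\<^sup>2 * ((phi1 t)\<^sup>2 + phi t * phi2 t)\<bar> \<le> 1/20000"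
      by (rule e2) (use ps in linarith)
  qed (auto simp: eps_def)
  finally show "norm (mm2 v t) \<le> 1/10" by simp
qed

lemma qq_bound: "\<bar>t\<bar> \<le> \<sigma> \<Longrightarrow> norm v = 1 \<Longrightarrow> norm (qq v t - 1) \<le> 1/20"
  using mm_bounds[of t v] norm_triangle_ineq4[of "mm v t - 1" "\<i> * mm1 v t"]
  unfolding qq_def by (simp add: norm_mult algebra_simps)

lemma qq_lipschitz:
  assumes "s \<in> {-\<sigma>..\<sigma>}" "t \<in> {-\<sigma>..\<sigma>}" "norm v = 1"
  shows "norm (qq v s - qq v t) \<le> 1/4 * \<bar>s - t\<bar>"
proof -
  have "norm (qq v s - qq v t) \<le> 1/4 * norm (s - t)"
  proof (rule differentiable_bound[of "{-\<sigma>..\<sigma>}" "qq v" "\<lambda>x h. h *\<^sub>R (mm1 v x - \<i> * mm2 v x)"])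
    fix x assume x: "x \<in> {-\<sigma>..\<sigma>}"
    show "(qq v has_derivative (\<lambda>h. h *\<^sub>R (mm1 v x - \<i> * mm2 v x))) (at x within {-\<sigma>..\<sigma>})"
      using deriv_qq[of v x "{-\<sigma>..\<sigma>}"] unfolding has_vector_derivative_def .
    have "norm (mm1 v x - \<i> * mm2 v x) \<le> 1/40 + 1/10"
      using norm_triangle_ineq4[of "mm1 v x" "\<i> * mm2 v x"] mm_bounds[OF _ assms(3), of x] x by (simp add: norm_mult abs_le_iff)
    then have "norm (mm1 v x - \<i> * mm2 v x) \<le> 1/4" by simp
    from mult_left_mono[OF this abs_ge_zero]
    show "onorm (\<lambda>h. h *\<^sub>R (mm1 v x - \<i> * mm2 v x)) \<le> 1/4"
      by (intro onorm_le) (simp add: mult.commute)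
  qed (use assms in auto)
  then show ?thesis by simp
qed

text \<open>The rotation by \<open>cis\<close> turns the velocity counterclockwise with unit speed, and the variation
  of \<open>qq\<close> is too slow (at most \<open>1/4\<close>) to undo this. So the new arc is convex.\<close>

lemma new_arc'_turns_left:
  assumes "s \<in> {-\<sigma>..\<sigma>}" "t \<in> {-\<sigma>..\<sigma>}" "t \<le> s" and v: "norm v = 1"
  shows "0 \<le> cr (new_arc' v t) (new_arc' v s)"
proof -
  let ?d = "s - t" let ?q = "qq v t"
  have d: "0 \<le> ?d" "?d \<le> 1/8" using assms s_small by auto
  have vv: "v * cnj v = 1" using v by (simp add: complex_norm_square[symmetric])
  have "cnj (new_arc' v t) * new_arc' v s = (v * cnj v) * (cnj (cis t) * cis s) * (cnj ?q * qq v s)"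
    unfolding new_arc'_def by (simp add: algebra_simps)
  also have "cnj (cis t) * cis s = cis ?d" by (simp add: cis_mult cis_cnj)
  finally have "cr (new_arc' v t) (new_arc' v s) = Im (cis ?d * (cnj ?q * qq v s))" unfolding cr_alt vv by simp
  also have "cnj ?q * qq v s = of_real ((norm ?q)\<^sup>2) + cnj ?q * (qq v s - ?q)"
    by (simp add: algebra_simps complex_norm_square[symmetric])
  also have "Im (cis ?d * \<dots>) = (norm ?q)\<^sup>2 * sin ?d + Im (cis ?d * (cnj ?q * (qq v s - ?q)))"
    by (simp add: algebra_simps)
  finally have e: "cr (new_arc' v t) (new_arc' v s) = (norm ?q)\<^sup>2 * sin ?d + Im (cis ?d * (cnj ?q * (qq v s - ?q)))" .
  have "\<bar>Im (cis ?d * (cnj ?q * (qq v s - ?q)))\<bar> \<le> norm ?q * norm (qq v s - ?q)"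
    by (rule order_trans[OF abs_Im_le_cmod]) (simp add: norm_mult)
  also have "\<dots> \<le> norm ?q * (1/4 * ?d)"
    using qq_lipschitz[OF assms(1,2) v] d by (intro mult_left_mono) auto
  finally have 1: "\<bar>Im (cis ?d * (cnj ?q * (qq v s - ?q)))\<bar> \<le> norm ?q * (1/4 * ?d)" .
  have nq: "norm ?q \<ge> 3/4"
    using qq_bound[OF _ v, of t] assms(2) norm_triangle_ineq2[of 1 "1 - ?q"]
    by (simp add: norm_minus_commute abs_le_iff)
  have "\<bar>sin ?d - (\<Sum>m<2. sin_coeff m * ?d ^ m)\<bar> \<le> inverse (fact 2) * \<bar>?d\<bar> ^ 2"
    by (rule Maclaurin_sin_bound)
  then have "\<bar>sin ?d - ?d\<bar> \<le> ?d * ?d / 2"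
    by (simp add: numeral_2_eq_2 sin_coeff_def)
  moreover have "?d * ?d \<le> 1 * ?d" using d by (intro mult_right_mono) auto
  moreover have "d / 2 \<le> S" if "\<bar>S - d\<bar> \<le> m / 2" "m \<le> 1 * d" for S d m :: real
    using that by linarith
  ultimately have "sin ?d \<ge> ?d / 2" by blast
  then have "norm ?q * (3/4 * (?d/2)) \<le> norm ?q * (norm ?q * sin ?d)"
    using nq d by (intro mult_left_mono mult_mono) auto
  moreover have "norm ?q * (1/4 * ?d) \<le> norm ?q * (3/4 * (?d/2))" using d nq by (intro mult_left_mono) auto
  moreover have "cr (new_arc' v t) (new_arc' v s) = norm ?q * (norm ?q * sin ?d) + Im (cis ?d * (cnj ?q * (qq v s - ?q)))"
    unfolding e by (simp only: power2_eq_square mult.assoc)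
  moreover have "0 \<le> E" if "\<bar>I\<bar> \<le> A" "A \<le> B" "B \<le> C" "E = C + I" for A B C E I :: real
    using that by linarith
  ultimately show ?thesis using 1 by blast
qed

lemma deriv_cr_new_arc:
  assumes "norm v = 1"
  shows "((\<lambda>s. cr n (new_arc v s)) has_real_derivative cr n (new_arc' v s)) (at s)"
proof -
  have "bounded_linear (\<lambda>x. cr n x)"
    unfolding cr_def
    by (intro bounded_linear_sub bounded_linear_const_mult bounded_linear_Re bounded_linear_Im)
  from bounded_linear.has_vector_derivative[OF this deriv_new_arc[OF assms, of s UNIV]]
  show ?thesis by (simp add: has_real_derivative_iff_has_vector_derivative)
qed

lemma new_arc_supporting:
  assumes s: "s \<in> {-\<sigma>..\<sigma>}" and t: "t \<in> {-\<sigma>..\<sigma>}" and v: "norm v = 1"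
  shows "cr (new_arc' v t) (new_arc v t) \<le> cr (new_arc' v t) (new_arc v s)"
proof (cases "t \<le> s")
  case True
  show ?thesis
  proof (rule DERIV_nonneg_imp_nondecreasing[OF True])
    fix x assume "t \<le> x" "x \<le> s"
    then show "\<exists>y. ((\<lambda>s. cr (new_arc' v t) (new_arc v s)) has_real_derivative y) (at x) \<and> y \<ge> 0"
      using deriv_cr_new_arc[OF v] new_arc'_turns_left[of x t v] s t v by auto
  qed
next
  case False
  then have st: "s \<le> t" by simp
  show ?thesis
  proof (rule DERIV_nonpos_imp_nonincreasing[OF st])
    fix x assume "s \<le> x" "x \<le> t"
    then show "\<exists>y. ((\<lambda>s. cr (new_arc' v t) (new_arc v s)) has_real_derivative y) (at x) \<and> y \<le> 0"
      using deriv_cr_new_arc[OF v, of "new_arc' v t" x] new_arc'_turns_left[of t x v] s t v cr_commute[of "new_arc' v t" "new_arc' v x"]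
      by (intro exI[of _ "cr (new_arc' v t) (new_arc' v x)"]) auto
  qed
qed

lemma phi_end: "phi \<sigma> = 0" "phi (-\<sigma>) = 0" "phi1 \<sigma> = 0" "phi1 (-\<sigma>) = 0"
  by (simp_all add: phi_def phi1_def)

lemma new_arc_end: "new_arc v \<sigma> = v * cis \<sigma>" "new_arc v (-\<sigma>) = v * cis (-\<sigma>)"
  by (simp_all add: new_arc_def rho_def beta_def phi_end mult.commute)

lemma new_arc'_end: "new_arc' v \<sigma> = \<i> * v * cis \<sigma>" "new_arc' v (-\<sigma>) = \<i> * v * cis (-\<sigma>)"
  by (simp_all add: new_arc'_def qq_def mm_alt mm1_def phi_end)

lemma new_arc_near:
  assumes t: "t \<in> {-\<sigma>..\<sigma>}" and v: "norm v = 1" shows "norm (new_arc v t - v) \<le> 1/8"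
proof -
  have "new_arc v t - v = v * ((cis t - cis 0) + cis t * (mm v t - 1))"
    by (simp add: new_arc_mm[OF v] algebra_simps)
  then have "norm (new_arc v t - v) \<le> norm (cis t - cis 0) + norm (cis t * (mm v t - 1))"
    using v norm_triangle_ineq[of "cis t - cis 0" "cis t * (mm v t - 1)"] by (simp add: norm_mult del: cis_zero)
  also have "\<dots> \<le> 1/16 + 1/50"
    using norm_cis_diff[of t 0] t s_small mm_bounds(1)[of t v] v
    by (intro add_mono) (auto simp: norm_mult)
  finally show ?thesis by simp
qed

lemma new_arc'_near:
  assumes t: "t \<in> {-\<sigma>..\<sigma>}" and v: "norm v = 1" shows "norm (new_arc' v t - \<i> * v) \<le> 1/8"
proof -
  have "new_arc' v t - \<i> * v = \<i> * v * ((cis t - cis 0) + cis t * (qq v t - 1))"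
    by (simp add: new_arc'_def algebra_simps)
  then have "norm (new_arc' v t - \<i> * v) \<le> norm (cis t - cis 0) + norm (cis t * (qq v t - 1))"
    using v norm_triangle_ineq[of "cis t - cis 0" "cis t * (qq v t - 1)"] by (simp add: norm_mult del: cis_zero)
  also have "\<dots> \<le> 1/16 + 1/20"
    using norm_cis_diff[of t 0] t s_small qq_bound[of t v] v
    by (intro add_mono) (auto simp: norm_mult)
  finally show ?thesis by simp
qed

end

subsection \<open>The deformed disk\<close>

text \<open>In the coordinates in which \<open>g\<close> is a rotation, the boundary of the disk contains six unit
  circular arcs around the sixth roots of unity.\<close>

locale arc_disk = bump +
  fixes K :: "complex set" and \<tau> :: real
  assumes K_convex: "convex K" and K_compact: "compact K" and K_sym: "uminus ` K = K"
    and K_zero: "0 \<in> interior K"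
    and s_less: "\<sigma> < \<tau>"
    and arcs: "\<And>v t. v \<in> hexroots \<Longrightarrow> \<bar>t\<bar> \<le> \<tau> \<Longrightarrow> v * cis t \<in> frontier K"
begin

lemma K_closed: "closed K" using K_compact compact_imp_closed by blast

lemma frontier_in_K: "frontier K \<subseteq> K" using K_compact frontier_subset_compact by blast

lemma cr_mult_left: "cr (w * a) (w * b) = (w \<bullet> w) * cr a b"
  by (simp add: cr_def inner_complex_def algebra_simps)

lemma inner_mult_left_complex: "(w * a) \<bullet> (w * b) = (w \<bullet> w) * (a \<bullet> b)" for w :: complex
  by (simp add: inner_complex_def algebra_simps)

lemma inner_v_cis: "norm v = 1 \<Longrightarrow> (v * cis s) \<bullet> (v * cis t) = cos (s - t)"
  for v :: complex
proof -
  assume v: "norm v = 1"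
  then have 1: "(Re v)\<^sup>2 + (Im v)\<^sup>2 = 1" by (simp add: cmod_def)
  have "(v * cis s) \<bullet> (v * cis t) = ((Re v)\<^sup>2 + (Im v)\<^sup>2) * cos (s - t)"
    unfolding inner_complex_def by (simp add: cos_diff power2_eq_square algebra_simps)
  then show ?thesis using 1 by simp
qed

lemma cr_v_cis: "norm v = 1 \<Longrightarrow> cr (v * cis s) (v * cis t) = sin (t - s)"
  for v :: complex
proof -
  assume v: "norm v = 1"
  then have 1: "(Re v)\<^sup>2 + (Im v)\<^sup>2 = 1" by (simp add: cmod_def)
  have "cr (v * cis s) (v * cis t) = ((Re v)\<^sup>2 + (Im v)\<^sup>2) * sin (t - s)"
    unfolding cr_def by (simp add: sin_diff power2_eq_square algebra_simps)
  then show ?thesis using 1 by simp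
qed

lemma frontier_support:
  assumes "s \<in> frontier K"
  shows "\<exists>n. n \<noteq> 0 \<and> (\<forall>y\<in>K. n \<bullet> y \<le> n \<bullet> s)"
proof -
  have "s \<notin> interior K" using assms by (simp add: frontier_def)
  then have "s \<notin> rel_interior K" using rel_interior_nonempty_interior K_zero by blast
  then obtain a where a: "a \<noteq> 0" "\<And>y. y \<in> closure K \<Longrightarrow> a \<bullet> s \<le> a \<bullet> y"
    using supporting_hyperplane_relative_frontier[OF K_convex, of s] assms frontier_in_K closure_subset
    by (metis subsetD)
  then have "\<forall>y\<in>K. (- a) \<bullet> y \<le> (- a) \<bullet> s" using closure_subset[of K] by auto
  then show ?thesis using a(1) by (intro exI[of _ "- a"]) simp
qed

text \<open>A supporting line of \<open>K\<close> at an inner point of a circular arc has no choice but to be the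
  tangent.\<close>

lemma arc_tangent:
  assumes v: "v \<in> hexroots" and t: "\<bar>t\<bar> < \<tau>" and x: "x \<in> K"
  shows "x \<bullet> (v * cis t) \<le> 1"
proof -
  let ?c = "v * cis t"
  have nc: "norm ?c = 1" using hexroots_norm[OF v] by (simp add: norm_mult)
  have c: "?c \<in> frontier K" using arcs v t by auto
  obtain n where n: "n \<noteq> 0" "\<And>y. y \<in> K \<Longrightarrow> n \<bullet> y \<le> n \<bullet> ?c"
    using frontier_support[OF c] by blast
  define \<eta> where "\<eta> = cr ?c n"
  define A where "A = n \<bullet> ?c"
  have ray: "n \<bullet> (v * cis s) = A * cos (s - t) + \<eta> * sin (s - t)" for s
    unfolding A_def \<eta>_def
    by (subst inner_rotate[OF nc]) (simp add: inner_v_cis cr_v_cis hexroots_norm[OF v])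
  have "A \<ge> 0" using n(2)[of 0] K_zero interior_subset unfolding A_def by force
  have le: "A * cos d + \<eta> * sin d \<le> A" if "\<bar>d\<bar> \<le> \<tau> - \<bar>t\<bar>" for d
  proof -
    have "v * cis (t + d) \<in> K" using arcs[OF v, of "t + d"] that frontier_in_K by auto
    from n(2)[OF this] show ?thesis using ray[of "t + d"] unfolding A_def by simp
  qed
  have "\<eta> = 0"
  proof (rule ccontr)
    assume "\<eta> \<noteq> 0"
    define g where "g = (\<lambda>d. A * cos d + \<eta> * sin d)"
    have dg: "(g has_real_derivative \<eta>) (at 0)"
      unfolding g_def by (auto intro!: derivative_eq_intros)
    have "\<eta> = 0"
    proof (rule DERIV_local_max[OF dg])
      show "0 < \<tau> - \<bar>t\<bar>" using t by simp
      show "\<forall>y. \<bar>0 - y\<bar> < \<tau> - \<bar>t\<bar> \<longrightarrow> g y \<le> g 0" using le unfolding g_def by auto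
    qed
    then show False using \<open>\<eta> \<noteq> 0\<close> by simp
  qed
  have A: "A \<noteq> 0"
  proof
    assume "A = 0"
    have "n \<bullet> n = (n \<bullet> ?c) * (n \<bullet> ?c) + cr ?c n * cr ?c n" by (rule inner_rotate[OF nc])
    then show False using \<open>A = 0\<close> \<open>\<eta> = 0\<close> n(1) unfolding A_def \<eta>_def by simp
  qed
  have "n \<bullet> x = A * (x \<bullet> ?c) + \<eta> * cr ?c x"
    unfolding A_def \<eta>_def by (rule inner_rotate[OF nc])
  then have "A * (x \<bullet> ?c) \<le> A * 1" using n(2)[OF x] \<open>\<eta> = 0\<close> unfolding A_def by simp
  then show ?thesis using A \<open>A \<ge> 0\<close> by (simp add: mult_le_cancel_left_pos)
qed

definition cone :: "complex \<Rightarrow> complex set" where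
  "cone v = {r *\<^sub>R (v * cis t) | r t. 0 < r \<and> \<bar>t\<bar> < \<sigma>}"

definition ea :: "complex \<Rightarrow> complex" where "ea v = v * cis (-\<sigma>)"
definition eb :: "complex \<Rightarrow> complex" where "eb v = v * cis \<sigma>"

lemma ea_eb_norm: "norm v = 1 \<Longrightarrow> norm (ea v) = 1" "norm v = 1 \<Longrightarrow> norm (eb v) = 1"
  by (simp_all add: ea_def eb_def norm_mult)

lemma s_lt_pi: "\<sigma> < pi / 4" using s_small pi_gt3 by simp

lemma cone_iff:
  assumes v: "norm v = 1"
  shows "x \<in> cone v \<longleftrightarrow> cr (ea v) x > 0 \<and> cr (eb v) x < 0"
proof
  assume "x \<in> cone v"
  then obtain r t where x: "x = r *\<^sub>R (v * cis t)" "r > 0" "\<bar>t\<bar> < \<sigma>" unfolding cone_def by auto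
  have "sin (t + \<sigma>) > 0" "sin (\<sigma> - t) > 0" using x(3) s_lt_pi pi_gt_zero by (auto intro!: sin_gt_zero)
  then have "sin (t + \<sigma>) > 0" "sin (t - \<sigma>) < 0" using sin_minus[of "t - \<sigma>"] by simp_all
  then show "cr (ea v) x > 0 \<and> cr (eb v) x < 0"
    unfolding x(1) cr_bilinear ea_def eb_def using cr_v_cis[OF v, of "-\<sigma>" t] cr_v_cis[OF v, of "\<sigma>" t] x(2)
    by (simp add: mult_pos_neg)
next
  assume c: "cr (ea v) x > 0 \<and> cr (eb v) x < 0"
  define w where "w = cnj v * x"
  have vv: "v * cnj v = 1" using v by (simp add: complex_norm_square[symmetric])
  have x: "x = v * w" unfolding w_def using vv by (simp add: mult.assoc[symmetric])
  define t where "t = Arg w" define r where "r = norm w"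
  have w: "w = r *\<^sub>R cis t" unfolding r_def t_def by (metis cis_Arg_unique rcis_cmod_Arg rcis_def scaleR_conv_of_real)
  have xr: "x = r *\<^sub>R (v * cis t)" unfolding x w by (simp add: scaleR_conv_of_real algebra_simps)
  have t: "-pi < t" "t \<le> pi" unfolding t_def by (simp_all add: Arg_bounded)
  have cs: "r * sin (t + \<sigma>) > 0" "r * sin (t - \<sigma>) < 0"
    using c unfolding xr cr_bilinear ea_def eb_def using cr_v_cis[OF v, of "-\<sigma>" t] cr_v_cis[OF v, of "\<sigma>" t]
    by simp_all
  have r: "r > 0" using cs(1) unfolding r_def by (metis mult_zero_left norm_ge_zero order_le_less less_irrefl)
  then have cs: "sin (t + \<sigma>) > 0" "sin (t - \<sigma>) < 0" using cs by (simp_all add: zero_less_mult_iff mult_less_0_iff)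
  have "t < \<sigma>"
  proof (rule ccontr)
    assume "\<not> t < \<sigma>"
    then have "0 \<le> sin (t - \<sigma>)" using t s_pos by (intro sin_ge_zero) auto
    then show False using cs by simp
  qed
  moreover have "- \<sigma> < t"
  proof (rule ccontr)
    assume "\<not> - \<sigma> < t"
    then have "0 \<le> sin (- (t + \<sigma>))" using t s_pos by (intro sin_ge_zero) auto
    then show False using cs(1) unfolding sin_minus by simp
  qed
  ultimately have "\<bar>t\<bar> < \<sigma>" by auto
  then show "x \<in> cone v" unfolding cone_def using xr r by blast
qed

lemma cone_open: assumes "norm v = 1" shows "open (cone v)"
proof -
  have "cone v = {x. cr (ea v) x > 0} \<inter> {x. cr (eb v) x < 0}" using cone_iff[OF assms] by auto
  moreover have "open {x. cr (ea v) x > 0}" "open {x. cr (eb v) x < 0}"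
    unfolding cr_def by (intro open_Collect_less continuous_intros)+
  ultimately show ?thesis by auto
qed

lemma cone_near:
  assumes "x \<in> cone v" "norm v = 1" shows "x \<noteq> 0" "norm (x - norm x *\<^sub>R v) \<le> norm x / 16"
proof -
  obtain r t where x: "x = r *\<^sub>R (v * cis t)" "r > 0" "\<bar>t\<bar> < \<sigma>" using assms unfolding cone_def by auto
  have nx: "norm x = r" using x assms(2) by (simp add: norm_mult)
  then show "x \<noteq> 0" using x by auto
  have "x - norm x *\<^sub>R v = r *\<^sub>R (v * (cis t - cis 0))" unfolding nx by (simp add: x scaleR_conv_of_real algebra_simps)
  then have "norm (x - norm x *\<^sub>R v) = r * norm (cis t - cis 0)" using x assms(2) by (simp add: norm_mult del: cis_zero)
  also have "\<dots> \<le> r * (1/16)" using norm_cis_diff[of t 0] x s_small by (intro mult_left_mono) auto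
  finally show "norm (x - norm x *\<^sub>R v) \<le> norm x / 16" using nx by simp
qed

lemma cone_scale: "x \<in> cone v \<Longrightarrow> 0 < r \<Longrightarrow> r *\<^sub>R x \<in> cone v"
proof -
  assume "x \<in> cone v" "0 < r"
  then obtain r' t where "x = r' *\<^sub>R (v * cis t)" "0 < r'" "\<bar>t\<bar> < \<sigma>" unfolding cone_def by auto
  then have "r *\<^sub>R x = (r * r') *\<^sub>R (v * cis t)" "0 < r * r'" "\<bar>t\<bar> < \<sigma>" using \<open>0 < r\<close> by auto
  then show ?thesis unfolding cone_def by blast
qed

lemma not_in_other_cone:
  assumes v: "v \<in> hexroots" "w \<in> hexroots" "v \<noteq> w" and s: "norm (s - w) \<le> 1/8"
  shows "s \<notin> cone v"
proof
  assume c: "s \<in> cone v"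
  note n = hexroots_norm[OF v(1)] hexroots_norm[OF v(2)]
  have ns: "\<bar>norm s - 1\<bar> \<le> 1/8" using norm_triangle_ineq3[of s w] s n by simp
  have "norm (v - w) \<le> norm ((1 - norm s) *\<^sub>R v) + norm (norm s *\<^sub>R v - s) + norm (s - w)"
    using norm_triangle_ineq[of "(1 - norm s) *\<^sub>R v + (norm s *\<^sub>R v - s)" "s - w"]
      norm_triangle_ineq[of "(1 - norm s) *\<^sub>R v" "norm s *\<^sub>R v - s"]
    by (simp add: algebra_simps)
  also have "norm ((1 - norm s) *\<^sub>R v) \<le> 1/8" using n ns by (simp add: abs_minus_commute)
  also have "norm (norm s *\<^sub>R v - s) \<le> 1/8"
    unfolding norm_minus_commute[of "norm s *\<^sub>R v"] using cone_near(2)[OF c n(1)] ns by linarith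
  finally have "norm (v - w) < 1" using s by simp
  then show False using hexroots_dist[OF v] by simp
qed

lemma cones_disjoint:
  assumes v: "v \<in> hexroots" "w \<in> hexroots" "v \<noteq> w" shows "cone v \<inter> cone w = {}"
proof (rule ccontr)
  assume "cone v \<inter> cone w \<noteq> {}"
  then obtain x where x: "x \<in> cone v" "x \<in> cone w" by auto
  note n = hexroots_norm[OF v(1)] hexroots_norm[OF v(2)]
  have nx: "norm x > 0" using cone_near(1)[OF x(1) n(1)] by simp
  define s where "s = (1 / norm x) *\<^sub>R x"
  have "s \<in> cone v" unfolding s_def using cone_scale[OF x(1)] nx by simp
  moreover have "norm (s - w) \<le> 1/8"
  proof -
    have "s - w = (1 / norm x) *\<^sub>R (x - norm x *\<^sub>R w)" unfolding s_def using nx by (simp add: algebra_simps)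
    then have e: "norm (s - w) = norm (x - norm x *\<^sub>R w) / norm x" using nx by simp
    have "norm (x - norm x *\<^sub>R w) / norm x \<le> 1/16"
      using cone_near(2)[OF x(2) n(2)] nx by (simp add: pos_divide_le_eq)
    then show ?thesis unfolding e by linarith
  qed
  ultimately show False using not_in_other_cone[OF v] by blast
qed

lemma frontier_cone:
  assumes v: "v \<in> hexroots" and x: "x \<in> frontier K" "x \<in> cone v"
  obtains t where "\<bar>t\<bar> < \<sigma>" "x = v * cis t"
proof -
  obtain r t where r: "x = r *\<^sub>R (v * cis t)" "r > 0" "\<bar>t\<bar> < \<sigma>" using x(2) unfolding cone_def by auto
  have a: "v * cis t \<in> frontier K" using arcs[OF v, of t] r s_less by auto
  have "r = 1"
    by (rule frontier_ray_unique[OF K_convex K_zero K_compact a]) (use x r in simp_all)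
  then show ?thesis using that r by simp
qed

text \<open>The deformed disk: inside the six cones over \<open>\<bar>t\<bar> < \<sigma>\<close> the old boundary is replaced by the new
  arcs. Taking the convex hull makes convexity trivial; what has to be shown is that the whole
  new curve lies on its frontier.\<close>

definition kept_boundary :: "complex set" where "kept_boundary = frontier K - (\<Union>v\<in>hexroots. cone v)"
definition new_boundary :: "complex set" where "new_boundary = kept_boundary \<union> (\<Union>v\<in>hexroots. new_arc v ` {-\<sigma>..\<sigma>})"
definition K' :: "complex set" where "K' = convex hull new_boundary"

lemma new_boundary_compact: "compact new_boundary"
proof -
  have "kept_boundary = frontier K \<inter> - (\<Union>v\<in>hexroots. cone v)" by (auto simp: kept_boundary_def)
  moreover have "closed (- (\<Union>v\<in>hexroots. cone v))"
    using cone_open hexroots_norm by (auto intro!: open_UN)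
  ultimately have "compact kept_boundary" using compact_frontier[OF K_compact] by (simp add: compact_Int_closed)
  moreover have "compact (new_arc v ` {-\<sigma>..\<sigma>})" if "v \<in> hexroots" for v
  proof (rule compact_continuous_image)
    show "continuous_on {-\<sigma>..\<sigma>} (new_arc v)"
      using deriv_new_arc[OF hexroots_norm[OF that]] has_vector_derivative_continuous
      unfolding continuous_on_eq_continuous_within by blast
  qed auto
  ultimately show ?thesis unfolding new_boundary_def using finite_hexroots by (intro compact_Un compact_UN) auto
qed

lemma K'_basic: "convex K'" "compact K'" "new_boundary \<subseteq> K'"
  unfolding K'_def using new_boundary_compact by (auto simp: compact_convex_hull hull_inc)

lemma cone_uminus: "x \<in> cone v \<Longrightarrow> - x \<in> cone (- v)"
  unfolding cone_def by auto

lemma new_boundary_uminus: assumes "x \<in> new_boundary" shows "- x \<in> new_boundary"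
proof (cases "x \<in> kept_boundary")
  case True
  have "- x \<in> frontier K"
  proof -
    have "x \<in> K" "x \<notin> interior K" using True frontier_in_K by (auto simp: kept_boundary_def frontier_def)
    then have "- x \<in> K" using K_sym by (metis image_eqI)
    moreover have "- x \<notin> interior K"
      using symmetric_interior[OF K_sym, of "-x"] \<open>x \<notin> interior K\<close> by auto
    ultimately show ?thesis using K_closed by (auto simp: frontier_def)
  qed
  moreover have "- x \<notin> cone v" if "v \<in> hexroots" for v
    using cone_uminus[of "-x" v] True hexroots_uminus[OF that] by (auto simp: kept_boundary_def)
  ultimately show ?thesis unfolding new_boundary_def kept_boundary_def by auto
next
  case False
  then obtain v t where vt: "v \<in> hexroots" "t \<in> {-\<sigma>..\<sigma>}" "x = new_arc v t" using assms by (auto simp: new_boundary_def)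
  have "- x = new_arc (- v) t" unfolding vt(3) by (simp add: new_arc_def algebra_simps)
  then have "- x \<in> new_arc (- v) ` {-\<sigma>..\<sigma>}" using vt(2) by blast
  then show ?thesis using hexroots_uminus[OF vt(1)] unfolding new_boundary_def by blast
qed

lemma K'_sym: "uminus ` K' = K'"
proof -
  have "uminus ` new_boundary = new_boundary" using new_boundary_uminus by (metis image_subsetI minus_minus subset_antisym subset_image_iff subsetI image_eqI)
  moreover have "linear (uminus :: complex \<Rightarrow> complex)" by (intro linearI) auto
  ultimately show ?thesis unfolding K'_def by (metis convex_hull_linear_image)
qed

lemma ray_meets_new_boundary:
  assumes "x \<noteq> 0" shows "\<exists>r>0. r *\<^sub>R x \<in> new_boundary \<and> (\<forall>v\<in>hexroots. x \<in> cone v \<longrightarrow> r *\<^sub>R x \<in> new_arc v ` {-\<sigma>..\<sigma>})"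
proof (cases "\<exists>v\<in>hexroots. x \<in> cone v")
  case True
  then obtain v where v: "v \<in> hexroots" and x: "x \<in> cone v" by auto
  note nv = hexroots_norm[OF v]
  have "continuous_on {-\<sigma>..\<sigma>} (\<lambda>t. cr x (new_arc v t))"
    using deriv_cr_new_arc[OF nv] by (intro DERIV_continuous_on) (auto intro: has_field_derivative_at_within)
  moreover have "cr x (new_arc v (-\<sigma>)) \<le> 0" "0 \<le> cr x (new_arc v \<sigma>)"
    using x cone_iff[OF nv, of x] cr_commute[of x] unfolding new_arc_end ea_def eb_def by (simp_all add: less_imp_le)
  ultimately obtain t where t: "t \<in> {-\<sigma>..\<sigma>}" "cr x (new_arc v t) = 0"
    using IVT'[of "\<lambda>t. cr x (new_arc v t)" "-\<sigma>" 0 \<sigma>] s_pos by (auto simp: atLeastAtMost_iff)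
  let ?p = "new_arc v t" and ?u = "(1 / norm x) *\<^sub>R x"
  have nx: "norm x > 0" using assms by simp
  have nu: "norm ?u = 1" using nx by simp
  have "?u - v = (1 / norm x) *\<^sub>R (x - norm x *\<^sub>R v)" using nx by (simp add: algebra_simps)
  then have e: "norm (?u - v) = norm (x - norm x *\<^sub>R v) / norm x" using nx by simp
  have uv: "norm (?u - v) \<le> 1/16"
    unfolding e using cone_near(2)[OF x nv] nx by (simp add: pos_divide_le_eq)
  have pd: "?p = (?p \<bullet> ?u) *\<^sub>R ?u"
    by (rule parallel_to_unit[OF _ nu]) (simp add: cr_bilinear t(2))
  have "1/2 < ?p \<bullet> ?u" by (rule inner_near_unit[OF nv new_arc_near[OF t(1) nv]]) (use uv in linarith)
  then have pos: "0 < ?p \<bullet> ?u" by linarith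
  define r where "r = (?p \<bullet> ?u) / norm x"
  have rx: "r *\<^sub>R x = ?p" using pd unfolding r_def by simp
  have only: "w = v" if "w \<in> hexroots" "x \<in> cone w" for w using cones_disjoint[OF v that(1)] x that by auto
  have in_arc: "r *\<^sub>R x \<in> new_arc v ` {-\<sigma>..\<sigma>}" unfolding rx using t(1) by simp
  have "0 < r" unfolding r_def by (rule divide_pos_pos[OF pos nx])
  moreover have "r *\<^sub>R x \<in> new_boundary" using in_arc v unfolding new_boundary_def by blast
  moreover have "\<forall>w\<in>hexroots. x \<in> cone w \<longrightarrow> r *\<^sub>R x \<in> new_arc w ` {-\<sigma>..\<sigma>}" using only in_arc by blast
  ultimately show ?thesis by blast
next
  case False
  obtain d where d: "0 < d" "0 + d *\<^sub>R x \<in> frontier K"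
    using ray_to_frontier[OF compact_imp_bounded[OF K_compact] K_zero assms] by metis
  have "d *\<^sub>R x \<notin> cone v" if v: "v \<in> hexroots" for v
  proof
    assume "d *\<^sub>R x \<in> cone v"
    from cone_scale[OF this, of "1/d"] False v d(1) show False by auto
  qed
  then show ?thesis using d False unfolding new_boundary_def kept_boundary_def by (intro exI[of _ d]) auto
qed

lemma K'_interior: "0 \<in> interior K'"
proof (rule zero_in_interior[OF K'_basic(1) K'_sym])
  show "interior K' \<noteq> {}"
  proof
    assume "interior K' = {}"
    then obtain a b where a: "a \<noteq> 0" "K' \<subseteq> {x. a \<bullet> x = b}"
      using empty_interior_subset_hyperplane[OF K'_basic(1)] by metis
    obtain r where r: "r > 0" "r *\<^sub>R a \<in> new_boundary" using ray_meets_new_boundary[OF a(1)] by auto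
    then have "r *\<^sub>R a \<in> K'" "- (r *\<^sub>R a) \<in> K'" using new_boundary_uminus K'_basic(3) by auto
    then have "a \<bullet> (r *\<^sub>R a) = b" "a \<bullet> (- (r *\<^sub>R a)) = b" using a(2) by auto
    then have "r * (a \<bullet> a) = 0" by simp
    then show False using r a by simp
  qed
qed

text \<open>The new curve stays in the wedge between the tangents at its endpoints.\<close>

lemma new_arc_wedge:
  assumes t: "t \<in> {-\<sigma>..\<sigma>}" and v: "norm v = 1"
  shows "new_arc v t \<bullet> ea v \<le> 1" "new_arc v t \<bullet> eb v \<le> 1" "0 \<le> new_arc v t \<bullet> ea v" "0 \<le> new_arc v t \<bullet> eb v"
    "cr (eb v) (new_arc v t) \<le> 0" "0 \<le> cr (ea v) (new_arc v t)"
proof -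
  have cri: "cr (\<i> * x) y = - (y \<bullet> x)" for x y by (simp add: cr_def inner_complex_def)
  have i: "new_arc' v \<sigma> = \<i> * eb v" "new_arc' v (-\<sigma>) = \<i> * ea v" by (simp_all add: new_arc'_end ea_def eb_def)
  have e: "new_arc v \<sigma> = eb v" "new_arc v (-\<sigma>) = ea v" by (simp_all add: new_arc_end ea_def eb_def)
  have ee: "eb v \<bullet> eb v = 1" "ea v \<bullet> ea v = 1" using ea_eb_norm[OF v] by (simp_all add: dot_square_norm)
  have sm: "\<sigma> \<in> {-\<sigma>..\<sigma>}" "-\<sigma> \<in> {-\<sigma>..\<sigma>}" using s_pos by auto
  show "new_arc v t \<bullet> eb v \<le> 1" using new_arc_supporting[OF t sm(1) v] unfolding i e cri ee by simp
  show "new_arc v t \<bullet> ea v \<le> 1" using new_arc_supporting[OF t sm(2) v] unfolding i e cri ee by simp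
  have near: "norm (eb v - v) \<le> 1/8" "norm (ea v - v) \<le> 1/8"
    using new_arc_near[OF sm(1) v] new_arc_near[OF sm(2) v] by (simp_all add: e)
  have pos: "0 \<le> p \<bullet> q" if "norm (p - v) \<le> 1/8" "norm (q - v) \<le> 1/8" for p q
    using inner_near_unit[OF v that] by simp
  show "0 \<le> new_arc v t \<bullet> ea v" "0 \<le> new_arc v t \<bullet> eb v" using pos new_arc_near[OF t v] near by auto
  have pos': "0 \<le> cr q p'" if "norm (p' - \<i> * v) \<le> 1/8" "norm (q - v) \<le> 1/8" for p' q
  proof -
    have "cr q p' = (- \<i> * p') \<bullet> q" by (simp add: cr_def inner_complex_def)
    moreover have "norm (- \<i> * p' - v) = norm (- \<i> * (p' - \<i> * v))" by (simp add: algebra_simps)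
    then have "norm (- \<i> * p' - v) \<le> 1/8" using that(1) by (simp add: norm_mult)
    ultimately show ?thesis using pos[of "- \<i> * p'" q] that(2) by simp
  qed
  show "cr (eb v) (new_arc v t) \<le> 0"
  proof -
    have "cr (eb v) (new_arc v t) \<le> cr (eb v) (new_arc v \<sigma>)"
    proof (rule DERIV_nonneg_imp_nondecreasing[of t \<sigma> "\<lambda>s. cr (eb v) (new_arc v s)"])
      fix x assume "t \<le> x" "x \<le> \<sigma>"
      then show "\<exists>y. ((\<lambda>s. cr (eb v) (new_arc v s)) has_real_derivative y) (at x) \<and> y \<ge> 0"
        using deriv_cr_new_arc[OF v, of "eb v" x] pos'[OF new_arc'_near[OF _ v] near(1), of x] t by auto
    qed (use t in auto)
    then show ?thesis by (simp add: e cr_bilinear)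
  qed
  show "0 \<le> cr (ea v) (new_arc v t)"
  proof -
    have "cr (ea v) (new_arc v (-\<sigma>)) \<le> cr (ea v) (new_arc v t)"
    proof (rule DERIV_nonneg_imp_nondecreasing[of "-\<sigma>" t "\<lambda>s. cr (ea v) (new_arc v s)"])
      fix x assume "-\<sigma> \<le> x" "x \<le> t"
      then show "\<exists>y. ((\<lambda>s. cr (ea v) (new_arc v s)) has_real_derivative y) (at x) \<and> y \<ge> 0"
        using deriv_cr_new_arc[OF v, of "ea v" x] pos'[OF new_arc'_near[OF _ v] near(2), of x] t by auto
    qed (use t in auto)
    then show ?thesis by (simp add: e cr_bilinear)
  qed
qed

text \<open>Write \<open>n\<close> in the orthonormal basis at one of the two ends of the arc. A normal between the two
  end normals is maximal, on the part of the wedge outside the cone, at one of the ends.\<close>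

lemma outside_cone_le:
  assumes v: "norm v = 1" and x: "x \<notin> cone v" "x \<bullet> ea v \<le> 1" "x \<bullet> eb v \<le> 1"
    and n: "0 \<le> n \<bullet> ea v" "0 \<le> n \<bullet> eb v" "0 \<le> cr (ea v) n" "cr (eb v) n \<le> 0"
  shows "n \<bullet> x \<le> n \<bullet> ea v \<or> n \<bullet> x \<le> n \<bullet> eb v"
proof (cases "cr (ea v) x > 0")
  case False
  have "n \<bullet> x = (n \<bullet> ea v) * (x \<bullet> ea v) + cr (ea v) n * cr (ea v) x"
    by (rule inner_rotate[OF ea_eb_norm(1)[OF v]])
  also have "\<dots> \<le> (n \<bullet> ea v) * 1 + 0"
    using False x n by (intro add_mono mult_left_mono mult_nonneg_nonpos) auto
  finally show ?thesis by simp
next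
  case True
  then have "cr (eb v) x \<ge> 0" using x cone_iff[OF v] by auto
  have "n \<bullet> x = (n \<bullet> eb v) * (x \<bullet> eb v) + cr (eb v) n * cr (eb v) x"
    by (rule inner_rotate[OF ea_eb_norm(2)[OF v]])
  also have "\<dots> \<le> (n \<bullet> eb v) * 1 + 0"
    using \<open>cr (eb v) x \<ge> 0\<close> x n by (intro add_mono mult_left_mono mult_nonpos_nonneg) auto
  finally show ?thesis by simp
qed

text \<open>The tangent of a new arc supports all of the new curve: the same arc by convexity, and the
  rest because it lies outside the cone and below the two end tangents.\<close>

lemma support_new_arc:
  assumes v: "v \<in> hexroots" and t: "t \<in> {-\<sigma>..\<sigma>}"
  shows "\<exists>n. 0 < n \<bullet> new_arc v t \<and> (\<forall>x\<in>new_boundary. n \<bullet> x \<le> n \<bullet> new_arc v t)"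
proof -
  note nv = hexroots_norm[OF v]
  define n where "n = - \<i> * new_arc' v t"
  have nx: "n \<bullet> x = - cr (new_arc' v t) x" for x by (simp add: n_def cr_def inner_complex_def)
  have nn: "norm (n - v) \<le> 1/8"
  proof -
    have "norm (n - v) = norm (- \<i> * (new_arc' v t - \<i> * v))" by (simp add: n_def algebra_simps)
    then show ?thesis using new_arc'_near[OF t nv] by (simp add: norm_mult)
  qed
  have sm: "\<sigma> \<in> {-\<sigma>..\<sigma>}" "-\<sigma> \<in> {-\<sigma>..\<sigma>}" using s_pos by auto
  have e: "new_arc v \<sigma> = eb v" "new_arc v (-\<sigma>) = ea v" by (simp_all add: new_arc_end ea_def eb_def)
  have i: "new_arc' v \<sigma> = \<i> * eb v" "new_arc' v (-\<sigma>) = \<i> * ea v" by (simp_all add: new_arc'_end ea_def eb_def)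
  note pos = inner_near_unit[OF nv]
  have near: "norm (eb v - v) \<le> 1/8" "norm (ea v - v) \<le> 1/8"
    using new_arc_near[OF sm(1) nv] new_arc_near[OF sm(2) nv] by (simp_all add: e)
  have n_a: "0 \<le> n \<bullet> ea v" "0 \<le> n \<bullet> eb v" using pos[OF nn near(2)] pos[OF nn near(1)] by auto
  have n_c: "0 \<le> cr (ea v) n" "cr (eb v) n \<le> 0"
  proof -
    have 1: "cr (\<i> * a) (new_arc' v t) = cr a n" "cr (new_arc' v t) (\<i> * a) = - cr a n" for a
      by (simp_all add: n_def cr_def)
    show "0 \<le> cr (ea v) n" using new_arc'_turns_left[OF t sm(2) _ nv] t unfolding i 1 by simp
    show "cr (eb v) n \<le> 0" using new_arc'_turns_left[OF sm(1) t _ nv] t unfolding i 1 by simp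
  qed
  have arc: "n \<bullet> new_arc v s \<le> n \<bullet> new_arc v t" if "s \<in> {-\<sigma>..\<sigma>}" for s
    unfolding nx using new_arc_supporting[OF that t nv] by simp
  have far: "n \<bullet> x \<le> n \<bullet> new_arc v t" if "x \<notin> cone v" "x \<bullet> ea v \<le> 1" "x \<bullet> eb v \<le> 1" for x
    using outside_cone_le[OF nv that n_a n_c] arc[OF sm(1)] arc[OF sm(2)] unfolding e by auto
  have "n \<bullet> x \<le> n \<bullet> new_arc v t" if x: "x \<in> new_boundary" for x
  proof (cases "x \<in> kept_boundary")
    case True
    then have "x \<in> K" "x \<notin> cone v" using frontier_in_K v by (auto simp: kept_boundary_def)
    then show ?thesis using far arc_tangent[OF v, of _ x] s_less s_pos unfolding ea_def eb_def by simp
  next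
    case False
    then obtain w s where w: "w \<in> hexroots" "s \<in> {-\<sigma>..\<sigma>}" "x = new_arc w s" using x by (auto simp: new_boundary_def)
    show ?thesis
    proof (cases "w = v")
      case True then show ?thesis using arc w by simp
    next
      case False
      note nw = hexroots_norm[OF w(1)]
      have xw: "norm (x - w) \<le> 1/8" using new_arc_near[OF w(2) nw] w by simp
      have "x \<bullet> p \<le> 1" if "norm (p - v) \<le> 1/8" for p
      proof -
        have "x \<bullet> p = w \<bullet> v + (x - w) \<bullet> v + w \<bullet> (p - v) + (x - w) \<bullet> (p - v)"
          by (simp add: inner_diff_left inner_diff_right inner_commute)
        moreover have "w \<bullet> v \<le> 1/2" using hexroots_inner[OF w(1) v False] .
        moreover have "\<bar>(x - w) \<bullet> v\<bar> \<le> 1/8" "\<bar>w \<bullet> (p - v)\<bar> \<le> 1/8"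
          using Cauchy_Schwarz_ineq2[of "x - w" v] Cauchy_Schwarz_ineq2[of w "p - v"] that nv nw xw by auto
        moreover have "\<bar>(x - w) \<bullet> (p - v)\<bar> \<le> 1/8 * (1/8)"
          by (rule order_trans[OF Cauchy_Schwarz_ineq2]) (use that xw in \<open>intro mult_mono\<close>, auto)
        ultimately show ?thesis by linarith
      qed
      then show ?thesis using far not_in_other_cone[OF v w(1) _ xw] False near by auto
    qed
  qed
  moreover have "0 < n \<bullet> new_arc v t" using pos[OF nn new_arc_near[OF t nv]] by simp
  ultimately show ?thesis by blast
qed

text \<open>A supporting line of \<open>K\<close> supports the new arcs as well. If its normal does not point into the
  cone of an arc, then this is seen at one end of the arc. If it did, then the normal would be
  at least as large at an end of the arc as at the point of support, and larger still at the
  point of the arc in its own direction.\<close>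

lemma support_old:
  assumes s: "s \<in> kept_boundary"
  shows "\<exists>n. 0 < n \<bullet> s \<and> (\<forall>x\<in>new_boundary. n \<bullet> x \<le> n \<bullet> s)"
proof -
  have sf: "s \<in> frontier K" using s by (simp add: kept_boundary_def)
  obtain m where m: "m \<noteq> 0" "\<And>y. y \<in> K \<Longrightarrow> m \<bullet> y \<le> m \<bullet> s"
    using frontier_support[OF sf] by blast
  have ms: "m \<bullet> s > 0"
  proof -
    obtain e where e: "e > 0" "ball 0 e \<subseteq> K" using K_zero by (meson mem_interior)
    have "(e / 2 / norm m) *\<^sub>R m \<in> ball 0 e" using m(1) e(1) by simp
    then have "m \<bullet> ((e / 2 / norm m) *\<^sub>R m) \<le> m \<bullet> s" using m(2) e(2) by blast
    moreover have "m \<bullet> ((e / 2 / norm m) *\<^sub>R m) > 0" using m(1) e(1) by simp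
    ultimately show ?thesis by linarith
  qed
  define n where "n = (1 / (m \<bullet> s)) *\<^sub>R m"
  have ns: "n \<bullet> s = 1" using ms by (simp add: n_def)
  have nK: "n \<bullet> y \<le> 1" if "y \<in> K" for y using m(2)[OF that] ms by (simp add: n_def)
  have "n \<bullet> x \<le> 1" if x: "x \<in> new_boundary" for x
  proof (cases "x \<in> kept_boundary")
    case True then show ?thesis using nK frontier_in_K by (auto simp: kept_boundary_def)
  next
    case False
    then obtain v t where v: "v \<in> hexroots" and t: "t \<in> {-\<sigma>..\<sigma>}" and xp: "x = new_arc v t" using x by (auto simp: new_boundary_def)
    note nv = hexroots_norm[OF v]
    note W = new_arc_wedge[OF t nv]
    have ab: "ea v \<in> K" "eb v \<in> K"
      using arcs[OF v] s_less s_pos frontier_in_K unfolding ea_def eb_def by (auto simp: subset_iff)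
    have side: "n \<bullet> x \<le> 1" if e: "norm e = 1" "e \<in> K" "x \<bullet> e \<le> 1" "0 \<le> x \<bullet> e" "cr e n * cr e x \<le> 0" for e
    proof -
      have "n \<bullet> x = (n \<bullet> e) * (x \<bullet> e) + cr e n * cr e x" by (rule inner_rotate[OF e(1)])
      also have "\<dots> \<le> (n \<bullet> e) * (x \<bullet> e)" using e by simp
      also have "\<dots> \<le> 1 * (x \<bullet> e)" using nK[OF e(2)] e by (intro mult_right_mono) auto
      finally show ?thesis using e by simp
    qed
    consider "cr (eb v) n \<ge> 0" | "cr (ea v) n \<le> 0" | "n \<in> cone v" using cone_iff[OF nv, of n] by linarith
    then show ?thesis
    proof cases
      case 1
      show ?thesis
        by (rule side[OF ea_eb_norm(2)[OF nv] ab(2)]) (use W 1 xp in \<open>auto simp: mult_nonneg_nonpos\<close>)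
    next
      case 2
      show ?thesis
        by (rule side[OF ea_eb_norm(1)[OF nv] ab(1)]) (use W 2 xp in \<open>auto simp: mult_nonpos_nonneg\<close>)
    next
      case 3
      obtain r d where n: "n = r *\<^sub>R (v * cis d)" "r > 0" "\<bar>d\<bar> < \<sigma>" using 3 unfolding cone_def by auto
      have "v * cis d \<in> K" using arcs[OF v, of d] n s_less frontier_in_K by auto
      from nK[OF this] have r1: "r \<le> 1" using inner_v_cis[OF nv, of d d] by (simp add: n)
      have sK: "s \<in> K" "s \<notin> cone v" using s frontier_in_K v by (auto simp: kept_boundary_def)
      have se: "s \<bullet> ea v \<le> 1" "s \<bullet> eb v \<le> 1"
        using arc_tangent[OF v _ sK(1)] s_less s_pos unfolding ea_def eb_def by auto
      have ne: "n \<bullet> ea v = r * cos (d + \<sigma>)" "n \<bullet> eb v = r * cos (d - \<sigma>)"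
        unfolding n(1) ea_def eb_def using inner_v_cis[OF nv, of d "-\<sigma>"] inner_v_cis[OF nv, of d \<sigma>] by simp_all
      have "cos (d + \<sigma>) \<ge> 0" "cos (d - \<sigma>) \<ge> 0" using n s_lt_pi by (auto intro!: cos_ge_zero)
      moreover have "cos (d + \<sigma>) < 1" "cos (d - \<sigma>) < 1"
        using cos_monotone_0_pi[of 0 "d + \<sigma>"] cos_monotone_0_pi[of 0 "\<sigma> - d"] cos_minus[of "d - \<sigma>"] n s_lt_pi by auto
      ultimately have small: "0 \<le> n \<bullet> ea v" "0 \<le> n \<bullet> eb v" "n \<bullet> ea v < 1" "n \<bullet> eb v < 1"
        unfolding ne using n(2) r1 by (auto, (smt (verit) mult_le_cancel_right1 mult_less_cancel_left2)+)
      have "0 \<le> cr (ea v) n" "cr (eb v) n \<le> 0" using 3 cone_iff[OF nv, of n] by auto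
      from outside_cone_le[OF nv sK(2) se small(1,2) this] ns small(3,4) show ?thesis by simp
    qed
  qed
  then show ?thesis using ns by (intro exI[of _ n]) auto
qed

lemma new_boundary_frontier: "new_boundary \<subseteq> frontier K'"
proof
  fix s assume s: "s \<in> new_boundary"
  then obtain n where n: "0 < n \<bullet> s" "\<forall>x\<in>new_boundary. n \<bullet> x \<le> n \<bullet> s"
    using support_old support_new_arc unfolding new_boundary_def by blast
  have "new_boundary \<subseteq> {x. n \<bullet> x \<le> n \<bullet> s}" using n by auto
  then have K'n: "K' \<subseteq> {x. n \<bullet> x \<le> n \<bullet> s}"
    unfolding K'_def by (intro hull_minimal) (auto simp: convex_halfspace_le)
  have "s \<notin> interior K'"
  proof
    assume "s \<in> interior K'"
    then obtain e where e: "e > 0" "ball s e \<subseteq> K'" by (meson mem_interior)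
    have s0: "s \<noteq> 0" using n by auto
    have "s + (e / 2 / norm s) *\<^sub>R s \<in> ball s e" using s0 e by (simp add: dist_norm)
    then have "n \<bullet> (s + (e / 2 / norm s) *\<^sub>R s) \<le> n \<bullet> s" using e K'n by auto
    then have "(e / 2 / norm s) * (n \<bullet> s) \<le> 0" by (simp add: inner_add_right)
    moreover have "0 < (e / 2 / norm s) * (n \<bullet> s)" using n e s0 by (intro mult_pos_pos) auto
    ultimately show False by simp
  qed
  moreover have "s \<in> closure K'" using s K'_basic(3) closure_subset by blast
  ultimately show "s \<in> frontier K'" by (simp add: frontier_def)
qed

text \<open>Each ray from the interior point \<open>0\<close> meets the new curve and meets the frontier only once.\<close>

lemma frontier_K': "frontier K' = new_boundary"
proof
  show "frontier K' \<subseteq> new_boundary"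
  proof
    fix x assume x: "x \<in> frontier K'"
    then have x0: "x \<noteq> 0" using K'_interior by (auto simp: frontier_def)
    obtain r where r: "r > 0" "r *\<^sub>R x \<in> new_boundary" using ray_meets_new_boundary[OF x0] by auto
    have rf: "r *\<^sub>R x \<in> frontier K'" using r new_boundary_frontier by auto
    have "r = 1" by (rule frontier_ray_unique[OF K'_basic(1) K'_interior K'_basic(2) x rf r(1)])
    then show "x \<in> new_boundary" using r by simp
  qed
qed (rule new_boundary_frontier)

lemma K'_subset_sectors:
  "K' \<subseteq> insert 0 (K - (\<Union>v\<in>hexroots. cone v)) \<union> (\<Union>v\<in>hexroots. {r *\<^sub>R new_arc v t | r t. r \<in> {0..1} \<and> t \<in> {-\<sigma>..\<sigma>}})"
proof
  fix x assume x: "x \<in> K'"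
  show "x \<in> insert 0 (K - (\<Union>v\<in>hexroots. cone v)) \<union> (\<Union>v\<in>hexroots. {r *\<^sub>R new_arc v t | r t. r \<in> {0..1} \<and> t \<in> {-\<sigma>..\<sigma>}})"
  proof (cases "x = 0")
    case False
    obtain r where r: "r > 0" "r *\<^sub>R x \<in> new_boundary" "\<forall>v\<in>hexroots. x \<in> cone v \<longrightarrow> r *\<^sub>R x \<in> new_arc v ` {-\<sigma>..\<sigma>}"
      using ray_meets_new_boundary[OF False] by auto
    have "1 \<le> r" using ray_factor_ge_one[OF K'_basic(1) K'_interior x, of r] r new_boundary_frontier by (auto simp: frontier_def)
    then have r1: "0 \<le> 1 / r" "1 / r \<le> 1" by auto
    show ?thesis
    proof (cases "\<exists>v\<in>hexroots. x \<in> cone v")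
      case True
      then obtain v where v: "v \<in> hexroots" "x \<in> cone v" by auto
      then obtain t where t: "t \<in> {-\<sigma>..\<sigma>}" "r *\<^sub>R x = new_arc v t" using r(3) by auto
      have "x = (1/r) *\<^sub>R new_arc v t" using t(2)[symmetric] r(1) by simp
      then have "x \<in> {r *\<^sub>R new_arc v t | r t. r \<in> {0..1} \<and> t \<in> {-\<sigma>..\<sigma>}}"
        using t(1) r1 by (intro CollectI exI[of _ "1/r"] exI[of _ t]) simp
      then show ?thesis using v(1) by blast
    next
      case no: False
      obtain d where d: "0 < d" "0 + d *\<^sub>R x \<in> frontier K"
        using ray_to_frontier[OF compact_imp_bounded[OF K_compact] K_zero False] by metis
      have "d *\<^sub>R x \<notin> cone v" if v: "v \<in> hexroots" for v
      proof
        assume "d *\<^sub>R x \<in> cone v"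
        from cone_scale[OF this, of "1/d"] no v d(1) show False by auto
      qed
      then have "d *\<^sub>R x \<in> new_boundary" using d unfolding new_boundary_def kept_boundary_def by auto
      then have "1 \<le> d" using ray_factor_ge_one[OF K'_basic(1) K'_interior x, of d] d new_boundary_frontier by (auto simp: frontier_def)
      moreover have "d *\<^sub>R x \<in> K" using d(2) frontier_in_K by auto
      moreover have "0 \<le> 1 / d" "1 / d \<le> 1" using \<open>1 \<le> d\<close> by auto
      ultimately have "(1/d) *\<^sub>R (d *\<^sub>R x) \<in> K"
        using scale_in_convex[OF K_convex subsetD[OF interior_subset K_zero]] by blast
      then have "x \<in> K" using d by simp
      then show ?thesis using no by auto
    qed
  qed auto
qed

lemma sector_subset_K: "v \<in> hexroots \<Longrightarrow> r \<in> {0<..<1} \<Longrightarrow> t \<in> {-\<sigma><..<\<sigma>} \<Longrightarrow> r *\<^sub>R (v * cis t) \<in> K \<inter> cone v"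
proof -
  assume a: "v \<in> hexroots" "r \<in> {0<..<1}" "t \<in> {-\<sigma><..<\<sigma>}"
  have "v * cis t \<in> K" using arcs[OF a(1), of t] a(3) s_less frontier_in_K by auto
  then have "r *\<^sub>R (v * cis t) \<in> K"
    using a K_zero interior_subset by (intro scale_in_convex K_convex) auto
  moreover have "\<bar>t\<bar> < \<sigma>" using a(3) by auto
  ultimately show ?thesis using a unfolding cone_def by auto
qed

text \<open>An inscribed hexagon of \<open>K\<close> with one vertex on a circular arc is the rotated regular one: the
  given area leaves one parameter, and the tangents at the two neighbouring vertices of the
  regular hexagon bound it from both sides. So the hexagons with a vertex on the kept boundary
  have no vertex on a replaced arc, and they survive. A point of a new arc is a vertex of the
  hexagon formed by the six new arcs at the same time.\<close>

lemma inscribed_hexagon_deformed: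
  assumes hexK: "\<And>p. p \<in> frontier K \<Longrightarrow> \<exists>q. q \<in> frontier K \<and> q - p \<in> frontier K \<and> cr p q = sqrt 3 / 2"
    and p: "p \<in> frontier K'"
  shows "\<exists>q. q \<in> K' \<and> q - p \<in> K' \<and> sqrt 3 / 2 \<le> cr p q"
proof -
  have p: "p \<in> new_boundary" using p frontier_K' by simp
  show ?thesis
  proof (cases "p \<in> kept_boundary")
    case True
    then have pf: "p \<in> frontier K" and new_arc: "\<And>v. v \<in> hexroots \<Longrightarrow> p \<notin> cone v" by (auto simp: kept_boundary_def)
    obtain q where q: "q \<in> frontier K" "q - p \<in> frontier K" "cr p q = sqrt 3 / 2" using hexK[OF pf] by auto
    have unit: "(v * cis d) \<bullet> (v * cis d) = 1" if "v \<in> hexroots" for v d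
      using inner_v_cis[OF hexroots_norm[OF that], of d d] by simp
    have parallel: "\<exists>l. y = l *\<^sub>R u" if "cr y u = 0" "u \<bullet> u = 1" for y u
    proof -
      have "cr u y = 0" "norm u = 1" using that cr_commute[of u y] by (simp_all add: norm_eq_1)
      then show ?thesis using parallel_to_unit by blast
    qed
    have tan: "x \<bullet> (w * cis d) \<le> 1" if "w \<in> hexroots" "\<bar>d\<bar> < \<sigma>" "x \<in> frontier K" for x w d
      using arc_tangent[OF that(1), of d x] that s_less frontier_in_K by auto
    have not_arc: "w * cis d \<noteq> p" if "w \<in> hexroots" "\<bar>d\<bar> < \<sigma>" for w d
    proof
      assume "w * cis d = p"
      then have "p = 1 *\<^sub>R (w * cis d)" by simp
      then have "p \<in> cone w" unfolding cone_def using that(2) zero_less_one by blast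
      then show False using new_arc[OF that(1)] by simp
    qed
    have conj_root: "cnj hexroot = 1 - hexroot" by (simp add: complex_eq_iff hexroot_simps)
    have pred: "v * (1 - hexroot) \<in> hexroots" if "v \<in> hexroots" for v
    proof -
      have "v * hexroot * hexroot \<in> hexroots" using hexroots_mult that by blast
      then have "- (v * hexroot * hexroot) \<in> hexroots" by (rule hexroots_uminus)
      moreover have "- (v * hexroot * hexroot) = v * (1 - hexroot)"
        unfolding mult.assoc hexroot_sq by (simp add: algebra_simps)
      ultimately show ?thesis by simp
    qed
    have q_out: "q \<notin> cone v" if v: "v \<in> hexroots" for v
    proof
      assume "q \<in> cone v"
      then obtain d where d: "\<bar>d\<bar> < \<sigma>" "q = v * cis d" using frontier_cone[OF v q(1)] by metis
      define p' where "p' = v * (1 - hexroot) * cis d"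
      define r' where "r' = v * hexroot * cis d"
      have qq: "q \<bullet> q = 1" using unit[OF v] d by simp
      have "cr p' q = sqrt 3 / 2 * (q \<bullet> q)"
        using cr_mult_left[of q "1 - hexroot" 1] unfolding p'_def d(2)
        by (simp add: cr_def[of "1 - hexroot"] hexroot_simps mult.commute mult.left_commute)
      then have "cr (p - p') q = 0" using q(3) qq by (simp add: cr_bilinear)
      then obtain l where l: "p - p' = l *\<^sub>R q" using parallel qq by blast
      have pq: "q \<bullet> p' = 1/2 * (q \<bullet> q)" "q \<bullet> r' = 1/2 * (q \<bullet> q)"
        using inner_mult_left_complex[of q 1 "1 - hexroot"] inner_mult_left_complex[of q 1 hexroot]
        unfolding p'_def r'_def d(2)
        by (simp_all add: inner_complex_def[of 1] hexroot_simps mult.commute mult.left_commute)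
      have "p = p' + l *\<^sub>R q" using l by (simp add: algebra_simps)
      then have "p \<bullet> p' = 1 + l / 2" using unit[OF pred[OF v], of d] pq(1) qq by (simp add: inner_add_left p'_def)
      then have "l \<le> 0" using tan[OF pred[OF v] d(1) pf] by (simp add: p'_def)
      have "q - p = r' - l *\<^sub>R q" using l unfolding p'_def r'_def d(2) by (simp add: algebra_simps)
      then have "(q - p) \<bullet> r' = 1 - l / 2" using unit[OF hexroots_mult[OF v], of d] pq(2) qq by (simp add: inner_diff_left r'_def)
      then have "l \<ge> 0" using tan[OF hexroots_mult[OF v] d(1) q(2)] by (simp add: r'_def)
      then have "p = p'" using l \<open>l \<le> 0\<close> by simp
      then show False using not_arc[OF pred[OF v] d(1)] by (simp add: p'_def)
    qed
    have r_out: "q - p \<notin> cone v" if v: "v \<in> hexroots" for v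
    proof
      assume "q - p \<in> cone v"
      then obtain d where d: "\<bar>d\<bar> < \<sigma>" "q - p = v * cis d" using frontier_cone[OF v q(2)] by metis
      define r where "r = q - p"
      have rd: "r = v * cis d" using d by (simp add: r_def)
      have rf: "r \<in> frontier K" using q by (simp add: r_def)
      define q' where "q' = v * (1 - hexroot) * cis d"
      define p' where "p' = v * (1 - hexroot) * (1 - hexroot) * cis d"
      have rr: "r \<bullet> r = 1" using unit[OF v] rd by simp
      have crpr: "cr p r = sqrt 3 / 2" using q(3) by (simp add: r_def cr_bilinear)
      have h2: "(1 - hexroot) * (1 - hexroot) = - hexroot" using hexroot_sq by (simp add: algebra_simps)
      have p'2: "p' = - (v * hexroot * cis d)" unfolding p'_def using h2 by (simp add: mult.assoc)
      have "cr p' r = sqrt 3 / 2 * (r \<bullet> r)"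
        using cr_mult_left[of r "- hexroot" 1] unfolding p'2 rd
        by (simp add: cr_def[of "- hexroot"] hexroot_simps mult.commute mult.left_commute)
      then have "cr (p - p') r = 0" using crpr rr by (simp add: cr_bilinear)
      then obtain l where l: "p - p' = l *\<^sub>R r" using parallel rr by blast
      have pq: "r \<bullet> q' = 1/2 * (r \<bullet> r)" "r \<bullet> p' = - 1/2 * (r \<bullet> r)"
        using inner_mult_left_complex[of r 1 "1 - hexroot"] inner_mult_left_complex[of r 1 "- hexroot"]
        unfolding q'_def p'2 rd
        by (simp_all add: inner_complex_def[of 1] hexroot_simps mult.commute mult.left_commute)
      have vv: "v * (1 - hexroot) * (1 - hexroot) \<in> hexroots" by (intro pred v)
      have "p = p' + l *\<^sub>R r" using l by (simp add: algebra_simps)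
      then have "p \<bullet> p' = 1 - l / 2" using unit[OF vv, of d] pq(2) rr by (simp add: inner_add_left p'_def)
      then have "l \<ge> 0" using tan[OF vv d(1) pf] by (simp add: p'_def)
      have "q = q' + l *\<^sub>R r" using l unfolding r_def[symmetric] q'_def p'2
        using rd r_def by (simp add: algebra_simps)
      then have "q \<bullet> q' = 1 + l / 2" using unit[OF pred[OF v], of d] pq(1) rr by (simp add: inner_add_left q'_def)
      then have "l \<le> 0" using tan[OF pred[OF v] d(1) q(1)] by (simp add: q'_def)
      then have "p = p'" using l \<open>l \<ge> 0\<close> by simp
      then show False using not_arc[OF vv d(1)] by (simp add: p'_def)
    qed
    have "q \<in> new_boundary" "q - p \<in> new_boundary" using q q_out r_out unfolding new_boundary_def kept_boundary_def by auto
    then show ?thesis using q(3) K'_basic(3) by (intro exI[of _ q]) auto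
  next
    case False
    then obtain v t where v: "v \<in> hexroots" and t: "t \<in> {-\<sigma>..\<sigma>}" and pv: "p = new_arc v t" using p by (auto simp: new_boundary_def)
    define q where "q = new_arc (v * hexroot) t"
    have "q - p = new_arc (v * hexroot * hexroot) t"
    proof -
      have lin: "new_arc a t - new_arc b t = new_arc (a - b) t" for a b by (simp add: new_arc_def algebra_simps)
      have "v * hexroot * hexroot = v * hexroot - v"
        unfolding mult.assoc hexroot_sq by (simp add: algebra_simps)
      then show ?thesis unfolding q_def pv lin by simp
    qed
    moreover have "new_arc w t \<in> new_boundary" if "w \<in> hexroots" for w using that t unfolding new_boundary_def by blast
    ultimately have "q \<in> new_boundary" "q - p \<in> new_boundary" using hexroots_mult v unfolding q_def by simp_all
    moreover have "sqrt 3 / 2 \<le> cr p q"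
    proof -
      (* The real linear map x \<mapsto> rho x + beta cnj x has determinant rho^2 - |beta|^2. *)
      have "cr p q = ((rho t)\<^sup>2 - (norm (beta t))\<^sup>2) * (sqrt 3 / 2)"
      proof -
        have v1: "(Re v)\<^sup>2 + (Im v)\<^sup>2 = 1" using hexroots_norm[OF v] by (simp add: cmod_def)
        have gen: "cr (cis t * (r *\<^sub>R x + b * cnj x)) (cis t * (r *\<^sub>R y + b * cnj y)) = (r\<^sup>2 - (norm b)\<^sup>2) * cr x y" for r b x y
        proof -
          have "cr (cis t * z) (cis t * w) = cr z w" for z w
            using cr_mult_left[of "cis t" z w] by (simp add: dot_square_norm)
          then have "cr (cis t * (r *\<^sub>R x + b * cnj x)) (cis t * (r *\<^sub>R y + b * cnj y))
            = cr (r *\<^sub>R x + b * cnj x) (r *\<^sub>R y + b * cnj y)" .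
          also have "\<dots> = (r\<^sup>2 - (norm b)\<^sup>2) * cr x y"
            unfolding cr_def cmod_power2 by (simp add: power2_eq_square algebra_simps)
          finally show ?thesis .
        qed
        have "cr v (v * hexroot) = ((Re v)\<^sup>2 + (Im v)\<^sup>2) * (sqrt 3 / 2)"
          by (simp add: cr_def hexroot_simps power2_eq_square algebra_simps)
        then show ?thesis unfolding pv q_def new_arc_def gen v1 by simp
      qed
      moreover have "(rho t)\<^sup>2 - (norm (beta t))\<^sup>2 = 1 + ((eps * phi t)\<^sup>2)\<^sup>2 / 4"
        unfolding rho_def beta_def by (simp add: power2_eq_square algebra_simps)
      then have "1 \<le> (rho t)\<^sup>2 - (norm (beta t))\<^sup>2" by simp
      ultimately show ?thesis by (simp add: mult_le_cancel_right1)
    qed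
    ultimately show ?thesis using K'_basic(3) by (intro exI[of _ q]) auto
  qed
qed

end

subsection \<open>The area of the deformed disk\<close>

context arc_disk
begin

lemma cr_new_arc:
  assumes v: "norm v = 1"
  shows "cr (new_arc v t) (new_arc' v t) = 1 - (eps * phi t)\<^sup>2 + (eps * phi t) ^ 4 / 4
    + Im ((2 * \<i> * of_real (rho t) * beta t + of_real (rho t) * (of_real eps * (of_real (phi1 t) - 3 * \<i> * of_real (phi t)) * cis (- 3 * t))
        - of_real (eps\<^sup>2 * phi t * phi1 t) * beta t) * (cnj v)\<^sup>2)"
proof -
  define b where "b = eps * phi t"
  define w where "w = cis (- 3 * t) * (cnj v)\<^sup>2"
  have w1: "(Re w)\<^sup>2 + (Im w)\<^sup>2 = 1"
  proof -
    have "norm w = 1" unfolding w_def using v by (simp add: norm_mult norm_power)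
    then show ?thesis by (metis cmod_power2 one_power2)
  qed
  have vv: "v * cnj v = 1" using v by (simp add: complex_norm_square[symmetric])
  have m: "mm v t = of_real (1 + b\<^sup>2 / 2) + of_real b * w"
    by (simp add: mm_alt b_def w_def)
  have m1: "mm1 v t = of_real (eps * b * phi1 t) + (of_real (eps * phi1 t) - 3 * \<i> * of_real b) * w"
    by (simp add: mm1_def b_def w_def power2_eq_square algebra_simps)
  have "cnj (new_arc v t) * new_arc' v t = (v * cnj v) * (cnj (cis t) * cis t) * (cnj (mm v t) * (\<i> * mm v t + mm1 v t))"
    unfolding new_arc_mm[OF v] new_arc'_def qq_def by (simp add: algebra_simps)
  also have "cnj (cis t) * cis t = 1" by (simp add: cis_cnj cis_mult)
  finally have "cr (new_arc v t) (new_arc' v t) = Im (cnj (mm v t) * (\<i> * mm v t + mm1 v t))"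
    unfolding cr_alt vv by simp
  also have "\<dots> = (1 + b\<^sup>2 / 2)\<^sup>2 - 2 * b\<^sup>2 * ((Re w)\<^sup>2 + (Im w)\<^sup>2)
      + Im ((2 * \<i> * of_real (1 + b\<^sup>2/2) * of_real b + of_real (1 + b\<^sup>2 / 2) * (of_real (eps * phi1 t) - 3 * \<i> * of_real b) - of_real (eps * b * phi1 t * b)) * w)"
  proof -
    have "Im (cnj (of_real A + of_real b * w) * (\<i> * (of_real A + of_real b * w) + (of_real p + (of_real q - 3 * \<i> * of_real b) * w)))
      = A\<^sup>2 - 2 * b\<^sup>2 * ((Re w)\<^sup>2 + (Im w)\<^sup>2)
        + Im ((2 * \<i> * of_real A * of_real b + of_real A * (of_real q - 3 * \<i> * of_real b) - of_real (p * b)) * w)" for A p q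
      by (simp add: power2_eq_square algebra_simps)
    then show ?thesis unfolding m m1 .
  qed
  also have "\<dots> = 1 - b\<^sup>2 + b ^ 4 / 4
      + Im ((2 * \<i> * of_real (1 + b\<^sup>2/2) * of_real b + of_real (1 + b\<^sup>2 / 2) * (of_real (eps * phi1 t) - 3 * \<i> * of_real b) - of_real (eps * b * phi1 t * b)) * w)"
    unfolding w1 by (simp add: power2_eq_square power4_eq_xxxx algebra_simps)
  also have "(2 * \<i> * of_real (1 + b\<^sup>2/2) * of_real b + of_real (1 + b\<^sup>2 / 2) * (of_real (eps * phi1 t) - 3 * \<i> * of_real b) - of_real (eps * b * phi1 t * b)) * w
    = (2 * \<i> * of_real (rho t) * beta t + of_real (rho t) * (of_real eps * (of_real (phi1 t) - 3 * \<i> * of_real (phi t)) * cis (- 3 * t))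
        - of_real (eps\<^sup>2 * phi t * phi1 t) * beta t) * (cnj v)\<^sup>2"
    by (simp add: rho_def beta_def b_def w_def scaleR_conv_of_real power2_eq_square algebra_simps)
  finally show ?thesis unfolding b_def .
qed

text \<open>The terms of first order in the perturbation are multiples of \<open>(cnj v)\<^sup>2\<close>, and these cancel
  over the six roots.\<close>

lemma sum_cr_new_arc: "(\<Sum>v\<in>hexroots. cr (new_arc v t) (new_arc' v t)) = 6 * (1 - (eps * phi t)\<^sup>2 + (eps * phi t) ^ 4 / 4)"
proof -
  define k where "k = 2 * \<i> * of_real (rho t) * beta t + of_real (rho t) * (of_real eps * (of_real (phi1 t) - 3 * \<i> * of_real (phi t)) * cis (- 3 * t))
        - of_real (eps\<^sup>2 * phi t * phi1 t) * beta t"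
  have card: "card hexroots = 6" using sum_hexroots[of "\<lambda>_. 1::nat"] by simp
  have "(\<Sum>v\<in>hexroots. (cnj v)\<^sup>2) = 0"
    unfolding sum_hexroots by (simp add: complex_eq_iff hexroot_simps power2_eq_square)
  then have z: "(\<Sum>v\<in>hexroots. Im (k * (cnj v)\<^sup>2)) = 0"
    by (simp add: Im_sum[symmetric] sum_distrib_left[symmetric] del: times_complex.sel)
  have "(\<Sum>v\<in>hexroots. cr (new_arc v t) (new_arc' v t)) =
     (\<Sum>v\<in>hexroots. (1 - (eps * phi t)\<^sup>2 + (eps * phi t) ^ 4 / 4) + Im (k * (cnj v)\<^sup>2))"
    unfolding k_def by (intro sum.cong refl cr_new_arc hexroots_norm)
  also have "\<dots> = 6 * (1 - (eps * phi t)\<^sup>2 + (eps * phi t) ^ 4 / 4)"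
    unfolding sum.distrib z by (simp add: card)
  finally show ?thesis .
qed

lemma cr_new_arc_nonneg:
  assumes "norm v = 1" "t \<in> {-\<sigma>..\<sigma>}" shows "0 \<le> cr (new_arc v t) (new_arc' v t)"
proof -
  define n where "n = - \<i> * new_arc' v t"
  have nn: "norm (n - v) \<le> 1/8"
  proof -
    have "norm (n - v) = norm (- \<i> * (new_arc' v t - \<i> * v))" by (simp add: n_def algebra_simps)
    then show ?thesis using new_arc'_near[OF assms(2,1)] by (simp add: norm_mult)
  qed
  have np: "norm (new_arc v t - v) \<le> 1/8" using new_arc_near[OF assms(2,1)] .
  have "1/2 < n \<bullet> new_arc v t" by (rule inner_near_unit[OF assms(1) nn np])
  moreover have "n \<bullet> new_arc v t = cr (new_arc v t) (new_arc' v t)" by (simp add: n_def cr_def inner_complex_def)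
  ultimately show ?thesis by simp
qed

definition sector_box :: "(real^2) set" where
  "sector_box = cbox (vector [0, -\<sigma>]) (vector [1, \<sigma>])"

lemma sector_box_iff: "s \<in> sector_box \<longleftrightarrow> 0 \<le> s$1 \<and> s$1 \<le> 1 \<and> -\<sigma> \<le> s$2 \<and> s$2 \<le> \<sigma>"
  by (auto simp: sector_box_def mem_box_cart forall_2)

lemma sector_open_box_iff: "s \<in> box (vector [0, -\<sigma>]) (vector [1, \<sigma>]) \<longleftrightarrow> 0 < s$1 \<and> s$1 < 1 \<and> -\<sigma> < s$2 \<and> s$2 < \<sigma>"
  for s :: "real^2"
  by (auto simp: mem_box_cart forall_2)

lemma polar_derivative:
  fixes T :: "complex \<Rightarrow> real^2" and s :: "real^2"
  assumes T: "linear T" and crT: "\<And>x y. cross2 (T x) (T y) = cr x y"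
    and c: "(c has_vector_derivative c') (at (s$2))"
  shows "((\<lambda>s. T (s$1 *\<^sub>R c (s$2))) has_derivative (\<lambda>h. T (h$1 *\<^sub>R c (s$2) + (s$1 * h$2) *\<^sub>R c'))) (at s within S)"
    and "det (matrix (\<lambda>h. T (h$1 *\<^sub>R c (s$2) + (s$1 * h$2) *\<^sub>R c'))) = s$1 * cr (c (s$2)) c'"
proof -
  have bT: "bounded_linear T" using T by (simp add: linear_conv_bounded_linear)
  have d1: "((\<lambda>s::real^2. s$1) has_derivative (\<lambda>h. h$1)) (at s within S)"
    by (rule bounded_linear_imp_has_derivative[OF bounded_linear_vec_nth])
  have d2: "((\<lambda>s::real^2. s$2) has_derivative (\<lambda>h. h$2)) (at s within S)"
    by (rule bounded_linear_imp_has_derivative[OF bounded_linear_vec_nth])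
  have "(c has_derivative (\<lambda>h. h *\<^sub>R c')) (at (s$2) within (\<lambda>s. s$2) ` S)"
    using c unfolding has_vector_derivative_def by (rule has_derivative_at_withinI)
  from has_derivative_in_compose[OF d2 this]
  have d3: "((\<lambda>s. c (s$2)) has_derivative (\<lambda>h. (h$2) *\<^sub>R c')) (at s within S)" .
  have "((\<lambda>s. s$1 *\<^sub>R c (s$2)) has_derivative (\<lambda>h. s$1 *\<^sub>R (h$2 *\<^sub>R c') + h$1 *\<^sub>R c (s$2))) (at s within S)"
    by (rule has_derivative_scaleR[OF d1 d3])
  from bounded_linear.has_derivative[OF bT this]
  show "((\<lambda>s. T (s$1 *\<^sub>R c (s$2))) has_derivative (\<lambda>h. T (h$1 *\<^sub>R c (s$2) + (s$1 * h$2) *\<^sub>R c'))) (at s within S)"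
    by (simp add: add.commute)
  have "det (matrix (\<lambda>h. T (h$1 *\<^sub>R c (s$2) + (s$1 * h$2) *\<^sub>R c'))) = cross2 (T (c (s$2))) (T (s$1 *\<^sub>R c'))"
    by (simp add: det_2 matrix_def cross2_def axis_def)
  then show "det (matrix (\<lambda>h. T (h$1 *\<^sub>R c (s$2) + (s$1 * h$2) *\<^sub>R c'))) = s$1 * cr (c (s$2)) c'"
    by (simp add: crT cr_bilinear)
qed

lemma continuous_new_arc': "continuous_on UNIV (new_arc' v)"
proof -
  have "continuous_on UNIV (qq v)" "continuous_on UNIV (\<lambda>t::real. cis t)"
    using deriv_qq deriv_cis has_vector_derivative_continuous
    unfolding continuous_on_eq_continuous_within by blast+
  then show ?thesis unfolding new_arc'_def[abs_def] by (intro continuous_on_mult continuous_on_const)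
qed

lemma continuous_new_arc: "norm v = 1 \<Longrightarrow> continuous_on UNIV (new_arc v)"
  using deriv_new_arc has_vector_derivative_continuous unfolding continuous_on_eq_continuous_within by blast

text \<open>Compare the two areas sector by sector: in the coordinates \<open>(r, t) \<mapsto> r p(t)\<close> the Jacobian is
  \<open>r\<close> times the cross product of \<open>p\<close> and \<open>p'\<close>. For the new sectors only an upper bound is
  needed, so there it does not matter whether the coordinates are injective; for the circular
  sectors they are.\<close>

lemma deformed_area_less:
  fixes T :: "complex \<Rightarrow> real^2"
  assumes T: "linear T" and crT: "\<And>x y. cross2 (T x) (T y) = cr x y"
  shows "measure lebesgue (T ` K') < measure lebesgue (T ` K)"
proof -
  let ?B = sector_box
  have bT: "bounded_linear T" using T by (simp add: linear_conv_bounded_linear)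
  have injT: "inj T" and surjT: "surj T"
    using area_preserving_bij[OF T crT] by (simp_all add: bij_is_inj bij_is_surj)
  have cT: "continuous_on S T" for S using bT linear_continuous_on by blast
  define F where "F v s = T (s$1 *\<^sub>R new_arc v (s$2))" for v and s :: "real^2"
  define E where "E v s = T (s$1 *\<^sub>R (v * cis (s$2)))" for v and s :: "real^2"
  define M0 where "M0 = T ` (K - (\<Union>v\<in>hexroots. cone v))"
  define I where "I = integral ?B (\<lambda>s. s$1)"
  let ?b = "\<lambda>t. (eps * phi t)\<^sup>2 - (eps * phi t) ^ 4 / 4"
  let ?G = "\<lambda>v s. s$1 * cr (new_arc v (s$2)) (new_arc' v (s$2))"
  have contG: "continuous_on ?B (?G v)" if "v \<in> hexroots" for v
    unfolding cr_def using hexroots_norm[OF that]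
    by (intro continuous_intros continuous_on_compose2[OF continuous_new_arc] continuous_on_compose2[OF continuous_new_arc']) auto
  have intG: "?G v integrable_on ?B" if "v \<in> hexroots" for v
    using contG[OF that] unfolding sector_box_def by (rule integrable_continuous)
  have Fm: "F v ` ?B \<in> lmeasurable \<and> measure lebesgue (F v ` ?B) \<le> integral ?B (?G v)" if v: "v \<in> hexroots" for v
  proof -
    let ?F' = "\<lambda>s h. T (h$1 *\<^sub>R new_arc v (s$2) + (s$1 * h$2) *\<^sub>R new_arc' v (s$2))"
    note d = polar_derivative[OF T crT deriv_new_arc[OF hexroots_norm[OF v]]]
    have eq: "\<bar>det (matrix (?F' s))\<bar> = ?G v s" if "s \<in> ?B" for s
      unfolding d(2) using that cr_new_arc_nonneg[OF hexroots_norm[OF v], of "s$2"] by (simp add: sector_box_iff)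
    have i: "(\<lambda>s. \<bar>det (matrix (?F' s))\<bar>) integrable_on ?B"
      using intG[OF v] eq by (metis (no_types, lifting) integrable_eq)
    have "?B \<in> sets lebesgue" unfolding sector_box_def by simp
    note m = measurable_differentiable_image[OF this, of "F v" ?F'] measure_differentiable_image[OF this, of "F v" ?F']
    have dF: "(F v has_derivative ?F' s) (at s within ?B)" for s unfolding F_def[abs_def] by (rule d(1))
    have "integral ?B (\<lambda>s. \<bar>det (matrix (?F' s))\<bar>) = integral ?B (?G v)"
      by (rule integral_cong) (rule eq)
    then show ?thesis using m dF i by auto
  qed
  have Em: "E v ` box (vector [0, -\<sigma>]) (vector [1, \<sigma>]) \<in> lmeasurable
      \<and> measure lebesgue (E v ` box (vector [0, -\<sigma>]) (vector [1, \<sigma>])) = I" if v: "v \<in> hexroots" for v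
  proof -
    let ?O = "box (vector [0, -\<sigma>]) (vector [1, \<sigma>]) :: (real^2) set"
    note nv = hexroots_norm[OF v]
    let ?E' = "\<lambda>s h. T (h$1 *\<^sub>R (v * cis (s$2)) + (s$1 * h$2) *\<^sub>R (v * (\<i> * cis (s$2))))"
    note d = polar_derivative[OF T crT has_vector_derivative_mult_right[OF deriv_cis], of v]
    have eq: "\<bar>det (matrix (?E' s))\<bar> = s$1" if "s \<in> ?O" for s
    proof -
      have "cr (v * cis (s$2)) (v * (\<i> * cis (s$2))) = (v * cis (s$2)) \<bullet> (v * cis (s$2))"
        by (simp add: cr_def inner_complex_def algebra_simps)
      then show ?thesis unfolding d(2) using that inner_v_cis[OF nv, of "s$2" "s$2"] by (simp add: sector_open_box_iff)
    qed
    have inj: "inj_on (E v) ?O"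
    proof (rule inj_onI)
      fix s s' :: "real^2" assume s: "s \<in> ?O" "s' \<in> ?O" "E v s = E v s'"
      then have e: "s$1 *\<^sub>R (v * cis (s$2)) = s'$1 *\<^sub>R (v * cis (s'$2))" using injT by (simp add: E_def inj_eq)
      have "norm (s$1 *\<^sub>R (v * cis (s$2))) = norm (s'$1 *\<^sub>R (v * cis (s'$2)))" using e by simp
      then have 1: "s$1 = s'$1" using s nv by (simp add: norm_mult sector_open_box_iff)
      then have "v * cis (s$2) = v * cis (s'$2)" using e s by (simp add: sector_open_box_iff)
      then have "cr (v * cis (s$2)) (v * cis (s'$2)) = 0" by (metis cr_bilinear(7))
      then have s0: "sin (s'$2 - s$2) = 0" using cr_v_cis[OF nv] by simp
      have "\<bar>s'$2 - s$2\<bar> < pi" using s s_lt_pi by (auto simp: sector_open_box_iff abs_if)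
      then have "s'$2 - s$2 = 0" using s0 sin_eq_0_pi[of "s'$2 - s$2"] by linarith
      then show "s = s'" using 1 by (simp add: vec_eq_iff forall_2)
    qed
    have i0: "((\<lambda>s::real^2. s$1) has_integral I) ?O"
    proof -
      have "(\<lambda>s::real^2. s$1) integrable_on ?B"
        unfolding sector_box_def by (intro integrable_continuous continuous_intros)
      then show ?thesis unfolding I_def sector_box_def using has_integral_open_interval by blast
    qed
    have "((\<lambda>s. \<bar>det (matrix (?E' s))\<bar>) has_integral I) ?O"
      using has_integral_eq[OF eq[symmetric] i0] .
    then show ?thesis
      using has_measure_differentiable_image[of ?O "E v" ?E' I] inj d(1)[of _ ?O] unfolding E_def[abs_def] by auto
  qed
  have Tcone: "open (T ` cone v)" if "v \<in> hexroots" for v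
    using open_surjective_linear_image[OF cone_open[OF hexroots_norm[OF that]] T surjT] .
  have TK: "T ` K \<in> lmeasurable"
    using K_compact cT compact_continuous_image lmeasurable_compact by blast
  have TK': "T ` K' \<in> lmeasurable"
    using K'_basic(2) cT compact_continuous_image lmeasurable_compact by blast
  have M0eq: "M0 = T ` K - (\<Union>v\<in>hexroots. T ` cone v)"
    unfolding M0_def using injT by (auto simp: image_set_diff image_UN)
  have M0m: "M0 \<in> lmeasurable"
  proof -
    have "open (\<Union>v\<in>hexroots. T ` cone v)" using Tcone by blast
    from sets_completionI_sets[OF borel_open[OF this, folded sets_lborel]]
    have "(\<Union>v\<in>hexroots. T ` cone v) \<in> sets lebesgue" .
    then show ?thesis unfolding M0eq by (rule fmeasurable_Diff[OF TK])
  qed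
  have "T ` K' \<subseteq> {T 0} \<union> M0 \<union> (\<Union>v\<in>hexroots. F v ` ?B)"
  proof
    fix y assume "y \<in> T ` K'"
    then obtain x where x: "x \<in> K'" "y = T x" by auto
    from subsetD[OF K'_subset_sectors x(1)] consider "x = 0" | "x \<in> K - (\<Union>v\<in>hexroots. cone v)"
      | v r t where "v \<in> hexroots" "x = r *\<^sub>R new_arc v t" "r \<in> {0..1}" "t \<in> {-\<sigma>..\<sigma>}" by blast
    then show "y \<in> {T 0} \<union> M0 \<union> (\<Union>v\<in>hexroots. F v ` ?B)"
    proof cases
      case 3
      have "y = F v (vector [r, t])" unfolding F_def x(2) 3(2) by simp
      moreover have "(vector [r, t] :: real^2) \<in> ?B" using 3 by (simp add: sector_box_iff)
      ultimately show ?thesis using 3(1) by blast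
    qed (auto simp: M0_def x)
  qed
  moreover have UFm: "(\<Union>v\<in>hexroots. F v ` ?B) \<in> lmeasurable" using Fm finite_hexroots by (intro fmeasurable.finite_UN) auto
  moreover have "{T 0} \<in> lmeasurable" by (rule lmeasurable_compact) simp
  ultimately have "measure lebesgue (T ` K') \<le> measure lebesgue ({T 0} \<union> M0 \<union> (\<Union>v\<in>hexroots. F v ` ?B))"
    using TK' M0m by (intro measure_mono_fmeasurable fmeasurable.Un) (auto dest: fmeasurableD)
  also have "\<dots> \<le> measure lebesgue ({T 0} \<union> M0) + measure lebesgue (\<Union>v\<in>hexroots. F v ` ?B)"
    using fmeasurableD[OF M0m] fmeasurableD[OF UFm] fmeasurableD[OF \<open>{T 0} \<in> lmeasurable\<close>]
    by (intro measure_Un_le sets.Un)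
  also have "measure lebesgue ({T 0} \<union> M0) \<le> measure lebesgue {T 0} + measure lebesgue M0"
    using fmeasurableD[OF M0m] fmeasurableD[OF \<open>{T 0} \<in> lmeasurable\<close>] by (intro measure_Un_le)
  also have "measure lebesgue {T 0} = 0" by simp
  also have "measure lebesgue (\<Union>v\<in>hexroots. F v ` ?B) \<le> (\<Sum>v\<in>hexroots. measure lebesgue (F v ` ?B))"
    using Fm finite_hexroots by (intro measure_UNION_le) (auto dest: fmeasurableD)
  also have "\<dots> \<le> (\<Sum>v\<in>hexroots. integral ?B (?G v))" by (intro sum_mono) (use Fm in auto)
  also have "\<dots> = integral ?B (\<lambda>s. \<Sum>v\<in>hexroots. ?G v s)"
    by (rule integral_sum[symmetric]) (use finite_hexroots intG in auto)
  also have "(\<lambda>s. \<Sum>v\<in>hexroots. ?G v s) = (\<lambda>s. 6 * s$1 - 6 * (s$1 * ?b (s$2)))"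
    unfolding sum_distrib_left[symmetric] sum_cr_new_arc by (auto simp: algebra_simps)
  also have "integral ?B (\<lambda>s. 6 * s$1 - 6 * (s$1 * ?b (s$2))) = 6 * I - 6 * integral ?B (\<lambda>s. s$1 * ?b (s$2))"
  proof -
    have "(\<lambda>s::real^2. s$1) integrable_on ?B" "(\<lambda>s::real^2. s$1 * ?b (s$2)) integrable_on ?B"
      unfolding sector_box_def phi_def by (intro integrable_continuous continuous_intros; simp)+
    then show ?thesis unfolding I_def
      by (subst integral_diff) (auto intro: integrable_on_mult_right)
  qed
  finally have up: "measure lebesgue (T ` K') \<le> measure lebesgue M0 + (6 * I - 6 * integral ?B (\<lambda>s. s$1 * ?b (s$2)))" by simp
  have card: "card hexroots = 6" using sum_hexroots[of "\<lambda>_. 1::nat"] by simp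
  let ?O = "box (vector [0, -\<sigma>]) (vector [1, \<sigma>]) :: (real^2) set"
  have Esub: "E v ` ?O \<subseteq> T ` (K \<inter> cone v)" if "v \<in> hexroots" for v
    unfolding E_def using sector_subset_K[OF that] by (auto simp: sector_open_box_iff)
  then have Econe: "E v ` ?O \<subseteq> T ` cone v" if "v \<in> hexroots" for v using that by blast
  have lo: "measure lebesgue M0 + 6 * I \<le> measure lebesgue (T ` K)"
  proof -
    have dj: "pairwise (\<lambda>v w. disjnt (E v ` ?O) (E w ` ?O)) hexroots"
    proof (rule pairwiseI)
      fix v w assume vw: "v \<in> hexroots" "w \<in> hexroots" "v \<noteq> w"
      then have "T ` cone v \<inter> T ` cone w = T ` {}"
        unfolding cones_disjoint[OF vw, symmetric] by (intro image_Int[symmetric] injT)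
      then have "T ` cone v \<inter> T ` cone w = {}" by simp
      then show "disjnt (E v ` ?O) (E w ` ?O)"
        unfolding disjnt_def using Econe[OF vw(1)] Econe[OF vw(2)] by blast
    qed
    have UE: "measure lebesgue (\<Union>v\<in>hexroots. E v ` ?O) = 6 * I"
      using measure_UNION'[OF finite_hexroots _ dj, of lebesgue] Em by (simp add: card)
    have UEm: "(\<Union>v\<in>hexroots. E v ` ?O) \<in> lmeasurable" using Em finite_hexroots by (intro fmeasurable.finite_UN) auto
    have "M0 \<inter> (\<Union>v\<in>hexroots. E v ` ?O) = {}"
      unfolding M0eq using Econe by blast
    then have "measure lebesgue (M0 \<union> (\<Union>v\<in>hexroots. E v ` ?O)) = measure lebesgue M0 + 6 * I"
      unfolding UE[symmetric] using M0m UEm by (intro measure_Un_AE) auto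
    moreover have "M0 \<union> (\<Union>v\<in>hexroots. E v ` ?O) \<subseteq> T ` K" using Esub unfolding M0_def by blast
    ultimately show ?thesis using measure_mono_fmeasurable[OF _ _ TK] M0m UEm
      by (metis fmeasurable.Un fmeasurableD)
  qed
  have b0: "0 \<le> ?b t" if "\<bar>t\<bar> \<le> \<sigma>" for t
  proof -
    have "\<bar>eps * phi t\<bar> \<le> 1" using phi_bounds(1)[OF that] by (simp add: eps_def abs_mult)
    then have "(eps * phi t)\<^sup>2 \<le> 1" by (simp add: abs_square_le_1)
    then have "(eps * phi t)\<^sup>2 * (eps * phi t)\<^sup>2 \<le> (eps * phi t)\<^sup>2 * 1" by (intro mult_left_mono) auto
    moreover have "(eps * phi t) ^ 4 = (eps * phi t)\<^sup>2 * (eps * phi t)\<^sup>2"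
      by (simp only: power_add[symmetric]) simp
    moreover have "0 \<le> (eps * phi t)\<^sup>2" by simp
    ultimately show ?thesis by linarith
  qed
  have "integral ?B (\<lambda>s. s$1 * ?b (s$2)) \<noteq> 0"
  proof
    assume z: "integral ?B (\<lambda>s. s$1 * ?b (s$2)) = 0"
    have c: "continuous_on ?B (\<lambda>s::real^2. s$1 * ?b (s$2))"
      unfolding phi_def by (intro continuous_intros; simp)
    then have "(\<lambda>s::real^2. s$1 * ?b (s$2)) integrable_on ?B"
      unfolding sector_box_def by (rule integrable_continuous)
    from integrable_integral[OF this, unfolded z]
    have hi: "((\<lambda>s. s$1 * ?b (s$2)) has_integral 0) ?B" .
    have nn: "0 \<le> s$1 * ?b (s$2)" if "s \<in> ?B" for s using that b0[of "s$2"] by (simp add: sector_box_iff abs_le_iff)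
    have mem: "(vector [1, 0] :: real^2) \<in> ?B" using s_pos by (simp add: sector_box_iff)
    have "(vector [1/2, 0] :: real^2) \<in> box (vector [0, -\<sigma>]) (vector [1, \<sigma>])"
      using s_pos by (simp add: sector_open_box_iff)
    then have ne: "box (vector [0, -\<sigma>]) (vector [1, \<sigma>]) \<noteq> ({} :: (real^2) set)" by blast
    have "(vector [1, 0] :: real^2)$1 * ?b ((vector [1, 0] :: real^2)$2) = 0"
      by (rule has_integral_0_cbox_imp_0[OF c[unfolded sector_box_def] nn[unfolded sector_box_def, OF subsetD[OF box_subset_cbox]]
          hi[unfolded sector_box_def] ne mem[unfolded sector_box_def]])
    then have "?b 0 = 0" by simp
    then have e: "(eps * phi 0)\<^sup>2 = (eps * phi 0)\<^sup>2 * (eps * phi 0)\<^sup>2 / 4" by (simp add: power4_eq_xxxx power2_eq_square mult.assoc)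
    have p: "eps * phi 0 > 0" using s_pos by (simp add: phi_def eps_def)
    moreover have "q = 4" if "q = q * q / 4" "q > 0" for q :: real using that by simp
    ultimately have "(eps * phi 0)\<^sup>2 = 4" using e by (simp only: zero_less_power)
    moreover have "\<bar>eps * phi 0\<bar> \<le> 1" using phi_bounds(1)[of 0] s_pos by (simp add: eps_def abs_mult)
    then have "(eps * phi 0)\<^sup>2 \<le> 1" by (simp add: abs_square_le_1)
    ultimately show False by simp
  qed
  moreover have "0 \<le> integral ?B (\<lambda>s. s$1 * ?b (s$2))"
    unfolding phi_def[symmetric]
  proof (rule integral_nonneg)
    show "(\<lambda>s::real^2. s$1 * ?b (s$2)) integrable_on ?B"
      unfolding sector_box_def phi_def by (intro integrable_continuous continuous_intros; simp)
    show "0 \<le> s$1 * ?b (s$2)" if "s \<in> ?B" for s using that b0[of "s$2"] by (simp add: sector_box_iff abs_le_iff)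
  qed
  ultimately show ?thesis using up lo by linarith
qed

end

section \<open>The motion along a singular arc\<close>

text \<open>If \<open>lc = 0\<close>, then \<open>\<Lambda>\<close> and \<open>\<nu>\<close> would vanish together with it at some time of the arc, which is
  excluded for an extremal.\<close>

lemma singular_arc_circle:
  assumes pe: "pontryagin_extremal T u g z lc \<Lambda> \<nu>"
    and ab: "a < b" "{a..b} \<subseteq> {0..T}" and sing: "singular_arc a b lc \<Lambda> z \<nu>"
    and t: "t \<in> {a<..<b}"
  shows "X_mat (z t) = J_mat"
proof -
  interpret S: extremal_system T "3/2 * lc" \<Lambda> "\<lambda>t. X_mat (z t)" "\<lambda>t. Zm (\<nu> t) (z t)" "\<lambda>t. Pm (u t)"
    by (rule extremal_system_of_pontryagin(1)[OF pe])
  note vertex_zero = extremal_system_of_pontryagin(2)[OF pe]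
  note vertex_nonneg = extremal_system_of_pontryagin(3)[OF pe]
  have Y: "S.Y s = Ym lc (\<Lambda> s) (z s) (\<nu> s)" for s unfolding S.Y_def S.L_def Ym_def ..
  have sub: "{a<..<b} \<subseteq> {0..T}" using ab(2) by auto
  have hs: "z s \<in> h_star" if "s \<in> {0..T}" for s
    using pe that unfolding pontryagin_extremal_def lifted_trajectory_def admissible_trajectory_def by blast
  have two: "\<exists>Q\<in>verts. \<exists>Q'\<in>verts. Q \<noteq> Q' \<and> trace_form (S.Y s) Q = 0 \<and> trace_form (S.Y s) Q' = 0"
    if s: "s \<in> {a<..<b}" for s
  proof -
    have s0: "s \<in> {0..T}" using s sub by blast
    have "0 < aff_dim (maximizing_face lc (\<Lambda> s) (z s) (\<nu> s))"
      using sing s unfolding singular_arc_def by simp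
    from face_two_vertices[OF hs[OF s0] vertex_nonneg[OF s0] vertex_zero[OF s0] this] show ?thesis
      unfolding Y .
  qed
  have Y0: "S.Y s = 0" if s: "s \<in> {a<..<b}" for s by (rule S.singular_Y_zero[OF sub two s])
  have lc: "lc \<noteq> 0"
  proof
    assume lc0: "lc = 0"
    then have "3/2 * lc = 0" by simp
    from S.Y_zero_circle(1)[OF ab(1) sub Y0 this] obtain s where
      s: "s \<in> {a<..<b}" "\<Lambda> s = 0" "Zm (\<nu> s) (z s) = 0" by blast
    have s0: "s \<in> {0..T}" using s sub by blast
    have im: "Im (z s) > 0" using hs[OF s0] by (simp add: h_star_def upper_half_plane_def)
    have n1: "\<nu> s $ 1 = 0" using Zm_entries(3)[of "\<nu> s" "z s"] s(3) by simp
    have "\<nu> s $ 2 = 0" using Zm_entries(1)[of "\<nu> s" "z s"] s(3) n1 im by simp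
    then have "\<nu> s = 0" using n1 by (simp add: vec_eq_iff forall_2)
    then have "(lc, \<Lambda> s, \<nu> s) = 0" using lc0 s(2) by (simp add: zero_prod_def)
    then show False using pe s0 unfolding pontryagin_extremal_def by blast
  qed
  then have "3/2 * lc \<noteq> 0" by simp
  from S.Y_zero_circle(2)[OF ab(1) sub Y0 this t]
  have X: "X_mat (z t)$1$1 = 0" "X_mat (z t)$2$1 = 1" by auto
  then have "Im (z t) = 1" "Re (z t) = 0" by (simp_all add: X_mat_entries)
  then show ?thesis by (simp add: vec_eq_iff forall_2 X_mat_entries J_mat_entries)
qed

text \<open>The function \<open>g t ** rotm (cis (- t))\<close> is Lipschitz with derivative \<open>0\<close> almost everywhere.\<close>

lemma rotation_of_circle:
  fixes g :: "real \<Rightarrow> real^2^2"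
  assumes lg: "\<And>i j. lip {a..b} (\<lambda>t. g t $ i $ j)" and N: "negligible N"
    and ode: "\<And>t. t \<in> {a..b} - N \<Longrightarrow> (g has_vector_derivative g t ** J_mat) (at t within {a..b})"
    and st: "s \<in> {a..b}" "t \<in> {a..b}"
  shows "g t = g s ** rotm (cis (t - s))"
proof -
  define G where "G t = g t ** rotm (cis (- t))" for t
  have lc: "lip {a..b} cos" unfolding lip_def
  proof (intro exI lipschitz_onI)
    show "dist (cos x) (cos y) \<le> 1 * dist x y" for x y :: real
      using norm_cis_diff[of x y] abs_Re_le_cmod[of "cis x - cis y"] by (simp add: dist_real_def)
  qed simp
  have ls: "lip {a..b} sin" unfolding lip_def
  proof (intro exI lipschitz_onI)
    show "dist (sin x) (sin y) \<le> 1 * dist x y" for x y :: real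
      using norm_cis_diff[of x y] abs_Im_le_cmod[of "cis x - cis y"] by (simp add: dist_real_def)
  qed simp
  have G: "G x $ i $ 1 = g x $ i $ 1 * cos x - g x $ i $ 2 * sin x"
    "G x $ i $ 2 = g x $ i $ 1 * sin x + g x $ i $ 2 * cos x" for x i
    unfolding G_def by (simp_all add: matrix_matrix_mult_def sum_2 rotm_entries)
  have gJ: "(A ** J_mat) $ i $ 1 = A $ i $ 2" "(A ** J_mat) $ i $ 2 = - A $ i $ 1" for A :: "real^2^2" and i
    by (simp_all add: matrix_matrix_mult_def sum_2 J_mat_entries)
  have const: "G y $ i $ j = G x $ i $ j" if xy: "a \<le> x" "x \<le> y" "y \<le> b" for x y i j
  proof -
    have l1: "lip {a..b} (\<lambda>t. G t $ i $ 1)" and l2: "lip {a..b} (\<lambda>t. G t $ i $ 2)"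
      unfolding G by (intro lip_add lip_diff lip_mult lg lc ls)+
    have d: "((\<lambda>t. g t $ i $ 1) has_real_derivative g w $ i $ 2) (at w within {a..b})"
      "((\<lambda>t. g t $ i $ 2) has_real_derivative - g w $ i $ 1) (at w within {a..b})" if "w \<in> {a..b} - N" for w
      using entry_has_derivative[OF ode[OF that], of i 1] entry_has_derivative[OF ode[OF that], of i 2]
      unfolding gJ .
    have d1: "((\<lambda>t. G t $ i $ 1) has_real_derivative 0) (at w within {a..b})"
      and d2: "((\<lambda>t. G t $ i $ 2) has_real_derivative 0) (at w within {a..b})" if "w \<in> {a..b} - N" for w
      unfolding G by (auto intro!: derivative_eq_intros d[OF that])
    have "G y $ i $ 1 = G x $ i $ 1" by (rule lip_constant[OF l1 N xy]) (use d1 xy in auto)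
    moreover have "G y $ i $ 2 = G x $ i $ 2" by (rule lip_constant[OF l2 N xy]) (use d2 xy in auto)
    ultimately have "\<forall>j. G y $ i $ j = G x $ i $ j" by (simp add: forall_2)
    then show ?thesis ..
  qed
  have "G t = G s"
  proof (cases "s \<le> t")
    case True
    have "G t $ i $ j = G s $ i $ j" for i j by (rule const) (use True st in auto)
    then show ?thesis by (simp add: vec_eq_iff)
  next
    case False
    have "G s $ i $ j = G t $ i $ j" for i j by (rule const) (use False st in auto)
    then show ?thesis by (simp add: vec_eq_iff)
  qed
  then have "G t ** rotm (cis t) = G s ** rotm (cis t)" by simp
  then show ?thesis
    unfolding G_def matrix_mul_assoc[symmetric] rotm_mult[symmetric] cis_mult by (simp add: rotm_one)
qed

section \<open>The densities of the two disks\<close>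

text \<open>The packing \<open>v, w\<close> also serves to make the set of densities nonempty: the supremum over the
  empty set would be arbitrary.\<close>

lemma density_bounds:
  fixes D :: "(real^2) set"
  assumes D: "disk D" "uminus ` D = D"
    and hex: "\<And>p. p \<in> frontier D \<Longrightarrow> \<exists>q. q \<in> D \<and> q - p \<in> D \<and> h \<le> cross2 p q" and h: "0 < h"
    and pk: "lattice_packing D v w"
  shows "densest_lattice_density D \<le> measure lebesgue D / (4 * h)"
    and "packing_density D v w \<le> densest_lattice_density D"
proof -
  have D': "convex D" "compact D" "interior D \<noteq> {}" using D(1) by (auto simp: disk_def)
  have z: "0 \<in> interior D" by (rule zero_in_interior[OF D'(1) D(2) D'(3)])
  have le: "packing_density D v' w' \<le> measure lebesgue D / (4 * h)" if pk': "lattice_packing D v' w'" for v' w'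
  proof -
    have "4 * h \<le> \<bar>det (vector [v', w'] :: real^2^2)\<bar>"
      by (rule packing_det_lower_bound[OF D'(1) D(2) z D'(2) hex pk'])
    then show ?thesis unfolding packing_density_def using h by (intro frac_le) auto
  qed
  show "densest_lattice_density D \<le> measure lebesgue D / (4 * h)"
    unfolding densest_lattice_density_def by (rule cSUP_least) (use pk le in auto)
  have "bdd_above ((\<lambda>(v, w). packing_density D v w) ` {(v, w). lattice_packing D v w})"
    by (rule bdd_aboveI2[where M = "measure lebesgue D / (4 * h)"]) (use le in auto)
  from cSUP_upper[OF _ this, of "(v, w)"] show "packing_density D v w \<le> densest_lattice_density D"
    using pk unfolding densest_lattice_density_def by simp
qed

lemma compact_linear_image:
  fixes T :: "'a::euclidean_space \<Rightarrow> 'b::euclidean_space"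
  assumes "linear T" "compact S" shows "compact (T ` S)"
  using assms linear_continuous_on by (intro compact_continuous_image) (auto simp: linear_conv_bounded_linear)

lemma frontier_linear_image:
  fixes T :: "complex \<Rightarrow> real^2"
  assumes T: "linear T" "bij T" and C: "compact C"
  shows "frontier (T ` C) = T ` frontier C"
proof -
  have c: "closure (T ` C) = T ` C" "closure C = C"
    using C compact_linear_image[OF T(1) C] by (simp_all add: closure_closed compact_imp_closed)
  show ?thesis unfolding frontier_def c interior_bijective_linear_image[OF T]
    using image_set_diff[OF bij_is_inj[OF T(2)]] by metis
qed

lemma cr_hexroot: "cr (1 * a) (hexroot * a) = (norm a)\<^sup>2 * (sqrt 3 / 2)"
  unfolding cmod_power2 by (simp add: cr_def hexroot_simps power2_eq_square algebra_simps)

text \<open>For both disks \<open>area / (4 * (sqrt 3 / 2))\<close> is an upper bound of the density. For \<open>K\<close> it is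
  attained, by the lattice of the regular hexagon inscribed in the circular arcs, and the area
  of \<open>K'\<close> is smaller.\<close>

lemma (in arc_disk) deformed_density_less:
  fixes T :: "complex \<Rightarrow> real^2"
  assumes T: "linear T" and crT: "\<And>x y. cross2 (T x) (T y) = cr x y"
    and hexK: "\<And>p. p \<in> frontier K \<Longrightarrow> \<exists>q. q \<in> frontier K \<and> q - p \<in> frontier K \<and> cr p q = sqrt 3 / 2"
  shows "disk (T ` K')" "uminus ` (T ` K') = T ` K'"
    "densest_lattice_density (T ` K') < densest_lattice_density (T ` K)"
proof -
  note bij = area_preserving_bij[OF T crT]
  have sym: "uminus ` (T ` C) = T ` C" if C: "uminus ` C = C" for C
  proof -
    have "uminus ` (T ` C) = T ` (uminus ` C)" by (simp add: image_image linear_neg[OF T])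
    then show ?thesis using C by simp
  qed
  have zero: "0 \<in> interior (T ` C)" if "0 \<in> interior C" for C
    unfolding interior_bijective_linear_image[OF T bij] using that linear_0[OF T] by (metis image_eqI)
  have disk: "disk (T ` C)" if "convex C" "compact C" "0 \<in> interior C" for C
    unfolding disk_def
    using zero[OF that(3)] convex_linear_image[OF T that(1)] compact_linear_image[OF T that(2)] by blast
  have hex: "\<exists>q. q \<in> T ` C \<and> q - p \<in> T ` C \<and> sqrt 3 / 2 \<le> cross2 p q"
    if C: "compact C" "\<And>p. p \<in> frontier C \<Longrightarrow> \<exists>q. q \<in> C \<and> q - p \<in> C \<and> sqrt 3 / 2 \<le> cr p q"
      and p: "p \<in> frontier (T ` C)" for C p
  proof -
    obtain x where x: "x \<in> frontier C" "p = T x" using p unfolding frontier_linear_image[OF T bij C(1)] by blast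
    obtain y where y: "y \<in> C" "y - x \<in> C" "sqrt 3 / 2 \<le> cr x y" using C(2)[OF x(1)] by blast
    have "T y - p \<in> T ` C" unfolding x(2) linear_diff[OF T, symmetric] using y(2) by (rule imageI)
    then show ?thesis using y by (intro exI[of _ "T y"]) (simp add: x(2) crT)
  qed
  have pack: "lattice_packing (T ` C) (2 *\<^sub>R T p) (2 *\<^sub>R T q)"
    if C: "convex C" "compact C" "uminus ` C = C" "0 \<in> interior C"
      and pq: "p \<in> frontier C" "q \<in> frontier C" "q - p \<in> frontier C" "cr p q \<noteq> 0" for C p q
  proof -
    have fr: "T x \<in> T ` C" "T x \<notin> interior (T ` C)" if x: "x \<in> frontier C" for x
    proof -
      have "T x \<in> frontier (T ` C)" unfolding frontier_linear_image[OF T bij C(2)] using x by (rule imageI)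
      then show "T x \<notin> interior (T ` C)" by (simp add: frontier_def)
      show "T x \<in> T ` C" using x frontier_subset_compact[OF C(2)] by blast
    qed
    show ?thesis
      by (rule hexagon_lattice_packing[OF convex_linear_image[OF T C(1)] sym[OF C(3)] zero[OF C(4)]])
         (use fr[OF pq(1)] fr[OF pq(2)] fr[OF pq(3)] pq(4) in \<open>simp_all add: crT linear_diff[OF T]\<close>)
  qed
  note K'_all = K'_basic(1,2) K'_sym K'_interior
  show d': "disk (T ` K')" by (rule disk[OF K'_all(1,2,4)])
  show s': "uminus ` (T ` K') = T ` K'" by (rule sym[OF K'_sym])
  have pos: "0 < sqrt 3 / (2::real)" by simp
  have hex': "\<exists>q. q \<in> T ` K' \<and> q - p \<in> T ` K' \<and> sqrt 3 / 2 \<le> cross2 p q" if "p \<in> frontier (T ` K')" for p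
    by (rule hex[OF K'_all(2) inscribed_hexagon_deformed[OF hexK] that])
  (* The ends of the six arcs have not moved, so K' has a hexagonal packing. *)
  have "v * cis \<sigma> \<in> frontier K'" if "v \<in> hexroots" for v
  proof -
    have "v * cis \<sigma> \<in> new_arc v ` {-\<sigma>..\<sigma>}" unfolding new_arc_end(1)[symmetric] using s_pos by (intro imageI) simp
    then show ?thesis unfolding frontier_K' new_boundary_def using that by blast
  qed
  from this[of 1] this[of hexroot] this[of "hexroot - 1"]
  have c': "1 * cis \<sigma> \<in> frontier K'" "hexroot * cis \<sigma> \<in> frontier K'" "hexroot * cis \<sigma> - 1 * cis \<sigma> \<in> frontier K'"
    by (simp_all add: hexroots_def left_diff_distrib)
  have "cr (1 * cis \<sigma>) (hexroot * cis \<sigma>) \<noteq> 0" unfolding cr_hexroot by simp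
  note pack' = pack[OF K'_all c' this]
  have hexK': "\<exists>q. q \<in> K \<and> q - p \<in> K \<and> sqrt 3 / 2 \<le> cr p q" if "p \<in> frontier K" for p
    using hexK[OF that] frontier_in_K by (metis order_refl subsetD)
  have hex0: "\<exists>q. q \<in> T ` K \<and> q - p \<in> T ` K \<and> sqrt 3 / 2 \<le> cross2 p q" if "p \<in> frontier (T ` K)" for p
    by (rule hex[OF K_compact hexK' that])
  have "v \<in> frontier K" if "v \<in> hexroots" for v using arcs[OF that, of 0] s_less s_pos by simp
  from this[of 1] this[of hexroot] this[of "hexroot - 1"]
  have c: "1 \<in> frontier K" "hexroot \<in> frontier K" "hexroot - 1 \<in> frontier K" by (simp_all add: hexroots_def)
  have cr1: "cr 1 hexroot = sqrt 3 / 2" using cr_hexroot[of 1] by simp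
  then have "cr 1 hexroot \<noteq> 0" using pos by linarith
  note pack0 = pack[OF K_convex K_compact K_sym K_zero c this]
  have "densest_lattice_density (T ` K') \<le> measure lebesgue (T ` K') / (4 * (sqrt 3 / 2))"
    by (rule density_bounds(1)[OF d' s' hex' pos pack'])
  also have "\<dots> < measure lebesgue (T ` K) / (4 * (sqrt 3 / 2))"
    using deformed_area_less[OF T crT] by (intro divide_strict_right_mono) auto
  also have "\<dots> = packing_density (T ` K) (2 *\<^sub>R T 1) (2 *\<^sub>R T hexroot)"
    unfolding packing_density_def det_vector_cross2 cross2_bilinear crT cr1 by simp
  also have "\<dots> \<le> densest_lattice_density (T ` K)"
    by (rule density_bounds(2)[OF disk[OF K_convex K_compact K_zero] sym[OF K_sym] hex0 pos pack0])
  finally show "densest_lattice_density (T ` K') < densest_lattice_density (T ` K)" .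
qed

section \<open>A disk with circular arcs is not optimal\<close>

definition vc :: "complex \<Rightarrow> real^2" where "vc x = vector [Re x, Im x]"

lemma vc_linear: "vc (x + y) = vc x + vc y" "vc (x - y) = vc x - vc y" "vc (r *\<^sub>R x) = r *\<^sub>R vc x"
  by (simp_all add: vc_def vec_eq_iff forall_2)

lemma rotm_vc: "rotm w *v vc x = vc (w * x)"
  by (simp add: vec_eq_iff forall_2 matrix_vector_mult_def sum_2 rotm_entries vc_def)

lemma cross2_matrix_vc: "cross2 (A *v vc x) (A *v vc y) = det A * cr x y"
  by (simp add: cross2_def matrix_vector_mult_def sum_2 vc_def cr_def det_2 algebra_simps)

lemma hexroot_power: "hexroot ^ j = cis (real j * (pi / 3))"
proof -
  have "hexroot = cis (pi / 3)" by (simp add: complex_eq_iff hexroot_simps cos_60 sin_60)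
  from arg_cong[OF this, of "\<lambda>w. w ^ j"] show ?thesis unfolding Complex.DeMoivre .
qed

lemma e_star_hexroot: "e_star j = vc (hexroot ^ j)"
proof -
  have "2 * pi * real j / 6 = real j * (pi / 3)" by simp
  then show ?thesis unfolding e_star_def vc_def hexroot_power cis.sel by (simp only:)
qed

lemma hexroot_power_values: "hexroot ^ 2 = hexroot - 1" "hexroot ^ 3 = - 1" "hexroot ^ 4 = - hexroot" "hexroot ^ 5 = 1 - hexroot"
  "hexroot ^ 6 = 1"
proof -
  show 2: "hexroot ^ 2 = hexroot - 1" using hexroot_sq by (simp add: power2_eq_square)
  have "hexroot ^ 3 = hexroot ^ 2 * hexroot" by (simp add: eval_nat_numeral)
  then show 3: "hexroot ^ 3 = - 1" unfolding 2 using hexroot_sq by (simp add: algebra_simps)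
  have "hexroot ^ 4 = hexroot ^ 3 * hexroot" "hexroot ^ 5 = hexroot ^ 3 * hexroot ^ 2" "hexroot ^ 6 = hexroot ^ 3 * hexroot ^ 3"
    by (simp_all add: eval_nat_numeral)
  then show "hexroot ^ 4 = - hexroot" "hexroot ^ 5 = 1 - hexroot" "hexroot ^ 6 = 1" unfolding 2 3 by simp_all
qed

lemma hexroots_powers: "v \<in> hexroots \<Longrightarrow> \<exists>j. v = hexroot ^ j"
  unfolding hexroots_def using hexroot_power_values power_0[of hexroot] power_one_right[of hexroot]
  by (metis insertE singletonD)

lemma boundary_arcs_mem: "t \<in> {0..T} \<Longrightarrow> g t *v e_star j \<in> boundary_arcs T g"
proof -
  assume t: "t \<in> {0..T}"
  have "hexroot ^ j = hexroot ^ (6 * (j div 6) + j mod 6)" by simp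
  then have "hexroot ^ j = hexroot ^ (j mod 6)"
    unfolding power_add power_mult hexroot_power_values by simp
  then have "e_star j = e_star (j mod 6)" unfolding e_star_hexroot by simp
  moreover have "j mod 6 \<in> {0..5}" by auto
  ultimately show ?thesis unfolding boundary_arcs_def using t by (intro UN_I[of "j mod 6"]) auto
qed

theorem lemma5p2p1:
  fixes tf lc :: real
    and u :: "real \<Rightarrow> real^3"
    and g \<Lambda> :: "real \<Rightarrow> real^2^2"
    and z :: "real \<Rightarrow> complex"
    and \<nu> :: "real \<Rightarrow> real^2"
  assumes "reinhardt_trajectory tf u g z"
    and "pontryagin_extremal tf u g z lc \<Lambda> \<nu>"
  shows "\<not> (\<exists>t1 t2. t1 < t2 \<and> {t1..t2} \<subseteq> {0..tf} \<and> singular_arc t1 t2 lc \<Lambda> z \<nu>)"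
proof
  assume "\<exists>t1 t2. t1 < t2 \<and> {t1..t2} \<subseteq> {0..tf} \<and> singular_arc t1 t2 lc \<Lambda> z \<nu>"
  then obtain t1 t2 where t12: "t1 < t2" "{t1..t2} \<subseteq> {0..tf}" and sing: "singular_arc t1 t2 lc \<Lambda> z \<nu>" by blast
  have adm: "admissible_trajectory tf u g z" using assms(1) by (simp add: reinhardt_trajectory_def)
  have tr: "trajectory tf u g z" using adm by (simp add: admissible_trajectory_def)
  obtain D where D: "trajectory_disk tf g D" "reinhardt_solution D"
    using assms(1) by (auto simp: reinhardt_trajectory_def)
  have Dd: "compact D" "convex D" "interior D \<noteq> {}" "uminus ` D = D" and fD: "frontier D = boundary_arcs tf g"
    using D(1) by (auto simp: trajectory_disk_def disk_def)
  have det: "det (g t) = 1" if "t \<in> {0..tf}" for t 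
  proof -
    have "g ` {0..tf} \<subseteq> SL2" using tr by (simp add: trajectory_def)
    then have "g t \<in> SL2" using that by blast
    then show ?thesis by (simp add: SL2_def)
  qed

  have ae: "AE t in lebesgue_on {0..tf}. (g has_vector_derivative (g t ** X_mat (z t))) (at t within {0..tf})"
  proof (rule AE_mp)
    show "AE t in lebesgue_on {0..tf}.
        ((\<lambda>s. Re (z s)) has_real_derivative f1 (Re (z t)) (Im (z t)) (u t)) (at t within {0..tf}) \<and>
        ((\<lambda>s. Im (z s)) has_real_derivative f2 (Re (z t)) (Im (z t)) (u t)) (at t within {0..tf}) \<and>
        (g has_vector_derivative (g t ** X_mat (z t))) (at t within {0..tf})"
      using tr unfolding trajectory_def by blast
  qed auto
  obtain N where N: "negligible N" and ode: "\<And>t. t \<in> {0..tf} - N \<Longrightarrow>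
      (g has_vector_derivative (g t ** X_mat (z t))) (at t within {0..tf})"
    using AE_lebesgue_on_exceptional_set[OF ae] by blast
  have rot: "g t = g s ** rotm (cis (t - s))" if st: "s \<in> {t1..t2}" "t \<in> {t1..t2}" for s t
  proof (rule rotation_of_circle[where N = "N \<union> {t1, t2}", OF _ _ _ st])
    show "lip {t1..t2} (\<lambda>t. g t $ i $ j)" for i j
      by (rule lip_subset[OF extremal_system_of_pontryagin(4)[OF assms(2)] t12(2)])
    show "negligible (N \<union> {t1, t2})" using N by (simp add: negligible_Un)
    fix w assume w: "w \<in> {t1..t2} - (N \<union> {t1, t2})"
    then have "w \<in> {t1<..<t2}" "w \<in> {0..tf} - N" using t12(2) by auto
    from ode[OF this(2)] show "(g has_vector_derivative g w ** J_mat) (at w within {t1..t2})"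
      unfolding singular_arc_circle[OF assms(2) t12 sing \<open>w \<in> {t1<..<t2}\<close>]
      by (rule has_vector_derivative_within_subset[OF _ t12(2)])
  qed

  (* Coordinates in which the boundary arcs are circular around the middle tm of the singular arc. *)
  define tm where "tm = (t1 + t2) / 2"
  define \<tau> where "\<tau> = (t2 - t1) / 2"
  define \<sigma> where "\<sigma> = min (\<tau> / 2) (1/16)"
  have tm: "tm \<in> {t1..t2}" "tm \<in> {0..tf}" and \<tau>: "0 < \<tau>" using t12 by (auto simp: tm_def \<tau>_def field_simps)
  define T where "T x = g tm *v vc x" for x
  have T: "linear T"
    by (rule linearI) (simp_all add: T_def vc_linear matrix_vector_right_distrib matrix_vector_mult_scaleR)
  have crT: "cross2 (T x) (T y) = cr x y" for x y
    unfolding T_def cross2_matrix_vc using det[OF tm(2)] by simp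
  note bij = area_preserving_bij[OF T crT]
  obtain U where U: "linear U" "U \<circ> T = id" using linear_injective_left_inverse[OF T bij_is_inj[OF bij]] by blast
  have TU: "T (U y) = y" for y
  proof -
    obtain x where "y = T x" using bij_is_surj[OF bij] by (metis surjD)
    then show ?thesis using fun_cong[OF U(2), of x] by simp
  qed
  define K where "K = U ` D"
  have TK: "T ` K = D" unfolding K_def image_image TU by simp
  have K: "convex K" "compact K"
    unfolding K_def using convex_linear_image[OF U(1) Dd(2)] compact_linear_image[OF U(1) Dd(1)] by simp_all
  have memK: "x \<in> K \<longleftrightarrow> T x \<in> D" for x unfolding TK[symmetric] using bij_is_inj[OF bij] by (simp add: inj_image_mem_iff)
  have fK: "x \<in> frontier K \<longleftrightarrow> T x \<in> boundary_arcs tf g" for x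
    unfolding fD[symmetric] TK[symmetric] frontier_linear_image[OF T bij K(2)]
    using bij_is_inj[OF bij] by (simp add: inj_image_mem_iff)
  have Ksym: "uminus ` K = K"
  proof -
    have neg: "- x \<in> K" if "x \<in> K" for x
      using that Dd(4) unfolding memK linear_neg[OF T] by (metis image_eqI)
    then show ?thesis by (metis image_subset_iff minus_minus subsetI subset_antisym image_eqI)
  qed
  have "0 \<in> interior (T ` K)" unfolding TK by (rule zero_in_interior[OF Dd(2,4,3)])
  then have "T 0 \<in> T ` interior K" unfolding interior_bijective_linear_image[OF T bij] linear_0[OF T] .
  then have K0: "0 \<in> interior K" using bij_is_inj[OF bij] by (simp add: inj_image_mem_iff)
  interpret arc_disk \<sigma> K \<tau>
  proof
    show "0 < \<sigma>" "\<sigma> \<le> 1/16" "\<sigma> < \<tau>" using \<tau> by (auto simp: \<sigma>_def min_def)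
    show "convex K" "compact K" "uminus ` K = K" "0 \<in> interior K" by (fact K Ksym K0)+
    fix v t assume v: "v \<in> hexroots" and t: "\<bar>t\<bar> \<le> \<tau>"
    obtain j where j: "v = hexroot ^ j" using hexroots_powers[OF v] by blast
    have t': "tm + t \<in> {t1..t2}" using t by (auto simp: tm_def \<tau>_def abs_le_iff field_simps)
    have "T (v * cis t) = g tm *v (rotm (cis t) *v e_star j)"
      unfolding T_def e_star_hexroot rotm_vc j by (simp add: mult.commute)
    also have "\<dots> = g (tm + t) *v e_star j"
      unfolding rot[OF tm(1) t'] by (simp add: matrix_vector_mul_assoc)
    also have "\<dots> \<in> boundary_arcs tf g" using t' t12(2) by (intro boundary_arcs_mem) auto
    finally show "v * cis t \<in> frontier K" unfolding fK .
  qed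
  (* The points of the six boundary arcs at equal times form hexagons of equal area. *)
  have hexK: "\<exists>q. q \<in> frontier K \<and> q - p \<in> frontier K \<and> cr p q = sqrt 3 / 2" if p: "p \<in> frontier K" for p
  proof -
    obtain j t where jt: "t \<in> {0..tf}" "T p = g t *v e_star j"
      using p unfolding fK boundary_arcs_def by auto
    obtain q where q: "T q = g t *v e_star (j + 1)" using bij_is_surj[OF bij] by (metis surjD)
    have "hexroot ^ (j + 1) - hexroot ^ j = hexroot ^ (j + 2)"
      unfolding power_add hexroot_power_values by (simp add: algebra_simps)
    then have "T (q - p) = g t *v e_star (j + 2)"
      unfolding linear_diff[OF T] q jt(2) e_star_hexroot matrix_vector_mult_diff_distrib[symmetric] vc_linear(2)[symmetric] by simp
    moreover have "cr p q = sqrt 3 / 2"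
    proof -
      have "cr p q = cr (1 * hexroot ^ j) (hexroot * hexroot ^ j)"
        unfolding crT[symmetric, of p q] q jt(2) e_star_hexroot cross2_matrix_vc det[OF jt(1)] by simp
      then show ?thesis unfolding cr_hexroot hexroot_power by simp
    qed
    ultimately show ?thesis using q boundary_arcs_mem[OF jt(1)] unfolding fK by (intro exI[of _ q]) simp
  qed
  note less = deformed_density_less[OF T crT hexK]
  have "centrally_symmetric (T ` K')"
    unfolding centrally_symmetric_def using less(2) by (intro exI[of _ 0]) simp
  then have "densest_lattice_density D \<le> densest_lattice_density (T ` K')"
    using D(2) less(1) unfolding reinhardt_solution_def by blast
  then show False using less(3) unfolding TK by simp
qed

end
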